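(* Let $n\ge1$, $s\in(0,1)$, $B_1\subset\mathbb{R}^n$, and let $\{f_{m,k,l}\}_{m,k\in\mathbb{N},\,0\le l\le l_m}$ be an orthonormal basis of $L^2(B_3\setminus\overline{B}_2)$ of the form $f_{m,k,l}(x)=g_{m,k}(|x|)h_{m,l}(x/|x|)$ such that $\|A_0f_{m,k,l}\|_{L^2(B_1)}\le C_0e^{-c(m+k)}$ for all $m,k,l$, where $C_0,c>0$ are constants depending only on $n,s$. Then there exists a constant $C=C_{n,s}>1$, depending only on $n$ and $s$, such that the following holds. Let $q\in L^\infty(B_1)$ be such that $0$ is not an eigenvalue of the operator $(-\Delta)^s+q$ in $B_1$ (with exterior Dirichlet data). Then for all $(m_i,k_i,l_i)$ with $m_i,k_i\in\mathbb{N}$, $0\le l_i\le l_{m_i}$, $i\in\{1,2\}$, one has $$(\Gamma(q)f_{m_1,k_1,l_1},f_{m_2,k_2,l_2})_{L^2(B_3\setminus\overline{B}_2)}\le C e^{-c\max\{m_1+k_1,\,m_2+k_2\}}\,\|q\|_{L^\infty(B_1)}\,\|((-\Delta)^s+q)^{-1}\|_{L^2(B_1)\to L^2(B_1)}.$$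
   Context: $\mathbb{N}=\{0,1,2,\dots\}$; $B_r$ is the open ball of radius $r$ centred at $0$ in $\mathbb{R}^n$; potentials are real-valued. For each $m$, $\{h_{m,l}\}_{0\le l\le l_m}$ is an $L^2(\partial B_1)$-orthonormal basis of the spherical harmonics of degree $m$ on $\partial B_1$ (restrictions of homogeneous harmonic polynomials of degree $m$; for $n=1$ these are nontrivial only for $m=0,1$, and for other $m$ the index set for $l$ is empty). $\widetilde{H}^s(B_1)$ is the closure of $C_c^\infty(B_1)$ in $H^s(\mathbb{R}^n)$, and $(-\Delta)^s$ is the fractional Laplacian on $\mathbb{R}^n$ (Fourier multiplier $|\xi|^{2s}$). That $0$ is not an eigenvalue of $(-\Delta)^s+q$ means that the only $v\in\widetilde{H}^s(B_1)$ with $((-\Delta)^s+q)v=0$ in $B_1$ is $v=0$. In that case, $((-\Delta)^s+q)^{-1}$ denotes the operator $L^2(B_1)\to L^2(B_1)$ mapping $F$ to (the restriction to $B_1$ of) the unique weak solution $w\in\widetilde{H}^s(B_1)$ of $((-\Delta)^s+q)w=F$ in $B_1$. For $f\in L^2(B_3\setminus\overline{B}_2)$, with extension by zero $E_0f$ to $\mathbb{R}^n$, the solution $u$ of $((-\Delta)^s+q)u=0$ in $B_1$, $u=E_0f$ in $\mathbb{R}^n\setminus\overline{B}_1$, is $u=E_0f+v$, where $v\in\widetilde{H}^s(B_1)$ is the unique weak solution of $((-\Delta)^s+q)v=-((-\Delta)^sE_0f)|_{B_1}$ in $B_1$. Set $\Lambda_qf:=(-\Delta)^su|_{B_3\setminus\overline{B}_2}\in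 H^{-2s}(B_3\setminus\overline{B}_2)$ and $\Gamma(q):=\Lambda_q-\Lambda_0$, which is a bounded operator on $L^2(B_3\setminus\overline{B}_2)$. The map $A_0:L^2(B_3\setminus\overline{B}_2)\to L^2(B_1)$ is $A_0f:=u|_{B_1}$, where $u$ is this solution for $q=0$. An orthonormal basis with the stated properties exists. *)

theory Defs
  imports "HOL-Analysis.Analysis" "HOL-Probability.Essential_Supremum"
begin

section \<open>Lebesgue spaces\<close>

text \<open>
  All functions are real-valued and are representatives of their almost-everywhere class. For
  \<open>M = lebesgue_on S\<close> the notions below only depend on the values on \<open>S\<close>, so that restricting a
  function on the whole space to \<open>S\<close> needs no operation on the function itself.
\<close>

definition L2 :: "'a measure \<Rightarrow> ('a \<Rightarrow> real) set" where
  "L2 M = {f \<in> borel_measurable M. integrable M (\<lambda>x. (f x)\<^sup>2)}"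

definition L2_inner :: "'a measure \<Rightarrow> ('a \<Rightarrow> real) \<Rightarrow> ('a \<Rightarrow> real) \<Rightarrow> real" where
  "L2_inner M f g = (LINT x|M. f x * g x)"

definition L2_norm :: "'a measure \<Rightarrow> ('a \<Rightarrow> real) \<Rightarrow> real" where
  "L2_norm M f = sqrt (L2_inner M f f)"

definition L2_orthonormal :: "'a measure \<Rightarrow> 'i set \<Rightarrow> ('i \<Rightarrow> 'a \<Rightarrow> real) \<Rightarrow> bool" where
  "L2_orthonormal M I e \<longleftrightarrow>
     (\<forall>i\<in>I. e i \<in> L2 M) \<and>
     (\<forall>i\<in>I. \<forall>j\<in>I. L2_inner M (e i) (e j) = (if i = j then 1 else 0))"

definition L2_orthonormal_basis :: "'a measure \<Rightarrow> 'i set \<Rightarrow> ('i \<Rightarrow> 'a \<Rightarrow> real) \<Rightarrow> bool" where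
  "L2_orthonormal_basis M I e \<longleftrightarrow>
     L2_orthonormal M I e \<and>
     (\<forall>F\<in>L2 M. \<forall>\<epsilon>>0. \<exists>J a. finite J \<and> J \<subseteq> I \<and>
        L2_norm M (\<lambda>x. F x - (\<Sum>j\<in>J. a j * e j x)) < \<epsilon>)"

definition L2_opnorm ::
  "'a measure \<Rightarrow> 'b measure \<Rightarrow> (('a \<Rightarrow> real) \<Rightarrow> ('b \<Rightarrow> real)) \<Rightarrow> real" where
  "L2_opnorm M N T = (SUP F\<in>{F \<in> L2 M. L2_norm M F \<le> 1}. L2_norm N (T F))"

definition Linf :: "'a measure \<Rightarrow> ('a \<Rightarrow> real) set" where
  "Linf M = {q \<in> borel_measurable M. esssup M (\<lambda>x. ereal \<bar>q x\<bar>) < \<infinity>}"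

definition Linf_norm :: "'a measure \<Rightarrow> ('a \<Rightarrow> real) \<Rightarrow> real" where
  "Linf_norm M q = real_of_ereal (esssup M (\<lambda>x. ereal \<bar>q x\<bar>))"

section \<open>Spherical harmonics\<close>

text \<open>
  The surface measure of the unit sphere, as the cone measure
  \<open>E \<mapsto> n \<cdot> vol {x. 0 < \<bar>x\<bar> < 1 \<and> x / \<bar>x\<bar> \<in> E}\<close> that appears in polar coordinates. For \<open>n = 1\<close> this is
  the counting measure on the two points of the sphere.
\<close>

definition sphere_measure :: "('a::euclidean_space) measure" where
  "sphere_measure = scale_measure (of_nat DIM('a))
     (distr (lebesgue_on (ball 0 1 - {0})) (restrict_space borel (sphere 0 1))
       (\<lambda>x. x /\<^sub>R norm x))"

definition laplacian :: "('a::euclidean_space \<Rightarrow> real) \<Rightarrow> 'a \<Rightarrow> real" where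
  "laplacian p x = (\<Sum>b\<in>Basis. deriv (deriv (\<lambda>t. p (x + t *\<^sub>R b))) 0)"

definition homogeneous_harmonic_polynomial :: "nat \<Rightarrow> ('a::euclidean_space \<Rightarrow> real) \<Rightarrow> bool" where
  "homogeneous_harmonic_polynomial m p \<longleftrightarrow>
     real_polynomial_function p \<and> (\<forall>t x. p (t *\<^sub>R x) = t ^ m * p x) \<and> (\<forall>x. laplacian p x = 0)"

definition spherical_harmonic :: "nat \<Rightarrow> ('a::euclidean_space \<Rightarrow> real) \<Rightarrow> bool" where
  "spherical_harmonic m Y \<longleftrightarrow>
     (\<exists>p. homogeneous_harmonic_polynomial m p \<and> (\<forall>x\<in>sphere 0 1. Y x = p x))"

text \<open>
  \<open>d m\<close> is the number of admissible indices \<open>l\<close>, that is \<open>l\<^sub>m + 1\<close>, or \<open>0\<close> if there are none.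
\<close>

definition spherical_harmonic_basis ::
  "nat \<Rightarrow> nat \<Rightarrow> (nat \<Rightarrow> 'a::euclidean_space \<Rightarrow> real) \<Rightarrow> bool" where
  "spherical_harmonic_basis m d h \<longleftrightarrow>
     (\<forall>l<d. spherical_harmonic m (h l)) \<and>
     L2_orthonormal sphere_measure {..<d} h \<and>
     (\<forall>Y. spherical_harmonic m Y \<longrightarrow> (\<exists>a. \<forall>x\<in>sphere 0 1. Y x = (\<Sum>l<d. a l * h l x)))"

section \<open>Fourier transform and Sobolev spaces\<close>

definition fourier_integral :: "('a::euclidean_space \<Rightarrow> real) \<Rightarrow> 'a \<Rightarrow> complex" where
  "fourier_integral u \<xi> = (LINT x|lebesgue. of_real (u x) * cis (- (x \<bullet> \<xi>)))"

text \<open>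
  The Fourier transform on \<open>L\<^sup>2\<close> is the \<open>L\<^sup>2\<close>-limit of the Fourier integrals over growing balls; it
  is determined up to null sets.
\<close>

definition fourier_transform :: "('a::euclidean_space \<Rightarrow> real) \<Rightarrow> 'a \<Rightarrow> complex" where
  "fourier_transform u = (SOME U. U \<in> borel_measurable lebesgue \<and>
     ((\<lambda>R. \<integral>\<^sup>+ \<xi>. ennreal ((cmod (fourier_integral (\<lambda>x. indicator (ball 0 R) x * u x) \<xi> - U \<xi>))\<^sup>2)
        \<partial>lebesgue) \<longlongrightarrow> 0) at_top)"

definition sobolev_space :: "real \<Rightarrow> ('a::euclidean_space \<Rightarrow> real) set" where
  "sobolev_space s = {u \<in> L2 lebesgue.
     integrable lebesgue (\<lambda>\<xi>. (1 + (norm \<xi>)\<^sup>2) powr s * (cmod (fourier_transform u \<xi>))\<^sup>2)}"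

definition sobolev_norm :: "real \<Rightarrow> ('a::euclidean_space \<Rightarrow> real) \<Rightarrow> real" where
  "sobolev_norm s u =
     sqrt (LINT \<xi>|lebesgue. (1 + (norm \<xi>)\<^sup>2) powr s * (cmod (fourier_transform u \<xi>))\<^sup>2)"

fun C_k :: "nat \<Rightarrow> ('a::euclidean_space \<Rightarrow> real) \<Rightarrow> bool" where
  "C_k 0 f \<longleftrightarrow> continuous_on UNIV f"
| "C_k (Suc k) f \<longleftrightarrow> (\<forall>x. f differentiable (at x)) \<and>
     (\<forall>b\<in>Basis. C_k k (\<lambda>x. frechet_derivative f (at x) b))"

definition test_functions :: "'a::euclidean_space set \<Rightarrow> ('a \<Rightarrow> real) set" where
  "test_functions \<Omega> = {\<phi>. (\<forall>k. C_k k \<phi>) \<and>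
     compact (closure {x. \<phi> x \<noteq> 0}) \<and> closure {x. \<phi> x \<noteq> 0} \<subseteq> \<Omega>}"

definition sobolev_tilde :: "real \<Rightarrow> 'a::euclidean_space set \<Rightarrow> ('a \<Rightarrow> real) set" where
  "sobolev_tilde s \<Omega> = {v \<in> sobolev_space s.
     \<forall>\<epsilon>>0. \<exists>\<phi>\<in>test_functions \<Omega>. sobolev_norm s (\<lambda>x. v x - \<phi> x) < \<epsilon>}"

section \<open>The fractional Schroedinger equation\<close>

text \<open>
  Distributions are represented by their action on test functions. For \<open>u\<close> in \<open>L\<^sup>2\<close>,
  \<open>frac_laplacian s u\<close> is the distribution with Fourier transform \<open>\<bar>\<xi>\<bar>\<^bsup>2s\<^esup> \<cdot> fourier_transform u \<xi>\<close>,
  which pairs with a test function through Parseval's formula. For real-valued \<open>u\<close> and \<open>\<phi>\<close> the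
  integral is real. Restriction of the distribution to an open set is restriction to the test
  functions supported there.
\<close>

definition frac_laplacian ::
  "real \<Rightarrow> ('a::euclidean_space \<Rightarrow> real) \<Rightarrow> ('a \<Rightarrow> real) \<Rightarrow> real" where
  "frac_laplacian s u \<phi> = Re (LINT \<xi>|lebesgue.
     of_real (norm \<xi> powr (2 * s)) * fourier_transform u \<xi> * cnj (fourier_transform \<phi> \<xi>))
     / (2 * pi) ^ DIM('a)"

abbreviation B1 :: "'a::euclidean_space set" where
  "B1 \<equiv> ball 0 1"

abbreviation annulus :: "'a::euclidean_space set" where
  "annulus \<equiv> ball 0 3 - cball 0 2"

text \<open>\<open>v\<close> is a weak solution in \<open>B1\<close> of the equation with potential \<open>q\<close> and right-hand side the
  distribution \<open>T\<close>.\<close>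

definition weak_solution :: "real \<Rightarrow> ('a::euclidean_space \<Rightarrow> real) \<Rightarrow>
    (('a \<Rightarrow> real) \<Rightarrow> real) \<Rightarrow> ('a \<Rightarrow> real) \<Rightarrow> bool" where
  "weak_solution s q T v \<longleftrightarrow> v \<in> sobolev_tilde s B1 \<and>
     (\<forall>\<phi>\<in>test_functions B1.
        frac_laplacian s v \<phi> + (LINT x|lebesgue_on B1. q x * v x * \<phi> x) = T \<phi>)"

definition zero_eigenvalue :: "real \<Rightarrow> ('a::euclidean_space \<Rightarrow> real) \<Rightarrow> bool" where
  "zero_eigenvalue s q \<longleftrightarrow>
     (\<exists>v. weak_solution s q (\<lambda>\<phi>. 0) v \<and> \<not> (AE x in lebesgue. v x = 0))"

definition resolvent :: "real \<Rightarrow> ('a::euclidean_space \<Rightarrow> real) \<Rightarrow> ('a \<Rightarrow> real) \<Rightarrow> 'a \<Rightarrow> real" where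
  "resolvent s q F = (SOME w. weak_solution s q (\<lambda>\<phi>. LINT x|lebesgue_on B1. F x * \<phi> x) w)"

definition E0 :: "('a::euclidean_space \<Rightarrow> real) \<Rightarrow> 'a \<Rightarrow> real" where
  "E0 f x = (if x \<in> annulus then f x else 0)"

definition exterior_solution ::
  "real \<Rightarrow> ('a::euclidean_space \<Rightarrow> real) \<Rightarrow> ('a \<Rightarrow> real) \<Rightarrow> 'a \<Rightarrow> real" where
  "exterior_solution s q f =
     (let v = (SOME v. weak_solution s q (\<lambda>\<phi>. - frac_laplacian s (E0 f) \<phi>) v)
      in (\<lambda>x. E0 f x + v x))"

definition DN_map ::
  "real \<Rightarrow> ('a::euclidean_space \<Rightarrow> real) \<Rightarrow> ('a \<Rightarrow> real) \<Rightarrow> ('a \<Rightarrow> real) \<Rightarrow> real" where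
  "DN_map s q f = restrict (frac_laplacian s (exterior_solution s q f)) (test_functions annulus)"

text \<open>The difference of the two distributions on the annulus, identified with the \<open>L\<^sup>2\<close> function
  representing it.\<close>

definition Gamma_map ::
  "real \<Rightarrow> ('a::euclidean_space \<Rightarrow> real) \<Rightarrow> ('a \<Rightarrow> real) \<Rightarrow> 'a \<Rightarrow> real" where
  "Gamma_map s q f = (SOME G. G \<in> L2 (lebesgue_on annulus) \<and>
     (\<forall>\<phi>\<in>test_functions annulus.
        (LINT x|lebesgue_on annulus. G x * \<phi> x) = DN_map s q f \<phi> - DN_map s (\<lambda>x. 0) f \<phi>))"

text \<open>Only the values on \<open>B1\<close>, seen through \<open>lebesgue_on B1\<close>, are relevant.\<close>

definition A0 :: "real \<Rightarrow> ('a::euclidean_space \<Rightarrow> real) \<Rightarrow> 'a \<Rightarrow> real" where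
  "A0 s f = exterior_solution s (\<lambda>x. 0) f"

end

theory Submission
  imports Defs "HOL-Probability.Characteristic_Functions" "HOL-Real_Asymp.Real_Asymp"
    "HOL-Complex_Analysis.Great_Picard"
begin

text \<open>
  The estimate rests on an identity of Alessandrini type. Let \<open>v\<^sub>q(f)\<close> denote the part of the exterior
  solution that lives in \<open>B\<^sub>1\<close> (\<open>exterior_correction\<close>), so that \<open>A\<^sub>0 f = v\<^sub>0(f)\<close> on \<open>B\<^sub>1\<close>. The ball and the annulus
  have distance \<open>1\<close>, hence \<open>(-\<Delta>)\<^sup>s\<close> of a function supported in one of them is given in the other by a
  bounded symmetric integral kernel (\<open>frac_laplacian_kernel\<close>). Let \<open>P f\<close> be the resulting function on \<open>B\<^sub>1\<close>, the far
  field of \<open>f\<close>. Then \<open>((-\<Delta>)\<^sup>s + q) v\<^sub>q(f) = - P f\<close> in \<open>B\<^sub>1\<close>, and \<open>\<Gamma>(q) f\<close> is the far field of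
  \<open>v\<^sub>q(f) - v\<^sub>0(f)\<close>. Testing these equations with each other gives (\<open>Gamma_inner_identity\<close>)
  \<open>(\<Gamma>(q) f\<^sub>1, f\<^sub>2) = \<integral> (v\<^sub>q(f\<^sub>1) - v\<^sub>0(f\<^sub>1)) P f\<^sub>2 = \<integral> q v\<^sub>q(f\<^sub>1) v\<^sub>0(f\<^sub>2)\<close>,
  with integrals over \<open>B\<^sub>1\<close>, and shows that this form is symmetric in \<open>f\<^sub>1\<close> and \<open>f\<^sub>2\<close>. Now \<open>v\<^sub>q(f\<^sub>1)\<close> is minus the resolvent
  applied to \<open>P f\<^sub>1\<close>, and \<open>P\<close> is bounded, so the form is at most a constant times
  \<open>\<parallel>q\<parallel> \<parallel>((-\<Delta>)\<^sup>s + q)\<^sup>-\<^sup>1\<parallel> \<parallel>f\<^sub>1\<parallel> \<parallel>A\<^sub>0 f\<^sub>2\<parallel>\<close> (\<open>Gamma_bound\<close>). The last factor decays exponentially in the index of the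
  second basis function, and by symmetry the two indices may be exchanged; this is where the maximum comes from.

  Most of the text establishes that the objects in this argument exist. The solutions, the
  resolvent and \<open>\<Gamma>(q)\<close> are defined by choice, so each needs a witness. Weak solutions come from the Riesz
  theorem for a shifted equation, Rellich's compactness theorem and the Fredholm alternative
  (\<open>weak_solution_exists\<close>), which also bounds the resolvent and thereby gives its operator norm a meaning. The function
  representing \<open>\<Gamma>(q) f\<close> is determined almost everywhere because test functions separate \<open>L\<^sup>2\<close>.

  On the Fourier side everything follows from one identity for Gaussians (\<open>heat_form\<close>). For small times it yields
  Plancherel's theorem, and integrated against \<open>t\<^bsup>-1-s\<^esup>\<close>, by way of
  \<open>c \<bar>\<xi>\<bar>\<^bsup>2s\<^esup> = \<integral> (1 - e\<^bsup>-t\<bar>\<xi>\<bar>\<^sup>2\<^esup>) t\<^bsup>-1-s\<^esup> dt\<close>, it yields the kernel of the fractional Laplacian off the diagonal.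
\<close>


section \<open>Hilbert spaces of functions\<close>

text \<open>
  The spaces below consist of functions rather than of classes modulo null sets, so their inner products
  are only semi-definite: \<open>I u u = 0\<close> means that \<open>u\<close> vanishes almost everywhere. Completeness and the
  usual theorems make sense in this form, with equality of vectors replaced by distance \<open>0\<close>.
\<close>

locale semi_inner =
  fixes V :: "('a \<Rightarrow> real) set" and I :: "('a \<Rightarrow> real) \<Rightarrow> ('a \<Rightarrow> real) \<Rightarrow> real"
  assumes lincomb: "\<And>u v a b. u \<in> V \<Longrightarrow> v \<in> V \<Longrightarrow> (\<lambda>x. a * u x + b * v x) \<in> V"
    and zero: "(\<lambda>x. 0) \<in> V"
    and linear_left: "\<And>u v w a b. u \<in> V \<Longrightarrow> v \<in> V \<Longrightarrow> w \<in> V \<Longrightarrow>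
        I (\<lambda>x. a * u x + b * v x) w = a * I u w + b * I v w"
    and sym: "\<And>u v. u \<in> V \<Longrightarrow> v \<in> V \<Longrightarrow> I u v = I v u"
    and nonneg: "\<And>u. u \<in> V \<Longrightarrow> 0 \<le> I u u"
begin

lemma diff_mem: "u \<in> V \<Longrightarrow> v \<in> V \<Longrightarrow> (\<lambda>x. u x - v x) \<in> V"
  using lincomb[of u v 1 "-1"] by simp

lemma scale_mem: "u \<in> V \<Longrightarrow> (\<lambda>x. a * u x) \<in> V"
  using lincomb[of u u a 0] by simp

lemma diff_left: "u \<in> V \<Longrightarrow> v \<in> V \<Longrightarrow> w \<in> V \<Longrightarrow> I (\<lambda>x. u x - v x) w = I u w - I v w"
  using linear_left[of u v w 1 "-1"] by simp

lemma scale_left: "u \<in> V \<Longrightarrow> w \<in> V \<Longrightarrow> I (\<lambda>x. a * u x) w = a * I u w"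
  using linear_left[of u u w a 0] by simp

lemma linear_right: "u \<in> V \<Longrightarrow> v \<in> V \<Longrightarrow> w \<in> V \<Longrightarrow>
    I w (\<lambda>x. a * u x + b * v x) = a * I w u + b * I w v"
  using linear_left[of u v w a b] sym lincomb by metis

lemma diff_right: "u \<in> V \<Longrightarrow> v \<in> V \<Longrightarrow> w \<in> V \<Longrightarrow> I w (\<lambda>x. u x - v x) = I w u - I w v"
  using linear_right[of u v w 1 "-1"] by simp

lemma quad_expand: "u \<in> V \<Longrightarrow> v \<in> V \<Longrightarrow>
    I (\<lambda>x. a * u x + b * v x) (\<lambda>x. a * u x + b * v x) = a\<^sup>2 * I u u + 2 * a * b * I u v + b\<^sup>2 * I v v"
  by (simp add: linear_left linear_right lincomb sym[of v u] power2_eq_square algebra_simps)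

lemma quad_diff: "u \<in> V \<Longrightarrow> v \<in> V \<Longrightarrow>
    I (\<lambda>x. u x - v x) (\<lambda>x. u x - v x) = I u u - 2 * I u v + I v v"
  using quad_expand[of u v 1 "-1"] by simp

lemma Cauchy_Schwarz:
  assumes "u \<in> V" "v \<in> V"
  shows "(I u v)\<^sup>2 \<le> I u u * I v v"
proof -
  have q: "0 \<le> (I v v)\<^sup>2 * I u u + 2 * I v v * (- I u v) * I u v + (- I u v)\<^sup>2 * I v v"
    using nonneg[OF lincomb[OF assms, of "I v v" "- I u v"]] quad_expand[OF assms, of "I v v" "- I u v"]
    by linarith
  show ?thesis
  proof (cases "I v v = 0")
    case False
    then have "I v v > 0" using nonneg[OF assms(2)] by linarith
    moreover have "0 \<le> I v v * (I u u * I v v - (I u v)\<^sup>2)"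
      using q by (simp add: power2_eq_square algebra_simps)
    ultimately show ?thesis by (simp add: zero_le_mult_iff)
  next
    case True
    have "I u v = 0"
    proof (rule ccontr)
      assume n: "I u v \<noteq> 0"
      have pos: "0 \<le> I u u + 2 * t * I u v" for t
        using nonneg[OF lincomb[OF assms, of 1 t]] quad_expand[OF assms, of 1 t] True by simp
      have "2 * (- (I u u + 1) / (2 * I u v)) * I u v = - (I u u + 1)" using n by simp
      then show False using pos[of "- (I u u + 1) / (2 * I u v)"] by linarith
    qed
    with True show ?thesis by simp
  qed
qed

lemma Cauchy_Schwarz_sqrt:
  "u \<in> V \<Longrightarrow> v \<in> V \<Longrightarrow> \<bar>I u v\<bar> \<le> sqrt (I u u) * sqrt (I v v)"
  by (metis Cauchy_Schwarz real_sqrt_abs real_sqrt_le_mono real_sqrt_mult)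

lemma null_orthogonal: "u \<in> V \<Longrightarrow> v \<in> V \<Longrightarrow> I u u = 0 \<Longrightarrow> I u v = 0"
  using Cauchy_Schwarz[of u v] by simp

lemma triangle_sq:
  assumes "u \<in> V" "v \<in> V"
  shows "I (\<lambda>x. u x + v x) (\<lambda>x. u x + v x) \<le> 2 * I u u + 2 * I v v"
  using nonneg[OF diff_mem[OF assms]] quad_expand[OF assms, of 1 1] quad_diff[OF assms] by simp

lemma diff_sq:
  assumes "u \<in> V" "v \<in> V"
  shows "I (\<lambda>x. u x - v x) (\<lambda>x. u x - v x) \<le> 2 * I u u + 2 * I v v"
  using nonneg[OF lincomb[OF assms, of 1 1]] quad_expand[OF assms, of 1 1] quad_diff[OF assms] by simp

lemma diff_sq3:
  assumes "u \<in> V" "v \<in> V" "w \<in> V"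
  shows "I (\<lambda>x. u x - v x) (\<lambda>x. u x - v x)
    \<le> 2 * I (\<lambda>x. u x - w x) (\<lambda>x. u x - w x) + 2 * I (\<lambda>x. v x - w x) (\<lambda>x. v x - w x)"
  using diff_sq[OF diff_mem[OF assms(1,3)] diff_mem[OF assms(2,3)]] by (simp add: algebra_simps)

lemma tendsto_left:
  assumes "\<And>n. f n \<in> V" "u \<in> V" "v \<in> V"
    and "(\<lambda>n. I (\<lambda>x. f n x - u x) (\<lambda>x. f n x - u x)) \<longlonglongrightarrow> 0"
  shows "(\<lambda>n. I (f n) v) \<longlonglongrightarrow> I u v"
proof -
  have "(\<lambda>n. I (\<lambda>x. f n x - u x) v) \<longlonglongrightarrow> 0"
  proof (rule Lim_null_comparison[where g = "\<lambda>n. sqrt (I (\<lambda>x. f n x - u x) (\<lambda>x. f n x - u x)) * sqrt (I v v)"])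
    show "\<forall>\<^sub>F n in sequentially. norm (I (\<lambda>x. f n x - u x) v)
        \<le> sqrt (I (\<lambda>x. f n x - u x) (\<lambda>x. f n x - u x)) * sqrt (I v v)"
      using Cauchy_Schwarz_sqrt[OF diff_mem[OF assms(1,2)] assms(3)] by simp
    show "(\<lambda>n. sqrt (I (\<lambda>x. f n x - u x) (\<lambda>x. f n x - u x)) * sqrt (I v v)) \<longlonglongrightarrow> 0"
      using tendsto_mult_right[OF tendsto_real_sqrt[OF assms(4)], of "sqrt (I v v)"] by simp
  qed
  then have "(\<lambda>n. I (f n) v - I u v) \<longlonglongrightarrow> 0"
    by (simp add: diff_left assms)
  then show ?thesis by (simp add: LIM_zero_iff)
qed

lemma tendsto_quad:
  assumes "\<And>n. f n \<in> V" "u \<in> V"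
    and l: "(\<lambda>n. I (\<lambda>x. f n x - u x) (\<lambda>x. f n x - u x)) \<longlonglongrightarrow> 0"
  shows "(\<lambda>n. I (f n) (f n)) \<longlonglongrightarrow> I u u"
proof -
  have "I (f n) (f n) = I (\<lambda>x. f n x - u x) (\<lambda>x. f n x - u x) + 2 * I (f n) u - I u u" for n
    using quad_diff[OF assms(1,2), of n] by simp
  moreover have "(\<lambda>n. I (\<lambda>x. f n x - u x) (\<lambda>x. f n x - u x) + 2 * I (f n) u - I u u)
      \<longlonglongrightarrow> 0 + 2 * I u u - I u u"
    by (intro tendsto_intros l tendsto_left assms)
  ultimately show ?thesis by simp
qed

definition Cauchy_in :: "(nat \<Rightarrow> 'a \<Rightarrow> real) \<Rightarrow> bool" where
  "Cauchy_in f \<longleftrightarrow> (\<forall>n. f n \<in> V) \<and>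
     (\<forall>\<epsilon>>0. \<exists>N. \<forall>m\<ge>N. \<forall>n\<ge>N. I (\<lambda>x. f m x - f n x) (\<lambda>x. f m x - f n x) < \<epsilon>)"

definition converges_in :: "(nat \<Rightarrow> 'a \<Rightarrow> real) \<Rightarrow> ('a \<Rightarrow> real) \<Rightarrow> bool" where
  "converges_in f u \<longleftrightarrow> (\<forall>n. f n \<in> V) \<and> u \<in> V \<and>
     (\<lambda>n. I (\<lambda>x. f n x - u x) (\<lambda>x. f n x - u x)) \<longlonglongrightarrow> 0"

end

locale semi_hilbert = semi_inner +
  assumes complete: "\<And>f. Cauchy_in f \<Longrightarrow> \<exists>u. converges_in f u"
begin

text \<open>
  The representing vector minimises \<open>J v = I v v - 2 l v\<close>. Boundedness of \<open>l\<close> bounds \<open>J\<close> from below, the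
  parallelogram identity makes every minimising sequence a Cauchy sequence, and the first variation of
  \<open>J\<close> at the limit is the asserted equation.
\<close>

lemma Riesz_representation:
  assumes lin: "\<And>u v a b. u \<in> V \<Longrightarrow> v \<in> V \<Longrightarrow> l (\<lambda>x. a * u x + b * v x) = a * l u + b * l v"
    and bdd: "\<And>u. u \<in> V \<Longrightarrow> (l u)\<^sup>2 \<le> C * I u u" and C: "0 \<le> C"
  shows "\<exists>u\<in>V. \<forall>v\<in>V. I u v = l v"
proof -
  define J where "J v = I v v - 2 * l v" for v
  have lb: "- C \<le> J v" if v: "v \<in> V" for v
  proof -
    have "l v \<le> sqrt C * sqrt (I v v)"
      using bdd[OF v] by (metis real_le_rsqrt real_sqrt_mult)
    moreover have "0 \<le> (sqrt (I v v) - sqrt C)\<^sup>2" by simp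
    then have "2 * (sqrt C * sqrt (I v v)) \<le> I v v + C"
      using C nonneg[OF v] by (simp add: power2_diff algebra_simps)
    ultimately show ?thesis by (simp add: J_def)
  qed
  define m where "m = Inf (J ` V)"
  have bb: "bdd_below (J ` V)" using lb by (auto intro!: bdd_belowI2)
  have m_le: "m \<le> J v" if "v \<in> V" for v
    unfolding m_def using that bb by (intro cInf_lower) auto
  have "\<exists>v\<in>V. J v < m + 1 / (real n + 1)" for n :: nat
  proof -
    have "Inf (J ` V) < m + 1 / (real n + 1)" by (simp add: m_def)
    then show ?thesis using cInf_lessD[of "J ` V"] zero by blast
  qed
  then obtain f where f: "\<And>n. f n \<in> V" "\<And>n. J (f n) < m + 1 / (real n + 1)" by metis
  \<comment> \<open>Parallelogram identity: the midpoint of \<open>u\<close> and \<open>v\<close> has \<open>J\<close> at least \<open>m\<close>.\<close>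
  have par: "I (\<lambda>x. u x - v x) (\<lambda>x. u x - v x) \<le> 2 * (J u - m) + 2 * (J v - m)"
    if "u \<in> V" "v \<in> V" for u v
    using quad_expand[OF that, of "1/2" "1/2"] quad_diff[OF that] lin[OF that, of "1/2" "1/2"]
      m_le[OF lincomb[OF that, of "1/2" "1/2"]]
    by (simp add: J_def power2_eq_square)
  have "Cauchy_in f"
    unfolding Cauchy_in_def
  proof (intro conjI allI impI)
    fix \<epsilon> :: real assume "\<epsilon> > 0"
    then obtain N :: nat where N: "N > 4 / \<epsilon>" using reals_Archimedean2 by blast
    have le: "1 / (real k + 1) < \<epsilon> / 4" if "k \<ge> N" for k
    proof -
      have "4 / \<epsilon> < real k + 1" using N that by linarith
      then show ?thesis using \<open>\<epsilon> > 0\<close> by (simp add: field_simps)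
    qed
    have J_le: "J (f k) < m + \<epsilon> / 4" if "k \<ge> N" for k
      using f(2)[of k] le[OF that] by (meson add_strict_left_mono order_less_trans)
    have "I (\<lambda>x. f p x - f n x) (\<lambda>x. f p x - f n x) < \<epsilon>" if "p \<ge> N" "n \<ge> N" for p n
      using par[OF f(1) f(1), of p n] J_le[OF that(1)] J_le[OF that(2)] by argo
    then show "\<exists>N. \<forall>m\<ge>N. \<forall>n\<ge>N. I (\<lambda>x. f m x - f n x) (\<lambda>x. f m x - f n x) < \<epsilon>" by blast
  qed (rule f)
  then obtain u where "converges_in f u" using complete by blast
  then have u: "u \<in> V" "(\<lambda>n. I (\<lambda>x. f n x - u x) (\<lambda>x. f n x - u x)) \<longlonglongrightarrow> 0"
    by (auto simp: converges_in_def)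
  have "I u v = l v" if v: "v \<in> V" for v
  proof -
    \<comment> \<open>Moving from the almost minimal \<open>f n\<close> in direction \<open>v\<close> lowers \<open>J\<close> by at most \<open>1 / (n + 1)\<close>.\<close>
    have var: "0 \<le> 2 * t * (I u v - l v) + t\<^sup>2 * I v v" for t
    proof (rule tendsto_lowerbound)
      have "(\<lambda>n. 1 / (real n + 1)) \<longlonglongrightarrow> 0"
        using LIMSEQ_inverse_real_of_nat by (simp add: inverse_eq_divide add.commute)
      then have "(\<lambda>n. 2 * t * (I (f n) v - l v) + t\<^sup>2 * I v v + 1 / (real n + 1))
          \<longlonglongrightarrow> 2 * t * (I u v - l v) + t\<^sup>2 * I v v + 0"
        by (intro tendsto_intros tendsto_left[OF f(1) u(1) v u(2)])
      then show "(\<lambda>n. 2 * t * (I (f n) v - l v) + t\<^sup>2 * I v v + 1 / (real n + 1))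
          \<longlonglongrightarrow> 2 * t * (I u v - l v) + t\<^sup>2 * I v v"
        by simp
      have "m \<le> J (\<lambda>x. 1 * f n x + t * v x)" for n using f v by (intro m_le lincomb)
      then show "\<forall>\<^sub>F n in sequentially. 0 \<le> 2 * t * (I (f n) v - l v) + t\<^sup>2 * I v v + 1 / (real n + 1)"
      proof (intro always_eventually allI)
        fix n
        show "0 \<le> 2 * t * (I (f n) v - l v) + t\<^sup>2 * I v v + 1 / (real n + 1)"
          using \<open>m \<le> J (\<lambda>x. 1 * f n x + t * v x)\<close> f(2)[of n] quad_expand[OF f(1)[of n] v, of 1 t] lin[OF f(1)[of n] v, of 1 t]
          by (simp add: J_def algebra_simps)
      qed
    qed simp
    show ?thesis
    proof (rule ccontr)
      assume "I u v \<noteq> l v"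
      then have p: "0 < (I u v - l v)\<^sup>2" by simp
      define d where "d = I u v - l v"
      \<comment> \<open>Close to the minimum of the quadratic in \<open>t\<close>; the \<open>+ 1\<close> covers the case \<open>I v v = 0\<close>.\<close>
      define t where "t = - d / (I v v + 1)"
      have iv: "0 < I v v + 1" using nonneg[OF v] by linarith
      have "2 * t * d + t\<^sup>2 * I v v = - d\<^sup>2 * (I v v + 2) / (I v v + 1)\<^sup>2"
        using iv unfolding t_def by (simp add: divide_simps power2_eq_square) (simp add: algebra_simps)
      moreover have "- d\<^sup>2 * (I v v + 2) / (I v v + 1)\<^sup>2 < 0"
        using p iv by (simp add: d_def divide_neg_pos mult_neg_pos)
      ultimately show False using var[of t] by (simp add: d_def)
    qed
  qed
  with u(1) show ?thesis by blast
qed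

text \<open>
  Put \<open>T = id - K\<close>. If \<open>T\<close> were not bounded below, unit vectors \<open>f n\<close> with \<open>T (f n)\<close> tending to \<open>0\<close> would exist;
  by compactness \<open>K (f n)\<close>, hence \<open>f n\<close>, would converge along a subsequence to a unit vector in the
  kernel of \<open>T\<close>, against injectivity. So \<open>I (T u) (T v)\<close> is an equivalent complete form, and its Riesz
  theorem, applied to \<open>v \<mapsto> I (T v) G\<close>, gives \<open>F\<close> with \<open>T F - G\<close> orthogonal to the range of \<open>T\<close>. As \<open>T\<close> is symmetric,
  \<open>T F - G\<close> lies in the kernel of \<open>T\<close> and is null.
\<close>

lemma Fredholm_alternative:
  assumes KV: "\<And>u. u \<in> V \<Longrightarrow> K u \<in> V"
    and Ksym: "\<And>u v. u \<in> V \<Longrightarrow> v \<in> V \<Longrightarrow> I (K u) v = I u (K v)"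
    and Kbdd: "\<And>u. u \<in> V \<Longrightarrow> I (K u) (K u) \<le> M * I u u"
    and Kcompact: "\<And>f. (\<And>n. f n \<in> V) \<Longrightarrow> (\<And>n. I (f n) (f n) \<le> 1) \<Longrightarrow>
      \<exists>r g. strict_mono (r :: nat \<Rightarrow> nat) \<and> converges_in (\<lambda>n. K (f (r n))) g"
    and inj: "\<And>u. u \<in> V \<Longrightarrow> I (\<lambda>x. u x - K u x) (\<lambda>x. u x - K u x) = 0 \<Longrightarrow> I u u = 0"
  shows "\<exists>C\<ge>0. \<forall>G\<in>V. \<exists>F\<in>V.
    I (\<lambda>x. (F x - K F x) - G x) (\<lambda>x. (F x - K F x) - G x) = 0 \<and> I F F \<le> C * I G G"
proof -
  define T where "T u = (\<lambda>x. u x - K u x)" for u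
  have TV: "T u \<in> V" if "u \<in> V" for u unfolding T_def using that KV by (intro diff_mem) auto
  have Tsym: "I (T u) v = I u (T v)" if "u \<in> V" "v \<in> V" for u v
    unfolding T_def using that by (simp add: diff_left diff_right KV Ksym)
  have Tlin: "I (T (\<lambda>x. a * u x + b * v x)) w = a * I (T u) w + b * I (T v) w"
    if "u \<in> V" "v \<in> V" "w \<in> V" for u v w a b
    using that by (simp add: Tsym TV lincomb linear_left)
  have Tbdd: "I (T u) (T u) \<le> (2 + 2 * M) * I u u" if "u \<in> V" for u
    using diff_sq[OF that KV[OF that]] Kbdd[OF that] by (simp add: T_def algebra_simps)
  have "\<exists>\<delta>>0. \<forall>u\<in>V. \<delta> * I u u \<le> I (T u) (T u)"
  proof (rule ccontr)
    assume neg: "\<not> ?thesis"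
    have ex: "\<exists>u\<in>V. I (T u) (T u) < (1 / (real n + 1)) * I u u" for n :: nat
    proof (rule ccontr)
      assume "\<not> ?thesis"
      then have "\<forall>u\<in>V. (1 / (real n + 1)) * I u u \<le> I (T u) (T u)" by force
      moreover have "0 < 1 / (real n + 1)" by simp
      ultimately show False using neg by blast
    qed
    have "\<exists>v\<in>V. I v v = 1 \<and> I (T v) (T v) < 1 / (real n + 1)" for n :: nat
    proof -
      obtain u where u: "u \<in> V" "I (T u) (T u) < (1 / (real n + 1)) * I u u" using ex by blast
      have pos: "0 < I u u"
        using u nonneg[OF TV[OF u(1)]] nonneg[OF u(1)] by (cases "I u u = 0") auto
      define c where "c = 1 / sqrt (I u u)"
      have c2: "c\<^sup>2 * I u u = 1" using pos by (simp add: c_def power_divide)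
      have cu: "(\<lambda>x. c * u x) \<in> V" by (rule scale_mem[OF u(1)])
      have sc: "I (T (\<lambda>x. c * u x)) w = c * I (T u) w" if "w \<in> V" for w
        using Tlin[OF u(1) u(1) that, of c 0] by simp
      have "I (T (\<lambda>x. c * u x)) (T (\<lambda>x. c * u x)) = c * I (T (\<lambda>x. c * u x)) (T u)"
        using sc[OF TV[OF cu]] sym[OF TV TV, OF u(1) cu] by simp
      also have "\<dots> = c\<^sup>2 * I (T u) (T u)" using sc[OF TV[OF u(1)]] by (simp add: power2_eq_square)
      finally have "I (T (\<lambda>x. c * u x)) (T (\<lambda>x. c * u x)) = c\<^sup>2 * I (T u) (T u)" .
      moreover have "c\<^sup>2 * I (T u) (T u) < c\<^sup>2 * ((1 / (real n + 1)) * I u u)"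
        using u(2) pos by (intro mult_strict_left_mono) (auto simp: c_def)
      moreover have "c\<^sup>2 * ((1 / (real n + 1)) * I u u) = 1 / (real n + 1)"
        using c2 by (simp add: field_simps)
      moreover have "I (\<lambda>x. c * u x) (\<lambda>x. c * u x) = 1"
        using quad_expand[OF u(1) u(1), of c 0] c2 by simp
      ultimately show ?thesis using cu by auto
    qed
    then obtain f where f: "\<And>n. f n \<in> V" "\<And>n. I (f n) (f n) = 1"
      "\<And>n. I (T (f n)) (T (f n)) < 1 / (real n + 1)" by metis
    obtain r g where r: "strict_mono (r :: nat \<Rightarrow> nat)" and g: "converges_in (\<lambda>n. K (f (r n))) g"
      using Kcompact[of f] f by auto
    have gV: "g \<in> V" using g by (simp add: converges_in_def)
    have "(\<lambda>n. 1 / (real n + 1)) \<longlonglongrightarrow> 0"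
      using LIMSEQ_inverse_real_of_nat by (simp add: inverse_eq_divide add.commute)
    then have "(\<lambda>n. I (T (f n)) (T (f n))) \<longlonglongrightarrow> 0"
      by (rule real_tendsto_sandwich[rotated 2, OF tendsto_const])
         (use f nonneg TV in \<open>auto intro!: always_eventually simp: less_imp_le\<close>)
    then have T0: "(\<lambda>n. I (T (f (r n))) (T (f (r n)))) \<longlonglongrightarrow> 0"
      using LIMSEQ_subseq_LIMSEQ[OF _ r] unfolding o_def by fast
    have fg: "(\<lambda>n. I (\<lambda>x. f (r n) x - g x) (\<lambda>x. f (r n) x - g x)) \<longlonglongrightarrow> 0"
    proof (rule real_tendsto_sandwich[OF _ _ tendsto_const])
      have "I (\<lambda>x. f (r n) x - g x) (\<lambda>x. f (r n) x - g x) \<le> 2 * I (T (f (r n))) (T (f (r n)))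
        + 2 * I (\<lambda>x. K (f (r n)) x - g x) (\<lambda>x. K (f (r n)) x - g x)" for n
        using triangle_sq[OF TV[OF f(1)] diff_mem[OF KV[OF f(1)] gV], of "r n" "r n"]
        by (simp add: T_def)
      then show "\<forall>\<^sub>F n in sequentially. I (\<lambda>x. f (r n) x - g x) (\<lambda>x. f (r n) x - g x) \<le>
         2 * I (T (f (r n))) (T (f (r n))) + 2 * I (\<lambda>x. K (f (r n)) x - g x) (\<lambda>x. K (f (r n)) x - g x)"
        by simp
      show "\<forall>\<^sub>F n in sequentially. 0 \<le> I (\<lambda>x. f (r n) x - g x) (\<lambda>x. f (r n) x - g x)"
        using nonneg[OF diff_mem[OF f(1) gV]] by simp
      show "(\<lambda>n. 2 * I (T (f (r n))) (T (f (r n)))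
        + 2 * I (\<lambda>x. K (f (r n)) x - g x) (\<lambda>x. K (f (r n)) x - g x)) \<longlonglongrightarrow> 0"
        using tendsto_add[OF tendsto_mult_left[OF T0, of 2] tendsto_mult_left[of _ 0 _ 2]] g
        by (simp add: converges_in_def)
    qed
    have "I g g = 1"
      using tendsto_quad[OF f(1) gV fg] f(2) by (simp add: LIMSEQ_const_iff)
    moreover have "I (T g) (T g) = 0"
    proof -
      have "(\<lambda>n. I (f (r n)) (T (T g))) \<longlonglongrightarrow> I g (T (T g))"
        by (rule tendsto_left[OF f(1) gV TV[OF TV[OF gV]] fg])
      then have "(\<lambda>n. I (T (f (r n))) (T g)) \<longlonglongrightarrow> I (T g) (T g)"
        using Tsym TV gV f(1) by simp
      moreover have "(\<lambda>n. I (T (f (r n))) (T g)) \<longlonglongrightarrow> 0"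
      proof (rule Lim_null_comparison)
        show "\<forall>\<^sub>F n in sequentially. norm (I (T (f (r n))) (T g))
           \<le> sqrt (I (T (f (r n))) (T (f (r n)))) * sqrt (I (T g) (T g))"
          using Cauchy_Schwarz_sqrt[OF TV[OF f(1)] TV[OF gV]] by simp
        show "(\<lambda>n. sqrt (I (T (f (r n))) (T (f (r n)))) * sqrt (I (T g) (T g))) \<longlonglongrightarrow> 0"
          using tendsto_mult_right[OF tendsto_real_sqrt[OF T0], of "sqrt (I (T g) (T g))"] by simp
      qed
      ultimately show ?thesis using LIMSEQ_unique by blast
    qed
    ultimately show False using inj[OF gV] by (simp add: T_def)
  qed
  then obtain \<delta> where \<delta>: "\<delta> > 0" "\<And>u. u \<in> V \<Longrightarrow> \<delta> * I u u \<le> I (T u) (T u)" by blast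
  interpret T: semi_inner V "\<lambda>u v. I (T u) (T v)"
    by unfold_locales (auto simp: lincomb zero Tlin TV nonneg intro: sym)
  have Tdiff: "I (T (\<lambda>x. u x - v x)) w = I (T u) w - I (T v) w" if "u \<in> V" "v \<in> V" "w \<in> V" for u v w
    using Tlin[OF that, of 1 "-1"] by simp
  interpret T: semi_hilbert V "\<lambda>u v. I (T u) (T v)"
  proof
    fix f assume f: "T.Cauchy_in f"
    have fV: "f n \<in> V" for n using f by (simp add: T.Cauchy_in_def)
    have "Cauchy_in f"
      unfolding Cauchy_in_def
    proof (intro conjI allI impI fV)
      fix \<epsilon> :: real assume "\<epsilon> > 0"
      then obtain N where N: "\<And>m n. m \<ge> N \<Longrightarrow> n \<ge> N \<Longrightarrow>
          I (T (\<lambda>x. f m x - f n x)) (T (\<lambda>x. f m x - f n x)) < \<delta> * \<epsilon>"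
        using f \<delta>(1) unfolding T.Cauchy_in_def by (meson mult_pos_pos)
      have "I (\<lambda>x. f m x - f n x) (\<lambda>x. f m x - f n x) < \<epsilon>" if "m \<ge> N" "n \<ge> N" for m n
      proof -
        have "\<delta> * I (\<lambda>x. f m x - f n x) (\<lambda>x. f m x - f n x) < \<delta> * \<epsilon>"
          by (rule order_le_less_trans[OF \<delta>(2)[OF diff_mem[OF fV fV]] N[OF that]])
        then show ?thesis using \<delta>(1) by simp
      qed
      then show "\<exists>N. \<forall>m\<ge>N. \<forall>n\<ge>N. I (\<lambda>x. f m x - f n x) (\<lambda>x. f m x - f n x) < \<epsilon>" by blast
    qed
    then obtain u where u: "converges_in f u" using complete by blast
    then have uV: "u \<in> V" by (simp add: converges_in_def)
    have "(\<lambda>n. I (T (\<lambda>x. f n x - u x)) (T (\<lambda>x. f n x - u x))) \<longlonglongrightarrow> 0"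
    proof (rule real_tendsto_sandwich[OF _ _ tendsto_const])
      show "\<forall>\<^sub>F n in sequentially. I (T (\<lambda>x. f n x - u x)) (T (\<lambda>x. f n x - u x))
         \<le> (2 + 2 * M) * I (\<lambda>x. f n x - u x) (\<lambda>x. f n x - u x)"
        using Tbdd[OF diff_mem[OF fV uV]] by simp
      show "(\<lambda>n. (2 + 2 * M) * I (\<lambda>x. f n x - u x) (\<lambda>x. f n x - u x)) \<longlonglongrightarrow> 0"
        using u tendsto_mult_left[of "\<lambda>n. I (\<lambda>x. f n x - u x) (\<lambda>x. f n x - u x)" 0 _ "2 + 2 * M"]
        by (simp add: converges_in_def)
      show "\<forall>\<^sub>F n in sequentially. 0 \<le> I (T (\<lambda>x. f n x - u x)) (T (\<lambda>x. f n x - u x))"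
        by (simp add: nonneg TV diff_mem fV uV)
    qed
    then show "\<exists>u. T.converges_in f u" using fV uV by (auto simp: T.converges_in_def)
  qed
  have "\<exists>F\<in>V. I (\<lambda>x. T F x - G x) (\<lambda>x. T F x - G x) = 0 \<and> I F F \<le> 1 / \<delta> * I G G" if G: "G \<in> V" for G
  proof -
    have "\<exists>F\<in>V. \<forall>v\<in>V. I (T F) (T v) = I (T v) G"
    proof (rule T.Riesz_representation[where C = "I G G"])
      show "(I (T u) G)\<^sup>2 \<le> I G G * I (T u) (T u)" if "u \<in> V" for u
        using Cauchy_Schwarz[OF TV[OF that] G] by (simp add: mult.commute)
    qed (auto simp: Tlin G nonneg)
    then obtain F where F: "F \<in> V" "\<And>v. v \<in> V \<Longrightarrow> I (T F) (T v) = I (T v) G" by blast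
    define z where "z = (\<lambda>x. T F x - G x)"
    have z: "z \<in> V" unfolding z_def using TV F G by (intro diff_mem) auto
    have "I z (T v) = 0" if "v \<in> V" for v
      unfolding z_def using that by (simp add: diff_left TV F G sym)
    then have "I (T z) (T z) = 0" using Tsym[OF z TV[OF z]] TV[OF z] by simp
    then have "I z z = 0" using inj[OF z] by (simp add: T_def)
    moreover have "I F F \<le> 1 / \<delta> * I G G"
    proof -
      define a where "a = I (T F) (T F)"
      have a0: "0 \<le> a" unfolding a_def by (rule nonneg[OF TV[OF F(1)]])
      have "a\<^sup>2 \<le> a * I G G" using Cauchy_Schwarz[OF TV[OF F(1)] G] F(2)[OF F(1)] by (simp add: a_def)
      then have "a \<le> I G G" using a0 nonneg[OF G] by (cases "a = 0") (auto simp: power2_eq_square)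
      moreover have "\<delta> * I F F \<le> a" unfolding a_def by (rule \<delta>(2)[OF F(1)])
      ultimately show ?thesis using \<delta>(1) by (simp add: field_simps)
    qed
    ultimately show ?thesis using F(1) by (auto simp: z_def)
  qed
  then show ?thesis using \<delta>(1) unfolding T_def by (intro exI[of _ "1 / \<delta>"]) auto
qed

end


section \<open>Square integrable functions\<close>

text \<open>
  The squared norm with values in \<open>ennreal\<close>, for functions with values in any normed space: finiteness
  need not be known beforehand, and monotone convergence and Fatou apply without side conditions. It
  serves real functions and their complex Fourier transforms alike.
\<close>

definition sqn :: "'a measure \<Rightarrow> ('a \<Rightarrow> 'b::real_normed_vector) \<Rightarrow> ennreal" where
  "sqn M f = (\<integral>\<^sup>+x. ennreal ((norm (f x))\<^sup>2) \<partial>M)"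

lemma norm_add_sq_le: "(norm (a + b))\<^sup>2 \<le> 2 * (norm a)\<^sup>2 + 2 * (norm (b::'b::real_normed_vector))\<^sup>2"
proof -
  have "(norm (a + b))\<^sup>2 \<le> (norm a + norm b)\<^sup>2" by (intro power_mono norm_triangle_ineq) simp
  also have "\<dots> \<le> 2 * (norm a)\<^sup>2 + 2 * (norm b)\<^sup>2"
    using zero_le_power2[of "norm a - norm b"] by (simp add: power2_eq_square algebra_simps)
  finally show ?thesis .
qed

lemma sqn_cong_AE: "AE x in M. norm (f x) = norm (g x) \<Longrightarrow> sqn M f = sqn M g"
  unfolding sqn_def by (intro nn_integral_cong_AE) auto

lemma sqn_mono_AE: "AE x in M. norm (f x) \<le> norm (g x) \<Longrightarrow> sqn M f \<le> sqn M g"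
  unfolding sqn_def by (intro nn_integral_mono_AE) (auto intro!: power_mono ennreal_leI)

lemma sqn_add_le:
  fixes f g :: "'a \<Rightarrow> 'b::{real_normed_vector, second_countable_topology}"
  assumes [measurable]: "f \<in> borel_measurable M" "g \<in> borel_measurable M"
  shows "sqn M (\<lambda>x. f x + g x) \<le> 2 * sqn M f + 2 * sqn M g"
proof -
  have "sqn M (\<lambda>x. f x + g x) \<le> (\<integral>\<^sup>+x. 2 * ennreal ((norm (f x))\<^sup>2) + 2 * ennreal ((norm (g x))\<^sup>2) \<partial>M)"
    unfolding sqn_def
  proof (rule nn_integral_mono)
    fix x
    have "ennreal ((norm (f x + g x))\<^sup>2) \<le> ennreal (2 * (norm (f x))\<^sup>2 + 2 * (norm (g x))\<^sup>2)"
      by (intro ennreal_leI norm_add_sq_le)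
    then show "ennreal ((norm (f x + g x))\<^sup>2) \<le> 2 * ennreal ((norm (f x))\<^sup>2) + 2 * ennreal ((norm (g x))\<^sup>2)"
      by (simp add: ennreal_plus ennreal_mult)
  qed
  also have "\<dots> = 2 * sqn M f + 2 * sqn M g"
    by (simp add: sqn_def nn_integral_add nn_integral_cmult)
  finally show ?thesis .
qed

lemma sqn_minus [simp]: "sqn M (\<lambda>x. - f x) = sqn M f"
  by (simp add: sqn_def)

lemma sqn_commute: "sqn M (\<lambda>x. f x - g x) = sqn M (\<lambda>x. g x - f x)"
  by (simp add: sqn_def norm_minus_commute)

lemma sqn_diff_le:
  fixes f g :: "'a \<Rightarrow> 'b::{real_normed_vector, second_countable_topology}"
  assumes "f \<in> borel_measurable M" "g \<in> borel_measurable M"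
  shows "sqn M (\<lambda>x. f x - g x) \<le> 2 * sqn M f + 2 * sqn M g"
  using sqn_add_le[of f M "\<lambda>x. - g x"] assms by simp

lemma sqn_diff_trans:
  fixes f g h :: "'a \<Rightarrow> 'b::{real_normed_vector, second_countable_topology}"
  assumes [measurable]: "f \<in> borel_measurable M" "g \<in> borel_measurable M" "h \<in> borel_measurable M"
  shows "sqn M (\<lambda>x. f x - h x) \<le> 2 * sqn M (\<lambda>x. f x - g x) + 2 * sqn M (\<lambda>x. g x - h x)"
  using sqn_add_le[of "\<lambda>x. f x - g x" M "\<lambda>x. g x - h x"] by simp

lemma sqn_scale: "sqn M (\<lambda>x. a *\<^sub>R f x) = ennreal (a\<^sup>2) * sqn M f" if "f \<in> borel_measurable M"
  for f :: "'a \<Rightarrow> 'b::{real_normed_vector, second_countable_topology}"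
  using that unfolding sqn_def
  by (subst nn_integral_cmult[symmetric]) (auto simp: power_mult_distrib ennreal_mult)

lemma sqn_eq_0_iff:
  fixes f :: "'a \<Rightarrow> 'b::{real_normed_vector, second_countable_topology}"
  assumes [measurable]: "f \<in> borel_measurable M"
  shows "sqn M f = 0 \<longleftrightarrow> (AE x in M. f x = 0)"
  unfolding sqn_def by (subst nn_integral_0_iff_AE) (auto simp: ennreal_eq_0_iff)

text \<open>
  How bounds pass to limits throughout: a pointwise limit of functions with squared norm at most \<open>c\<close>
  has squared norm at most \<open>c\<close>, and need not be known to be square integrable.
\<close>

lemma sqn_Fatou:
  fixes f :: "nat \<Rightarrow> 'a \<Rightarrow> 'b::{real_normed_vector, second_countable_topology}"
  assumes [measurable]: "\<And>k. f k \<in> borel_measurable M"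
    and lim: "AE x in M. (\<lambda>k. f k x) \<longlonglongrightarrow> g x"
    and le: "\<forall>\<^sub>F k in sequentially. sqn M (f k) \<le> c"
  shows "sqn M g \<le> c"
proof -
  have "sqn M g = (\<integral>\<^sup>+x. liminf (\<lambda>k. ennreal ((norm (f k x))\<^sup>2)) \<partial>M)"
    unfolding sqn_def
  proof (rule nn_integral_cong_AE)
    show "AE x in M. ennreal ((norm (g x))\<^sup>2) = liminf (\<lambda>k. ennreal ((norm (f k x))\<^sup>2))"
      using lim
    proof eventually_elim
      case (elim x)
      have "(\<lambda>k. ennreal ((norm (f k x))\<^sup>2)) \<longlonglongrightarrow> ennreal ((norm (g x))\<^sup>2)"
        by (intro tendsto_ennrealI tendsto_intros elim)
      then show ?case using lim_imp_Liminf[OF trivial_limit_sequentially] by metis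
    qed
  qed
  also have "\<dots> \<le> liminf (\<lambda>k. \<integral>\<^sup>+x. ennreal ((norm (f k x))\<^sup>2) \<partial>M)"
    by (intro nn_integral_liminf) auto
  also have "\<dots> \<le> liminf (\<lambda>k. c)"
    by (rule Liminf_mono) (use le in \<open>simp add: sqn_def\<close>)
  also have "\<dots> = c" by (simp add: Liminf_const)
  finally show ?thesis .
qed

lemma sqn_dominated:
  fixes f :: "nat \<Rightarrow> 'a \<Rightarrow> 'b::{real_normed_vector, second_countable_topology}"
  assumes [measurable]: "\<And>k. f k \<in> borel_measurable M" "g \<in> borel_measurable M" "w \<in> borel_measurable M"
    and lim: "AE x in M. (\<lambda>k. f k x) \<longlonglongrightarrow> g x"
    and le: "\<And>k. AE x in M. norm (f k x) \<le> norm (w x)" and w: "sqn M (w :: 'a \<Rightarrow> real) < \<infinity>"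
  shows "(\<lambda>k. sqn M (\<lambda>x. f k x - g x)) \<longlonglongrightarrow> 0"
proof -
  have gw: "AE x in M. norm (g x) \<le> norm (w x)"
  proof -
    have "AE x in M. \<forall>k. norm (f k x) \<le> norm (w x)" using le by (simp add: AE_all_countable)
    with lim show ?thesis
    proof eventually_elim
      case (elim x)
      then show ?case by (intro Lim_bounded[OF tendsto_norm[OF elim(1)], of 0]) auto
    qed
  qed
  have "(\<lambda>k. \<integral>\<^sup>+x. ennreal ((norm (f k x - g x))\<^sup>2) \<partial>M) \<longlonglongrightarrow> (\<integral>\<^sup>+x. 0 \<partial>M)"
  proof (rule nn_integral_dominated_convergence[where w = "\<lambda>x. 4 * ennreal ((norm (w x))\<^sup>2)"])
    show "AE x in M. ennreal ((norm (f k x - g x))\<^sup>2) \<le> 4 * ennreal ((norm (w x))\<^sup>2)" for k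
      using le[of k] gw
    proof eventually_elim
      case (elim x)
      have "norm (f k x - g x) \<le> 2 * norm (w x)" using elim norm_triangle_ineq4[of "f k x" "g x"] by linarith
      then have "(norm (f k x - g x))\<^sup>2 \<le> (2 * norm (w x))\<^sup>2" by (intro power_mono) auto
      then have "ennreal ((norm (f k x - g x))\<^sup>2) \<le> ennreal (4 * (norm (w x))\<^sup>2)"
        by (intro ennreal_leI) (simp add: power_mult_distrib)
      then show ?case by (simp add: ennreal_mult)
    qed
    show "(\<integral>\<^sup>+x. 4 * ennreal ((norm (w x))\<^sup>2) \<partial>M) < \<infinity>"
      using w by (subst nn_integral_cmult) (auto simp: sqn_def ennreal_mult_less_top)
    show "AE x in M. (\<lambda>k. ennreal ((norm (f k x - g x))\<^sup>2)) \<longlonglongrightarrow> 0"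
      using lim
    proof eventually_elim
      case (elim x)
      have "(\<lambda>k. ennreal ((norm (f k x - g x))\<^sup>2)) \<longlonglongrightarrow> ennreal ((norm (g x - g x))\<^sup>2)"
        by (intro tendsto_ennrealI tendsto_intros elim)
      then show ?case by simp
    qed
  qed auto
  then show ?thesis by (simp add: sqn_def)
qed

text \<open>
  A subsequence with squared distances of consecutive terms below \<open>8\<^sup>-\<^sup>k\<close> converges almost everywhere:
  the sum of \<open>4\<^sup>k \<bar>f (r (k + 1)) - f (r k)\<bar>\<^sup>2\<close> has finite integral, so almost everywhere the increments are
  eventually below \<open>2\<^sup>-\<^sup>k\<close>. Fatou then shows that the whole sequence converges to this pointwise
  limit in the mean.
\<close>

lemma L2_complete:
  fixes f :: "nat \<Rightarrow> 'a \<Rightarrow> 'b::{banach, second_countable_topology}"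
  assumes [measurable]: "\<And>k. f k \<in> borel_measurable M"
    and Cauchy: "\<And>\<epsilon>. \<epsilon> > 0 \<Longrightarrow> \<exists>N. \<forall>m\<ge>N. \<forall>n\<ge>N. sqn M (\<lambda>x. f m x - f n x) < ennreal \<epsilon>"
  obtains g r where "g \<in> borel_measurable M" "(\<lambda>n. sqn M (\<lambda>x. f n x - g x)) \<longlonglongrightarrow> 0"
    "strict_mono (r :: nat \<Rightarrow> nat)" "AE x in M. (\<lambda>k. f (r k) x) \<longlonglongrightarrow> g x"
proof -
  define P where "P k N \<longleftrightarrow> (\<forall>m\<ge>N. \<forall>n\<ge>N. sqn M (\<lambda>x. f m x - f n x) < ennreal ((1/8)^k))" for k N :: nat
  have exP: "\<exists>N. P k N" for k unfolding P_def by (intro Cauchy) simp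
  have P_mono: "P k N'" if "P k N" "N \<le> N'" for k N N' using that unfolding P_def by auto
  have ex: "\<exists>N>N0. P k N" for k N0
  proof -
    obtain N where "P k N" using exP by blast
    then show ?thesis using P_mono[of k N "max N (Suc N0)"] by (intro exI[of _ "max N (Suc N0)"]) auto
  qed
  define r where "r = rec_nat (SOME N. P 0 N) (\<lambda>k N. SOME N'. N' > N \<and> P (Suc k) N')"
  have r0: "P 0 (r 0)" unfolding r_def by simp (rule someI_ex, rule exP)
  have rS: "r (Suc k) > r k \<and> P (Suc k) (r (Suc k))" for k
    unfolding r_def by simp (rule someI_ex, rule ex)
  have r: "strict_mono r" using rS by (simp add: strict_mono_Suc_iff)
  have Pr: "P k (r k)" for k using r0 rS by (cases k) auto
  define D where "D k x = f (r (Suc k)) x - f (r k) x" for k x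
  have [measurable]: "D k \<in> borel_measurable M" for k unfolding D_def by measurable
  have D_le: "sqn M (D k) \<le> ennreal ((1/8)^k)" for k
    using Pr[of k] rS[of k] unfolding P_def D_def by (meson less_imp_le order_refl)
  have "(\<integral>\<^sup>+x. (\<Sum>k. ennreal (4^k * (norm (D k x))\<^sup>2)) \<partial>M) = (\<Sum>k. \<integral>\<^sup>+x. ennreal (4^k * (norm (D k x))\<^sup>2) \<partial>M)"
    by (intro nn_integral_suminf) auto
  also have "\<dots> = (\<Sum>k. ennreal (4^k) * sqn M (D k))"
    by (simp add: sqn_def ennreal_mult nn_integral_cmult)
  also have "\<dots> \<le> (\<Sum>k. ennreal ((1/2)^k))"
  proof (intro suminf_le)
    fix k
    have "ennreal (4^k) * sqn M (D k) \<le> ennreal (4^k) * ennreal ((1/8)^k)"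
      by (intro mult_left_mono D_le) auto
    also have "\<dots> = ennreal ((1/2)^k)"
      by (simp add: ennreal_mult[symmetric] power_mult_distrib[symmetric])
    finally show "ennreal (4^k) * sqn M (D k) \<le> ennreal ((1/2)^k)" .
  qed auto
  also have "\<dots> = ennreal (\<Sum>k. (1/2)^k)"
    by (intro suminf_ennreal2) (auto intro: summable_geometric)
  finally have "(\<integral>\<^sup>+x. (\<Sum>k. ennreal (4^k * (norm (D k x))\<^sup>2)) \<partial>M) < \<infinity>"
    by (rule order_le_less_trans) simp
  then have "AE x in M. (\<Sum>k. ennreal (4^k * (norm (D k x))\<^sup>2)) \<noteq> \<infinity>"
    by (intro nn_integral_PInf_AE) auto
  then have conv: "AE x in M. convergent (\<lambda>k. f (r k) x)"
  proof eventually_elim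
    case (elim x)
    have "summable (\<lambda>k. 4^k * (norm (D k x))\<^sup>2)"
      using elim by (intro summable_suminf_not_top) (auto simp: top_ennreal_def)
    then have "(\<lambda>k. 4^k * (norm (D k x))\<^sup>2) \<longlonglongrightarrow> 0" by (rule summable_LIMSEQ_zero)
    then have "\<forall>\<^sub>F k in sequentially. 4^k * (norm (D k x))\<^sup>2 < 1" by (rule order_tendstoD) simp
    then have "\<forall>\<^sub>F k in sequentially. norm (D k x) \<le> (1/2)^k"
    proof eventually_elim
      case (elim k)
      have "(4::real)^k = (2^k)\<^sup>2" by (simp add: power2_eq_square flip: power_mult_distrib)
      then have "(2^k * norm (D k x))\<^sup>2 \<le> 1\<^sup>2" using elim by (simp add: power_mult_distrib)
      then have "2^k * norm (D k x) \<le> 1" by (rule power2_le_imp_le) simp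
      then show ?case by (simp add: power_one_over field_simps)
    qed
    then have "summable (\<lambda>k. D k x)"
      by (rule summable_comparison_test_ev) (auto intro: summable_geometric)
    then have "convergent (\<lambda>n. \<Sum>k<n. D k x)" by (simp add: summable_iff_convergent)
    moreover have "(\<Sum>k<n. D k x) = f (r n) x - f (r 0) x" for n
      unfolding D_def by (rule sum_lessThan_telescope)
    ultimately have "convergent (\<lambda>n. f (r n) x - f (r 0) x)" by simp
    then show ?case using convergent_diff_const_right_iff by blast
  qed
  define g where "g x = lim (\<lambda>k. f (r k) x)" for x
  have [measurable]: "g \<in> borel_measurable M" unfolding g_def by (rule borel_measurable_lim_metric) simp
  have lim: "AE x in M. (\<lambda>k. f (r k) x) \<longlonglongrightarrow> g x"
    using conv by eventually_elim (simp add: g_def convergent_LIMSEQ_iff)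
  have "(\<lambda>n. sqn M (\<lambda>x. f n x - g x)) \<longlonglongrightarrow> 0"
  proof (rule order_tendstoI)
    fix a :: ennreal assume "0 < a"
    then have "\<exists>b>0. ennreal b < a"
    proof (cases a)
      case (real r)
      with \<open>0 < a\<close> show ?thesis by (intro exI[of _ "r/2"]) (auto simp: ennreal_less_iff)
    next
      case top
      then show ?thesis by (intro exI[of _ 1]) auto
    qed
    then obtain b where b: "0 < b" "ennreal b < a" by blast
    obtain N where N: "\<And>m n. m \<ge> N \<Longrightarrow> n \<ge> N \<Longrightarrow> sqn M (\<lambda>x. f m x - f n x) < ennreal b"
      using Cauchy[OF b(1)] by blast
    have "sqn M (\<lambda>x. f n x - g x) < a" if "n \<ge> N" for n
    proof -
      have "sqn M (\<lambda>x. f n x - g x) \<le> ennreal b"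
      proof (rule sqn_Fatou[where f = "\<lambda>k x. f n x - f (r k) x"])
        show "AE x in M. (\<lambda>k. f n x - f (r k) x) \<longlonglongrightarrow> f n x - g x"
          using lim by eventually_elim (intro tendsto_intros)
        show "\<forall>\<^sub>F k in sequentially. sqn M (\<lambda>x. f n x - f (r k) x) \<le> ennreal b"
          unfolding eventually_sequentially
          using N[OF that] r by (meson less_imp_le order_trans seq_suble)
      qed simp
      then show ?thesis using b(2) by (rule order_le_less_trans)
    qed
    then show "\<forall>\<^sub>F n in sequentially. sqn M (\<lambda>x. f n x - g x) < a"
      unfolding eventually_sequentially by blast
  qed auto
  then show ?thesis using that \<open>g \<in> borel_measurable M\<close> r lim by blast
qed

lemma L2_tendsto_Cauchy:
  fixes f :: "nat \<Rightarrow> 'a \<Rightarrow> 'b::{banach, second_countable_topology}"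
  assumes [measurable]: "\<And>k. f k \<in> borel_measurable M" "g \<in> borel_measurable M"
    and lim: "(\<lambda>n. sqn M (\<lambda>x. f n x - g x)) \<longlonglongrightarrow> 0" and "\<epsilon> > 0"
  shows "\<exists>N. \<forall>m\<ge>N. \<forall>n\<ge>N. sqn M (\<lambda>x. f m x - f n x) < ennreal \<epsilon>"
proof -
  have "\<forall>\<^sub>F n in sequentially. sqn M (\<lambda>x. f n x - g x) < ennreal (\<epsilon>/4)"
    using lim \<open>\<epsilon> > 0\<close> by (intro order_tendstoD) auto
  then obtain N where N: "\<And>n. n \<ge> N \<Longrightarrow> sqn M (\<lambda>x. f n x - g x) < ennreal (\<epsilon>/4)"
    unfolding eventually_sequentially by blast
  have "sqn M (\<lambda>x. f m x - f n x) < ennreal \<epsilon>" if "m \<ge> N" "n \<ge> N" for m n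
  proof -
    have "sqn M (\<lambda>x. f m x - f n x) \<le> 2 * sqn M (\<lambda>x. f m x - g x) + 2 * sqn M (\<lambda>x. f n x - g x)"
      using sqn_diff_trans[of "f m" M g "f n"] by (simp add: sqn_commute[of M g])
    also have "\<dots> < 2 * ennreal (\<epsilon>/4) + 2 * ennreal (\<epsilon>/4)"
      using N that by (intro add_strict_mono ennreal_mult_strict_left_mono) auto
    also have "\<dots> = ennreal \<epsilon>"
      using \<open>\<epsilon> > 0\<close> by (simp add: mult_2[symmetric] ennreal_mult'[symmetric] flip: ennreal_numeral)
    finally show ?thesis .
  qed
  then show ?thesis by blast
qed

lemma L2_limit_unique:
  fixes f :: "nat \<Rightarrow> 'a \<Rightarrow> 'b::{banach, second_countable_topology}"
  assumes [measurable]: "\<And>k. f k \<in> borel_measurable M" "g \<in> borel_measurable M" "h \<in> borel_measurable M"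
    and g: "(\<lambda>n. sqn M (\<lambda>x. f n x - g x)) \<longlonglongrightarrow> 0" and h: "(\<lambda>n. sqn M (\<lambda>x. f n x - h x)) \<longlonglongrightarrow> 0"
  shows "AE x in M. g x = h x"
proof -
  have "(\<lambda>n. 2 * sqn M (\<lambda>x. f n x - g x) + 2 * sqn M (\<lambda>x. f n x - h x)) \<longlonglongrightarrow> 2 * 0 + 2 * 0"
    by (intro tendsto_add ennreal_tendsto_cmult g h) auto
  moreover have "sqn M (\<lambda>x. g x - h x) \<le> 2 * sqn M (\<lambda>x. f n x - g x) + 2 * sqn M (\<lambda>x. f n x - h x)" for n
    using sqn_diff_trans[of g M "f n" h] by (simp add: sqn_commute[of M g])
  ultimately have "sqn M (\<lambda>x. g x - h x) \<le> 2 * 0 + 2 * 0"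
    by (intro tendsto_lowerbound[of "\<lambda>n. 2 * sqn M (\<lambda>x. f n x - g x) + 2 * sqn M (\<lambda>x. f n x - h x)"]) auto
  then have "sqn M (\<lambda>x. g x - h x) = 0" by simp
  then show ?thesis by (subst (asm) sqn_eq_0_iff) auto
qed

lemma L2_tendsto_AE_subseq:
  fixes f :: "nat \<Rightarrow> 'a \<Rightarrow> 'b::{banach, second_countable_topology}"
  assumes [measurable]: "\<And>k. f k \<in> borel_measurable M" "g \<in> borel_measurable M"
    and lim: "(\<lambda>n. sqn M (\<lambda>x. f n x - g x)) \<longlonglongrightarrow> 0"
  obtains r where "strict_mono (r :: nat \<Rightarrow> nat)" "AE x in M. (\<lambda>k. f (r k) x) \<longlonglongrightarrow> g x"
proof -
  obtain h r where h: "h \<in> borel_measurable M" "(\<lambda>n. sqn M (\<lambda>x. f n x - h x)) \<longlonglongrightarrow> 0"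
    "strict_mono (r :: nat \<Rightarrow> nat)" "AE x in M. (\<lambda>k. f (r k) x) \<longlonglongrightarrow> h x"
    by (rule L2_complete[of f M]) (use L2_tendsto_Cauchy[of f M g] lim in auto)
  have "AE x in M. g x = h x" by (rule L2_limit_unique[of f]) (use lim h in auto)
  then have "AE x in M. (\<lambda>k. f (r k) x) \<longlonglongrightarrow> g x" using h(4) by eventually_elim simp
  then show ?thesis using that h(3) by blast
qed

lemma sqn_finite_of_near:
  fixes f g :: "'a \<Rightarrow> 'b::{real_normed_vector, second_countable_topology}"
  assumes [measurable]: "f \<in> borel_measurable M" "g \<in> borel_measurable M"
    and "sqn M f < \<infinity>" "sqn M (\<lambda>x. f x - g x) < \<infinity>"
  shows "sqn M g < \<infinity>"
proof -
  have "sqn M g \<le> 2 * sqn M f + 2 * sqn M (\<lambda>x. f x - g x)"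
    using sqn_diff_le[of f M "\<lambda>x. f x - g x"] by simp
  also have "\<dots> < \<infinity>" using assms by (simp add: ennreal_mult_less_top)
  finally show ?thesis .
qed

lemma integrable_mult_sqn:
  fixes f g :: "'a \<Rightarrow> 'b::{banach, second_countable_topology, real_normed_algebra}"
  assumes [measurable]: "f \<in> borel_measurable M" "g \<in> borel_measurable M"
    and "sqn M f < \<infinity>" "sqn M g < \<infinity>"
  shows "integrable M (\<lambda>x. f x * g x)"
proof -
  have i: "integrable M (\<lambda>x. (norm (f x))\<^sup>2)" "integrable M (\<lambda>x. (norm (g x))\<^sup>2)"
    using assms by (auto simp: integrable_iff_bounded sqn_def)
  show ?thesis
  proof (rule Bochner_Integration.integrable_bound[OF Bochner_Integration.integrable_add[OF i]])
    show "AE x in M. norm (f x * g x) \<le> norm ((norm (f x))\<^sup>2 + (norm (g x))\<^sup>2)"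
    proof (rule AE_I2)
      fix x
      have "norm (f x * g x) \<le> norm (f x) * norm (g x)" by (rule norm_mult_ineq)
      also have "\<dots> \<le> (norm (f x))\<^sup>2 + (norm (g x))\<^sup>2"
      proof -
        have "0 \<le> (norm (f x) - norm (g x))\<^sup>2" "0 \<le> norm (f x) * norm (g x)" by simp_all
        then show ?thesis unfolding power2_diff by linarith
      qed
      finally show "norm (f x * g x) \<le> norm ((norm (f x))\<^sup>2 + (norm (g x))\<^sup>2)" by simp
    qed
  qed simp
qed

lemma sqn_finite_iff_integrable:
  assumes "f \<in> borel_measurable M"
  shows "sqn M f < \<infinity> \<longleftrightarrow> integrable M (\<lambda>x. (norm (f x :: 'b::{banach, second_countable_topology}))\<^sup>2)"
  using assms by (auto simp: integrable_iff_bounded sqn_def)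

lemma L2_iff: "f \<in> L2 M \<longleftrightarrow> f \<in> borel_measurable M \<and> sqn M f < \<infinity>"
  using sqn_finite_iff_integrable[of f M] by (auto simp: L2_def)

lemma L2_measurable [measurable_dest]: "f \<in> L2 M \<Longrightarrow> f \<in> borel_measurable M"
  by (simp add: L2_def)

lemma L2_integrable_mult: "f \<in> L2 M \<Longrightarrow> g \<in> L2 M \<Longrightarrow> integrable M (\<lambda>x. f x * g x)"
  by (intro integrable_mult_sqn) (auto simp: L2_iff)

lemma sqn_eq_integral:
  fixes f :: "'a \<Rightarrow> 'b::{banach, second_countable_topology}"
  assumes "f \<in> borel_measurable M" "sqn M f < \<infinity>"
  shows "sqn M f = ennreal (LINT x|M. (norm (f x))\<^sup>2)"
  using assms unfolding sqn_def
  by (intro nn_integral_eq_integral) (auto simp: integrable_iff_bounded sqn_def)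

lemma sqn_eq_L2_inner: "f \<in> L2 M \<Longrightarrow> sqn M f = ennreal (L2_inner M f f)"
  using sqn_eq_integral[of f M] by (simp add: L2_iff L2_inner_def power2_eq_square)

lemma L2_lincomb:
  assumes "f \<in> L2 M" "g \<in> L2 M" shows "(\<lambda>x. a * f x + b * g x) \<in> L2 M"
proof -
  have [measurable]: "f \<in> borel_measurable M" "g \<in> borel_measurable M" using assms by (auto simp: L2_iff)
  have "sqn M (\<lambda>x. a * f x + b * g x) \<le> 2 * sqn M (\<lambda>x. a *\<^sub>R f x) + 2 * sqn M (\<lambda>x. b *\<^sub>R g x)"
    using sqn_add_le[of "\<lambda>x. a *\<^sub>R f x" M "\<lambda>x. b *\<^sub>R g x"] by simp
  also have "\<dots> < \<infinity>" using assms sqn_scale[of f M a] sqn_scale[of g M b] by (simp add: L2_iff ennreal_mult_less_top)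
  finally show ?thesis by (simp add: L2_iff)
qed

global_interpretation L2: semi_hilbert "L2 M" "L2_inner M" for M :: "'a measure"
proof -
  interpret semi_inner "L2 M" "L2_inner M"
  proof
    show "(\<lambda>x. 0) \<in> L2 M" by (simp add: L2_def)
    fix u v w :: "'a \<Rightarrow> real" and a b :: real
    assume "u \<in> L2 M" "v \<in> L2 M" "w \<in> L2 M"
    then show "L2_inner M (\<lambda>x. a * u x + b * v x) w = a * L2_inner M u w + b * L2_inner M v w"
      using L2_integrable_mult[of u M w] L2_integrable_mult[of v M w]
      by (simp add: L2_inner_def distrib_right mult.assoc)
  next
    show "(\<lambda>x. a * u x + b * v x) \<in> L2 M" if "u \<in> L2 M" "v \<in> L2 M" for u v a b
      using that by (rule L2_lincomb)
  qed (auto simp: L2_inner_def mult.commute)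
  show "semi_hilbert (L2 M) (L2_inner M)"
  proof
    fix f assume f: "Cauchy_in f"
    have fL: "f n \<in> L2 M" for n using f by (simp add: Cauchy_in_def)
    have [measurable]: "f n \<in> borel_measurable M" for n using fL by (simp add: L2_iff)
    have "\<exists>N. \<forall>m\<ge>N. \<forall>n\<ge>N. sqn M (\<lambda>x. f m x - f n x) < ennreal \<epsilon>" if "\<epsilon> > 0" for \<epsilon>
    proof -
      have "\<exists>N. \<forall>m\<ge>N. \<forall>n\<ge>N. L2_inner M (\<lambda>x. f m x - f n x) (\<lambda>x. f m x - f n x) < \<epsilon>"
        using f that by (simp add: Cauchy_in_def)
      then obtain N where N: "\<forall>m\<ge>N. \<forall>n\<ge>N. L2_inner M (\<lambda>x. f m x - f n x) (\<lambda>x. f m x - f n x) < \<epsilon>" ..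
      then have "sqn M (\<lambda>x. f m x - f n x) < ennreal \<epsilon>" if "m \<ge> N" "n \<ge> N" for m n
        using N that \<open>\<epsilon> > 0\<close> by (simp add: sqn_eq_L2_inner diff_mem fL ennreal_less_iff nonneg)
      then show ?thesis by blast
    qed
    then obtain g where g: "g \<in> borel_measurable M" "(\<lambda>n. sqn M (\<lambda>x. f n x - g x)) \<longlonglongrightarrow> 0"
      by - (rule L2_complete[of f M], auto)
    have "\<forall>\<^sub>F n in sequentially. sqn M (\<lambda>x. f n x - g x) < \<infinity>"
      using g(2) by (intro order_tendstoD) auto
    then obtain n where "sqn M (\<lambda>x. f n x - g x) < \<infinity>" using eventually_happens by fastforce
    then have "sqn M g < \<infinity>"
      by (rule sqn_finite_of_near[rotated 3]) (use fL[of n] g(1) in \<open>simp_all add: L2_iff\<close>)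
    then have gL: "g \<in> L2 M" using g by (simp add: L2_iff)
    have "(\<lambda>n. ennreal (L2_inner M (\<lambda>x. f n x - g x) (\<lambda>x. f n x - g x))) \<longlonglongrightarrow> ennreal 0"
      using g(2) by (simp add: sqn_eq_L2_inner diff_mem fL gL)
    then have "(\<lambda>n. L2_inner M (\<lambda>x. f n x - g x) (\<lambda>x. f n x - g x)) \<longlonglongrightarrow> 0"
      by (subst (asm) tendsto_ennreal_iff) (auto simp: nonneg diff_mem fL gL)
    then show "\<exists>u. converges_in f u" using fL gL by (auto simp: converges_in_def)
  qed
qed


section \<open>Lebesgue measure and bounded kernels\<close>

lemma sigma_finite_lebesgue: "sigma_finite_measure (lebesgue :: 'a::euclidean_space measure)"
proof
  obtain A :: "'a set set" where A: "countable A" "A \<subseteq> sets lborel" "\<Union>A = space lborel"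
    "\<forall>a\<in>A. emeasure lborel a \<noteq> \<infinity>"
    using lborel.sigma_finite_countable by blast
  then show "\<exists>A::'a set set. countable A \<and> A \<subseteq> sets lebesgue \<and> \<Union>A = space lebesgue \<and>
     (\<forall>a\<in>A. emeasure lebesgue a \<noteq> \<infinity>)"
    by (intro exI[of _ A]) (auto simp: subset_iff)
qed

interpretation lebesgue: sigma_finite_measure "lebesgue :: 'a::euclidean_space measure"
  by (rule sigma_finite_lebesgue)

lemma borel_measurable_lebesgueI: "f \<in> borel \<rightarrow>\<^sub>M N \<Longrightarrow> f \<in> lebesgue \<rightarrow>\<^sub>M N"
  by (rule measurable_completion) simp

lemma measurable_fst_lebesgue [measurable]: "fst \<in> lebesgue \<Otimes>\<^sub>M M \<rightarrow>\<^sub>M borel"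
  by (rule measurable_compose[OF measurable_fst, of "\<lambda>x. x", simplified])
     (rule borel_measurable_lebesgueI, simp)

lemma measurable_snd_lebesgue [measurable]: "snd \<in> M \<Otimes>\<^sub>M lebesgue \<rightarrow>\<^sub>M borel"
  by (rule measurable_compose[OF measurable_snd, of "\<lambda>x. x", simplified])
     (rule borel_measurable_lebesgueI, simp)

lemma cis_measurable [measurable]: "cis \<in> borel_measurable borel"
  by (intro borel_measurable_continuous_onI continuous_intros)

lemma cnj_measurable [measurable]: "cnj \<in> borel_measurable borel"
  by (intro borel_measurable_continuous_onI continuous_intros)

text \<open>
  The single form of Fubini's theorem used for convolutions, Fourier integrals and kernels: two
  integrable factors, coupled by a bounded kernel.
\<close>

lemma Fubini_kernel:
  fixes f :: "'a \<Rightarrow> 'c::{banach, second_countable_topology, real_normed_field}"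
  assumes M: "sigma_finite_measure M1" "sigma_finite_measure M2"
    and f: "integrable M1 f" and g: "integrable M2 g"
    and k[measurable]: "(\<lambda>(x, y). k x y) \<in> borel_measurable (M1 \<Otimes>\<^sub>M M2)"
    and bound: "\<And>x y. norm (k x y) \<le> C"
  shows "(LINT x|M1. f x * (LINT y|M2. g y * k x y)) = (LINT y|M2. g y * (LINT x|M1. f x * k x y))"
    and "integrable (M1 \<Otimes>\<^sub>M M2) (\<lambda>(x, y). f x * g y * k x y)"
    and "integrable M1 (\<lambda>x. f x * (LINT y|M2. g y * k x y))"
proof -
  interpret M1: sigma_finite_measure M1 by fact
  interpret M2: sigma_finite_measure M2 by fact
  interpret pair_sigma_finite M1 M2 ..
  have [measurable]: "f \<in> borel_measurable M1" "g \<in> borel_measurable M2" using f g by auto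
  have prod: "integrable (M1 \<Otimes>\<^sub>M M2) (\<lambda>(x, y). f x * g y)"
  proof (rule Fubini_integrable)
    have "(\<lambda>x. LINT y|M2. norm (case (x, y) of (x, y) \<Rightarrow> f x * g y))
        = (\<lambda>x. norm (f x) * (LINT y|M2. norm (g y)))"
      by (simp add: norm_mult)
    then show "integrable M1 (\<lambda>x. LINT y|M2. norm (case (x, y) of (x, y) \<Rightarrow> f x * g y))"
      using f by simp
    show "AE x in M1. integrable M2 (\<lambda>y. case (x, y) of (x, y) \<Rightarrow> f x * g y)"
      using g by simp
  qed measurable
  show int: "integrable (M1 \<Otimes>\<^sub>M M2) (\<lambda>(x, y). f x * g y * k x y)"
  proof (rule Bochner_Integration.integrable_bound[where f = "\<lambda>z. C *\<^sub>R (case z of (x, y) \<Rightarrow> f x * g y)"])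
    show "AE z in M1 \<Otimes>\<^sub>M M2. norm (case z of (x, y) \<Rightarrow> f x * g y * k x y)
        \<le> norm (C *\<^sub>R (case z of (x, y) \<Rightarrow> f x * g y))"
    proof (intro AE_I2)
      fix z :: "'a \<times> 'b"
      have "norm (k (fst z) (snd z)) \<le> \<bar>C\<bar>" using bound[of "fst z" "snd z"] by linarith
      then have "norm (f (fst z) * g (snd z)) * norm (k (fst z) (snd z)) \<le> norm (f (fst z) * g (snd z)) * \<bar>C\<bar>"
        by (rule mult_left_mono) simp
      then show "norm (case z of (x, y) \<Rightarrow> f x * g y * k x y) \<le> norm (C *\<^sub>R (case z of (x, y) \<Rightarrow> f x * g y))"
        by (simp add: case_prod_beta norm_mult mult_ac)
    qed
  qed (use prod in \<open>auto intro!: Bochner_Integration.integrable_scaleR_right\<close>)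
  have "(LINT x|M1. f x * (LINT y|M2. g y * k x y)) = (LINT x|M1. LINT y|M2. f x * g y * k x y)"
    by (simp add: mult.assoc)
  also have "\<dots> = (LINT y|M2. LINT x|M1. f x * g y * k x y)"
    by (rule Fubini_integral[OF int, symmetric])
  also have "\<dots> = (LINT y|M2. LINT x|M1. g y * (f x * k x y))"
    by (simp add: mult_ac)
  also have "\<dots> = (LINT y|M2. g y * (LINT x|M1. f x * k x y))" by simp
  finally show "(LINT x|M1. f x * (LINT y|M2. g y * k x y)) = (LINT y|M2. g y * (LINT x|M1. f x * k x y))" .
  show "integrable M1 (\<lambda>x. f x * (LINT y|M2. g y * k x y))"
    using integrable_fst'[OF int] by (simp add: mult.assoc)
qed

section \<open>Gaussians\<close>

text \<open>
  A rescaling of the characteristic function of the standard normal distribution.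
\<close>

lemma gaussian_line_integral:
  fixes t a :: real
  assumes "t > 0"
  shows "integrable lborel (\<lambda>x. of_real (exp (- t * x\<^sup>2)) * cis (a * x))"
    and "(LINT x|lborel. of_real (exp (- t * x\<^sup>2)) * cis (a * x)) = of_real (sqrt (pi / t) * exp (- a\<^sup>2 / (4 * t)))"
proof -
  define c where "c = 1 / sqrt (2 * t)"
  have c: "c > 0" using assms by (simp add: c_def)
  define \<phi> where "\<phi> x = std_normal_density x *\<^sub>R iexp ((a * c) * x)" for x
  have i: "integrable lborel \<phi>"
  proof (rule Bochner_Integration.integrable_bound[OF integrable_normal_density[of 1 0]])
    show "AE x in lborel. norm (\<phi> x) \<le> norm (std_normal_density x)"
      by (simp add: \<phi>_def)
  qed (auto simp: \<phi>_def[abs_def])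
  have v: "integral\<^sup>L lborel \<phi> = of_real (exp (- (a * c)\<^sup>2 / 2))"
  proof -
    have "char std_normal_distribution (a * c) = integral\<^sup>L lborel \<phi>"
      unfolding char_def \<phi>_def by (subst integral_density) auto
    then show ?thesis by (simp add: char_std_normal_distribution)
  qed
  have eq: "of_real (exp (- t * x\<^sup>2)) * cis (a * x) = sqrt (2 * pi) *\<^sub>R \<phi> (0 + (1 / c) * x)" for x
  proof -
    have "(x / c)\<^sup>2 / 2 = t * x\<^sup>2" using assms by (simp add: c_def power_mult_distrib)
    then have "std_normal_density (x / c) = 1 / sqrt (2 * pi) * exp (- t * x\<^sup>2)"
      by (simp add: std_normal_density_def)
    moreover have "iexp ((a * c) * (x / c)) = cis (a * x)" using c by (simp add: cis_conv_exp)
    ultimately show ?thesis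
      unfolding \<phi>_def by (simp add: scaleR_conv_of_real)
  qed
  have c': "1 / c \<noteq> 0" using c by simp
  show "integrable lborel (\<lambda>x. of_real (exp (- t * x\<^sup>2)) * cis (a * x))"
    unfolding eq using lborel_integrable_real_affine[OF i c', of 0] by simp
  have "(LINT x|lborel. of_real (exp (- t * x\<^sup>2)) * cis (a * x))
      = sqrt (2 * pi) *\<^sub>R (LINT x|lborel. \<phi> (0 + (1 / c) * x))"
    unfolding eq by simp
  also have "(LINT x|lborel. \<phi> (0 + (1 / c) * x)) = c *\<^sub>R integral\<^sup>L lborel \<phi>"
    using lborel_integral_real_affine[OF c', of \<phi> 0] c by simp
  also have "sqrt (2 * pi) *\<^sub>R (c *\<^sub>R integral\<^sup>L lborel \<phi>) = of_real (sqrt (2 * pi) * c * exp (- (a * c)\<^sup>2 / 2))"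
    by (simp add: v scaleR_conv_of_real)
  also have "sqrt (2 * pi) * c = sqrt (pi / t)"
    unfolding c_def by (simp add: real_sqrt_mult real_sqrt_divide)
  also have "- (a * c)\<^sup>2 / 2 = - a\<^sup>2 / (4 * t)"
    using assms by (simp add: c_def power_mult_distrib power_divide)
  finally show "(LINT x|lborel. of_real (exp (- t * x\<^sup>2)) * cis (a * x)) = of_real (sqrt (pi / t) * exp (- a\<^sup>2 / (4 * t)))"
    by simp
qed

lemma norm_sq_eq_sum_Basis: "(norm (x::'a::euclidean_space))\<^sup>2 = (\<Sum>b\<in>Basis. (x \<bullet> b)\<^sup>2)"
  unfolding power2_norm_eq_inner by (subst euclidean_inner) (simp add: power2_eq_square)

lemma gaussian_fourier:
  fixes z :: "'a::euclidean_space"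
  assumes t: "t > 0"
  shows "integrable lborel (\<lambda>\<xi>. of_real (exp (- t * (norm \<xi>)\<^sup>2)) * cis (z \<bullet> \<xi>))"
    and "(LINT \<xi>|lborel. of_real (exp (- t * (norm \<xi>)\<^sup>2)) * cis (z \<bullet> \<xi>))
      = of_real (sqrt (pi / t) ^ DIM('a) * exp (- (norm z)\<^sup>2 / (4 * t)))"
proof -
  interpret product_sigma_finite "\<lambda>_::'a. lborel :: real measure" ..
  define F where "F b x = of_real (exp (- t * x\<^sup>2)) * cis ((z \<bullet> b) * x)" for b x
  have prod: "of_real (exp (- t * (norm \<xi>)\<^sup>2)) * cis (z \<bullet> \<xi>) = (\<Prod>b\<in>Basis. F b (\<xi> \<bullet> b))" for \<xi> :: 'a
  proof -
    have "(\<Prod>b\<in>Basis. F b (\<xi> \<bullet> b)) = of_real (\<Prod>b\<in>Basis. exp (- t * (\<xi> \<bullet> b)\<^sup>2)) * (\<Prod>b\<in>Basis. cis ((z \<bullet> b) * (\<xi> \<bullet> b)))"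
      by (simp add: F_def prod.distrib)
    also have "(\<Prod>b\<in>Basis. exp (- t * (\<xi> \<bullet> b)\<^sup>2)) = exp (- t * (norm \<xi>)\<^sup>2)"
      by (simp add: exp_sum[symmetric] norm_sq_eq_sum_Basis sum_distrib_left)
    also have "(\<Prod>b\<in>Basis. cis ((z \<bullet> b) * (\<xi> \<bullet> b))) = cis (z \<bullet> \<xi>)"
      by (subst euclidean_inner) (simp add: cis_conv_exp exp_sum[symmetric] sum_distrib_left)
    finally show ?thesis by simp
  qed
  have Fi: "integrable lborel (F b)" for b
    unfolding F_def by (rule gaussian_line_integral(1)[OF t])
  have [measurable]: "F b \<in> borel_measurable borel" for b unfolding F_def by measurable
  have sum_b: "(\<Sum>b\<in>Basis. f b *\<^sub>R b) \<bullet> c = f c" if "c \<in> Basis" for f and c :: 'a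
    using that by simp
  have int: "integrable (Pi\<^sub>M Basis (\<lambda>_. lborel)) (\<lambda>f. \<Prod>b\<in>Basis. F b (f b))"
    by (intro product_integrable_prod Fi) auto
  then have int': "integrable (Pi\<^sub>M Basis (\<lambda>_. lborel)) (\<lambda>f. \<Prod>b\<in>Basis. F b ((\<Sum>c\<in>Basis. f c *\<^sub>R c) \<bullet> b))"
    by (simp add: sum_b cong: prod.cong)
  show "integrable lborel (\<lambda>\<xi>. of_real (exp (- t * (norm \<xi>)\<^sup>2)) * cis (z \<bullet> \<xi>))"
    unfolding prod by (subst lborel_eq, subst integrable_distr_eq) (use int' in auto)
  have "(LINT \<xi>|lborel. of_real (exp (- t * (norm \<xi>)\<^sup>2)) * cis (z \<bullet> \<xi>))
    = (LINT f|(Pi\<^sub>M Basis (\<lambda>_. lborel)). (\<Prod>b\<in>Basis. F b ((\<Sum>c\<in>Basis. f c *\<^sub>R c) \<bullet> b)))"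
    unfolding prod by (subst lborel_eq, subst integral_distr) auto
  also have "\<dots> = (LINT f|(Pi\<^sub>M Basis (\<lambda>_. lborel)). (\<Prod>b\<in>Basis. F b (f b)))"
    by (simp add: sum_b cong: prod.cong)
  also have "\<dots> = (\<Prod>b\<in>Basis. integral\<^sup>L lborel (F b))"
    by (rule product_integral_prod) (use Fi in auto)
  also have "\<dots> = (\<Prod>b\<in>Basis. of_real (sqrt (pi / t) * exp (- (z \<bullet> b)\<^sup>2 / (4 * t))))"
    by (intro prod.cong refl) (unfold F_def, rule gaussian_line_integral(2)[OF t])
  also have "\<dots> = of_real (sqrt (pi / t) ^ DIM('a) * (\<Prod>b\<in>Basis. exp (- (z \<bullet> b)\<^sup>2 / (4 * t))))"
    by (simp add: prod.distrib)
  also have "(\<Prod>b\<in>Basis. exp (- (z \<bullet> b)\<^sup>2 / (4 * t))) = exp (- (norm z)\<^sup>2 / (4 * t))"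
    by (simp add: exp_sum[symmetric] norm_sq_eq_sum_Basis sum_divide_distrib sum_negf)
  finally show "(LINT \<xi>|lborel. of_real (exp (- t * (norm \<xi>)\<^sup>2)) * cis (z \<bullet> \<xi>))
      = of_real (sqrt (pi / t) ^ DIM('a) * exp (- (norm z)\<^sup>2 / (4 * t)))" .
qed

definition heat_kernel :: "real \<Rightarrow> 'a::euclidean_space \<Rightarrow> real" where
  "heat_kernel t z = exp (- (norm z)\<^sup>2 / (4 * t)) / sqrt (4 * pi * t) ^ DIM('a)"

lemma heat_kernel_measurable [measurable]: "heat_kernel t \<in> borel_measurable borel"
  unfolding heat_kernel_def by measurable

lemma heat_kernel_nonneg: "0 \<le> t \<Longrightarrow> 0 \<le> heat_kernel t z"
  by (simp add: heat_kernel_def)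

lemma heat_kernel_minus: "heat_kernel t (- z) = heat_kernel t z"
  by (simp add: heat_kernel_def)

lemma gaussian_integrable:
  "t > 0 \<Longrightarrow> integrable lborel (\<lambda>\<xi>::'a::euclidean_space. exp (- t * (norm \<xi>)\<^sup>2))"
  using integrable_Re[OF gaussian_fourier(1)[of t "0::'a"]] by simp

lemma gaussian_fourier_heat_kernel:
  fixes z :: "'a::euclidean_space"
  assumes t: "t > 0"
  shows "(LINT \<xi>|lborel. of_real (exp (- t * (norm \<xi>)\<^sup>2)) * cis (z \<bullet> \<xi>)) = of_real ((2 * pi) ^ DIM('a) * heat_kernel t z)"
proof -
  have "sqrt (pi / t) = 2 * pi / sqrt (4 * pi * t)"
  proof -
    have "pi / t = (2 * pi)\<^sup>2 / (4 * pi * t)" using t by (simp add: power2_eq_square)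
    then have "sqrt (pi / t) = sqrt ((2 * pi)\<^sup>2) / sqrt (4 * pi * t)" by (simp only: real_sqrt_divide)
    also have "sqrt ((2 * pi)\<^sup>2) = 2 * pi" by (subst real_sqrt_abs) simp
    finally show ?thesis .
  qed
  then show ?thesis unfolding gaussian_fourier(2)[OF t] heat_kernel_def by (simp add: power_divide)
qed

lemma heat_kernel_integral:
  assumes t: "t > 0"
  shows "integrable lborel (heat_kernel t :: 'a::euclidean_space \<Rightarrow> real)"
    and "(LINT z|lborel. heat_kernel t (z :: 'a)) = 1"
proof -
  define r where "r = 1 / (4 * t)"
  have r: "r > 0" using t by (simp add: r_def)
  have eq: "heat_kernel t = (\<lambda>z::'a. exp (- r * (norm z)\<^sup>2) / sqrt (4 * pi * t) ^ DIM('a))"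
    by (simp add: heat_kernel_def r_def fun_eq_iff)
  show "integrable lborel (heat_kernel t :: 'a \<Rightarrow> real)"
    unfolding eq by (intro integrable_divide_zero gaussian_integrable r)
  have "of_real (LINT z|lborel. exp (- r * (norm (z::'a))\<^sup>2)) = complex_of_real (sqrt (pi / r) ^ DIM('a))"
    using gaussian_fourier(2)[OF r, of "0::'a"] by (simp del: of_real_power flip: integral_complex_of_real)
  then have "(LINT z|lborel. exp (- r * (norm (z::'a))\<^sup>2)) = sqrt (pi / r) ^ DIM('a)"
    by (simp only: of_real_eq_iff)
  then show "(LINT z|lborel. heat_kernel t (z :: 'a)) = 1"
    using t unfolding eq by (simp add: r_def mult_ac)
qed

section \<open>The heat form\<close>

lemma fourier_integral_measurable [measurable]:
  fixes u :: "'a::euclidean_space \<Rightarrow> real"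
  assumes [measurable]: "u \<in> borel_measurable lebesgue"
  shows "fourier_integral u \<in> borel_measurable borel"
proof -
  have "(\<lambda>\<xi>. LINT x|lebesgue. of_real (u x) * cis (- (x \<bullet> \<xi>))) \<in> borel_measurable borel"
  proof (rule lebesgue.borel_measurable_lebesgue_integral)
    show "(\<lambda>(\<xi>, x). of_real (u x) * cis (- (x \<bullet> \<xi>))) \<in> borel_measurable (borel \<Otimes>\<^sub>M lebesgue)"
      by measurable
  qed
  then show ?thesis by (simp add: fourier_integral_def[abs_def])
qed

lemma norm_fourier_integral_le:
  "integrable lebesgue u \<Longrightarrow> norm (fourier_integral u \<xi>) \<le> (LINT x|lebesgue. \<bar>u x\<bar>)"
  unfolding fourier_integral_def
  by (rule order_trans[OF integral_norm_bound]) (simp add: norm_mult)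

lemma integrable_fourier_integrand:
  fixes u :: "'a::euclidean_space \<Rightarrow> real"
  assumes "integrable lebesgue u"
  shows "integrable lebesgue (\<lambda>x. of_real (u x) * cis (- (x \<bullet> \<xi>)))"
proof (rule Bochner_Integration.integrable_bound[OF assms])
  have [measurable]: "u \<in> borel_measurable lebesgue" using assms by simp
  have [measurable]: "(\<lambda>x. cis (- (x \<bullet> \<xi>))) \<in> borel_measurable lebesgue"
    by (rule borel_measurable_lebesgueI) measurable
  show "(\<lambda>x. of_real (u x) * cis (- (x \<bullet> \<xi>))) \<in> borel_measurable lebesgue" by measurable
qed (simp add: norm_mult)

text \<open>
  A Gaussian damps the product of two Fourier transforms; undoing both Fourier integrals by Fubini leaves
  the Fourier transform of the Gaussian, which is the heat kernel. This identity is the source both of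
  Plancherel's theorem (\<open>t\<close> tending to \<open>0\<close>) and of the kernel of the fractional Laplacian (integration in \<open>t\<close>).
\<close>

lemma heat_form:
  fixes u v :: "'a::euclidean_space \<Rightarrow> real"
  assumes t: "t > 0" and u: "integrable lebesgue u" and v: "integrable lebesgue v"
  shows "(LINT \<xi>|lborel. of_real (exp (- t * (norm \<xi>)\<^sup>2)) * (fourier_integral u \<xi> * cnj (fourier_integral v \<xi>)))
      = of_real ((2 * pi) ^ DIM('a) * (LINT x|lebesgue. u x * (LINT y|lebesgue. v y * heat_kernel t (x - y))))"
proof -
  define g where "g \<xi> = complex_of_real (exp (- t * (norm \<xi>)\<^sup>2))" for \<xi> :: 'a
  have gi: "integrable lborel g" unfolding g_def by (intro integrable_of_real gaussian_integrable t)
  have [measurable]: "u \<in> borel_measurable lebesgue" "v \<in> borel_measurable lebesgue" using u v by auto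
  have [measurable]: "g \<in> borel_measurable borel" unfolding g_def by measurable
  define V where "V \<xi> = cnj (fourier_integral v \<xi>)" for \<xi>
  have [measurable]: "V \<in> borel_measurable borel" unfolding V_def by measurable
  have V_le: "norm (V \<xi>) \<le> (LINT x|lebesgue. \<bar>v x\<bar>)" for \<xi>
    unfolding V_def using norm_fourier_integral_le[OF v] by simp
  have V_eq: "V \<xi> = (LINT y|lebesgue. of_real (v y) * cis (y \<bullet> \<xi>))" for \<xi>
    unfolding V_def fourier_integral_def by (simp add: cis_cnj flip: Bochner_Integration.integral_cnj)
  have uc: "integrable lebesgue (\<lambda>x. complex_of_real (u x))" "integrable lebesgue (\<lambda>x. complex_of_real (v x))"
    using u v by auto
  have inner: "(LINT \<xi>|lborel. g \<xi> * (cis (- (x \<bullet> \<xi>)) * V \<xi>))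
      = of_real ((2 * pi) ^ DIM('a)) * of_real (LINT y|lebesgue. v y * heat_kernel t (x - y))" for x
  proof -
    have "(LINT \<xi>|lborel. g \<xi> * (cis (- (x \<bullet> \<xi>)) * V \<xi>))
        = (LINT \<xi>|lborel. g \<xi> * (LINT y|lebesgue. of_real (v y) * cis (- ((x - y) \<bullet> \<xi>))))"
    proof (intro Bochner_Integration.integral_cong refl)
      fix \<xi>
      have "cis (- (x \<bullet> \<xi>)) * V \<xi> = (LINT y|lebesgue. cis (- (x \<bullet> \<xi>)) * (of_real (v y) * cis (y \<bullet> \<xi>)))"
        unfolding V_eq by simp
      also have "\<dots> = (LINT y|lebesgue. of_real (v y) * cis (- ((x - y) \<bullet> \<xi>)))"
      proof (intro Bochner_Integration.integral_cong refl)
        fix y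
        have "cis (- ((x - y) \<bullet> \<xi>)) = cis (- (x \<bullet> \<xi>)) * cis (y \<bullet> \<xi>)"
          by (simp add: cis_mult inner_diff_left)
        then show "cis (- (x \<bullet> \<xi>)) * (of_real (v y) * cis (y \<bullet> \<xi>)) = of_real (v y) * cis (- ((x - y) \<bullet> \<xi>))"
          by simp
      qed
      finally show "g \<xi> * (cis (- (x \<bullet> \<xi>)) * V \<xi>) = g \<xi> * (LINT y|lebesgue. of_real (v y) * cis (- ((x - y) \<bullet> \<xi>)))"
        by simp
    qed
    also have "\<dots> = (LINT y|lebesgue. of_real (v y) * (LINT \<xi>|lborel. g \<xi> * cis (- ((x - y) \<bullet> \<xi>))))"
      by (rule Fubini_kernel(1)[OF lborel.sigma_finite_measure_axioms sigma_finite_lebesgue gi uc(2), where C = 1])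
         (simp_all, measurable)
    also have "\<dots> = (LINT y|lebesgue. of_real (v y) * of_real ((2 * pi) ^ DIM('a) * heat_kernel t (x - y)))"
    proof (intro Bochner_Integration.integral_cong refl arg_cong2[where f = "(*)"])
      fix y
      have "- ((x - y) \<bullet> \<xi>) = (y - x) \<bullet> \<xi>" for \<xi> by (simp add: inner_diff_left)
      then show "(LINT \<xi>|lborel. g \<xi> * cis (- ((x - y) \<bullet> \<xi>))) = of_real ((2 * pi) ^ DIM('a) * heat_kernel t (x - y))"
        unfolding g_def using gaussian_fourier_heat_kernel[OF t, of "y - x"] heat_kernel_minus[of t "x - y"] by simp
    qed
    also have "\<dots> = (LINT y|lebesgue. of_real ((2 * pi) ^ DIM('a)) * of_real (v y * heat_kernel t (x - y)))"
      by (simp add: mult_ac)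
    also have "\<dots> = of_real ((2 * pi) ^ DIM('a)) * of_real (LINT y|lebesgue. v y * heat_kernel t (x - y))"
      by (simp only: integral_mult_right_zero integral_complex_of_real)
    finally show ?thesis .
  qed
  have "(LINT \<xi>|lborel. g \<xi> * (fourier_integral u \<xi> * V \<xi>))
      = (LINT \<xi>|lborel. g \<xi> * (LINT x|lebesgue. of_real (u x) * (cis (- (x \<bullet> \<xi>)) * V \<xi>)))"
  proof (intro Bochner_Integration.integral_cong refl)
    fix \<xi>
    have "fourier_integral u \<xi> * V \<xi> = (LINT x|lebesgue. of_real (u x) * cis (- (x \<bullet> \<xi>)) * V \<xi>)"
      unfolding fourier_integral_def by simp
    then show "g \<xi> * (fourier_integral u \<xi> * V \<xi>) = g \<xi> * (LINT x|lebesgue. of_real (u x) * (cis (- (x \<bullet> \<xi>)) * V \<xi>))"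
      by (simp add: mult.assoc)
  qed
  also have "\<dots> = (LINT x|lebesgue. of_real (u x) * (LINT \<xi>|lborel. g \<xi> * (cis (- (x \<bullet> \<xi>)) * V \<xi>)))"
    by (rule Fubini_kernel(1)[OF lborel.sigma_finite_measure_axioms sigma_finite_lebesgue gi uc(1),
          where C = "LINT x|lebesgue. \<bar>v x\<bar>"]) (use V_le in \<open>simp_all add: norm_mult\<close>, measurable)
  also have "\<dots> = (LINT x|lebesgue. of_real ((2 * pi) ^ DIM('a)) * of_real (u x * (LINT y|lebesgue. v y * heat_kernel t (x - y))))"
    unfolding inner by (simp add: mult_ac)
  also have "\<dots> = of_real ((2 * pi) ^ DIM('a)) * of_real (LINT x|lebesgue. u x * (LINT y|lebesgue. v y * heat_kernel t (x - y)))"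
    by (simp only: integral_mult_right_zero integral_complex_of_real)
  finally show ?thesis unfolding g_def V_def by (simp only: of_real_mult)
qed


section \<open>Plancherel for continuous functions\<close>

lemma sqn_lebesgue: "sqn lebesgue f = sqn lborel f"
  by (simp add: sqn_def nn_integral_completion)

text \<open>
  After the substitution \<open>y = x + \<surd>t z\<close> the kernel no longer depends on \<open>t\<close>, and dominated convergence
  applies.
\<close>

lemma heat_kernel_average_tendsto:
  fixes v :: "'a::euclidean_space \<Rightarrow> real"
  assumes v: "continuous_on UNIV v" and bd: "\<And>x. \<bar>v x\<bar> \<le> M"
  shows "(\<lambda>k. LINT y|lebesgue. v y * heat_kernel (1 / real (Suc k)) (x - y)) \<longlonglongrightarrow> v x"
    and "\<bar>LINT y|lebesgue. v y * heat_kernel (1 / real (Suc k)) (x - y)\<bar> \<le> M"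
proof -
  have [measurable]: "v \<in> borel_measurable borel" using v by (rule borel_measurable_continuous_onI)
  have eq: "(LINT y|lebesgue. v y * heat_kernel t (x - y)) = (LINT z|lborel. v (x + sqrt t *\<^sub>R z) * heat_kernel 1 z)"
    if t: "t > 0" for t
  proof -
    have c: "sqrt t \<noteq> 0" using t by simp
    have hk: "\<bar>sqrt t\<bar> ^ DIM('a) * heat_kernel t (x - (x + sqrt t *\<^sub>R z)) = heat_kernel 1 z" for z :: 'a
      using t by (simp add: heat_kernel_def power_mult_distrib real_sqrt_mult field_simps)
    have "(LINT y|lebesgue. v y * heat_kernel t (x - y)) = (LINT y|lborel. v y * heat_kernel t (x - y))"
      by (rule integral_completion) measurable
    also have "\<dots> = (LINT y|density (distr lborel borel (\<lambda>z. x + sqrt t *\<^sub>R z)) (\<lambda>_. ennreal (\<bar>sqrt t\<bar> ^ DIM('a))). v y * heat_kernel t (x - y))"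
      by (subst lborel_affine[OF c, of x]) (simp add: ennreal_power)
    also have "\<dots> = (LINT z|lborel. \<bar>sqrt t\<bar> ^ DIM('a) * (v (x + sqrt t *\<^sub>R z) * heat_kernel t (x - (x + sqrt t *\<^sub>R z))))"
      by (subst integral_density) (simp_all add: integral_distr)
    also have "\<dots> = (LINT z|lborel. v (x + sqrt t *\<^sub>R z) * heat_kernel 1 z)"
      by (intro Bochner_Integration.integral_cong refl) (simp only: hk[symmetric] mult_ac)
    finally show ?thesis .
  qed
  have int: "integrable lborel (heat_kernel 1 :: 'a \<Rightarrow> real)" "(LINT z|lborel. heat_kernel 1 (z::'a)) = 1"
    using heat_kernel_integral[of 1] by auto
  have intM: "integrable lborel (\<lambda>z::'a. M * heat_kernel 1 z)" using int by simp
  have le: "norm (v y * heat_kernel 1 z) \<le> M * heat_kernel 1 z" for y z :: 'a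
    using bd[of y] heat_kernel_nonneg[of 1 z] by (simp add: abs_mult mult_right_mono)
  have "(\<lambda>k. LINT z|lborel. v (x + sqrt (1 / real (Suc k)) *\<^sub>R z) * heat_kernel 1 z)
      \<longlonglongrightarrow> (LINT z|lborel. v x * heat_kernel 1 (z :: 'a))"
  proof (rule integral_dominated_convergence[where w = "\<lambda>z. M * heat_kernel 1 (z :: 'a)"])
    show "AE z in lborel. (\<lambda>k. v (x + sqrt (1 / real (Suc k)) *\<^sub>R z) * heat_kernel 1 z)
        \<longlonglongrightarrow> v x * heat_kernel 1 z"
    proof (rule AE_I2)
      fix z :: 'a
      have "(\<lambda>k. 1 / real (Suc k)) \<longlonglongrightarrow> 0" using LIMSEQ_inverse_real_of_nat by (simp add: inverse_eq_divide)
      then have "(\<lambda>k. x + sqrt (1 / real (Suc k)) *\<^sub>R z) \<longlonglongrightarrow> x + sqrt 0 *\<^sub>R z"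
        by (intro tendsto_intros)
      then have "(\<lambda>k. v (x + sqrt (1 / real (Suc k)) *\<^sub>R z)) \<longlonglongrightarrow> v x"
        using continuous_on_tendsto_compose[OF v, of "\<lambda>k. x + sqrt (1 / real (Suc k)) *\<^sub>R z" x sequentially] by simp
      then show "(\<lambda>k. v (x + sqrt (1 / real (Suc k)) *\<^sub>R z) * heat_kernel 1 z) \<longlonglongrightarrow> v x * heat_kernel 1 z"
        by (intro tendsto_intros)
    qed
  qed (use le intM in auto)
  then show "(\<lambda>k. LINT y|lebesgue. v y * heat_kernel (1 / real (Suc k)) (x - y)) \<longlonglongrightarrow> v x"
    using int(2) by (simp add: eq)
  have "norm (v y * heat_kernel 1 z) \<le> norm (M * heat_kernel 1 z)" for y z :: 'a
    using le[of y z] by (simp only: real_norm_def order_trans[OF _ abs_ge_self])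
  then have vi: "integrable lborel (\<lambda>z. v (x + sqrt (1 / real (Suc k)) *\<^sub>R z) * heat_kernel 1 z)"
    by (intro Bochner_Integration.integrable_bound[OF intM] AE_I2) auto
  have "norm (LINT z|lborel. v (x + sqrt (1 / real (Suc k)) *\<^sub>R z) * heat_kernel 1 z) \<le> (LINT z|lborel. M * heat_kernel 1 (z::'a))"
    by (rule Bochner_Integration.integral_norm_bound_integral[OF vi intM le])
  then show "\<bar>LINT y|lebesgue. v y * heat_kernel (1 / real (Suc k)) (x - y)\<bar> \<le> M"
    using int(2) by (simp add: eq)
qed

lemma heat_form_tendsto:
  fixes u v :: "'a::euclidean_space \<Rightarrow> real"
  assumes u: "integrable lebesgue u" and v: "continuous_on UNIV v" and bd: "\<And>x. \<bar>v x\<bar> \<le> M"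
  shows "(\<lambda>k. LINT x|lebesgue. u x * (LINT y|lebesgue. v y * heat_kernel (1 / real (Suc k)) (x - y)))
      \<longlonglongrightarrow> (LINT x|lebesgue. u x * v x)"
proof (rule integral_dominated_convergence[where w = "\<lambda>x. M * \<bar>u x\<bar>"])
  have [measurable]: "v \<in> borel_measurable lebesgue" "u \<in> borel_measurable lebesgue"
    using v u by (auto intro!: borel_measurable_lebesgueI borel_measurable_continuous_onI)
  show "integrable lebesgue (\<lambda>x. M * \<bar>u x\<bar>)" using u by simp
  show "(\<lambda>x. u x * v x) \<in> borel_measurable lebesgue" by measurable
  have "(\<lambda>x. LINT y|lebesgue. v y * heat_kernel (1 / real (Suc k)) (x - y)) \<in> borel_measurable borel" for k
    by (rule lebesgue.borel_measurable_lebesgue_integral) measurable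
  then have [measurable]: "(\<lambda>x. LINT y|lebesgue. v y * heat_kernel (1 / real (Suc k)) (x - y)) \<in> borel_measurable lebesgue" for k
    by (rule borel_measurable_lebesgueI)
  show "(\<lambda>x. u x * (LINT y|lebesgue. v y * heat_kernel (1 / real (Suc k)) (x - y))) \<in> borel_measurable lebesgue" for k
    by (rule borel_measurable_times) measurable
  show "AE x in lebesgue. (\<lambda>k. u x * (LINT y|lebesgue. v y * heat_kernel (1 / real (Suc k)) (x - y))) \<longlonglongrightarrow> u x * v x"
    by (intro AE_I2 tendsto_mult tendsto_const heat_kernel_average_tendsto(1)[OF v bd])
  show "AE x in lebesgue. norm (u x * (LINT y|lebesgue. v y * heat_kernel (1 / real (Suc k)) (x - y))) \<le> M * \<bar>u x\<bar>" for k
  proof (rule AE_I2)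
    fix x
    have "\<bar>u x\<bar> * \<bar>LINT y|lebesgue. v y * heat_kernel (1 / real (Suc k)) (x - y)\<bar> \<le> \<bar>u x\<bar> * M"
      by (intro mult_left_mono heat_kernel_average_tendsto(2)[OF v bd]) simp
    then show "norm (u x * (LINT y|lebesgue. v y * heat_kernel (1 / real (Suc k)) (x - y))) \<le> M * \<bar>u x\<bar>"
      by (simp only: real_norm_def abs_mult mult.commute)
  qed
qed

lemma gaussian_fourier_integrable:
  fixes u v :: "'a::euclidean_space \<Rightarrow> real"
  assumes t: "t > 0" and u: "integrable lebesgue u" and v: "integrable lebesgue v"
  shows "integrable lborel (\<lambda>\<xi>. of_real (exp (- t * (norm \<xi>)\<^sup>2)) * (fourier_integral u \<xi> * cnj (fourier_integral v \<xi>)))"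
proof -
  define A where "A = (LINT x|lebesgue. \<bar>u x\<bar>) * (LINT x|lebesgue. \<bar>v x\<bar>)"
  have [measurable]: "u \<in> borel_measurable lebesgue" "v \<in> borel_measurable lebesgue" using u v by auto
  have i: "integrable lborel (\<lambda>\<xi>::'a. exp (- t * (norm \<xi>)\<^sup>2) * A)"
    by (intro integrable_mult_left gaussian_integrable t)
  show ?thesis
  proof (rule Bochner_Integration.integrable_bound[OF i])
    show "AE \<xi> in lborel. norm (of_real (exp (- t * (norm \<xi>)\<^sup>2)) * (fourier_integral u \<xi> * cnj (fourier_integral v \<xi>)))
        \<le> norm (exp (- t * (norm \<xi>)\<^sup>2) * A)"
    proof (rule AE_I2)
      fix \<xi>
      have "norm (fourier_integral u \<xi>) * norm (fourier_integral v \<xi>) \<le> A" unfolding A_def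
        by (intro mult_mono norm_fourier_integral_le u v) auto
      then have "norm (fourier_integral u \<xi>) * norm (fourier_integral v \<xi>) \<le> \<bar>A\<bar>" by linarith
      then show "norm (of_real (exp (- t * (norm \<xi>)\<^sup>2)) * (fourier_integral u \<xi> * cnj (fourier_integral v \<xi>)))
        \<le> norm (exp (- t * (norm \<xi>)\<^sup>2) * A)"
        by (simp add: norm_mult abs_mult)
    qed
  qed measurable
qed

text \<open>
  Let \<open>t = 1 / (k + 1)\<close> in the heat form with \<open>v = u\<close>. The frequency side increases to the squared norm of
  the transform by monotone convergence, so that its finiteness is a conclusion; the space side
  converges to the squared norm of \<open>u\<close> because \<open>u\<close> is continuous and bounded.
\<close>

lemma Plancherel_continuous:
  fixes u :: "'a::euclidean_space \<Rightarrow> real"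
  assumes u: "integrable lebesgue u" and cont: "continuous_on UNIV u" and bd: "\<And>x. \<bar>u x\<bar> \<le> M"
    and u2: "u \<in> L2 lebesgue"
  shows "sqn lebesgue (fourier_integral u) = ennreal ((2 * pi) ^ DIM('a)) * sqn lebesgue u"
proof -
  have [measurable]: "u \<in> borel_measurable lebesgue" using u by auto
  define G where "G k \<xi> = exp (- (1 / real (Suc k)) * (norm \<xi>)\<^sup>2) * (norm (fourier_integral u \<xi>))\<^sup>2" for k and \<xi> :: 'a
  have [measurable]: "G k \<in> borel_measurable borel" for k unfolding G_def by measurable
  define Q where "Q k = (LINT x|lebesgue. u x * (LINT y|lebesgue. u y * heat_kernel (1 / real (Suc k)) (x - y)))" for k
  have Q: "Q \<longlonglongrightarrow> L2_inner lebesgue u u"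
    unfolding Q_def[abs_def] L2_inner_def by (rule heat_form_tendsto[OF u cont bd])
  have Geq: "of_real (exp (- (1 / real (Suc k)) * (norm \<xi>)\<^sup>2)) * (fourier_integral u \<xi> * cnj (fourier_integral u \<xi>))
      = complex_of_real (G k \<xi>)" for k \<xi>
    unfolding G_def of_real_mult complex_norm_square ..
  have t: "1 / real (Suc k) > 0" for k by simp
  have Gi: "integrable lborel (G k)" for k
    using integrable_Re[OF gaussian_fourier_integrable[OF t u u, of k, unfolded Geq]] by simp
  have "complex_of_real (LINT \<xi>|lborel. G k \<xi>) = of_real ((2 * pi) ^ DIM('a) * Q k)" for k
    using heat_form[OF t u u, of k, unfolded Geq] unfolding Q_def by (simp only: integral_complex_of_real)
  then have GQ: "(LINT \<xi>|lborel. G k \<xi>) = (2 * pi) ^ DIM('a) * Q k" for k by (simp only: of_real_eq_iff)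
  have nnG: "(\<integral>\<^sup>+\<xi>. ennreal (G k \<xi>) \<partial>lborel) = ennreal ((2 * pi) ^ DIM('a) * Q k)" for k
    unfolding GQ[symmetric] by (rule nn_integral_eq_integral[OF Gi]) (simp add: G_def)
  have inc: "incseq (\<lambda>k. \<lambda>\<xi>. ennreal (G k \<xi>))"
  proof (rule incseq_SucI, rule le_funI)
    fix k and \<xi> :: 'a
    have "1 / real (Suc (Suc k)) \<le> 1 / real (Suc k)" by (simp add: field_simps)
    then have "1 / real (Suc (Suc k)) * (norm \<xi>)\<^sup>2 \<le> 1 / real (Suc k) * (norm \<xi>)\<^sup>2"
      by (rule mult_right_mono) simp
    then have "G k \<xi> \<le> G (Suc k) \<xi>" unfolding G_def by (intro mult_right_mono) auto
    then show "ennreal (G k \<xi>) \<le> ennreal (G (Suc k) \<xi>)" by (rule ennreal_leI)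
  qed
  have "(SUP k. ennreal (G k \<xi>)) = ennreal ((norm (fourier_integral u \<xi>))\<^sup>2)" for \<xi> :: 'a
  proof -
    have "(\<lambda>k. 1 / real (Suc k)) \<longlonglongrightarrow> 0" using LIMSEQ_inverse_real_of_nat by (simp add: inverse_eq_divide)
    then have "(\<lambda>k. G k \<xi>) \<longlonglongrightarrow> exp (- 0 * (norm \<xi>)\<^sup>2) * (norm (fourier_integral u \<xi>))\<^sup>2"
      unfolding G_def by (intro tendsto_intros)
    then have "(\<lambda>k. ennreal (G k \<xi>)) \<longlonglongrightarrow> ennreal ((norm (fourier_integral u \<xi>))\<^sup>2)"
      by (intro tendsto_ennrealI) simp
    moreover have "(\<lambda>k. ennreal (G k \<xi>)) \<longlonglongrightarrow> (SUP k. ennreal (G k \<xi>))"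
      using inc by (intro LIMSEQ_SUP) (auto simp: incseq_def le_fun_def)
    ultimately show ?thesis using LIMSEQ_unique by blast
  qed
  then have "sqn lborel (fourier_integral u) = (\<integral>\<^sup>+\<xi>. (SUP k. ennreal (G k \<xi>)) \<partial>lborel)" by (simp add: sqn_def)
  also have "\<dots> = (SUP k. \<integral>\<^sup>+\<xi>. ennreal (G k \<xi>) \<partial>lborel)"
    by (rule nn_integral_monotone_convergence_SUP[OF inc]) simp
  finally have S: "sqn lborel (fourier_integral u) = (SUP k. \<integral>\<^sup>+\<xi>. ennreal (G k \<xi>) \<partial>lborel)" .
  have "(\<lambda>k. \<integral>\<^sup>+\<xi>. ennreal (G k \<xi>) \<partial>lborel) \<longlonglongrightarrow> sqn lborel (fourier_integral u)"
    unfolding S using inc by (intro LIMSEQ_SUP) (auto simp: incseq_def le_fun_def intro!: nn_integral_mono)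
  moreover have "(\<lambda>k. \<integral>\<^sup>+\<xi>. ennreal (G k \<xi>) \<partial>lborel) \<longlonglongrightarrow> ennreal ((2 * pi) ^ DIM('a) * L2_inner lebesgue u u)"
    unfolding nnG by (intro tendsto_ennrealI tendsto_intros Q)
  ultimately have "sqn lborel (fourier_integral u) = ennreal ((2 * pi) ^ DIM('a) * L2_inner lebesgue u u)"
    using LIMSEQ_unique by blast
  then show ?thesis using u2 by (simp add: sqn_lebesgue[of "fourier_integral u"] sqn_eq_L2_inner ennreal_mult L2.nonneg)
qed

section \<open>Approximation by continuous functions\<close>

text \<open>
  Clip \<open>u\<close> to a bounded function, use that a Lebesgue measurable function is an almost everywhere
  limit of continuous ones, and clip and cut off these as well. The bounds on values and support make
  dominated convergence applicable.
\<close>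

lemma L2_approx_continuous:
  fixes u :: "'a::euclidean_space \<Rightarrow> real"
  assumes u: "u \<in> L2 lebesgue" and supp: "\<And>x. x \<notin> ball 0 R \<Longrightarrow> u x = 0" and e: "\<epsilon> > 0"
  obtains g M where "continuous_on UNIV g" "\<And>x. \<bar>g x\<bar> \<le> M" "\<And>x. x \<notin> ball 0 (R + 1) \<Longrightarrow> g x = 0"
    "sqn lebesgue (\<lambda>x. g x - u x) < ennreal \<epsilon>"
proof -
  have [measurable]: "u \<in> borel_measurable lebesgue" and su: "sqn lebesgue u < \<infinity>" using u by (auto simp: L2_iff)
  define T where "T N x = max (- real N) (min (real N) (u x))" for N x
  have [measurable]: "T N \<in> borel_measurable lebesgue" for N unfolding T_def by measurable
  have "(\<lambda>N. sqn lebesgue (\<lambda>x. T N x - u x)) \<longlonglongrightarrow> 0"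
  proof (rule sqn_dominated[where w = u])
    show "AE x in lebesgue. (\<lambda>N. T N x) \<longlonglongrightarrow> u x"
    proof (intro AE_I2 tendsto_eventually)
      fix x
      obtain N :: nat where N: "\<bar>u x\<bar> \<le> real N" using real_arch_simple by blast
      show "\<forall>\<^sub>F N in sequentially. T N x = u x"
        unfolding eventually_sequentially
        by (rule exI[of _ N]) (use N in \<open>auto simp: T_def max_def min_def\<close>)
    qed
    show "AE x in lebesgue. norm (T k x) \<le> norm (u x)" for k
      by (rule AE_I2) (auto simp: T_def max_def min_def)
  qed (use su in auto)
  then have "\<forall>\<^sub>F N in sequentially. sqn lebesgue (\<lambda>x. T N x - u x) < ennreal (\<epsilon> / 4)"
    using e by (intro order_tendstoD) auto
  then obtain N where N: "sqn lebesgue (\<lambda>x. T N x - u x) < ennreal (\<epsilon> / 4)"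
    using eventually_happens by fastforce
  have "T N measurable_on UNIV"
    using measurable_on_iff_borel_measurable[of UNIV "T N"] by simp
  then obtain Z g where Z: "negligible Z" and gc: "\<And>n. continuous_on UNIV (g n)"
    and gl: "\<And>x. x \<notin> Z \<Longrightarrow> (\<lambda>n. g n x) \<longlonglongrightarrow> T N x"
    unfolding measurable_on_def by auto
  define cut where "cut x = max 0 (min 1 (R + 1 - norm x))" for x :: 'a
  define G where "G n x = max (- real N) (min (real N) (g n x)) * cut x" for n x
  have Gc: "continuous_on UNIV (G n)" for n
    unfolding G_def cut_def by (intro continuous_intros gc)
  have Gb: "\<bar>G n x\<bar> \<le> real N" for n x
  proof -
    have "\<bar>max (- real N) (min (real N) (g n x))\<bar> * \<bar>cut x\<bar> \<le> real N * 1"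
      by (intro mult_mono) (auto simp: cut_def)
    then show ?thesis by (simp add: G_def abs_mult)
  qed
  have Gs: "G n x = 0" if "x \<notin> ball 0 (R + 1)" for n x
    using that by (simp add: G_def cut_def)
  have [measurable]: "G n \<in> borel_measurable lebesgue" for n
    using Gc by (intro borel_measurable_lebesgueI borel_measurable_continuous_onI)
  define w where "w x = real N * indicator (ball 0 (R + 1)) x" for x :: 'a
  have [measurable]: "w \<in> borel_measurable lebesgue" unfolding w_def
    by (intro borel_measurable_lebesgueI borel_measurable_times borel_measurable_const borel_measurable_indicator) simp
  have "(\<lambda>n. sqn lebesgue (\<lambda>x. G n x - T N x)) \<longlonglongrightarrow> 0"
  proof (rule sqn_dominated[where w = w])
    have "AE x in lebesgue. x \<notin> Z" using Z AE_not_in by (simp add: negligible_iff_null_sets)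
    then show "AE x in lebesgue. (\<lambda>n. G n x) \<longlonglongrightarrow> T N x"
    proof eventually_elim
      case (elim x)
      have "(\<lambda>n. G n x) \<longlonglongrightarrow> max (- real N) (min (real N) (T N x)) * cut x"
        unfolding G_def by (intro tendsto_intros gl elim)
      moreover have "max (- real N) (min (real N) (T N x)) * cut x = T N x"
      proof (cases "x \<in> ball 0 R")
        case True
        then have "cut x = 1" by (simp add: cut_def)
        then show ?thesis by (simp add: T_def)
      next
        case False
        then show ?thesis using supp[OF False] by (simp add: T_def)
      qed
      ultimately show ?case by simp
    qed
    show "AE x in lebesgue. norm (G k x) \<le> norm (w x)" for k
    proof (rule AE_I2)
      fix x show "norm (G k x) \<le> norm (w x)"
        using Gb[of k x] Gs[of x k] by (cases "x \<in> ball 0 (R + 1)") (auto simp: w_def)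
    qed
    have "sqn lebesgue w \<le> (\<integral>\<^sup>+x. ennreal ((real N)\<^sup>2) * indicator (ball (0::'a) (R + 1)) x \<partial>lebesgue)"
      unfolding sqn_def w_def by (intro nn_integral_mono) (auto split: split_indicator)
    also have "\<dots> < \<infinity>"
      using emeasure_bounded_finite[OF bounded_ball, of "0::'a" "R + 1"]
      by (simp add: nn_integral_cmult_indicator ennreal_mult_less_top)
    finally show "sqn lebesgue w < \<infinity>" .
  qed auto
  then have "\<forall>\<^sub>F n in sequentially. sqn lebesgue (\<lambda>x. G n x - T N x) < ennreal (\<epsilon> / 4)"
    using e by (intro order_tendstoD) auto
  then obtain n where n: "sqn lebesgue (\<lambda>x. G n x - T N x) < ennreal (\<epsilon> / 4)"
    using eventually_happens by fastforce
  have "sqn lebesgue (\<lambda>x. G n x - u x) \<le> 2 * sqn lebesgue (\<lambda>x. G n x - T N x) + 2 * sqn lebesgue (\<lambda>x. T N x - u x)"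
    by (rule sqn_diff_trans) auto
  also have "\<dots> < 2 * ennreal (\<epsilon>/4) + 2 * ennreal (\<epsilon>/4)"
    using N n by (intro add_strict_mono ennreal_mult_strict_left_mono) auto
  also have "\<dots> = ennreal \<epsilon>"
    using e by (simp add: mult_2[symmetric] ennreal_mult'[symmetric] flip: ennreal_numeral)
  finally show ?thesis using that[of "G n" "real N"] Gc Gb Gs by blast
qed


section \<open>Plancherel for functions of bounded support\<close>

text \<open>
  The norm is continuous. It is enough to compare \<open>\<bar>f n\<bar>\<close> with \<open>\<bar>g\<bar>\<close>, which reduces functions with values in
  any Banach space to the real inner product space.
\<close>

lemma sqn_tendsto:
  fixes f :: "nat \<Rightarrow> 'a \<Rightarrow> 'b::{banach, second_countable_topology}"
  assumes [measurable]: "\<And>k. f k \<in> borel_measurable M" "g \<in> borel_measurable M"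
    and lim: "(\<lambda>n. sqn M (\<lambda>x. f n x - g x)) \<longlonglongrightarrow> 0" and fin: "\<And>k. sqn M (f k) < \<infinity>"
  shows "(\<lambda>n. sqn M (f n)) \<longlonglongrightarrow> sqn M g" and "sqn M g < \<infinity>"
proof -
  have "\<forall>\<^sub>F n in sequentially. sqn M (\<lambda>x. f n x - g x) < \<infinity>"
    using lim by (intro order_tendstoD) auto
  then obtain n where n: "sqn M (\<lambda>x. f n x - g x) < \<infinity>" using eventually_happens by fastforce
  show g: "sqn M g < \<infinity>"
    by (rule sqn_finite_of_near[of "f n"]) (use fin n in auto)
  define F where "F n x = norm (f n x)" for n x
  define G where "G x = norm (g x)" for x
  have sF: "sqn M (F n) = sqn M (f n)" for n by (rule sqn_cong_AE) (simp add: F_def)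
  have sG: "sqn M G = sqn M g" by (rule sqn_cong_AE) (simp add: G_def)
  have F: "F n \<in> L2 M" for n using fin[of n] sF[of n] by (simp add: L2_iff F_def[abs_def])
  have G: "G \<in> L2 M" using g sG by (simp add: L2_iff G_def[abs_def])
  have le: "sqn M (\<lambda>x. F n x - G x) \<le> sqn M (\<lambda>x. f n x - g x)" for n
    by (rule sqn_mono_AE) (simp add: F_def G_def norm_triangle_ineq3)
  have "(\<lambda>n. sqn M (\<lambda>x. F n x - G x)) \<longlonglongrightarrow> 0"
    by (rule tendsto_sandwich[OF _ _ tendsto_const lim]) (use le in auto)
  then have "(\<lambda>n. ennreal (L2_inner M (\<lambda>x. F n x - G x) (\<lambda>x. F n x - G x))) \<longlonglongrightarrow> ennreal 0"
    by (simp add: sqn_eq_L2_inner L2.diff_mem F G)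
  then have "(\<lambda>n. L2_inner M (\<lambda>x. F n x - G x) (\<lambda>x. F n x - G x)) \<longlonglongrightarrow> 0"
    by (subst (asm) tendsto_ennreal_iff) (simp_all add: L2.nonneg L2.diff_mem F G)
  then have "(\<lambda>n. L2_inner M (F n) (F n)) \<longlonglongrightarrow> L2_inner M G G"
    by (rule L2.tendsto_quad[OF F G])
  then have "(\<lambda>n. ennreal (L2_inner M (F n) (F n))) \<longlonglongrightarrow> ennreal (L2_inner M G G)"
    by (rule tendsto_ennrealI)
  then show "(\<lambda>n. sqn M (f n)) \<longlonglongrightarrow> sqn M g"
    by (simp add: sqn_eq_L2_inner[OF F, symmetric] sqn_eq_L2_inner[OF G, symmetric] sF sG)
qed

lemma bounded_support_integrable:
  fixes u :: "'a::euclidean_space \<Rightarrow> real"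
  assumes u: "u \<in> L2 lebesgue" and supp: "\<And>x. x \<notin> ball 0 R \<Longrightarrow> u x = 0"
  shows "integrable lebesgue u"
    and "(LINT x|lebesgue. \<bar>u x\<bar>)\<^sup>2 \<le> measure lebesgue (ball (0::'a) R) * L2_inner lebesgue u u"
proof -
  have [measurable]: "u \<in> borel_measurable lebesgue" using u by (simp add: L2_iff)
  have fin: "emeasure lebesgue (ball (0::'a) R) < \<infinity>"
    using emeasure_bounded_finite[OF bounded_ball, of "0::'a" R] by simp
  define i where "i = (indicator (ball 0 R) :: 'a \<Rightarrow> real)"
  have im: "i \<in> borel_measurable lebesgue"
    unfolding i_def by (intro borel_measurable_lebesgueI borel_measurable_indicator) simp
  have "sqn lebesgue i = (\<integral>\<^sup>+x. indicator (ball (0::'a) R) x \<partial>lebesgue)"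
    unfolding sqn_def i_def by (intro nn_integral_cong) (auto split: split_indicator)
  also have "\<dots> = emeasure lebesgue (ball (0::'a) R)" by (rule nn_integral_indicator) simp
  finally have si: "sqn lebesgue i = emeasure lebesgue (ball (0::'a) R)" .
  have iL: "i \<in> L2 lebesgue" using im fin si by (simp add: L2_iff)
  have ii: "L2_inner lebesgue i i = measure lebesgue (ball (0::'a) R)"
    unfolding measure_def si[symmetric] sqn_eq_L2_inner[OF iL] by (simp add: L2.nonneg[OF iL])
  define a where "a x = \<bar>u x\<bar>" for x
  have am: "a \<in> borel_measurable lebesgue" unfolding a_def[abs_def] by measurable
  have aL: "a \<in> L2 lebesgue"
    using u am sqn_cong_AE[of a u lebesgue] by (simp add: L2_iff a_def)
  have aa: "L2_inner lebesgue a a = L2_inner lebesgue u u" by (simp add: L2_inner_def a_def)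
  have eq: "u x = u x * i x" for x using supp[of x] by (auto simp: i_def split: split_indicator)
  show "integrable lebesgue u" by (subst eq[abs_def]) (rule L2_integrable_mult[OF u iL])
  have "(LINT x|lebesgue. \<bar>u x\<bar>) = L2_inner lebesgue i a"
    unfolding L2_inner_def
  proof (intro Bochner_Integration.integral_cong refl)
    fix x show "\<bar>u x\<bar> = i x * a x"
      using supp[of x] by (auto simp: i_def a_def split: split_indicator)
  qed
  then show "(LINT x|lebesgue. \<bar>u x\<bar>)\<^sup>2 \<le> measure lebesgue (ball (0::'a) R) * L2_inner lebesgue u u"
    using L2.Cauchy_Schwarz[OF iL aL] by (simp add: ii aa)
qed

lemma fourier_integral_diff:
  "integrable lebesgue u \<Longrightarrow> integrable lebesgue v \<Longrightarrow>
    fourier_integral (\<lambda>x. u x - v x) \<xi> = fourier_integral u \<xi> - fourier_integral v \<xi>"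
  using integrable_fourier_integrand[of u \<xi>] integrable_fourier_integrand[of v \<xi>]
  by (simp add: fourier_integral_def left_diff_distrib)

lemma fourier_integral_lincomb:
  "integrable lebesgue u \<Longrightarrow> integrable lebesgue v \<Longrightarrow>
    fourier_integral (\<lambda>x. a * u x + b * v x) \<xi> = of_real a * fourier_integral u \<xi> + of_real b * fourier_integral v \<xi>"
  using integrable_fourier_integrand[of u \<xi>] integrable_fourier_integrand[of v \<xi>]
  by (simp add: fourier_integral_def distrib_right mult.assoc)

text \<open>
  For continuous approximations \<open>g k\<close> of \<open>u\<close> the transforms form a Cauchy sequence by the continuous case,
  with limit \<open>U\<close>. The supports lie in one ball, so \<open>g k\<close> also tends to \<open>u\<close> in the mean of order one and the
  transforms converge at every point to that of \<open>u\<close>; hence \<open>U\<close> is the transform of \<open>u\<close>.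
\<close>

lemma Plancherel_bounded_support:
  fixes u :: "'a::euclidean_space \<Rightarrow> real"
  assumes u: "u \<in> L2 lebesgue" and supp: "\<And>x. x \<notin> ball 0 R \<Longrightarrow> u x = 0"
  shows "sqn lebesgue (fourier_integral u) = ennreal ((2 * pi) ^ DIM('a)) * sqn lebesgue u"
proof -
  define C where "C = measure lebesgue (ball (0::'a) (R + 1))"
  have "\<exists>g. continuous_on UNIV g \<and> (\<exists>M. \<forall>x. \<bar>g x\<bar> \<le> M) \<and> (\<forall>x. x \<notin> ball 0 (R + 1) \<longrightarrow> g x = 0)
    \<and> sqn lebesgue (\<lambda>x. g x - u x) < ennreal (1 / real (Suc k))" for k
    by (rule L2_approx_continuous[OF u supp, where \<epsilon> = "1 / real (Suc k)"]) auto
  then obtain g where g: "\<And>k. continuous_on UNIV (g k)" "\<And>k. \<exists>M. \<forall>x. \<bar>g k x\<bar> \<le> M"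
    "\<And>k x. x \<notin> ball 0 (R + 1) \<Longrightarrow> g k x = 0" "\<And>k. sqn lebesgue (\<lambda>x. g k x - u x) < ennreal (1 / real (Suc k))"
    by metis
  have [measurable]: "u \<in> borel_measurable lebesgue" using u by (simp add: L2_iff)
  have gm[measurable]: "g k \<in> borel_measurable lebesgue" for k
    by (intro borel_measurable_lebesgueI borel_measurable_continuous_onI g)
  have sd: "sqn lebesgue (\<lambda>x. u x - g k x) < \<infinity>" for k
    using g(4)[of k] by (simp add: sqn_commute[of _ u] less_trans[OF _ ennreal_less_top])
  have gL: "g k \<in> L2 lebesgue" for k
    using u sqn_finite_of_near[of u lebesgue "g k", OF _ _ _ sd] by (simp add: L2_iff)
  have u0: "u x = 0" if "x \<notin> ball 0 (R + 1)" for x using that by (intro supp) auto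
  have lim: "(\<lambda>k. sqn lebesgue (\<lambda>x. g k x - u x)) \<longlonglongrightarrow> 0"
  proof (rule tendsto_sandwich[OF _ _ tendsto_const])
    show "\<forall>\<^sub>F k in sequentially. sqn lebesgue (\<lambda>x. g k x - u x) \<le> ennreal (1 / real (Suc k))"
      using g(4) by (intro always_eventually allI less_imp_le) 
    have "(\<lambda>k. 1 / real (Suc k)) \<longlonglongrightarrow> 0" using LIMSEQ_inverse_real_of_nat by (simp add: inverse_eq_divide)
    then show "(\<lambda>k. ennreal (1 / real (Suc k))) \<longlonglongrightarrow> 0"
      using tendsto_ennrealI by fastforce
  qed simp
  have gi: "integrable lebesgue (g k)" for k by (rule bounded_support_integrable(1)[OF gL g(3)])
  have ui: "integrable lebesgue u" by (rule bounded_support_integrable(1)[OF u u0])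
  have PL: "sqn lebesgue (fourier_integral (g k)) = ennreal ((2 * pi) ^ DIM('a)) * sqn lebesgue (g k)" for k
    using g(2)[of k] Plancherel_continuous[OF gi g(1) _ gL, of k] by blast
  have PLd: "sqn lebesgue (\<lambda>\<xi>. fourier_integral (g j) \<xi> - fourier_integral (g k) \<xi>)
      = ennreal ((2 * pi) ^ DIM('a)) * sqn lebesgue (\<lambda>x. g j x - g k x)" for j k
  proof -
    obtain M1 M2 where M: "\<And>x. \<bar>g j x\<bar> \<le> M1" "\<And>x. \<bar>g k x\<bar> \<le> M2" using g(2) by metis
    have "\<bar>g j x - g k x\<bar> \<le> M1 + M2" for x using M[of x] by linarith
    note Plancherel_continuous[OF Bochner_Integration.integrable_diff[OF gi gi] continuous_on_diff[OF g(1) g(1)] this L2.diff_mem[OF gL gL]]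
    moreover have "fourier_integral (\<lambda>x. g j x - g k x) = (\<lambda>\<xi>. fourier_integral (g j) \<xi> - fourier_integral (g k) \<xi>)"
      by (rule ext) (rule fourier_integral_diff[OF gi gi])
    ultimately show ?thesis by simp
  qed
  have [measurable]: "fourier_integral (g k) \<in> borel_measurable lebesgue" "fourier_integral u \<in> borel_measurable lebesgue" for k
    using u gm by (auto intro!: borel_measurable_lebesgueI[OF fourier_integral_measurable] simp: L2_iff)
  have Cau: "\<exists>N. \<forall>m\<ge>N. \<forall>n\<ge>N. sqn lebesgue (\<lambda>\<xi>. fourier_integral (g m) \<xi> - fourier_integral (g n) \<xi>) < ennreal \<epsilon>"
    if e: "\<epsilon> > 0" for \<epsilon>
  proof -
    define D where "D = (2 * pi) ^ DIM('a)"
    have D: "D > 0" by (simp add: D_def)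
    obtain N where N: "\<forall>m\<ge>N. \<forall>n\<ge>N. sqn lebesgue (\<lambda>x. g m x - g n x) < ennreal (\<epsilon> / D)"
      using L2_tendsto_Cauchy[OF gm _ lim, of "\<epsilon> / D"] e D by auto
    have "sqn lebesgue (\<lambda>\<xi>. fourier_integral (g m) \<xi> - fourier_integral (g n) \<xi>) < ennreal \<epsilon>" if "m \<ge> N" "n \<ge> N" for m n
    proof -
      have "ennreal D * sqn lebesgue (\<lambda>x. g m x - g n x) < ennreal D * ennreal (\<epsilon> / D)"
        using N that D by (intro ennreal_mult_strict_left_mono) auto
      also have "\<dots> = ennreal \<epsilon>" using D e by (simp flip: ennreal_mult)
      finally show ?thesis unfolding PLd D_def .
    qed
    then show ?thesis by blast
  qed
  obtain U r where U: "U \<in> borel_measurable lebesgue" "(\<lambda>n. sqn lebesgue (\<lambda>\<xi>. fourier_integral (g n) \<xi> - U \<xi>)) \<longlonglongrightarrow> 0"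
    "strict_mono (r :: nat \<Rightarrow> nat)" "AE \<xi> in lebesgue. (\<lambda>k. fourier_integral (g (r k)) \<xi>) \<longlonglongrightarrow> U \<xi>"
    by (rule L2_complete[of "\<lambda>k. fourier_integral (g k)" lebesgue]) (use Cau in auto)
  have pw: "(\<lambda>k. fourier_integral (g k) \<xi>) \<longlonglongrightarrow> fourier_integral u \<xi>" for \<xi>
  proof -
    define q where "q k = L2_inner lebesgue (\<lambda>x. g k x - u x) (\<lambda>x. g k x - u x)" for k
    have "(\<lambda>k. ennreal (q k)) \<longlonglongrightarrow> ennreal 0"
      using lim by (simp add: sqn_eq_L2_inner L2.diff_mem gL u q_def)
    then have q: "q \<longlonglongrightarrow> 0" by (subst (asm) tendsto_ennreal_iff) (auto simp: q_def L2.nonneg L2.diff_mem gL u)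
    have bnd: "norm (fourier_integral (g k) \<xi> - fourier_integral u \<xi>) \<le> sqrt (C * q k)" for k
    proof -
      have "norm (fourier_integral (\<lambda>x. g k x - u x) \<xi>) \<le> (LINT x|lebesgue. \<bar>g k x - u x\<bar>)"
        by (rule norm_fourier_integral_le) (use gi ui in auto)
      also have "\<dots> \<le> sqrt (C * q k)"
        unfolding C_def q_def
        by (rule real_le_rsqrt, rule bounded_support_integrable(2)) (use gL u g(3) u0 in \<open>auto intro: L2.diff_mem\<close>)
      finally show ?thesis by (simp add: fourier_integral_diff gi ui)
    qed
    have "(\<lambda>k. sqrt (C * q k)) \<longlonglongrightarrow> sqrt (C * 0)" by (intro tendsto_intros q)
    then have z: "(\<lambda>k. sqrt (C * q k)) \<longlonglongrightarrow> 0" by simp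
    have "(\<lambda>k. fourier_integral (g k) \<xi> - fourier_integral u \<xi>) \<longlonglongrightarrow> 0"
      by (rule Lim_null_comparison[OF always_eventually[OF allI[OF bnd]] z])
    then show ?thesis by (simp add: LIM_zero_iff)
  qed
  have "AE \<xi> in lebesgue. U \<xi> = fourier_integral u \<xi>"
    using U(4)
  proof eventually_elim
    case (elim \<xi>)
    then show ?case using LIMSEQ_subseq_LIMSEQ[OF pw[of \<xi>] U(3)] LIMSEQ_unique unfolding o_def by blast
  qed
  then have "sqn lebesgue (\<lambda>\<xi>. fourier_integral (g n) \<xi> - fourier_integral u \<xi>) = sqn lebesgue (\<lambda>\<xi>. fourier_integral (g n) \<xi> - U \<xi>)" for n
    by (intro sqn_cong_AE) (auto elim: eventually_mono)
  then have U': "(\<lambda>n. sqn lebesgue (\<lambda>\<xi>. fourier_integral (g n) \<xi> - fourier_integral u \<xi>)) \<longlonglongrightarrow> 0"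
    using U(2) by simp
  have "(\<lambda>n. sqn lebesgue (fourier_integral (g n))) \<longlonglongrightarrow> sqn lebesgue (fourier_integral u)"
  proof (rule sqn_tendsto(1)[OF _ _ U'])
    show "sqn lebesgue (fourier_integral (g k)) < \<infinity>" for k
      unfolding PL using gL by (simp add: L2_iff ennreal_mult_less_top)
  qed auto
  moreover have "(\<lambda>n. ennreal ((2 * pi) ^ DIM('a)) * sqn lebesgue (g n)) \<longlonglongrightarrow> ennreal ((2 * pi) ^ DIM('a)) * sqn lebesgue u"
    by (intro ennreal_tendsto_cmult sqn_tendsto(1)[OF _ _ lim]) (use gL in \<open>auto simp: L2_iff\<close>)
  ultimately show ?thesis unfolding PL using LIMSEQ_unique by blast
qed


section \<open>The Fourier transform on L2\<close>

definition truncate :: "real \<Rightarrow> ('a::euclidean_space \<Rightarrow> real) \<Rightarrow> 'a \<Rightarrow> real" where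
  "truncate R u x = indicator (ball 0 R) x * u x"

lemma truncate_measurable [measurable]:
  "u \<in> borel_measurable lebesgue \<Longrightarrow> truncate R u \<in> borel_measurable lebesgue"
  unfolding truncate_def[abs_def]
  by (intro borel_measurable_times borel_measurable_lebesgueI[OF borel_measurable_indicator]) simp

lemma truncate_L2: "u \<in> L2 lebesgue \<Longrightarrow> truncate R u \<in> L2 lebesgue"
  using sqn_mono_AE[of "truncate R u" u lebesgue]
  by (auto simp: L2_iff truncate_def split: split_indicator intro: order_le_less_trans)

lemma truncate_support: "x \<notin> ball 0 R \<Longrightarrow> truncate R u x = 0"
  by (simp add: truncate_def)

lemma truncate_tendsto:
  assumes u: "u \<in> L2 lebesgue"
  shows "(\<lambda>k. sqn lebesgue (\<lambda>x. truncate (real k) u x - u x)) \<longlonglongrightarrow> 0"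
proof (rule sqn_dominated[where w = u])
  have um[measurable]: "u \<in> borel_measurable lebesgue" using u by (simp add: L2_iff)
  show "truncate (real k) u \<in> borel_measurable lebesgue" for k by measurable
  show "AE x in lebesgue. (\<lambda>k. truncate (real k) u x) \<longlonglongrightarrow> u x"
  proof (intro AE_I2 tendsto_eventually)
    fix x :: 'a
    obtain N :: nat where N: "norm x < real N" using reals_Archimedean2 by blast
    show "\<forall>\<^sub>F k in sequentially. truncate (real k) u x = u x"
      unfolding eventually_sequentially by (rule exI[of _ N]) (use N in \<open>auto simp: truncate_def\<close>)
  qed
  show "AE x in lebesgue. norm (truncate (real k) u x) \<le> norm (u x)" for k
    by (rule AE_I2) (auto simp: truncate_def split: split_indicator)
qed (use u in \<open>auto simp: L2_iff\<close>)

lemma truncate_integrable: "u \<in> L2 lebesgue \<Longrightarrow> integrable lebesgue (truncate R u)"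
  by (rule bounded_support_integrable(1)[OF truncate_L2 truncate_support])

lemma fourier_integral_truncate_measurable:
  "u \<in> L2 lebesgue \<Longrightarrow> fourier_integral (truncate R u) \<in> borel_measurable lebesgue"
  by (rule borel_measurable_lebesgueI, rule fourier_integral_measurable, rule truncate_measurable) (simp add: L2_iff)

lemma Plancherel_truncate_diff:
  fixes u v :: "'a::euclidean_space \<Rightarrow> real"
  assumes u: "u \<in> L2 lebesgue" and v: "v \<in> L2 lebesgue"
  shows "sqn lebesgue (\<lambda>\<xi>. fourier_integral (truncate R u) \<xi> - fourier_integral (truncate S v) \<xi>)
    = ennreal ((2 * pi) ^ DIM('a)) * sqn lebesgue (\<lambda>x. truncate R u x - truncate S v x)"
proof -
  have "fourier_integral (\<lambda>x. truncate R u x - truncate S v x)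
      = (\<lambda>\<xi>. fourier_integral (truncate R u) \<xi> - fourier_integral (truncate S v) \<xi>)"
    by (rule ext, rule fourier_integral_diff[OF truncate_integrable[OF u] truncate_integrable[OF v]])
  moreover have "truncate R u x - truncate S v x = 0" if "x \<notin> ball 0 (max R S)" for x
    using that by (simp add: truncate_def)
  then have "sqn lebesgue (fourier_integral (\<lambda>x. truncate R u x - truncate S v x))
      = ennreal ((2 * pi) ^ DIM('a)) * sqn lebesgue (\<lambda>x. truncate R u x - truncate S v x)"
    by (rule Plancherel_bounded_support[OF L2.diff_mem[OF truncate_L2[OF u] truncate_L2[OF v]]])
  ultimately show ?thesis by simp
qed

text \<open>
  The transforms of the truncations to balls are Cauchy along integer radii by Plancherel, which
  gives a limit \<open>U\<close>. Since the distance of the transform at radius \<open>R\<close> to \<open>U\<close> is a multiple of the distance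
  of the truncation to \<open>u\<close>, it decreases in \<open>R\<close>, and convergence along all real radii follows.
  So the choice in the definition of the transform has a witness.
\<close>

lemma fourier_transform_spec:
  fixes u :: "'a::euclidean_space \<Rightarrow> real"
  assumes u: "u \<in> L2 lebesgue"
  shows "fourier_transform u \<in> borel_measurable lebesgue"
    and "((\<lambda>R. sqn lebesgue (\<lambda>\<xi>. fourier_integral (truncate R u) \<xi> - fourier_transform u \<xi>)) \<longlongrightarrow> 0) at_top"
proof -
  define D where "D = (2 * pi) ^ DIM('a)"
  have D: "D > 0" by (simp add: D_def)
  define F where "F R = fourier_integral (truncate R u)" for R
  have [measurable]: "F R \<in> borel_measurable lebesgue" for R
    unfolding F_def by (rule fourier_integral_truncate_measurable[OF u])
  have um[measurable]: "u \<in> borel_measurable lebesgue" using u by (simp add: L2_iff)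
  have PL: "sqn lebesgue (\<lambda>\<xi>. F R \<xi> - F S \<xi>) = ennreal D * sqn lebesgue (\<lambda>x. truncate R u x - truncate S u x)" for R S
    unfolding F_def D_def by (rule Plancherel_truncate_diff[OF u u])
  note tr = truncate_tendsto[OF u]
  have Cau: "\<exists>N. \<forall>m\<ge>N. \<forall>n\<ge>N. sqn lebesgue (\<lambda>\<xi>. F (real m) \<xi> - F (real n) \<xi>) < ennreal \<epsilon>" if e: "\<epsilon> > 0" for \<epsilon>
  proof -
    obtain N where N: "\<forall>m\<ge>N. \<forall>n\<ge>N. sqn lebesgue (\<lambda>x. truncate (real m) u x - truncate (real n) u x) < ennreal (\<epsilon> / D)"
      using L2_tendsto_Cauchy[OF _ um tr, of "\<epsilon> / D"] e D by auto
    have "sqn lebesgue (\<lambda>\<xi>. F (real m) \<xi> - F (real n) \<xi>) < ennreal \<epsilon>" if "m \<ge> N" "n \<ge> N" for m n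
    proof -
      have "ennreal D * sqn lebesgue (\<lambda>x. truncate (real m) u x - truncate (real n) u x) < ennreal D * ennreal (\<epsilon> / D)"
        using N that D by (intro ennreal_mult_strict_left_mono) auto
      also have "\<dots> = ennreal \<epsilon>" using D e by (simp flip: ennreal_mult)
      finally show ?thesis unfolding PL .
    qed
    then show ?thesis by blast
  qed
  obtain U where U: "U \<in> borel_measurable lebesgue" "(\<lambda>n. sqn lebesgue (\<lambda>\<xi>. F (real n) \<xi> - U \<xi>)) \<longlonglongrightarrow> 0"
    by (rule L2_complete[of "\<lambda>k. F (real k)" lebesgue]) (use Cau in auto)
  have eq: "sqn lebesgue (\<lambda>\<xi>. F R \<xi> - U \<xi>) = ennreal D * sqn lebesgue (\<lambda>x. truncate R u x - u x)" for R
  proof -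
    have "(\<lambda>k. sqn lebesgue (\<lambda>\<xi>. F R \<xi> - F (real k) \<xi>)) \<longlonglongrightarrow> sqn lebesgue (\<lambda>\<xi>. F R \<xi> - U \<xi>)"
    proof (rule sqn_tendsto(1))
      show "(\<lambda>n. sqn lebesgue (\<lambda>\<xi>. (F R \<xi> - F (real n) \<xi>) - (F R \<xi> - U \<xi>))) \<longlonglongrightarrow> 0"
        using U(2) by (simp add: sqn_commute[of _ U])
      show "sqn lebesgue (\<lambda>\<xi>. F R \<xi> - F (real k) \<xi>) < \<infinity>" for k
        unfolding PL using L2.diff_mem[OF truncate_L2[OF u, of R] truncate_L2[OF u, of "real k"]]
        by (simp add: L2_iff ennreal_mult_less_top)
    qed (use U(1) in auto)
    moreover have "(\<lambda>k. ennreal D * sqn lebesgue (\<lambda>x. truncate R u x - truncate (real k) u x))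
        \<longlonglongrightarrow> ennreal D * sqn lebesgue (\<lambda>x. truncate R u x - u x)"
    proof (intro ennreal_tendsto_cmult sqn_tendsto(1))
      show "(\<lambda>n. sqn lebesgue (\<lambda>x. (truncate R u x - truncate (real n) u x) - (truncate R u x - u x))) \<longlonglongrightarrow> 0"
        using tr by (simp add: sqn_commute[of _ u])
      show "sqn lebesgue (\<lambda>x. truncate R u x - truncate (real k) u x) < \<infinity>" for k
        using L2.diff_mem[OF truncate_L2[OF u, of R] truncate_L2[OF u, of "real k"]] by (simp add: L2_iff)
    qed auto
    ultimately show ?thesis unfolding PL using LIMSEQ_unique by blast
  qed
  have lim: "((\<lambda>R. sqn lebesgue (\<lambda>\<xi>. F R \<xi> - U \<xi>)) \<longlongrightarrow> 0) at_top"
  proof (rule order_tendstoI)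
    fix a :: ennreal assume a: "0 < a"
    have "(\<lambda>k. sqn lebesgue (\<lambda>\<xi>. F (real k) \<xi> - U \<xi>)) \<longlonglongrightarrow> 0" by (rule U(2))
    then have "\<forall>\<^sub>F k in sequentially. sqn lebesgue (\<lambda>\<xi>. F (real k) \<xi> - U \<xi>) < a" using a by (rule order_tendstoD)
    then obtain k :: nat where k: "sqn lebesgue (\<lambda>\<xi>. F (real k) \<xi> - U \<xi>) < a" using eventually_happens by fastforce
    have "sqn lebesgue (\<lambda>\<xi>. F R \<xi> - U \<xi>) < a" if "R \<ge> real k" for R
    proof -
      have "sqn lebesgue (\<lambda>x. truncate R u x - u x) \<le> sqn lebesgue (\<lambda>x. truncate (real k) u x - u x)"
        by (rule sqn_mono_AE, rule AE_I2) (use that in \<open>auto simp: truncate_def split: split_indicator\<close>)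
      then have "sqn lebesgue (\<lambda>\<xi>. F R \<xi> - U \<xi>) \<le> sqn lebesgue (\<lambda>\<xi>. F (real k) \<xi> - U \<xi>)"
        unfolding eq by (rule mult_left_mono) simp
      then show ?thesis using k by (rule order_le_less_trans)
    qed
    then show "\<forall>\<^sub>F R in at_top. sqn lebesgue (\<lambda>\<xi>. F R \<xi> - U \<xi>) < a"
      unfolding eventually_at_top_linorder by blast
  qed auto
  have "fourier_transform u \<in> borel_measurable lebesgue \<and>
    ((\<lambda>R. \<integral>\<^sup>+ \<xi>. ennreal ((cmod (fourier_integral (\<lambda>x. indicator (ball 0 R) x * u x) \<xi> - fourier_transform u \<xi>))\<^sup>2)
        \<partial>lebesgue) \<longlongrightarrow> 0) at_top"
    unfolding fourier_transform_def
    by (rule someI[of _ U]) (use U lim in \<open>simp add: F_def sqn_def truncate_def[abs_def]\<close>)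
  then show "fourier_transform u \<in> borel_measurable lebesgue"
    "((\<lambda>R. sqn lebesgue (\<lambda>\<xi>. fourier_integral (truncate R u) \<xi> - fourier_transform u \<xi>)) \<longlongrightarrow> 0) at_top"
    by (simp_all add: sqn_def truncate_def[abs_def])
qed

lemmas fourier_transform_measurable [measurable] = fourier_transform_spec(1)

lemma fourier_transform_tendsto:
  "u \<in> L2 lebesgue \<Longrightarrow>
    (\<lambda>k. sqn lebesgue (\<lambda>\<xi>. fourier_integral (truncate (real k) u) \<xi> - fourier_transform u \<xi>)) \<longlonglongrightarrow> 0"
  by (rule filterlim_compose[OF fourier_transform_spec(2) filterlim_real_sequentially])

lemma fourier_transform_unique:
  assumes u: "u \<in> L2 lebesgue" and U: "U \<in> borel_measurable lebesgue"
    and lim: "(\<lambda>k. sqn lebesgue (\<lambda>\<xi>. fourier_integral (truncate (real k) u) \<xi> - U \<xi>)) \<longlonglongrightarrow> 0"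
  shows "AE \<xi> in lebesgue. fourier_transform u \<xi> = U \<xi>"
  by (rule L2_limit_unique[OF fourier_integral_truncate_measurable[OF u] fourier_transform_spec(1)[OF u] U
      fourier_transform_tendsto[OF u] lim])

lemma fourier_transform_lincomb:
  fixes u v :: "'a::euclidean_space \<Rightarrow> real"
  assumes u: "u \<in> L2 lebesgue" and v: "v \<in> L2 lebesgue"
  shows "AE \<xi> in lebesgue. fourier_transform (\<lambda>x. a * u x + b * v x) \<xi>
      = of_real a * fourier_transform u \<xi> + of_real b * fourier_transform v \<xi>"
proof (rule fourier_transform_unique[OF L2_lincomb[OF u v]])
  note [measurable] = fourier_transform_spec(1)[OF u] fourier_transform_spec(1)[OF v]
    fourier_integral_truncate_measurable[OF u] fourier_integral_truncate_measurable[OF v]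
  show "(\<lambda>\<xi>. of_real a * fourier_transform u \<xi> + of_real b * fourier_transform v \<xi>) \<in> borel_measurable lebesgue"
    by measurable
  define p where "p k \<xi> = fourier_integral (truncate (real k) u) \<xi> - fourier_transform u \<xi>" for k \<xi>
  define q where "q k \<xi> = fourier_integral (truncate (real k) v) \<xi> - fourier_transform v \<xi>" for k \<xi>
  have pm[measurable]: "p k \<in> borel_measurable lebesgue" for k unfolding p_def by measurable
  have qm[measurable]: "q k \<in> borel_measurable lebesgue" for k unfolding q_def by measurable
  have eq: "fourier_integral (truncate (real k) (\<lambda>x. a * u x + b * v x)) \<xi>
      - (of_real a * fourier_transform u \<xi> + of_real b * fourier_transform v \<xi>) = a *\<^sub>R p k \<xi> + b *\<^sub>R q k \<xi>" for k \<xi>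
  proof -
    have "truncate (real k) (\<lambda>x. a * u x + b * v x) = (\<lambda>x. a * truncate (real k) u x + b * truncate (real k) v x)"
      by (simp add: truncate_def fun_eq_iff algebra_simps)
    then show ?thesis
      using fourier_integral_lincomb[OF truncate_integrable[OF u] truncate_integrable[OF v], of a "real k" b "real k"]
      by (simp add: p_def q_def scaleR_conv_of_real algebra_simps)
  qed
  show "(\<lambda>k. sqn lebesgue (\<lambda>\<xi>. fourier_integral (truncate (real k) (\<lambda>x. a * u x + b * v x)) \<xi>
      - (of_real a * fourier_transform u \<xi> + of_real b * fourier_transform v \<xi>))) \<longlonglongrightarrow> 0"
    unfolding eq
  proof (rule tendsto_sandwich[OF _ _ tendsto_const])
    show "\<forall>\<^sub>F k in sequentially. sqn lebesgue (\<lambda>\<xi>. a *\<^sub>R p k \<xi> + b *\<^sub>R q k \<xi>)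
        \<le> 2 * (ennreal (a\<^sup>2) * sqn lebesgue (p k)) + 2 * (ennreal (b\<^sup>2) * sqn lebesgue (q k))"
      using sqn_add_le[of "\<lambda>\<xi>. a *\<^sub>R p k \<xi>" lebesgue "\<lambda>\<xi>. b *\<^sub>R q k \<xi>" for k]
      by (simp add: sqn_scale[OF pm] sqn_scale[OF qm])
    have "(\<lambda>k. 2 * (ennreal (a\<^sup>2) * sqn lebesgue (p k)) + 2 * (ennreal (b\<^sup>2) * sqn lebesgue (q k)))
        \<longlonglongrightarrow> 2 * (ennreal (a\<^sup>2) * 0) + 2 * (ennreal (b\<^sup>2) * 0)"
      using fourier_transform_tendsto[OF u] fourier_transform_tendsto[OF v]
      by (intro tendsto_add ennreal_tendsto_cmult) (simp_all add: p_def[abs_def] q_def[abs_def])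
    then show "(\<lambda>k. 2 * (ennreal (a\<^sup>2) * sqn lebesgue (p k)) + 2 * (ennreal (b\<^sup>2) * sqn lebesgue (q k))) \<longlonglongrightarrow> 0"
      by simp
  qed simp
qed

lemma fourier_transform_diff:
  fixes u v :: "'a::euclidean_space \<Rightarrow> real"
  assumes "u \<in> L2 lebesgue" "v \<in> L2 lebesgue"
  shows "AE \<xi> in lebesgue. fourier_transform (\<lambda>x. u x - v x) \<xi> = fourier_transform u \<xi> - fourier_transform v \<xi>"
  using fourier_transform_lincomb[OF assms, of 1 "-1"] by simp

theorem Plancherel:
  fixes u :: "'a::euclidean_space \<Rightarrow> real"
  assumes u: "u \<in> L2 lebesgue"
  shows "sqn lebesgue (fourier_transform u) = ennreal ((2 * pi) ^ DIM('a)) * sqn lebesgue u"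
    and "sqn lebesgue (fourier_transform u) < \<infinity>"
proof -
  have PL: "sqn lebesgue (fourier_integral (truncate (real k) u)) = ennreal ((2 * pi) ^ DIM('a)) * sqn lebesgue (truncate (real k) u)" for k
    by (rule Plancherel_bounded_support[OF truncate_L2[OF u] truncate_support])
  have fin: "sqn lebesgue (truncate (real k) u) < \<infinity>" for k using truncate_L2[OF u] by (simp add: L2_iff)
  have um[measurable]: "u \<in> borel_measurable lebesgue" using u by (simp add: L2_iff)
  have "(\<lambda>k. sqn lebesgue (fourier_integral (truncate (real k) u))) \<longlonglongrightarrow> sqn lebesgue (fourier_transform u)"
    by (rule sqn_tendsto(1)[OF fourier_integral_truncate_measurable[OF u] fourier_transform_spec(1)[OF u] fourier_transform_tendsto[OF u]])
      (use fin in \<open>simp add: PL ennreal_mult_less_top\<close>)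
  moreover have "(\<lambda>k. ennreal ((2 * pi) ^ DIM('a)) * sqn lebesgue (truncate (real k) u)) \<longlonglongrightarrow> ennreal ((2 * pi) ^ DIM('a)) * sqn lebesgue u"
    by (intro ennreal_tendsto_cmult sqn_tendsto(1)[OF _ um truncate_tendsto[OF u]]) (use fin in auto)
  ultimately show eq: "sqn lebesgue (fourier_transform u) = ennreal ((2 * pi) ^ DIM('a)) * sqn lebesgue u"
    unfolding PL using LIMSEQ_unique by blast
  show "sqn lebesgue (fourier_transform u) < \<infinity>"
    unfolding eq using u by (simp add: L2_iff ennreal_mult_less_top)
qed

lemma fourier_transform_bounded_support:
  fixes u :: "'a::euclidean_space \<Rightarrow> real"
  assumes u: "u \<in> L2 lebesgue" and supp: "\<And>x. x \<notin> ball 0 R \<Longrightarrow> u x = 0"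
  shows "AE \<xi> in lebesgue. fourier_transform u \<xi> = fourier_integral u \<xi>"
proof (rule fourier_transform_unique[OF u])
  have um[measurable]: "u \<in> borel_measurable lebesgue" using u by (simp add: L2_iff)
  show "fourier_integral u \<in> borel_measurable lebesgue"
    by (rule borel_measurable_lebesgueI[OF fourier_integral_measurable[OF um]])
  show "(\<lambda>k. sqn lebesgue (\<lambda>\<xi>. fourier_integral (truncate (real k) u) \<xi> - fourier_integral u \<xi>)) \<longlonglongrightarrow> 0"
  proof (rule tendsto_eventually)
    obtain N :: nat where N: "R < real N" using reals_Archimedean2 by blast
    have "truncate (real k) u = u" if "k \<ge> N" for k
    proof
      fix x show "truncate (real k) u x = u x"
        using supp[of x] that N by (auto simp: truncate_def split: split_indicator)
    qed
    then show "\<forall>\<^sub>F k in sequentially. sqn lebesgue (\<lambda>\<xi>. fourier_integral (truncate (real k) u) \<xi> - fourier_integral u \<xi>) = 0"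
      unfolding eventually_sequentially by (intro exI[of _ N]) (auto simp: sqn_def)
  qed
qed

text \<open>
  Equality holds everywhere: functions that agree almost everywhere give the same condition on
  the transform, hence the same choice.
\<close>

lemma fourier_transform_cong_AE:
  fixes u v :: "'a::euclidean_space \<Rightarrow> real"
  assumes "AE x in lebesgue. u x = v x" "u \<in> borel_measurable lebesgue" "v \<in> borel_measurable lebesgue"
  shows "fourier_transform u = fourier_transform v"
proof -
  have "fourier_integral (truncate R u) = fourier_integral (truncate R v)" for R
  proof
    fix \<xi> :: 'a
    have [measurable]: "(\<lambda>x. cis (- (x \<bullet> \<xi>))) \<in> borel_measurable lebesgue"
      by (rule borel_measurable_lebesgueI) measurable
    have [measurable]: "truncate R u \<in> borel_measurable lebesgue" "truncate R v \<in> borel_measurable lebesgue"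
      using assms by auto
    show "fourier_integral (truncate R u) \<xi> = fourier_integral (truncate R v) \<xi>"
      unfolding fourier_integral_def
      by (rule integral_cong_AE, measurable) (use assms(1) in \<open>auto simp: truncate_def elim: eventually_mono\<close>)
  qed
  then show ?thesis unfolding fourier_transform_def truncate_def[abs_def] by simp
qed

text \<open>
  Polarisation. Only the real part is needed: for real functions the integral is real by symmetry in
  the frequency.
\<close>

lemma Parseval:
  fixes u v :: "'a::euclidean_space \<Rightarrow> real"
  assumes u: "u \<in> L2 lebesgue" and v: "v \<in> L2 lebesgue"
  shows "Re (LINT \<xi>|lebesgue. fourier_transform u \<xi> * cnj (fourier_transform v \<xi>)) = (2 * pi) ^ DIM('a) * L2_inner lebesgue u v"
proof -
  define D where "D = (2 * pi) ^ DIM('a)"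
  note [measurable] = fourier_transform_spec(1)[OF u] fourier_transform_spec(1)[OF v]
  have N: "integrable lebesgue (\<lambda>\<xi>. (norm (fourier_transform w \<xi>))\<^sup>2)"
    "(LINT \<xi>|lebesgue. (norm (fourier_transform w \<xi>))\<^sup>2) = D * L2_inner lebesgue w w" if w: "w \<in> L2 lebesgue" for w :: "'a \<Rightarrow> real"
  proof -
    show i: "integrable lebesgue (\<lambda>\<xi>. (norm (fourier_transform w \<xi>))\<^sup>2)"
      using Plancherel(2)[OF w] sqn_finite_iff_integrable[OF fourier_transform_spec(1)[OF w]] by simp
    have "ennreal (LINT \<xi>|lebesgue. (norm (fourier_transform w \<xi>))\<^sup>2) = ennreal (D * L2_inner lebesgue w w)"
      using Plancherel[OF w] sqn_eq_integral[OF fourier_transform_spec(1)[OF w] Plancherel(2)[OF w]]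
      by (simp add: D_def sqn_eq_L2_inner[OF w] ennreal_mult L2.nonneg[OF w])
    then show "(LINT \<xi>|lebesgue. (norm (fourier_transform w \<xi>))\<^sup>2) = D * L2_inner lebesgue w w"
      by (subst (asm) ennreal_inj) (auto simp: D_def L2.nonneg[OF w])
  qed
  have uv: "integrable lebesgue (\<lambda>\<xi>. fourier_transform u \<xi> * cnj (fourier_transform v \<xi>))"
    by (rule integrable_mult_sqn) (use Plancherel(2)[OF u] Plancherel(2)[OF v] sqn_cong_AE[of "\<lambda>\<xi>. cnj (fourier_transform v \<xi>)" "fourier_transform v" lebesgue] in \<open>auto\<close>)
  define w where "w x = 1 * u x + 1 * v x" for x
  have w: "w \<in> L2 lebesgue" unfolding w_def[abs_def] by (rule L2_lincomb[OF u v])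
  have sq: "(norm (a + b))\<^sup>2 = (norm a)\<^sup>2 + (norm b)\<^sup>2 + 2 * Re (a * cnj b)" for a b :: complex
    unfolding cmod_power2 by (simp add: power2_eq_square algebra_simps)
  have "(LINT \<xi>|lebesgue. (norm (fourier_transform w \<xi>))\<^sup>2)
      = (LINT \<xi>|lebesgue. (norm (fourier_transform u \<xi>))\<^sup>2 + (norm (fourier_transform v \<xi>))\<^sup>2 + 2 * Re (fourier_transform u \<xi> * cnj (fourier_transform v \<xi>)))"
  proof (rule integral_cong_AE)
    show "AE \<xi> in lebesgue. (norm (fourier_transform w \<xi>))\<^sup>2 = (norm (fourier_transform u \<xi>))\<^sup>2 + (norm (fourier_transform v \<xi>))\<^sup>2 + 2 * Re (fourier_transform u \<xi> * cnj (fourier_transform v \<xi>))"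
      using fourier_transform_lincomb[OF u v, of 1 1] unfolding w_def
      by eventually_elim (simp add: sq)
  qed (use fourier_transform_spec(1)[OF w] in measurable)
  also have "\<dots> = (LINT \<xi>|lebesgue. (norm (fourier_transform u \<xi>))\<^sup>2) + (LINT \<xi>|lebesgue. (norm (fourier_transform v \<xi>))\<^sup>2)
      + 2 * Re (LINT \<xi>|lebesgue. fourier_transform u \<xi> * cnj (fourier_transform v \<xi>))"
    using N(1)[OF u] N(1)[OF v] uv integrable_Re[OF uv] by (simp del: times_complex.sel)
  finally have "D * L2_inner lebesgue w w = D * L2_inner lebesgue u u + D * L2_inner lebesgue v v
      + 2 * Re (LINT \<xi>|lebesgue. fourier_transform u \<xi> * cnj (fourier_transform v \<xi>))"
    using N(2)[OF u] N(2)[OF v] N(2)[OF w] by simp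
  moreover have "L2_inner lebesgue w w = L2_inner lebesgue u u + 2 * L2_inner lebesgue u v + L2_inner lebesgue v v"
    unfolding w_def using L2.quad_expand[OF u v, of 1 1] by simp
  ultimately show ?thesis by (simp add: D_def algebra_simps)
qed


section \<open>Test functions\<close>

lemma frechet_derivative_lincomb:
  fixes f g :: "'a::euclidean_space \<Rightarrow> real"
  assumes "f differentiable (at x)" "g differentiable (at x)"
  shows "(\<lambda>x. a * f x + b * g x) differentiable (at x)"
    and "frechet_derivative (\<lambda>x. a * f x + b * g x) (at x) v
      = a * frechet_derivative f (at x) v + b * frechet_derivative g (at x) v"
proof -
  have "((\<lambda>x. a * f x + b * g x) has_derivative
      (\<lambda>v. a * frechet_derivative f (at x) v + b * frechet_derivative g (at x) v)) (at x)"
    using assms by (intro derivative_intros) (simp_all add: frechet_derivative_works)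
  then show "(\<lambda>x. a * f x + b * g x) differentiable (at x)"
    "frechet_derivative (\<lambda>x. a * f x + b * g x) (at x) v
      = a * frechet_derivative f (at x) v + b * frechet_derivative g (at x) v"
    by (auto simp: differentiable_def frechet_derivative_at[symmetric])
qed

lemma C_k_lincomb:
  "C_k k f \<Longrightarrow> C_k k g \<Longrightarrow> C_k k (\<lambda>x. a * f x + b * g x)"
proof (induction k arbitrary: f g)
  case 0
  then show ?case by (auto intro!: continuous_intros)
next
  case (Suc k)
  then have d: "f differentiable (at x)" "g differentiable (at x)" for x by auto
  show ?case
    using Suc by (auto simp: frechet_derivative_lincomb[OF d])
qed

lemma C_k_continuous: "C_k k f \<Longrightarrow> continuous_on UNIV f"
  by (cases k) (auto intro!: continuous_at_imp_continuous_on differentiable_imp_continuous_within)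

lemma test_function_lincomb:
  assumes "\<phi> \<in> test_functions \<Omega>" "\<psi> \<in> test_functions \<Omega>"
  shows "(\<lambda>x. a * \<phi> x + b * \<psi> x) \<in> test_functions \<Omega>"
proof -
  have sub: "closure {x. a * \<phi> x + b * \<psi> x \<noteq> 0} \<subseteq> closure {x. \<phi> x \<noteq> 0} \<union> closure {x. \<psi> x \<noteq> 0}"
    unfolding closure_Un[symmetric] by (rule closure_mono) auto
  have c: "compact (closure {x. \<phi> x \<noteq> 0} \<union> closure {x. \<psi> x \<noteq> 0})"
    using assms by (intro compact_Un) (auto simp: test_functions_def)
  have "compact (closure {x. a * \<phi> x + b * \<psi> x \<noteq> 0})"
    using compact_Int_closed[OF c closed_closure, of "{x. a * \<phi> x + b * \<psi> x \<noteq> 0}"] sub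
    by (simp add: inf_absorb2)
  then show ?thesis using assms sub by (auto simp: test_functions_def intro: C_k_lincomb)
qed

lemma test_function_continuous: "\<phi> \<in> test_functions \<Omega> \<Longrightarrow> continuous_on UNIV \<phi>"
  using C_k_continuous[of 0 \<phi>] by (simp add: test_functions_def)

lemma test_function_outside: "\<phi> \<in> test_functions \<Omega> \<Longrightarrow> x \<notin> \<Omega> \<Longrightarrow> \<phi> x = 0"
  using closure_subset[of "{x. \<phi> x \<noteq> 0}"] by (auto simp: test_functions_def)

lemma test_function_bounded_support:
  assumes "\<phi> \<in> test_functions \<Omega>"
  obtains R where "R > 0" "\<And>x. x \<notin> ball 0 R \<Longrightarrow> \<phi> x = 0"
proof -
  have "bounded {x. \<phi> x \<noteq> 0}"
    using assms compact_imp_bounded bounded_subset closure_subset by (fastforce simp: test_functions_def)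
  then obtain R where "R > 0" "{x. \<phi> x \<noteq> 0} \<subseteq> ball 0 R" using bounded_subset_ballD by blast
  then show ?thesis using that by blast
qed

lemma test_function_bounded:
  assumes "\<phi> \<in> test_functions \<Omega>"
  obtains M where "M \<ge> 0" "\<And>x. \<bar>\<phi> x\<bar> \<le> M"
proof -
  obtain R where R: "R > 0" "\<And>x. x \<notin> ball 0 R \<Longrightarrow> \<phi> x = 0" using test_function_bounded_support[OF assms] by blast
  have "compact (\<phi> ` cball 0 R)"
    using test_function_continuous[OF assms] by (intro compact_continuous_image) (auto intro: continuous_on_subset)
  then have "bounded (\<phi> ` cball 0 R)" by (rule compact_imp_bounded)
  then obtain M where M: "\<And>x. x \<in> cball 0 R \<Longrightarrow> \<bar>\<phi> x\<bar> \<le> M"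
    unfolding bounded_iff real_norm_def by blast
  show ?thesis
  proof (rule that[of "max 0 M"])
    fix x show "\<bar>\<phi> x\<bar> \<le> max 0 M" using M[of x] R(2)[of x] by (cases "x \<in> ball 0 R") auto
  qed simp
qed

lemma bounded_L2:
  fixes u :: "'a::euclidean_space \<Rightarrow> real"
  assumes um: "u \<in> borel_measurable lebesgue" and R: "\<And>x. x \<notin> ball 0 R \<Longrightarrow> u x = 0" and M: "\<And>x. \<bar>u x\<bar> \<le> M"
  shows "u \<in> L2 lebesgue" "sqn lebesgue u \<le> ennreal (M\<^sup>2) * emeasure lborel (ball (0::'a) R)"
proof -
  have "sqn lebesgue u \<le> (\<integral>\<^sup>+x. ennreal (M\<^sup>2) * indicator (ball (0::'a) R) x \<partial>lebesgue)"
    unfolding sqn_def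
  proof (intro nn_integral_mono)
    fix x
    have "\<bar>u x\<bar>\<^sup>2 \<le> M\<^sup>2" using M[of x] by (intro power_mono) auto
    then show "ennreal ((norm (u x))\<^sup>2) \<le> ennreal (M\<^sup>2) * indicator (ball 0 R) x"
      using R[of x] by (auto split: split_indicator intro!: ennreal_leI)
  qed
  also have "\<dots> = ennreal (M\<^sup>2) * emeasure lborel (ball (0::'a) R)"
    by (simp add: nn_integral_cmult_indicator)
  finally show le: "sqn lebesgue u \<le> ennreal (M\<^sup>2) * emeasure lborel (ball (0::'a) R)" .
  also have "\<dots> < \<infinity>"
    using emeasure_bounded_finite[OF bounded_ball, of "0::'a" R] by (simp add: ennreal_mult_less_top)
  finally show "u \<in> L2 lebesgue" using um by (simp add: L2_iff)
qed

lemma test_function_measurable: "\<phi> \<in> test_functions \<Omega> \<Longrightarrow> \<phi> \<in> borel_measurable lebesgue"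
  by (intro borel_measurable_lebesgueI borel_measurable_continuous_onI test_function_continuous)

lemma test_function_L2:
  assumes "\<phi> \<in> test_functions \<Omega>" shows "\<phi> \<in> L2 lebesgue"
proof -
  obtain R where R: "R > 0" "\<And>x. x \<notin> ball 0 R \<Longrightarrow> \<phi> x = 0" using test_function_bounded_support[OF assms] by blast
  obtain M where M: "M \<ge> 0" "\<And>x. \<bar>\<phi> x\<bar> \<le> M" using test_function_bounded[OF assms] by blast
  show ?thesis by (rule bounded_L2(1)[OF test_function_measurable[OF assms] R(2) M(2)])
qed

lemma directional_derivative:
  fixes f :: "'a::euclidean_space \<Rightarrow> real"
  assumes "\<And>x. f differentiable (at x)"
  shows "((\<lambda>t. f (x + t *\<^sub>R b)) has_real_derivative frechet_derivative f (at (x + t *\<^sub>R b)) b) (at t)"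
proof -
  define f' where "f' = frechet_derivative f (at (x + t *\<^sub>R b))"
  have d: "(f has_derivative f') (at (x + t *\<^sub>R b))"
    unfolding f'_def using assms frechet_derivative_works by blast
  have "((\<lambda>t. x + t *\<^sub>R b) has_derivative (\<lambda>h. h *\<^sub>R b)) (at t)"
    by (auto intro!: derivative_eq_intros)
  from has_derivative_compose[OF this d]
  have "((\<lambda>t. f (x + t *\<^sub>R b)) has_derivative (\<lambda>h. f' (h *\<^sub>R b))) (at t)" .
  moreover have "(\<lambda>h. f' (h *\<^sub>R b)) = (\<lambda>h. f' b * h)"
    using has_derivative_bounded_linear[OF d] by (auto simp: linear_simps mult.commute)
  ultimately show ?thesis by (simp add: has_field_derivative_def f'_def)
qed

text \<open>
  Two applications of the mean value theorem, first to \<open>t \<mapsto> \<phi> (x + t b) + \<phi> (x - t b)\<close> and then to its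
  derivative.
\<close>

lemma second_difference_bound:
  fixes \<phi> :: "'a::euclidean_space \<Rightarrow> real"
  assumes \<phi>: "C_k 2 \<phi>" and b: "b \<in> Basis"
    and M: "\<And>x. x \<in> cball 0 (R + 2) \<Longrightarrow> \<bar>frechet_derivative (\<lambda>x. frechet_derivative \<phi> (at x) b) (at x) b\<bar> \<le> M"
    and x: "x \<in> ball 0 (R + 1)" and h: "0 < h" "h \<le> 1"
  shows "\<bar>\<phi> (x + h *\<^sub>R b) + \<phi> (x - h *\<^sub>R b) - 2 * \<phi> x\<bar> \<le> 2 * M * h\<^sup>2"
proof -
  define d1 where "d1 x = frechet_derivative \<phi> (at x) b" for x
  have ck: "C_k (Suc (Suc 0)) \<phi>" using \<phi> by (simp add: numeral_2_eq_2)
  have D0: "\<phi> differentiable (at x)" for x using ck by auto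
  have D1: "d1 differentiable (at x)" for x using ck b unfolding d1_def by auto
  define k where "k t = \<phi> (x + t *\<^sub>R b) + \<phi> (x + t *\<^sub>R (- b))" for t
  have neg: "frechet_derivative \<phi> (at y) (- b) = - d1 y" for y
    using D0[of y] linear_frechet_derivative[of \<phi> "at y"] by (simp add: d1_def linear_neg)
  have k': "(k has_real_derivative d1 (x + t *\<^sub>R b) - d1 (x + t *\<^sub>R (- b))) (at t)" for t
    unfolding k_def
    using DERIV_add[OF directional_derivative[OF D0, of x b t] directional_derivative[OF D0, of x "- b" t]]
    by (simp add: neg) (simp add: d1_def)
  obtain \<tau> where \<tau>: "0 < \<tau>" "\<tau> < h" "k h - k 0 = (h - 0) * (d1 (x + \<tau> *\<^sub>R b) - d1 (x + \<tau> *\<^sub>R (- b)))"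
    using MVT2[of 0 h k "\<lambda>t. d1 (x + t *\<^sub>R b) - d1 (x + t *\<^sub>R (- b))"] k' h by blast
  obtain \<sigma> where \<sigma>: "- \<tau> < \<sigma>" "\<sigma> < \<tau>"
    "d1 (x + \<tau> *\<^sub>R b) - d1 (x + (- \<tau>) *\<^sub>R b) = (\<tau> - - \<tau>) * frechet_derivative d1 (at (x + \<sigma> *\<^sub>R b)) b"
    using MVT2[of "- \<tau>" \<tau> "\<lambda>t. d1 (x + t *\<^sub>R b)" "\<lambda>t. frechet_derivative d1 (at (x + t *\<^sub>R b)) b"]
      directional_derivative[OF D1, of x b] \<tau>(1) by force
  have "norm (x + \<sigma> *\<^sub>R b) \<le> norm x + \<bar>\<sigma>\<bar>" using norm_triangle_ineq[of x "\<sigma> *\<^sub>R b"] b by simp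
  then have "x + \<sigma> *\<^sub>R b \<in> cball 0 (R + 2)" using x \<sigma> \<tau> h by simp
  then have m: "\<bar>frechet_derivative d1 (at (x + \<sigma> *\<^sub>R b)) b\<bar> \<le> M" unfolding d1_def by (rule M)
  have "\<phi> (x + h *\<^sub>R b) + \<phi> (x - h *\<^sub>R b) - 2 * \<phi> x = k h - k 0" by (simp add: k_def)
  also have "\<dots> = h * (2 * \<tau> * frechet_derivative d1 (at (x + \<sigma> *\<^sub>R b)) b)"
    using \<tau>(3) \<sigma>(3) by simp
  finally have "\<bar>\<phi> (x + h *\<^sub>R b) + \<phi> (x - h *\<^sub>R b) - 2 * \<phi> x\<bar> = 2 * (h * \<tau>) * \<bar>frechet_derivative d1 (at (x + \<sigma> *\<^sub>R b)) b\<bar>"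
    using h \<tau> by (simp add: abs_mult)
  also have "\<dots> \<le> 2 * (h * h) * M" using m \<tau> h by (intro mult_mono) auto
  finally show ?thesis by (simp add: power2_eq_square mult_ac)
qed

lemma integral_lborel_translate:
  fixes F :: "'a::euclidean_space \<Rightarrow> 'b::{banach, second_countable_topology}"
  assumes "F \<in> borel_measurable borel"
  shows "(LINT x|lborel. F (a + x)) = (LINT x|lborel. F x)"
  by (subst (2) lborel_distr_plus[of a, symmetric], subst integral_distr) (use assms in auto)

lemma fourier_integral_translate:
  fixes u :: "'a::euclidean_space \<Rightarrow> real"
  assumes [measurable]: "u \<in> borel_measurable borel"
  shows "fourier_integral (\<lambda>x. u (x + a)) \<xi> = cis (a \<bullet> \<xi>) * fourier_integral u \<xi>"
proof -
  have "fourier_integral (\<lambda>x. u (x + a)) \<xi> = (LINT x|lborel. of_real (u (a + x)) * cis (- (x \<bullet> \<xi>)))"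
    unfolding fourier_integral_def by (subst integral_completion) (auto simp: add.commute)
  also have "\<dots> = (LINT x|lborel. cis (a \<bullet> \<xi>) * (of_real (u (a + x)) * cis (- ((a + x) \<bullet> \<xi>))))"
  proof (intro Bochner_Integration.integral_cong refl)
    fix x
    have "cis (a \<bullet> \<xi>) * cis (- ((a + x) \<bullet> \<xi>)) = cis (- (x \<bullet> \<xi>))" by (simp add: cis_mult inner_add_left)
    then show "of_real (u (a + x)) * cis (- (x \<bullet> \<xi>)) = cis (a \<bullet> \<xi>) * (of_real (u (a + x)) * cis (- ((a + x) \<bullet> \<xi>)))"
      by (metis mult.left_commute)
  qed
  also have "\<dots> = cis (a \<bullet> \<xi>) * (LINT x|lborel. of_real (u (a + x)) * cis (- ((a + x) \<bullet> \<xi>)))" by simp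
  also have "(LINT x|lborel. of_real (u (a + x)) * cis (- ((a + x) \<bullet> \<xi>))) = (LINT x|lborel. of_real (u x) * cis (- (x \<bullet> \<xi>)))"
    by (rule integral_lborel_translate[of "\<lambda>x. of_real (u x) * cis (- (x \<bullet> \<xi>))"]) measurable
  also have "\<dots> = fourier_integral u \<xi>"
    unfolding fourier_integral_def by (rule integral_completion[symmetric]) measurable
  finally show ?thesis .
qed

lemma second_difference_quotient_tendsto:
  "(\<lambda>k. (2 - 2 * cos (1 / real (Suc k) * t)) * (real (Suc k))\<^sup>2) \<longlonglongrightarrow> t\<^sup>2"
  unfolding power2_eq_square[of t] by real_asymp

text \<open>
  The transform of \<open>\<phi> (x + h b) + \<phi> (x - h b) - 2 \<phi> x\<close> is that of \<open>\<phi>\<close> times \<open>2 cos (h \<xi>\<^sub>b) - 2\<close>. Divided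
  by \<open>h\<^sup>2\<close>, these second differences are bounded with supports in one ball, so by Plancherel their transforms
  are bounded in the mean, and Fatou's lemma as \<open>h\<close> tends to \<open>0\<close> bounds \<open>\<xi>\<^sub>b\<^sup>2\<close> times the transform
  of \<open>\<phi>\<close>.
\<close>

lemma test_function_fourier_decay:
  fixes \<phi> :: "'a::euclidean_space \<Rightarrow> real"
  assumes \<phi>: "\<phi> \<in> test_functions \<Omega>"
  shows "sqn lebesgue (\<lambda>\<xi>. (norm \<xi>)\<^sup>2 *\<^sub>R fourier_transform \<phi> \<xi>) < \<infinity>"
proof -
  obtain R where R: "R > 0" "\<And>x. x \<notin> ball 0 R \<Longrightarrow> \<phi> x = 0" using test_function_bounded_support[OF \<phi>] by blast
  note \<phi>L = test_function_L2[OF \<phi>]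
  have \<phi>c: "continuous_on UNIV \<phi>" by (rule test_function_continuous[OF \<phi>])
  have [measurable]: "\<phi> \<in> borel_measurable borel" using \<phi>c by (rule borel_measurable_continuous_onI)
  have \<phi>i: "integrable lebesgue \<phi>" by (rule bounded_support_integrable(1)[OF \<phi>L R(2)])
  have Fm[measurable]: "fourier_integral \<phi> \<in> borel_measurable lebesgue"
    by (rule borel_measurable_lebesgueI[OF fourier_integral_measurable[OF test_function_measurable[OF \<phi>]]])
  have comp: "sqn lebesgue (\<lambda>\<xi>. (\<xi> \<bullet> b)\<^sup>2 *\<^sub>R fourier_integral \<phi> \<xi>) < \<infinity>" if b: "b \<in> Basis" for b
  proof -
    have ck: "C_k (Suc (Suc 0)) \<phi>" using \<phi> by (auto simp: test_functions_def)
    then have "continuous_on UNIV (\<lambda>x. frechet_derivative (\<lambda>x. frechet_derivative \<phi> (at x) b) (at x) b)"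
      using b by auto
    then have "compact ((\<lambda>x. frechet_derivative (\<lambda>x. frechet_derivative \<phi> (at x) b) (at x) b) ` cball 0 (R + 2))"
      by (intro compact_continuous_image) (auto intro: continuous_on_subset)
    then have "bounded ((\<lambda>x. frechet_derivative (\<lambda>x. frechet_derivative \<phi> (at x) b) (at x) b) ` cball 0 (R + 2))"
      by (rule compact_imp_bounded)
    then obtain M where M: "\<And>x. x \<in> cball 0 (R + 2) \<Longrightarrow> \<bar>frechet_derivative (\<lambda>x. frechet_derivative \<phi> (at x) b) (at x) b\<bar> \<le> M"
      unfolding bounded_iff real_norm_def by blast
    define h where "h k = 1 / real (Suc k)" for k
    have h: "0 < h k" "h k \<le> 1" for k by (auto simp: h_def)
    define \<psi> where "\<psi> k x = \<phi> (x + h k *\<^sub>R b) + \<phi> (x - h k *\<^sub>R b) - 2 * \<phi> x" for k x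
    have \<psi>m[measurable]: "\<psi> k \<in> borel_measurable borel" for k unfolding \<psi>_def by measurable
    have \<psi>s: "\<psi> k x = 0" if "x \<notin> ball 0 (R + 1)" for k x
    proof -
      have "norm x \<ge> R + 1" using that by simp
      moreover have "norm (h k *\<^sub>R b) \<le> 1" using h[of k] b by simp
      ultimately have "x + h k *\<^sub>R b \<notin> ball 0 R" "x - h k *\<^sub>R b \<notin> ball 0 R" "x \<notin> ball 0 R"
        using norm_triangle_ineq4[of "x + h k *\<^sub>R b" "h k *\<^sub>R b"] norm_triangle_ineq[of "x - h k *\<^sub>R b" "h k *\<^sub>R b"]
        by auto
      then show ?thesis using R(2) by (simp add: \<psi>_def)
    qed
    have M0: "0 \<le> M" using M[of 0] R(1) by auto
    have \<psi>b: "\<bar>\<psi> k x\<bar> \<le> 2 * M * (h k)\<^sup>2" for k x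
    proof (cases "x \<in> ball 0 (R + 1)")
      case True
      show ?thesis unfolding \<psi>_def
        by (rule second_difference_bound[OF _ b M True h]) (use ck in \<open>simp_all add: numeral_2_eq_2\<close>)
    qed (use \<psi>s M0 in auto)
    have \<psi>m': "\<psi> k \<in> borel_measurable lebesgue" for k by (rule borel_measurable_lebesgueI) simp
    note \<psi>L = bounded_L2[OF \<psi>m' \<psi>s \<psi>b]
    define q where "q k \<xi> = (2 - 2 * cos (h k * (\<xi> \<bullet> b))) * (real (Suc k))\<^sup>2" for k \<xi>
    have F\<psi>: "fourier_integral (\<psi> k) \<xi> = of_real (- (2 - 2 * cos (h k * (\<xi> \<bullet> b)))) * fourier_integral \<phi> \<xi>" for k \<xi>
    proof -
      have tr: "integrable lebesgue (\<lambda>x. \<phi> (x + a))" for a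
      proof -
        have s: "\<phi> (x + a) = 0" if "x \<notin> ball 0 (R + norm a)" for x
          using that norm_triangle_ineq4[of "x + a" a] by (intro R(2)) auto
        obtain M where M: "\<And>x. \<bar>\<phi> x\<bar> \<le> M" using test_function_bounded[OF \<phi>] by blast
        have "(\<lambda>x. \<phi> (x + a)) \<in> L2 lebesgue"
          by (rule bounded_L2(1)[OF _ s M]) (rule borel_measurable_lebesgueI, measurable)
        then show ?thesis by (rule bounded_support_integrable(1)[OF _ s])
      qed
      have i1: "integrable lebesgue (\<lambda>x. 1 * \<phi> (x + h k *\<^sub>R b) + 1 * \<phi> (x + - (h k *\<^sub>R b)))"
        using tr[of "h k *\<^sub>R b"] tr[of "- (h k *\<^sub>R b)"] by simp
      have "fourier_integral (\<psi> k) \<xi> = fourier_integral (\<lambda>x. 1 * (1 * \<phi> (x + h k *\<^sub>R b) + 1 * \<phi> (x + - (h k *\<^sub>R b))) + (- 2) * \<phi> x) \<xi>"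
        by (rule arg_cong[where f = "\<lambda>u. fourier_integral u \<xi>"]) (simp add: \<psi>_def fun_eq_iff)
      also have "\<dots> = (cis (h k *\<^sub>R b \<bullet> \<xi>) + cis (- (h k *\<^sub>R b) \<bullet> \<xi>) - 2) * fourier_integral \<phi> \<xi>"
        unfolding fourier_integral_lincomb[OF i1 \<phi>i] fourier_integral_lincomb[OF tr tr]
          fourier_integral_translate[OF \<open>\<phi> \<in> borel_measurable borel\<close>]
        by (simp add: algebra_simps)
      also have "cis (h k *\<^sub>R b \<bullet> \<xi>) + cis (- (h k *\<^sub>R b) \<bullet> \<xi>) - 2 = of_real (- (2 - 2 * cos (h k * (\<xi> \<bullet> b))))"
        by (simp add: complex_eq_iff inner_commute)
      finally show ?thesis .
    qed
    have le: "sqn lebesgue (\<lambda>\<xi>. q k \<xi> *\<^sub>R fourier_integral \<phi> \<xi>)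
        \<le> ennreal ((2 * pi) ^ DIM('a)) * (ennreal ((2 * M)\<^sup>2) * emeasure lborel (ball (0::'a) (R + 1)))" for k
    proof -
      have PL\<psi>: "sqn lebesgue (fourier_integral (\<psi> k)) = ennreal ((2 * pi) ^ DIM('a)) * sqn lebesgue (\<psi> k)"
        by (rule Plancherel_bounded_support[OF \<psi>L(1) \<psi>s])
      have N: "(real (Suc k))\<^sup>2 * (h k)\<^sup>2 = 1" by (simp add: h_def power_divide)
      have "sqn lebesgue (\<lambda>\<xi>. q k \<xi> *\<^sub>R fourier_integral \<phi> \<xi>) = sqn lebesgue (\<lambda>\<xi>. ((real (Suc k))\<^sup>2) *\<^sub>R fourier_integral (\<psi> k) \<xi>)"
        by (rule sqn_cong_AE, rule AE_I2) (simp only: F\<psi> q_def norm_scaleR norm_mult norm_of_real abs_minus_cancel abs_mult mult_ac)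
      also have "\<dots> = ennreal (((real (Suc k))\<^sup>2)\<^sup>2) * (ennreal ((2 * pi) ^ DIM('a)) * sqn lebesgue (\<psi> k))"
        unfolding sqn_scale[OF borel_measurable_lebesgueI[OF fourier_integral_measurable[OF \<psi>m']]]
          PL\<psi> ..
      also have "\<dots> \<le> ennreal (((real (Suc k))\<^sup>2)\<^sup>2) * (ennreal ((2 * pi) ^ DIM('a)) * (ennreal ((2 * M * (h k)\<^sup>2)\<^sup>2) * emeasure lborel (ball (0::'a) (R + 1))))"
        by (intro mult_left_mono \<psi>L(2)) auto
      also have "\<dots> = ennreal ((2 * pi) ^ DIM('a)) * ((ennreal (((real (Suc k))\<^sup>2)\<^sup>2) * ennreal ((2 * M * (h k)\<^sup>2)\<^sup>2)) * emeasure lborel (ball (0::'a) (R + 1)))"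
        by (simp only: mult_ac)
      also have "ennreal (((real (Suc k))\<^sup>2)\<^sup>2) * ennreal ((2 * M * (h k)\<^sup>2)\<^sup>2) = ennreal ((2 * M)\<^sup>2)"
      proof -
        have "((real (Suc k))\<^sup>2)\<^sup>2 * (2 * M * (h k)\<^sup>2)\<^sup>2 = (2 * M)\<^sup>2 * ((real (Suc k))\<^sup>2 * (h k)\<^sup>2)\<^sup>2"
          by (simp only: power_mult_distrib mult_ac)
        also have "\<dots> = (2 * M)\<^sup>2" unfolding N by simp
        finally show ?thesis by (simp only: ennreal_mult[symmetric] zero_le_power2)
      qed
      finally show ?thesis .
    qed
    have qm[measurable]: "(\<lambda>\<xi>. q k \<xi>) \<in> borel_measurable lebesgue" for k
      unfolding q_def by (rule borel_measurable_lebesgueI) measurable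
    have "sqn lebesgue (\<lambda>\<xi>. (\<xi> \<bullet> b)\<^sup>2 *\<^sub>R fourier_integral \<phi> \<xi>)
        \<le> ennreal ((2 * pi) ^ DIM('a)) * (ennreal ((2 * M)\<^sup>2) * emeasure lborel (ball (0::'a) (R + 1)))"
    proof (rule sqn_Fatou[where f = "\<lambda>k \<xi>. q k \<xi> *\<^sub>R fourier_integral \<phi> \<xi>"])
      show "AE \<xi> in lebesgue. (\<lambda>k. q k \<xi> *\<^sub>R fourier_integral \<phi> \<xi>) \<longlonglongrightarrow> (\<xi> \<bullet> b)\<^sup>2 *\<^sub>R fourier_integral \<phi> \<xi>"
        unfolding q_def h_def by (intro AE_I2 tendsto_scaleR second_difference_quotient_tendsto tendsto_const)
    qed (use le in auto)
    also have "\<dots> < \<infinity>"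
      using emeasure_bounded_finite[OF bounded_ball, of "0::'a" "R + 1"] by (simp add: ennreal_mult_less_top)
    finally show ?thesis .
  qed
  have bm[measurable]: "(\<lambda>\<xi>::'a. (\<xi> \<bullet> b)\<^sup>2) \<in> borel_measurable lebesgue" for b
    by (rule borel_measurable_lebesgueI) measurable
  have "sqn lebesgue (\<lambda>\<xi>. \<Sum>b\<in>B. (\<xi> \<bullet> b)\<^sup>2 *\<^sub>R fourier_integral \<phi> \<xi>) < \<infinity>" if "finite B" "B \<subseteq> Basis" for B
    using that
  proof (induction B rule: finite_induct)
    case empty
    then show ?case by (simp add: sqn_def)
  next
    case (insert b B)
    have "sqn lebesgue (\<lambda>\<xi>. (\<xi> \<bullet> b)\<^sup>2 *\<^sub>R fourier_integral \<phi> \<xi> + (\<Sum>b\<in>B. (\<xi> \<bullet> b)\<^sup>2 *\<^sub>R fourier_integral \<phi> \<xi>))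
      \<le> 2 * sqn lebesgue (\<lambda>\<xi>. (\<xi> \<bullet> b)\<^sup>2 *\<^sub>R fourier_integral \<phi> \<xi>) + 2 * sqn lebesgue (\<lambda>\<xi>. \<Sum>b\<in>B. (\<xi> \<bullet> b)\<^sup>2 *\<^sub>R fourier_integral \<phi> \<xi>)"
      by (rule sqn_add_le) measurable
    also have "\<dots> < \<infinity>" using comp[of b] insert by (simp add: ennreal_mult_less_top)
    finally show ?case using insert by simp
  qed
  from this[of Basis] have "sqn lebesgue (\<lambda>\<xi>. (norm \<xi>)\<^sup>2 *\<^sub>R fourier_integral \<phi> \<xi>) < \<infinity>"
    by (simp add: norm_sq_eq_sum_Basis scaleR_sum_left)
  moreover have "AE \<xi> in lebesgue. fourier_transform \<phi> \<xi> = fourier_integral \<phi> \<xi>"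
    by (rule fourier_transform_bounded_support[OF \<phi>L R(2)])
  then have "AE \<xi> in lebesgue. norm ((norm \<xi>)\<^sup>2 *\<^sub>R fourier_transform \<phi> \<xi>) = norm ((norm \<xi>)\<^sup>2 *\<^sub>R fourier_integral \<phi> \<xi>)"
    by eventually_elim simp
  then have "sqn lebesgue (\<lambda>\<xi>. (norm \<xi>)\<^sup>2 *\<^sub>R fourier_transform \<phi> \<xi>) = sqn lebesgue (\<lambda>\<xi>. (norm \<xi>)\<^sup>2 *\<^sub>R fourier_integral \<phi> \<xi>)"
    by (rule sqn_cong_AE)
  ultimately show ?thesis by simp
qed


section \<open>Closed subspaces and equivalent forms\<close>

text \<open>
  For use with test functions, whose closure is \<open>sobolev_tilde\<close>.
\<close>

lemma (in semi_hilbert) semi_hilbert_closure: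
  assumes S: "S \<subseteq> V" "(\<lambda>x. 0) \<in> S"
    and lin: "\<And>u v a b. u \<in> S \<Longrightarrow> v \<in> S \<Longrightarrow> (\<lambda>x. a * u x + b * v x) \<in> S"
  defines "W \<equiv> {v \<in> V. \<forall>\<epsilon>>0. \<exists>\<phi>\<in>S. I (\<lambda>x. v x - \<phi> x) (\<lambda>x. v x - \<phi> x) < \<epsilon>}"
  shows "semi_hilbert W I"
proof -
  have WV: "W \<subseteq> V" by (auto simp: W_def)
  have SV: "\<phi> \<in> V" if "\<phi> \<in> S" for \<phi> using S that by auto
  interpret W: semi_inner W I
  proof
    show "(\<lambda>x. 0) \<in> W"
      using S zero quad_expand[of "\<lambda>x. 0" "\<lambda>x. 0" 0 0] by (auto simp: W_def intro!: bexI[of _ "\<lambda>x. 0"])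
    fix u v :: "'a \<Rightarrow> real" and a b :: real
    assume u: "u \<in> W" and v: "v \<in> W"
    have uv: "u \<in> V" "v \<in> V" using u v by (auto simp: W_def)
    show "(\<lambda>x. a * u x + b * v x) \<in> W"
      unfolding W_def
    proof (intro CollectI conjI allI impI lincomb uv)
      fix \<epsilon> :: real assume e: "\<epsilon> > 0"
      define \<delta> where "\<delta> = \<epsilon> / (4 * (a\<^sup>2 + b\<^sup>2 + 1))"
      have pos: "0 < a\<^sup>2 + b\<^sup>2 + 1" by (simp add: add_nonneg_pos)
      have d: "\<delta> > 0" using e pos by (simp add: \<delta>_def)
      obtain \<phi> \<psi> where p: "\<phi> \<in> S" "I (\<lambda>x. u x - \<phi> x) (\<lambda>x. u x - \<phi> x) < \<delta>"
        "\<psi> \<in> S" "I (\<lambda>x. v x - \<psi> x) (\<lambda>x. v x - \<psi> x) < \<delta>"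
        using u v d unfolding W_def by blast
      define f g where "f = (\<lambda>x. u x - \<phi> x)" and "g = (\<lambda>x. v x - \<psi> x)"
      have fg: "f \<in> V" "g \<in> V" unfolding f_def g_def using uv p SV by (auto intro: diff_mem)
      have "I (\<lambda>x. a * f x + b * g x) (\<lambda>x. a * f x + b * g x) \<le> 2 * (a\<^sup>2 * I f f) + 2 * (b\<^sup>2 * I g g)"
        using triangle_sq[OF scale_mem[OF fg(1), of a] scale_mem[OF fg(2), of b]]
          quad_expand[OF fg(1) fg(1), of a 0] quad_expand[OF fg(2) fg(2), of b 0] by simp
      also have "\<dots> \<le> 2 * (a\<^sup>2 * \<delta>) + 2 * (b\<^sup>2 * \<delta>)"
        using p by (intro add_mono mult_left_mono) (auto simp: f_def g_def)
      also have "\<dots> = 2 * (a\<^sup>2 + b\<^sup>2) * \<delta>" by (simp add: algebra_simps)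
      also have "\<dots> \<le> 2 * (a\<^sup>2 + b\<^sup>2 + 1) * \<delta>" using d by (intro mult_right_mono) auto
      also have "\<dots> = \<epsilon> / 2" unfolding \<delta>_def using pos by (simp add: field_simps)
      also have "\<dots> < \<epsilon>" using e by simp
      finally have "I (\<lambda>x. a * f x + b * g x) (\<lambda>x. a * f x + b * g x) < \<epsilon>" .
      moreover have "(\<lambda>x. a * f x + b * g x) = (\<lambda>x. (a * u x + b * v x) - (a * \<phi> x + b * \<psi> x))"
        by (simp add: f_def g_def algebra_simps)
      ultimately show "\<exists>\<phi>\<in>S. I (\<lambda>x. (a * u x + b * v x) - \<phi> x) (\<lambda>x. (a * u x + b * v x) - \<phi> x) < \<epsilon>"
        using lin[OF p(1,3), of a b] by (intro bexI[of _ "\<lambda>x. a * \<phi> x + b * \<psi> x"]) auto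
    qed
  next
    show "I (\<lambda>x. a * u x + b * v x) w = a * I u w + b * I v w" if "u \<in> W" "v \<in> W" "w \<in> W" for u v w a b
      using that WV linear_left by blast
    show "I u v = I v u" if "u \<in> W" "v \<in> W" for u v using that WV sym by blast
    show "0 \<le> I u u" if "u \<in> W" for u using that WV nonneg by blast
  qed
  show ?thesis
  proof
    fix f assume f: "W.Cauchy_in f"
    then have fW: "f n \<in> W" for n by (simp add: W.Cauchy_in_def)
    have fV: "f n \<in> V" for n using fW WV by blast
    have "Cauchy_in f" using f WV unfolding W.Cauchy_in_def Cauchy_in_def by blast
    then obtain u where "converges_in f u" using complete by blast
    then have u: "u \<in> V" and l: "(\<lambda>n. I (\<lambda>x. f n x - u x) (\<lambda>x. f n x - u x)) \<longlonglongrightarrow> 0"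
      by (auto simp: converges_in_def)
    have "u \<in> W"
      unfolding W_def
    proof (intro CollectI conjI allI impI u)
      fix \<epsilon> :: real assume e: "\<epsilon> > 0"
      have "\<forall>\<^sub>F n in sequentially. I (\<lambda>x. f n x - u x) (\<lambda>x. f n x - u x) < \<epsilon> / 4"
        using l e by (intro order_tendstoD) auto
      then obtain n where n: "I (\<lambda>x. f n x - u x) (\<lambda>x. f n x - u x) < \<epsilon> / 4"
        using eventually_happens by fastforce
      have "0 < \<epsilon> / 4" using e by simp
      then obtain \<phi> where p: "\<phi> \<in> S" "I (\<lambda>x. f n x - \<phi> x) (\<lambda>x. f n x - \<phi> x) < \<epsilon> / 4"
        using fW[of n] unfolding W_def by blast
      have q: "I (\<lambda>x. \<phi> x - f n x) (\<lambda>x. \<phi> x - f n x) = I (\<lambda>x. f n x - \<phi> x) (\<lambda>x. f n x - \<phi> x)"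
        "I (\<lambda>x. u x - f n x) (\<lambda>x. u x - f n x) = I (\<lambda>x. f n x - u x) (\<lambda>x. f n x - u x)"
        using quad_diff[OF fV SV[OF p(1)], of n] quad_diff[OF SV[OF p(1)] fV, of n] quad_diff[OF fV u, of n]
          quad_diff[OF u fV, of n] sym[OF fV SV[OF p(1)], of n] sym[OF fV u, of n] by linarith+
      have "I (\<lambda>x. u x - \<phi> x) (\<lambda>x. u x - \<phi> x) < \<epsilon>"
        using diff_sq3[OF u SV[OF p(1)] fV, of n] n p(2) q by linarith
      then show "\<exists>\<phi>\<in>S. I (\<lambda>x. u x - \<phi> x) (\<lambda>x. u x - \<phi> x) < \<epsilon>" using p(1) by blast
    qed
    then show "\<exists>u. W.converges_in f u" using l fW unfolding W.converges_in_def by blast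
  qed
qed

lemma semi_hilbert_equivalent:
  assumes "semi_hilbert V I" "semi_inner V J"
    and c: "c > 0" "\<And>u. u \<in> V \<Longrightarrow> c * I u u \<le> J u u" and C: "\<And>u. u \<in> V \<Longrightarrow> J u u \<le> C * I u u"
  shows "semi_hilbert V J"
proof -
  interpret semi_hilbert V I by fact
  interpret J: semi_inner V J by fact
  show ?thesis
  proof
    fix f assume f: "J.Cauchy_in f"
    then have fV: "f n \<in> V" for n by (simp add: J.Cauchy_in_def)
    have "Cauchy_in f"
      unfolding Cauchy_in_def
    proof (intro conjI allI impI fV)
      fix \<epsilon> :: real assume "\<epsilon> > 0"
      then have "0 < c * \<epsilon>" using c by simp
      then obtain N where N: "\<forall>m\<ge>N. \<forall>n\<ge>N. J (\<lambda>x. f m x - f n x) (\<lambda>x. f m x - f n x) < c * \<epsilon>"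
        using f unfolding J.Cauchy_in_def by blast
      have "I (\<lambda>x. f m x - f n x) (\<lambda>x. f m x - f n x) < \<epsilon>" if "m \<ge> N" "n \<ge> N" for m n
      proof -
        have "c * I (\<lambda>x. f m x - f n x) (\<lambda>x. f m x - f n x) < c * \<epsilon>"
          by (rule order_le_less_trans[OF c(2)[OF diff_mem[OF fV fV]]]) (use N that in blast)
        then show ?thesis using c(1) by simp
      qed
      then show "\<exists>N. \<forall>m\<ge>N. \<forall>n\<ge>N. I (\<lambda>x. f m x - f n x) (\<lambda>x. f m x - f n x) < \<epsilon>" by blast
    qed
    then obtain u where u: "converges_in f u" using complete by blast
    then have uV: "u \<in> V" by (simp add: converges_in_def)
    have "(\<lambda>n. J (\<lambda>x. f n x - u x) (\<lambda>x. f n x - u x)) \<longlonglongrightarrow> 0"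
    proof (rule real_tendsto_sandwich[OF _ _ tendsto_const])
      show "\<forall>\<^sub>F n in sequentially. J (\<lambda>x. f n x - u x) (\<lambda>x. f n x - u x) \<le> C * I (\<lambda>x. f n x - u x) (\<lambda>x. f n x - u x)"
        by (intro always_eventually allI C diff_mem fV uV)
      show "\<forall>\<^sub>F n in sequentially. 0 \<le> J (\<lambda>x. f n x - u x) (\<lambda>x. f n x - u x)"
        by (intro always_eventually allI J.nonneg diff_mem fV uV)
      show "(\<lambda>n. C * I (\<lambda>x. f n x - u x) (\<lambda>x. f n x - u x)) \<longlonglongrightarrow> 0"
        using u tendsto_mult_left[of "\<lambda>n. I (\<lambda>x. f n x - u x) (\<lambda>x. f n x - u x)" 0 _ C]
        by (simp add: converges_in_def)
    qed
    then show "\<exists>u. J.converges_in f u" using fV uV unfolding J.converges_in_def by blast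
  qed
qed

section \<open>Sobolev spaces\<close>

text \<open>
  The Fourier transform of \<open>(-\<Delta>)\<^bsup>s/2\<^esup> u\<close>. The quadratic form of \<open>(-\<Delta>)\<^sup>s\<close> is its squared norm, up to the
  factor \<open>(2 \<pi>)\<^sup>n\<close>.
\<close>

definition frac_symbol :: "real \<Rightarrow> ('a::euclidean_space \<Rightarrow> real) \<Rightarrow> 'a \<Rightarrow> complex" where
  "frac_symbol s u \<xi> = (norm \<xi> powr s) *\<^sub>R fourier_transform u \<xi>"

lemma lebesgue_measurable_norm_powr [measurable]:
  "(\<lambda>\<xi>::'a::euclidean_space. norm \<xi> powr s) \<in> borel_measurable lebesgue"
  by (rule borel_measurable_lebesgueI) measurable

lemma frac_symbol_measurable:
  "u \<in> L2 lebesgue \<Longrightarrow> frac_symbol s u \<in> borel_measurable lebesgue"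
  unfolding frac_symbol_def[abs_def] by (intro borel_measurable_scaleR fourier_transform_spec(1)) measurable

definition re_inner :: "('a::euclidean_space \<Rightarrow> complex) \<Rightarrow> ('a \<Rightarrow> complex) \<Rightarrow> real" where
  "re_inner U V = Re (LINT \<xi>|lebesgue. U \<xi> * cnj (V \<xi>))"

lemma sqn_cnj [simp]: "sqn M (\<lambda>\<xi>. cnj (V \<xi>)) = sqn M V"
  by (simp add: sqn_def)

lemma re_inner_integrable:
  assumes [measurable]: "U \<in> borel_measurable lebesgue" "V \<in> borel_measurable lebesgue"
    and "sqn lebesgue U < \<infinity>" "sqn lebesgue V < \<infinity>"
  shows "integrable lebesgue (\<lambda>\<xi>. U \<xi> * cnj (V \<xi>))"
  by (rule integrable_mult_sqn) (use assms in auto)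

lemma re_inner_commute: "re_inner U V = re_inner V U"
proof -
  have "(LINT \<xi>|lebesgue. V \<xi> * cnj (U \<xi>)) = cnj (LINT \<xi>|lebesgue. U \<xi> * cnj (V \<xi>))"
    by (simp add: mult.commute flip: Bochner_Integration.integral_cnj)
  then show ?thesis by (simp add: re_inner_def)
qed

lemma re_inner_self:
  assumes "U \<in> borel_measurable lebesgue" "sqn lebesgue U < \<infinity>"
  shows "ennreal (re_inner U U) = sqn lebesgue U" and "0 \<le> re_inner U U"
proof -
  have "(LINT \<xi>|lebesgue. U \<xi> * cnj (U \<xi>)) = of_real (LINT \<xi>|lebesgue. (norm (U \<xi>))\<^sup>2)"
    by (simp only: complex_norm_square[symmetric] integral_complex_of_real)
  then have "re_inner U U = (LINT \<xi>|lebesgue. (norm (U \<xi>))\<^sup>2)" by (simp add: re_inner_def)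
  then show "ennreal (re_inner U U) = sqn lebesgue U" "0 \<le> re_inner U U"
    using sqn_eq_integral[OF assms] by simp_all
qed

lemma frac_laplacian_eq_re_inner:
  "frac_laplacian s u (\<phi> :: 'a::euclidean_space \<Rightarrow> real) = re_inner (frac_symbol s u) (frac_symbol s \<phi>) / (2 * pi) ^ DIM('a)"
proof -
  have "of_real (norm \<xi> powr (2 * s)) * fourier_transform u \<xi> * cnj (fourier_transform \<phi> \<xi>)
      = frac_symbol s u \<xi> * cnj (frac_symbol s \<phi> \<xi>)" for \<xi>
  proof -
    have p: "norm \<xi> powr (2 * s) = norm \<xi> powr s * norm \<xi> powr s" by (simp add: powr_add[symmetric])
    show ?thesis unfolding p by (simp add: frac_symbol_def scaleR_conv_of_real mult_ac)
  qed
  then show ?thesis by (simp add: frac_laplacian_def re_inner_def)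
qed

lemma bessel_weight_bounds:
  fixes r s :: real
  assumes "0 < s" "s < 1" "0 \<le> r"
  shows "(r powr s)\<^sup>2 \<le> (1 + r\<^sup>2) powr s" "1 \<le> (1 + r\<^sup>2) powr s" "(1 + r\<^sup>2) powr s \<le> 2 * (1 + (r powr s)\<^sup>2)"
proof -
  have r2: "(r powr s)\<^sup>2 = (r\<^sup>2) powr s"
    using assms by (cases "r = 0") (auto simp: power2_eq_square powr_mult)
  show "(r powr s)\<^sup>2 \<le> (1 + r\<^sup>2) powr s" unfolding r2 using assms by (intro powr_mono2) auto
  show "1 \<le> (1 + r\<^sup>2) powr s" using assms by (intro ge_one_powr_ge_zero) auto
  have "(1 + r\<^sup>2) powr s \<le> (2 * max 1 (r\<^sup>2)) powr s" using assms by (intro powr_mono2) auto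
  also have "\<dots> = 2 powr s * (max 1 (r\<^sup>2)) powr s" by (simp add: powr_mult)
  also have "\<dots> \<le> 2 powr 1 * (1 + (r\<^sup>2) powr s)"
    using assms by (intro mult_mono powr_mono) (auto simp: max_def)
  finally show "(1 + r\<^sup>2) powr s \<le> 2 * (1 + (r powr s)\<^sup>2)" unfolding r2 by simp
qed

lemma bessel_sqn_bounds:
  fixes u :: "'a::euclidean_space \<Rightarrow> real"
  assumes s: "0 < s" "s < 1" and u: "u \<in> L2 lebesgue"
  defines "N \<equiv> \<integral>\<^sup>+\<xi>. ennreal ((1 + (norm \<xi>)\<^sup>2) powr s * (cmod (fourier_transform u \<xi>))\<^sup>2) \<partial>lebesgue"
  shows "sqn lebesgue (frac_symbol s u) \<le> N" "sqn lebesgue (fourier_transform u) \<le> N"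
    "N \<le> 2 * (sqn lebesgue (fourier_transform u) + sqn lebesgue (frac_symbol s u))"
proof -
  note b = bessel_weight_bounds[OF s norm_ge_zero]
  note [measurable] = fourier_transform_spec(1)[OF u] frac_symbol_measurable[OF u, of s]
  have n: "(norm (frac_symbol s u \<xi>))\<^sup>2 = (norm \<xi> powr s)\<^sup>2 * (cmod (fourier_transform u \<xi>))\<^sup>2" for \<xi>
    by (simp add: frac_symbol_def power_mult_distrib)
  show "sqn lebesgue (frac_symbol s u) \<le> N"
    unfolding sqn_def N_def n by (intro nn_integral_mono ennreal_leI mult_right_mono b) simp
  show "sqn lebesgue (fourier_transform u) \<le> N"
    unfolding sqn_def N_def
  proof (intro nn_integral_mono ennreal_leI)
    fix \<xi> :: 'a
    show "(norm (fourier_transform u \<xi>))\<^sup>2 \<le> (1 + (norm \<xi>)\<^sup>2) powr s * (cmod (fourier_transform u \<xi>))\<^sup>2"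
      using mult_right_mono[OF b(2)[of \<xi>], of "(cmod (fourier_transform u \<xi>))\<^sup>2"] by simp
  qed
  have "N \<le> (\<integral>\<^sup>+\<xi>. 2 * (ennreal ((norm (fourier_transform u \<xi>))\<^sup>2) + ennreal ((norm (frac_symbol s u \<xi>))\<^sup>2)) \<partial>lebesgue)"
    unfolding N_def
  proof (intro nn_integral_mono)
    fix \<xi> :: 'a
    have "ennreal ((1 + (norm \<xi>)\<^sup>2) powr s * (cmod (fourier_transform u \<xi>))\<^sup>2)
        \<le> ennreal (2 * ((norm (fourier_transform u \<xi>))\<^sup>2 + (norm (frac_symbol s u \<xi>))\<^sup>2))"
      using mult_right_mono[OF b(3)[of \<xi>], of "(cmod (fourier_transform u \<xi>))\<^sup>2"]
      by (intro ennreal_leI) (simp add: n algebra_simps)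
    then show "ennreal ((1 + (norm \<xi>)\<^sup>2) powr s * (cmod (fourier_transform u \<xi>))\<^sup>2)
        \<le> 2 * (ennreal ((norm (fourier_transform u \<xi>))\<^sup>2) + ennreal ((norm (frac_symbol s u \<xi>))\<^sup>2))"
      by (simp add: ennreal_mult)
  qed
  also have "\<dots> = 2 * (sqn lebesgue (fourier_transform u) + sqn lebesgue (frac_symbol s u))"
    unfolding sqn_def by (simp add: nn_integral_cmult nn_integral_add)
  finally show "N \<le> 2 * (sqn lebesgue (fourier_transform u) + sqn lebesgue (frac_symbol s u))" .
qed

text \<open>
  The weights \<open>(1 + \<bar>\<xi>\<bar>\<^sup>2)\<^sup>s\<close> and \<open>1 + \<bar>\<xi>\<bar>\<^bsup>2s\<^esup>\<close> are comparable, and the constant part of the second is controlled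
  by Plancherel's theorem.
\<close>

lemma sobolev_space_iff:
  fixes u :: "'a::euclidean_space \<Rightarrow> real"
  assumes s: "0 < s" "s < 1"
  shows "u \<in> sobolev_space s \<longleftrightarrow> u \<in> L2 lebesgue \<and> sqn lebesgue (frac_symbol s u) < \<infinity>"
proof (cases "u \<in> L2 lebesgue")
  case True
  note [measurable] = fourier_transform_spec(1)[OF True]
  have m: "(\<lambda>\<xi>. (1 + (norm \<xi>)\<^sup>2) powr s * (cmod (fourier_transform u \<xi>))\<^sup>2) \<in> borel_measurable lebesgue"
    by (intro borel_measurable_times borel_measurable_lebesgueI[of "\<lambda>\<xi>. (1 + (norm \<xi>)\<^sup>2) powr s"]) measurable
  have "integrable lebesgue (\<lambda>\<xi>. (1 + (norm \<xi>)\<^sup>2) powr s * (cmod (fourier_transform u \<xi>))\<^sup>2)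
      \<longleftrightarrow> (\<integral>\<^sup>+\<xi>. ennreal ((1 + (norm \<xi>)\<^sup>2) powr s * (cmod (fourier_transform u \<xi>))\<^sup>2) \<partial>lebesgue) < \<infinity>"
    using m by (subst integrable_iff_bounded) (auto simp: abs_mult)
  also have "\<dots> \<longleftrightarrow> sqn lebesgue (frac_symbol s u) < \<infinity>"
  proof
    assume "(\<integral>\<^sup>+\<xi>. ennreal ((1 + (norm \<xi>)\<^sup>2) powr s * (cmod (fourier_transform u \<xi>))\<^sup>2) \<partial>lebesgue) < \<infinity>"
    then show "sqn lebesgue (frac_symbol s u) < \<infinity>"
      by (rule order_le_less_trans[OF bessel_sqn_bounds(1)[OF s True]])
  next
    assume "sqn lebesgue (frac_symbol s u) < \<infinity>"
    then have "2 * (sqn lebesgue (fourier_transform u) + sqn lebesgue (frac_symbol s u)) < \<infinity>"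
      using Plancherel(2)[OF True] by (simp add: ennreal_mult_less_top)
    then show "(\<integral>\<^sup>+\<xi>. ennreal ((1 + (norm \<xi>)\<^sup>2) powr s * (cmod (fourier_transform u \<xi>))\<^sup>2) \<partial>lebesgue) < \<infinity>"
      by (rule order_le_less_trans[OF bessel_sqn_bounds(3)[OF s True]])
  qed
  finally show ?thesis using True by (simp add: sobolev_space_def)
qed (simp add: sobolev_space_def)

lemma sobolev_L2: "u \<in> sobolev_space s \<Longrightarrow> u \<in> L2 lebesgue"
  by (simp add: sobolev_space_def)

lemma frac_symbol_lincomb:
  assumes "u \<in> L2 lebesgue" "v \<in> L2 lebesgue"
  shows "AE \<xi> in lebesgue. frac_symbol s (\<lambda>x. a * u x + b * v x) \<xi> = a *\<^sub>R frac_symbol s u \<xi> + b *\<^sub>R frac_symbol s v \<xi>"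
  using fourier_transform_lincomb[OF assms, of a b]
  by eventually_elim (simp add: frac_symbol_def scaleR_conv_of_real algebra_simps)

lemma frac_laplacian_lincomb:
  fixes u v :: "'a::euclidean_space \<Rightarrow> real"
  assumes L: "u \<in> L2 lebesgue" "v \<in> L2 lebesgue" "\<phi> \<in> L2 lebesgue"
    and i: "integrable lebesgue (\<lambda>\<xi>. frac_symbol s u \<xi> * cnj (frac_symbol s \<phi> \<xi>))"
      "integrable lebesgue (\<lambda>\<xi>. frac_symbol s v \<xi> * cnj (frac_symbol s \<phi> \<xi>))"
  shows "frac_laplacian s (\<lambda>x. a * u x + b * v x) \<phi> = a * frac_laplacian s u \<phi> + b * frac_laplacian s v \<phi>"
proof -
  note [measurable] = L[THEN frac_symbol_measurable, of s] frac_symbol_measurable[OF L2_lincomb[OF L(1,2)], of s]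
  have "(LINT \<xi>|lebesgue. frac_symbol s (\<lambda>x. a * u x + b * v x) \<xi> * cnj (frac_symbol s \<phi> \<xi>))
     = (LINT \<xi>|lebesgue. a *\<^sub>R (frac_symbol s u \<xi> * cnj (frac_symbol s \<phi> \<xi>)) + b *\<^sub>R (frac_symbol s v \<xi> * cnj (frac_symbol s \<phi> \<xi>)))"
  proof (rule integral_cong_AE)
    show "AE \<xi> in lebesgue. frac_symbol s (\<lambda>x. a * u x + b * v x) \<xi> * cnj (frac_symbol s \<phi> \<xi>)
      = a *\<^sub>R (frac_symbol s u \<xi> * cnj (frac_symbol s \<phi> \<xi>)) + b *\<^sub>R (frac_symbol s v \<xi> * cnj (frac_symbol s \<phi> \<xi>))"
      using frac_symbol_lincomb[OF L(1,2), of s a b] by eventually_elim (simp add: algebra_simps)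
  qed measurable
  also have "\<dots> = a *\<^sub>R (LINT \<xi>|lebesgue. frac_symbol s u \<xi> * cnj (frac_symbol s \<phi> \<xi>)) + b *\<^sub>R (LINT \<xi>|lebesgue. frac_symbol s v \<xi> * cnj (frac_symbol s \<phi> \<xi>))"
    using i by simp
  finally show ?thesis
    unfolding frac_laplacian_eq_re_inner re_inner_def by (simp add: add_divide_distrib)
qed

lemma sobolev_semi_inner:
  assumes s: "0 < s" "s < 1"
  shows "semi_inner (sobolev_space s) (frac_laplacian s :: ('a::euclidean_space \<Rightarrow> real) \<Rightarrow> _)"
proof
  note iff = sobolev_space_iff[OF s]
  have z: "(\<lambda>x::'a. 0) \<in> L2 lebesgue" by (rule L2.zero)
  show lc: "(\<lambda>x. a * u x + b * v x) \<in> sobolev_space s" if u: "u \<in> sobolev_space s" and v: "v \<in> sobolev_space s"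
    for u v :: "'a \<Rightarrow> real" and a b
  proof -
    have L: "u \<in> L2 lebesgue" "v \<in> L2 lebesgue" using u v by (auto simp: iff)
    note [measurable] = L[THEN frac_symbol_measurable, of s]
    have "sqn lebesgue (frac_symbol s (\<lambda>x. a * u x + b * v x)) = sqn lebesgue (\<lambda>\<xi>. a *\<^sub>R frac_symbol s u \<xi> + b *\<^sub>R frac_symbol s v \<xi>)"
      by (rule sqn_cong_AE) (use frac_symbol_lincomb[OF L, of s a b] in eventually_elim, simp)
    also have "\<dots> \<le> 2 * sqn lebesgue (\<lambda>\<xi>. a *\<^sub>R frac_symbol s u \<xi>) + 2 * sqn lebesgue (\<lambda>\<xi>. b *\<^sub>R frac_symbol s v \<xi>)"
      by (rule sqn_add_le) auto
    also have "\<dots> < \<infinity>"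
      using u v by (simp add: iff sqn_scale[OF frac_symbol_measurable[OF L(1)]] sqn_scale[OF frac_symbol_measurable[OF L(2)]] ennreal_mult_less_top)
    finally show ?thesis using L2_lincomb[OF L] by (simp add: iff)
  qed
  have "fourier_transform (\<lambda>x::'a. 0) \<in> borel_measurable lebesgue" "sqn lebesgue (fourier_transform (\<lambda>x::'a. 0)) = 0"
    using fourier_transform_spec(1)[OF z] Plancherel(1)[OF z] by (simp_all add: sqn_def[of _ "\<lambda>x. 0"])
  then have "AE \<xi> in lebesgue. fourier_transform (\<lambda>x::'a. 0) \<xi> = 0" by (simp add: sqn_eq_0_iff)
  then have "AE \<xi> in lebesgue. norm (frac_symbol s (\<lambda>x::'a. 0) \<xi>) = norm (0::complex)"
    by eventually_elim (simp add: frac_symbol_def)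
  then have "sqn lebesgue (frac_symbol s (\<lambda>x::'a. 0)) = sqn lebesgue (\<lambda>x::'a. 0::complex)" by (rule sqn_cong_AE)
  then show "(\<lambda>x::'a. 0) \<in> sobolev_space s" using z by (simp add: iff) (simp add: sqn_def)
  show "frac_laplacian s (\<lambda>x. a * u x + b * v x) w = a * frac_laplacian s u w + b * frac_laplacian s v w"
    if "u \<in> sobolev_space s" "v \<in> sobolev_space s" "w \<in> sobolev_space s" for u v w :: "'a \<Rightarrow> real" and a b
    using that by (intro frac_laplacian_lincomb re_inner_integrable frac_symbol_measurable) (auto simp: iff)
  show "frac_laplacian s u v = frac_laplacian s v u" for u v :: "'a \<Rightarrow> real"
    unfolding frac_laplacian_eq_re_inner by (simp add: re_inner_commute)
  show "0 \<le> frac_laplacian s u u" if "u \<in> sobolev_space s" for u :: "'a \<Rightarrow> real"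
    using that re_inner_self(2)[OF frac_symbol_measurable, of u s]
    unfolding frac_laplacian_eq_re_inner by (simp add: iff)
qed


section \<open>Restriction and multiplication in L2\<close>

lemma L2_on_iff:
  assumes S: "S \<in> sets lebesgue"
  shows "u \<in> L2 (lebesgue_on S) \<longleftrightarrow> (\<lambda>x. indicator S x * u x) \<in> L2 lebesgue"
proof -
  have S': "S \<inter> space lebesgue \<in> sets lebesgue" using S by simp
  have "(indicator S x * u x)\<^sup>2 = indicator S x * (u x)\<^sup>2" for x by (simp add: indicator_def)
  then show ?thesis
    by (simp add: L2_def borel_measurable_restrict_space_iff[OF S'] integrable_restrict_space[OF S'])
qed

lemma L2_inner_on:
  assumes S: "S \<in> sets lebesgue"
  shows "L2_inner (lebesgue_on S) u v = L2_inner lebesgue (\<lambda>x. indicator S x * u x) v"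
    and "L2_inner (lebesgue_on S) u v = L2_inner lebesgue (\<lambda>x. indicator S x * u x) (\<lambda>x. indicator S x * v x)"
proof -
  have S': "S \<inter> space lebesgue \<in> sets lebesgue" using S by simp
  show "L2_inner (lebesgue_on S) u v = L2_inner lebesgue (\<lambda>x. indicator S x * u x) v"
    unfolding L2_inner_def integral_restrict_space[OF S'] by (simp add: mult.assoc)
  also have "\<dots> = L2_inner lebesgue (\<lambda>x. indicator S x * u x) (\<lambda>x. indicator S x * v x)"
    unfolding L2_inner_def by (intro Bochner_Integration.integral_cong refl) (simp add: indicator_def)
  finally show "L2_inner (lebesgue_on S) u v = L2_inner lebesgue (\<lambda>x. indicator S x * u x) (\<lambda>x. indicator S x * v x)" .
qed

lemma L2_restrict:
  assumes S: "S \<in> sets lebesgue" and u: "u \<in> L2 lebesgue"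
  shows "u \<in> L2 (lebesgue_on S)" and "L2_inner (lebesgue_on S) u u \<le> L2_inner lebesgue u u"
proof -
  have um[measurable]: "u \<in> borel_measurable lebesgue" using u by (simp add: L2_iff)
  have m: "(\<lambda>x. indicator S x * u x) \<in> borel_measurable lebesgue"
    using S by (intro borel_measurable_times borel_measurable_indicator) auto
  have le: "sqn lebesgue (\<lambda>x. indicator S x * u x) \<le> sqn lebesgue u"
    by (rule sqn_mono_AE, rule AE_I2) (auto simp: indicator_def)
  then have L: "(\<lambda>x. indicator S x * u x) \<in> L2 lebesgue"
    using m u by (auto simp: L2_iff intro: order_le_less_trans)
  then show "u \<in> L2 (lebesgue_on S)" using S by (simp add: L2_on_iff)
  show "L2_inner (lebesgue_on S) u u \<le> L2_inner lebesgue u u"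
    using le unfolding L2_inner_on(2)[OF S] sqn_eq_L2_inner[OF L] sqn_eq_L2_inner[OF u]
    by (simp add: ennreal_le_iff L2.nonneg[OF u])
qed

lemma L2_inner_cong_AE:
  assumes "AE x in M. u x = u' x" "AE x in M. v x = v' x"
    and "u \<in> borel_measurable M" "u' \<in> borel_measurable M" "v \<in> borel_measurable M" "v' \<in> borel_measurable M"
  shows "L2_inner M u v = L2_inner M u' v'"
  unfolding L2_inner_def
  by (rule integral_cong_AE) (use assms in \<open>auto elim: eventually_elim2\<close>)

lemma L2_inner_self_eq_0_iff: "u \<in> L2 M \<Longrightarrow> L2_inner M u u = 0 \<longleftrightarrow> (AE x in M. u x = 0)"
  using sqn_eq_0_iff[of u M] by (simp add: L2_iff[symmetric] sqn_eq_L2_inner L2.nonneg L2_measurable flip: ennreal_eq_0_iff)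

lemma AE_le_Linf_norm:
  assumes "q \<in> Linf M"
  shows "AE x in M. \<bar>q x\<bar> \<le> Linf_norm M q"
proof -
  have lt: "esssup M (\<lambda>x. ereal \<bar>q x\<bar>) < \<infinity>" using assms by (simp add: Linf_def)
  have ae: "AE x in M. ereal \<bar>q x\<bar> \<le> esssup M (\<lambda>x. ereal \<bar>q x\<bar>)" by (rule esssup_AE)
  show ?thesis
  proof (cases "esssup M (\<lambda>x. ereal \<bar>q x\<bar>)")
    case (real r)
    then show ?thesis using ae by (simp add: Linf_norm_def)
  next
    case MInf
    then have "AE x in M. False" using ae by simp
    then show ?thesis by eventually_elim simp
  qed (use lt in simp)
qed

lemma Linf_norm_nonneg:
  assumes "q \<in> Linf M" "\<not> (AE x in M. False)"
  shows "0 \<le> Linf_norm M q"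
proof (rule ccontr)
  assume n: "\<not> ?thesis"
  have "AE x in M. False" using AE_le_Linf_norm[OF assms(1)]
    by eventually_elim (use n in linarith)
  then show False using assms(2) by simp
qed

lemma Linf_mult_L2:
  assumes q: "q \<in> Linf M" and u: "u \<in> L2 M"
  shows "(\<lambda>x. q x * u x) \<in> L2 M"
    and "L2_inner M (\<lambda>x. q x * u x) (\<lambda>x. q x * u x) \<le> (Linf_norm M q)\<^sup>2 * L2_inner M u u"
proof -
  have [measurable]: "q \<in> borel_measurable M" "u \<in> borel_measurable M" using q u by (auto simp: Linf_def L2_iff)
  have su: "sqn M u < \<infinity>" using u by (simp add: L2_iff)
  have le: "sqn M (\<lambda>x. q x * u x) \<le> sqn M (\<lambda>x. Linf_norm M q *\<^sub>R u x)"
  proof (rule sqn_mono_AE)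
    show "AE x in M. norm (q x * u x) \<le> norm (Linf_norm M q *\<^sub>R u x)"
      using AE_le_Linf_norm[OF q]
    proof eventually_elim
      case (elim x)
      then have "\<bar>q x\<bar> * \<bar>u x\<bar> \<le> \<bar>Linf_norm M q\<bar> * \<bar>u x\<bar>" by (intro mult_right_mono) auto
      then show ?case by (simp add: abs_mult)
    qed
  qed
  also have eq: "sqn M (\<lambda>x. Linf_norm M q *\<^sub>R u x) = ennreal ((Linf_norm M q)\<^sup>2) * sqn M u" by (rule sqn_scale) simp
  also have "\<dots> < \<infinity>" using su by (simp add: ennreal_mult_less_top)
  finally show L: "(\<lambda>x. q x * u x) \<in> L2 M" by (simp add: L2_iff)
  show "L2_inner M (\<lambda>x. q x * u x) (\<lambda>x. q x * u x) \<le> (Linf_norm M q)\<^sup>2 * L2_inner M u u"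
    using le unfolding eq sqn_eq_L2_inner[OF L] sqn_eq_L2_inner[OF u]
    by (simp add: ennreal_le_iff L2.nonneg[OF u] flip: ennreal_mult)
qed

section \<open>The Sobolev form is complete\<close>

text \<open>
  An inner product of the Sobolev space of order \<open>s\<close>; its norm is equivalent to \<open>sobolev_norm\<close>, and it is the
  sum of the two forms that occur in the equation.
\<close>

definition H_inner :: "real \<Rightarrow> ('a::euclidean_space \<Rightarrow> real) \<Rightarrow> ('a \<Rightarrow> real) \<Rightarrow> real" where
  "H_inner s u v = L2_inner lebesgue u v + frac_laplacian s u v"

lemma L2_converges_iff_sqn:
  assumes "\<And>n. f n \<in> L2 M" "u \<in> L2 M"
  shows "L2.converges_in M f u \<longleftrightarrow> (\<lambda>n. sqn M (\<lambda>x. f n x - u x)) \<longlonglongrightarrow> 0"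
proof -
  have "(\<lambda>n. sqn M (\<lambda>x. f n x - u x)) \<longlonglongrightarrow> 0 \<longleftrightarrow>
      (\<lambda>n. ennreal (L2_inner M (\<lambda>x. f n x - u x) (\<lambda>x. f n x - u x))) \<longlonglongrightarrow> ennreal 0"
    using assms by (simp add: sqn_eq_L2_inner L2.diff_mem)
  also have "\<dots> \<longleftrightarrow> (\<lambda>n. L2_inner M (\<lambda>x. f n x - u x) (\<lambda>x. f n x - u x)) \<longlonglongrightarrow> 0"
    using assms by (subst tendsto_ennreal_iff) (auto intro!: always_eventually L2.nonneg L2.diff_mem)
  finally show ?thesis using assms by (simp add: L2.converges_in_def)
qed

lemma fourier_transform_L2_continuous:
  fixes u :: "'a::euclidean_space \<Rightarrow> real"
  assumes "L2.converges_in lebesgue f u"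
  shows "(\<lambda>n. sqn lebesgue (\<lambda>\<xi>. fourier_transform (f n) \<xi> - fourier_transform u \<xi>)) \<longlonglongrightarrow> 0"
proof -
  have f: "f n \<in> L2 lebesgue" and u: "u \<in> L2 lebesgue" for n using assms by (auto simp: L2.converges_in_def)
  have "sqn lebesgue (\<lambda>\<xi>. fourier_transform (f n) \<xi> - fourier_transform u \<xi>)
      = ennreal ((2 * pi) ^ DIM('a)) * sqn lebesgue (\<lambda>x. f n x - u x)" for n
  proof -
    have "sqn lebesgue (\<lambda>\<xi>. fourier_transform (f n) \<xi> - fourier_transform u \<xi>) = sqn lebesgue (fourier_transform (\<lambda>x. f n x - u x))"
    proof (rule sqn_cong_AE)
      show "AE \<xi> in lebesgue. norm (fourier_transform (f n) \<xi> - fourier_transform u \<xi>) = norm (fourier_transform (\<lambda>x. f n x - u x) \<xi>)"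
        using fourier_transform_diff[OF f u, of n] by eventually_elim simp
    qed
    then show ?thesis using Plancherel(1)[OF L2.diff_mem[OF f u]] by simp
  qed
  moreover have "(\<lambda>n. ennreal ((2 * pi) ^ DIM('a)) * sqn lebesgue (\<lambda>x. f n x - u x)) \<longlonglongrightarrow> ennreal ((2 * pi) ^ DIM('a)) * 0"
    using assms f u by (intro ennreal_tendsto_cmult) (auto simp: L2_converges_iff_sqn)
  ultimately show ?thesis by simp
qed

lemma test_function_frac_symbol:
  fixes \<phi> :: "'a::euclidean_space \<Rightarrow> real"
  assumes \<phi>: "\<phi> \<in> test_functions \<Omega>" and t: "0 \<le> t" "t \<le> 2"
  shows "sqn lebesgue (frac_symbol t \<phi>) < \<infinity>"
proof -
  note L = test_function_L2[OF \<phi>]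
  note [measurable] = fourier_transform_spec(1)[OF L]
  have m: "(\<lambda>\<xi>::'a. (norm \<xi>)\<^sup>2) \<in> borel_measurable lebesgue" by (rule borel_measurable_lebesgueI) measurable
  have "sqn lebesgue (frac_symbol t \<phi>) \<le> sqn lebesgue (\<lambda>\<xi>. norm (fourier_transform \<phi> \<xi>) + norm ((norm \<xi>)\<^sup>2 *\<^sub>R fourier_transform \<phi> \<xi>))"
  proof (rule sqn_mono_AE, rule AE_I2)
    fix \<xi> :: 'a
    have "norm \<xi> powr t \<le> 1 + (norm \<xi>)\<^sup>2"
    proof (cases "norm \<xi> \<le> 1")
      case True
      then have "norm \<xi> powr t \<le> 1 powr t" using t by (intro powr_mono2) auto
      then show ?thesis using t by (simp add: add_increasing2)
    next
      case False
      then have "norm \<xi> powr t \<le> norm \<xi> powr 2" using t by (intro powr_mono) auto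
      then show ?thesis using False by (simp add: powr_numeral)
    qed
    then have "norm \<xi> powr t * norm (fourier_transform \<phi> \<xi>) \<le> (1 + (norm \<xi>)\<^sup>2) * norm (fourier_transform \<phi> \<xi>)"
      by (rule mult_right_mono) simp
    then show "norm (frac_symbol t \<phi> \<xi>) \<le> norm (norm (fourier_transform \<phi> \<xi>) + norm ((norm \<xi>)\<^sup>2 *\<^sub>R fourier_transform \<phi> \<xi>))"
      by (simp add: frac_symbol_def algebra_simps)
  qed
  also have "\<dots> \<le> 2 * sqn lebesgue (\<lambda>\<xi>. norm (fourier_transform \<phi> \<xi>)) + 2 * sqn lebesgue (\<lambda>\<xi>. norm ((norm \<xi>)\<^sup>2 *\<^sub>R fourier_transform \<phi> \<xi>))"
    by (rule sqn_add_le) (use m in auto)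
  also have "\<dots> < \<infinity>"
    using Plancherel(2)[OF L] test_function_fourier_decay[OF \<phi>]
    by (simp add: ennreal_mult_less_top sqn_def)
  finally show ?thesis .
qed

lemma zero_test_function: "(\<lambda>x. 0) \<in> test_functions \<Omega>"
proof -
  have "C_k k (\<lambda>x::'a. 0)" for k
    by (induction k) (auto simp: frechet_derivative_const)
  then show ?thesis by (simp add: test_functions_def)
qed

locale frac_order =
  fixes s :: real
  assumes s: "0 < s" "s < 1"
begin

interpretation frac: semi_inner "sobolev_space s" "frac_laplacian s :: ('a::euclidean_space \<Rightarrow> real) \<Rightarrow> _"
  by (rule sobolev_semi_inner[OF s])

lemma frac_quad_eq_sqn:
  fixes u :: "'a::euclidean_space \<Rightarrow> real"
  assumes u: "u \<in> sobolev_space s"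
  shows "ennreal ((2 * pi) ^ DIM('a) * frac_laplacian s u u) = sqn lebesgue (frac_symbol s u)"
proof -
  have "u \<in> L2 lebesgue" "sqn lebesgue (frac_symbol s u) < \<infinity>" using u by (auto simp: sobolev_space_iff[OF s])
  then show ?thesis
    using re_inner_self(1)[OF frac_symbol_measurable[of u s]] by (simp add: frac_laplacian_eq_re_inner)
qed

lemma frac_symbol_diff:
  fixes u v :: "'a::euclidean_space \<Rightarrow> real"
  assumes "u \<in> L2 lebesgue" "v \<in> L2 lebesgue"
  shows "sqn lebesgue (\<lambda>\<xi>. frac_symbol s u \<xi> - frac_symbol s v \<xi>) = sqn lebesgue (frac_symbol s (\<lambda>x. u x - v x))"
proof (rule sqn_cong_AE)
  show "AE \<xi> in lebesgue. norm (frac_symbol s u \<xi> - frac_symbol s v \<xi>) = norm (frac_symbol s (\<lambda>x. u x - v x) \<xi>)"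
    using frac_symbol_lincomb[OF assms, of s 1 "-1"] by eventually_elim simp
qed

lemma H_semi_inner: "semi_inner (sobolev_space s) (H_inner s :: ('a::euclidean_space \<Rightarrow> real) \<Rightarrow> _)"
proof
  show "0 \<le> H_inner s u u" if "u \<in> sobolev_space s" for u :: "'a \<Rightarrow> real"
    using frac.nonneg[OF that] L2.nonneg[OF sobolev_L2[OF that]] by (simp add: H_inner_def)
qed (auto simp: H_inner_def frac.lincomb frac.zero frac.linear_left L2.linear_left sobolev_L2
    frac.sym[of _ _] L2.sym algebra_simps)

interpretation H: semi_inner "sobolev_space s" "H_inner s :: ('a::euclidean_space \<Rightarrow> real) \<Rightarrow> _"
  by (rule H_semi_inner)

lemma L2_le_H: "u \<in> sobolev_space s \<Longrightarrow> L2_inner lebesgue u u \<le> H_inner s u u"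
  using frac.nonneg[of u] by (simp add: H_inner_def)

lemma frac_le_H: "u \<in> sobolev_space s \<Longrightarrow> frac_laplacian s u u \<le> H_inner s u u"
  using L2.nonneg[OF sobolev_L2, of u s] by (simp add: H_inner_def)

lemma H_converges_L2:
  assumes "H.converges_in f u"
  shows "L2.converges_in lebesgue f u"
proof -
  have f: "f n \<in> sobolev_space s" and u: "u \<in> sobolev_space s"
    and l: "(\<lambda>n. H_inner s (\<lambda>x. f n x - u x) (\<lambda>x. f n x - u x)) \<longlonglongrightarrow> 0" for n
    using assms by (auto simp: H.converges_in_def)
  have "(\<lambda>n. L2_inner lebesgue (\<lambda>x. f n x - u x) (\<lambda>x. f n x - u x)) \<longlonglongrightarrow> 0"
    by (rule real_tendsto_sandwich[OF _ _ tendsto_const l])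
      (use f u in \<open>auto intro!: always_eventually L2.nonneg L2_le_H L2.diff_mem H.diff_mem sobolev_L2\<close>)
  then show ?thesis using sobolev_L2[OF f] sobolev_L2[OF u] by (simp add: L2.converges_in_def)
qed

lemma H_converges_frac:
  assumes "H.converges_in f u"
  shows "frac.converges_in f u"
proof -
  have f: "f n \<in> sobolev_space s" and u: "u \<in> sobolev_space s"
    and l: "(\<lambda>n. H_inner s (\<lambda>x. f n x - u x) (\<lambda>x. f n x - u x)) \<longlonglongrightarrow> 0" for n
    using assms by (auto simp: H.converges_in_def)
  have "(\<lambda>n. frac_laplacian s (\<lambda>x. f n x - u x) (\<lambda>x. f n x - u x)) \<longlonglongrightarrow> 0"
    by (rule real_tendsto_sandwich[OF _ _ tendsto_const l])
      (use f u in \<open>auto intro!: always_eventually frac.nonneg frac_le_H frac.diff_mem\<close>)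
  then show ?thesis using f u by (simp add: frac.converges_in_def)
qed

text \<open>
  A Cauchy sequence converges in the mean to some \<open>u\<close>, and the transforms converge almost everywhere to
  that of \<open>u\<close> along a subsequence. The symbols then converge there too, and Fatou's lemma turns the Cauchy
  bounds into a bound for the distance of the symbols to that of \<open>u\<close>.
\<close>

lemma H_semi_hilbert: "semi_hilbert (sobolev_space s) (H_inner s :: ('a::euclidean_space \<Rightarrow> real) \<Rightarrow> _)"
proof
  fix f :: "nat \<Rightarrow> 'a \<Rightarrow> real"
  assume f: "H.Cauchy_in f"
  define D where "D = (2 * pi) ^ DIM('a)"
  have D: "D > 0" by (simp add: D_def)
  have fH: "f n \<in> sobolev_space s" for n using f by (simp add: H.Cauchy_in_def)
  have fL: "f n \<in> L2 lebesgue" for n using fH by (rule sobolev_L2)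
  have Cau: "\<exists>N. \<forall>m\<ge>N. \<forall>n\<ge>N. H_inner s (\<lambda>x. f m x - f n x) (\<lambda>x. f m x - f n x) < \<epsilon>" if "\<epsilon> > 0" for \<epsilon>
    using f that unfolding H.Cauchy_in_def by blast
  have "L2.Cauchy_in lebesgue f"
    unfolding L2.Cauchy_in_def
  proof (intro conjI allI impI fL)
    fix \<epsilon> :: real assume "\<epsilon> > 0"
    from Cau[OF this] show "\<exists>N. \<forall>m\<ge>N. \<forall>n\<ge>N. L2_inner lebesgue (\<lambda>x. f m x - f n x) (\<lambda>x. f m x - f n x) < \<epsilon>"
      using L2_le_H[OF H.diff_mem[OF fH fH]] by (meson order_le_less_trans)
  qed
  then obtain u where u: "L2.converges_in lebesgue f u" using L2.complete by blast
  have uL: "u \<in> L2 lebesgue" using u by (simp add: L2.converges_in_def)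
  obtain r where r: "strict_mono (r :: nat \<Rightarrow> nat)"
    and ae: "AE \<xi> in lebesgue. (\<lambda>k. fourier_transform (f (r k)) \<xi>) \<longlonglongrightarrow> fourier_transform u \<xi>"
    by (rule L2_tendsto_AE_subseq[OF fourier_transform_spec(1)[OF fL] fourier_transform_spec(1)[OF uL] fourier_transform_L2_continuous[OF u]])
  have key: "sqn lebesgue (\<lambda>\<xi>. frac_symbol s (f n) \<xi> - frac_symbol s u \<xi>) \<le> ennreal (D * \<epsilon>)"
    if N: "\<forall>m\<ge>N. \<forall>n\<ge>N. H_inner s (\<lambda>x. f m x - f n x) (\<lambda>x. f m x - f n x) < \<epsilon>" and n: "n \<ge> N" for N n \<epsilon>
  proof (rule sqn_Fatou[where f = "\<lambda>k \<xi>. frac_symbol s (f n) \<xi> - frac_symbol s (f (r k)) \<xi>"])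
    show "(\<lambda>\<xi>. frac_symbol s (f n) \<xi> - frac_symbol s (f (r k)) \<xi>) \<in> borel_measurable lebesgue" for k
      by (intro borel_measurable_diff frac_symbol_measurable fL)
    show "AE \<xi> in lebesgue. (\<lambda>k. frac_symbol s (f n) \<xi> - frac_symbol s (f (r k)) \<xi>) \<longlonglongrightarrow> frac_symbol s (f n) \<xi> - frac_symbol s u \<xi>"
      using ae by eventually_elim (unfold frac_symbol_def, intro tendsto_intros)
    have "sqn lebesgue (\<lambda>\<xi>. frac_symbol s (f n) \<xi> - frac_symbol s (f (r k)) \<xi>) \<le> ennreal (D * \<epsilon>)" if k: "k \<ge> N" for k
    proof -
      have "r k \<ge> N" using k seq_suble[OF r, of k] by linarith
      then have "frac_laplacian s (\<lambda>x. f n x - f (r k) x) (\<lambda>x. f n x - f (r k) x) \<le> \<epsilon>"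
        using N n frac_le_H[OF H.diff_mem[OF fH fH], of n "r k"] by (meson less_imp_le order_trans)
      then have "ennreal (D * frac_laplacian s (\<lambda>x. f n x - f (r k) x) (\<lambda>x. f n x - f (r k) x)) \<le> ennreal (D * \<epsilon>)"
        using D by (intro ennreal_leI mult_left_mono) auto
      then show ?thesis
        unfolding D_def frac_quad_eq_sqn[OF H.diff_mem[OF fH fH]] frac_symbol_diff[OF fL fL] .
    qed
    then show "\<forall>\<^sub>F k in sequentially. sqn lebesgue (\<lambda>\<xi>. frac_symbol s (f n) \<xi> - frac_symbol s (f (r k)) \<xi>) \<le> ennreal (D * \<epsilon>)"
      unfolding eventually_sequentially by blast
  qed
  have uH: "u \<in> sobolev_space s"
  proof -
    obtain N where N: "\<forall>m\<ge>N. \<forall>n\<ge>N. H_inner s (\<lambda>x. f m x - f n x) (\<lambda>x. f m x - f n x) < 1"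
      using Cau[of 1] by auto
    have "sqn lebesgue (\<lambda>\<xi>. frac_symbol s (f N) \<xi> - frac_symbol s u \<xi>) < \<infinity>"
      using order_le_less_trans[OF key[OF N order_refl]] by simp
    then have "sqn lebesgue (frac_symbol s u) < \<infinity>"
      by (rule sqn_finite_of_near[rotated 3])
        (use fH[of N] uL fL[of N] in \<open>simp_all add: frac_symbol_measurable sobolev_space_iff[OF s]\<close>)
    then show ?thesis using uL by (simp add: sobolev_space_iff[OF s])
  qed
  have "(\<lambda>n. frac_laplacian s (\<lambda>x. f n x - u x) (\<lambda>x. f n x - u x)) \<longlonglongrightarrow> 0"
  proof (rule LIMSEQ_I)
    fix e :: real assume e: "e > 0"
    then obtain N where N: "\<forall>m\<ge>N. \<forall>n\<ge>N. H_inner s (\<lambda>x. f m x - f n x) (\<lambda>x. f m x - f n x) < e / 2"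
      using Cau[of "e / 2"] by auto
    have "norm (frac_laplacian s (\<lambda>x. f n x - u x) (\<lambda>x. f n x - u x) - 0) < e" if "n \<ge> N" for n
    proof -
      have "ennreal (D * frac_laplacian s (\<lambda>x. f n x - u x) (\<lambda>x. f n x - u x)) \<le> ennreal (D * (e / 2))"
        using key[OF N that] unfolding D_def frac_quad_eq_sqn[OF H.diff_mem[OF fH uH]] frac_symbol_diff[OF fL uL] .
      then have "D * frac_laplacian s (\<lambda>x. f n x - u x) (\<lambda>x. f n x - u x) \<le> D * (e / 2)"
        using D e by (subst (asm) ennreal_le_iff) auto
      then have "frac_laplacian s (\<lambda>x. f n x - u x) (\<lambda>x. f n x - u x) \<le> e / 2" using D by simp
      then show ?thesis using frac.nonneg[OF H.diff_mem[OF fH uH], of n] e by simp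
    qed
    then show "\<exists>N. \<forall>n\<ge>N. norm (frac_laplacian s (\<lambda>x. f n x - u x) (\<lambda>x. f n x - u x) - 0) < e" by blast
  qed
  moreover have "(\<lambda>n. L2_inner lebesgue (\<lambda>x. f n x - u x) (\<lambda>x. f n x - u x)) \<longlonglongrightarrow> 0"
    using u by (simp add: L2.converges_in_def)
  ultimately have "(\<lambda>n. H_inner s (\<lambda>x. f n x - u x) (\<lambda>x. f n x - u x)) \<longlonglongrightarrow> 0 + 0"
    unfolding H_inner_def by (intro tendsto_add)
  then show "\<exists>u. H.converges_in f u" using fH uH by (auto simp: H.converges_in_def)
qed

interpretation H: semi_hilbert "sobolev_space s" "H_inner s :: ('a::euclidean_space \<Rightarrow> real) \<Rightarrow> _"
  by (rule H_semi_hilbert)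

lemma sobolev_norm_equivalent:
  fixes u :: "'a::euclidean_space \<Rightarrow> real"
  assumes u: "u \<in> sobolev_space s"
  shows "(2 * pi) ^ DIM('a) * H_inner s u u \<le> 2 * (sobolev_norm s u)\<^sup>2"
    and "(sobolev_norm s u)\<^sup>2 \<le> 2 * ((2 * pi) ^ DIM('a) * H_inner s u u)"
proof -
  define D where "D = (2 * pi) ^ DIM('a)"
  have D: "D > 0" by (simp add: D_def)
  have uL: "u \<in> L2 lebesgue" using u by (rule sobolev_L2)
  define L where "L = (LINT \<xi>|lebesgue. (1 + (norm \<xi>)\<^sup>2) powr s * (cmod (fourier_transform u \<xi>))\<^sup>2)"
  have L0: "0 \<le> L" unfolding L_def by (rule Bochner_Integration.integral_nonneg) simp
  have nrm: "(sobolev_norm s u)\<^sup>2 = L" using L0 by (simp add: sobolev_norm_def L_def)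
  have N: "(\<integral>\<^sup>+\<xi>. ennreal ((1 + (norm \<xi>)\<^sup>2) powr s * (cmod (fourier_transform u \<xi>))\<^sup>2) \<partial>lebesgue) = ennreal L"
    unfolding L_def using u by (intro nn_integral_eq_integral) (auto simp: sobolev_space_def)
  have ft: "sqn lebesgue (fourier_transform u) = ennreal (D * L2_inner lebesgue u u)"
    using Plancherel(1)[OF uL] by (simp add: D_def sqn_eq_L2_inner[OF uL] ennreal_mult L2.nonneg[OF uL])
  note b = bessel_sqn_bounds[OF s uL, unfolded N ft frac_quad_eq_sqn[OF u, folded D_def, symmetric]]
  have n1: "0 \<le> D * L2_inner lebesgue u u" "0 \<le> D * frac_laplacian s u u"
    using D L2.nonneg[OF uL] frac.nonneg[OF u] by auto
  have "D * frac_laplacian s u u \<le> L" "D * L2_inner lebesgue u u \<le> L"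
    using b(1,2) L0 by (simp_all add: ennreal_le_iff)
  then show "(2 * pi) ^ DIM('a) * H_inner s u u \<le> 2 * (sobolev_norm s u)\<^sup>2"
    unfolding nrm H_inner_def D_def[symmetric] by (simp add: algebra_simps)
  have "ennreal L \<le> ennreal (2 * (D * L2_inner lebesgue u u + D * frac_laplacian s u u))"
    using b(3) n1 by (simp add: ennreal_mult ennreal_plus)
  then have "L \<le> 2 * (D * L2_inner lebesgue u u + D * frac_laplacian s u u)"
    using n1 by (subst (asm) ennreal_le_iff) auto
  then show "(sobolev_norm s u)\<^sup>2 \<le> 2 * ((2 * pi) ^ DIM('a) * H_inner s u u)"
    unfolding nrm H_inner_def D_def[symmetric] by (simp add: algebra_simps)
qed

lemma test_function_sobolev: "\<phi> \<in> test_functions \<Omega> \<Longrightarrow> \<phi> \<in> sobolev_space s"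
  using test_function_frac_symbol[of \<phi> \<Omega> s] s by (simp add: sobolev_space_iff[OF s] test_function_L2)

lemma sobolev_tilde_eq:
  "sobolev_tilde s \<Omega> = {v \<in> sobolev_space s. \<forall>\<epsilon>>0. \<exists>\<phi>\<in>test_functions \<Omega>.
     H_inner s (\<lambda>x. v x - \<phi> x) (\<lambda>x. v x - \<phi> x) < \<epsilon>}" for \<Omega> :: "'a::euclidean_space set"
proof -
  define D where "D = (2 * pi) ^ DIM('a)"
  have D: "D > 0" by (simp add: D_def)
  have nn: "0 \<le> sobolev_norm s u" for u :: "'a \<Rightarrow> real"
    unfolding sobolev_norm_def by (intro real_sqrt_ge_zero Bochner_Integration.integral_nonneg) simp
  have "(\<forall>\<epsilon>>0. \<exists>\<phi>\<in>test_functions \<Omega>. sobolev_norm s (\<lambda>x. v x - \<phi> x) < \<epsilon>) \<longleftrightarrow>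
      (\<forall>\<epsilon>>0. \<exists>\<phi>\<in>test_functions \<Omega>. H_inner s (\<lambda>x. v x - \<phi> x) (\<lambda>x. v x - \<phi> x) < \<epsilon>)"
    if v: "v \<in> sobolev_space s" for v
  proof -
    have d: "(\<lambda>x. v x - \<phi> x) \<in> sobolev_space s" if "\<phi> \<in> test_functions \<Omega>" for \<phi>
      by (rule H.diff_mem[OF v test_function_sobolev[OF that]])
    note b = sobolev_norm_equivalent[OF d, folded D_def]
    show ?thesis
    proof (intro iffI allI impI)
      fix \<epsilon> :: real
      assume a: "\<forall>\<epsilon>>0. \<exists>\<phi>\<in>test_functions \<Omega>. sobolev_norm s (\<lambda>x. v x - \<phi> x) < \<epsilon>" and e: "\<epsilon> > 0"
      have "sqrt (D * \<epsilon> / 2) > 0" using D e by simp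
      then obtain \<phi> where \<phi>: "\<phi> \<in> test_functions \<Omega>" "sobolev_norm s (\<lambda>x. v x - \<phi> x) < sqrt (D * \<epsilon> / 2)" using a by blast
      have "(sobolev_norm s (\<lambda>x. v x - \<phi> x))\<^sup>2 < (sqrt (D * \<epsilon> / 2))\<^sup>2"
        using \<phi>(2) nn by (intro power_strict_mono) auto
      then have "2 * (sobolev_norm s (\<lambda>x. v x - \<phi> x))\<^sup>2 < D * \<epsilon>" using D e by simp
      then have "D * H_inner s (\<lambda>x. v x - \<phi> x) (\<lambda>x. v x - \<phi> x) < D * \<epsilon>" using b(1)[OF \<phi>(1)] by linarith
      then show "\<exists>\<phi>\<in>test_functions \<Omega>. H_inner s (\<lambda>x. v x - \<phi> x) (\<lambda>x. v x - \<phi> x) < \<epsilon>" using D \<phi>(1) by auto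
    next
      fix \<epsilon> :: real
      assume a: "\<forall>\<epsilon>>0. \<exists>\<phi>\<in>test_functions \<Omega>. H_inner s (\<lambda>x. v x - \<phi> x) (\<lambda>x. v x - \<phi> x) < \<epsilon>" and e: "\<epsilon> > 0"
      have "\<epsilon>\<^sup>2 / (2 * D) > 0" using D e by simp
      then obtain \<phi> where \<phi>: "\<phi> \<in> test_functions \<Omega>" "H_inner s (\<lambda>x. v x - \<phi> x) (\<lambda>x. v x - \<phi> x) < \<epsilon>\<^sup>2 / (2 * D)" using a by blast
      have "2 * (D * H_inner s (\<lambda>x. v x - \<phi> x) (\<lambda>x. v x - \<phi> x)) < \<epsilon>\<^sup>2"
        using \<phi>(2) D by (simp add: field_simps)
      then have "(sobolev_norm s (\<lambda>x. v x - \<phi> x))\<^sup>2 < \<epsilon>\<^sup>2" using b(2)[OF \<phi>(1)] by linarith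
      then have "sobolev_norm s (\<lambda>x. v x - \<phi> x) < \<epsilon>" by (rule power2_less_imp_less) (use e in simp)
      then show "\<exists>\<phi>\<in>test_functions \<Omega>. sobolev_norm s (\<lambda>x. v x - \<phi> x) < \<epsilon>" using \<phi>(1) by blast
    qed
  qed
  then show ?thesis unfolding sobolev_tilde_def by blast
qed

lemma sobolev_tilde_hilbert: "semi_hilbert (sobolev_tilde s \<Omega>) (H_inner s)" for \<Omega> :: "'a::euclidean_space set"
  unfolding sobolev_tilde_eq
  by (rule H.semi_hilbert_closure) (auto intro: test_function_sobolev zero_test_function test_function_lincomb)

lemma sobolev_tilde_approx:
  assumes v: "v \<in> sobolev_tilde s (\<Omega> :: 'a::euclidean_space set)"
  shows "\<exists>\<phi>. (\<forall>n. \<phi> n \<in> test_functions \<Omega>) \<and> L2.converges_in lebesgue \<phi> v \<and>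
    (\<forall>w\<in>sobolev_space s. (\<lambda>n. frac_laplacian s (\<phi> n) w) \<longlonglongrightarrow> frac_laplacian s v w)"
proof -
  have "\<exists>\<phi>\<in>test_functions \<Omega>. H_inner s (\<lambda>x. v x - \<phi> x) (\<lambda>x. v x - \<phi> x) < 1 / real (Suc n)" for n
    using v unfolding sobolev_tilde_eq by simp
  then obtain \<phi> where \<phi>: "\<And>n. \<phi> n \<in> test_functions \<Omega>"
    "\<And>n. H_inner s (\<lambda>x. v x - \<phi> n x) (\<lambda>x. v x - \<phi> n x) < 1 / real (Suc n)" by metis
  have vH: "v \<in> sobolev_space s" using v by (simp add: sobolev_tilde_def)
  have pH: "\<phi> n \<in> sobolev_space s" for n using \<phi>(1) by (rule test_function_sobolev)
  have eq: "H_inner s (\<lambda>x. \<phi> n x - v x) (\<lambda>x. \<phi> n x - v x) = H_inner s (\<lambda>x. v x - \<phi> n x) (\<lambda>x. v x - \<phi> n x)" for n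
    using H.quad_diff[OF vH pH, of n] H.quad_diff[OF pH vH, of n] H.sym[OF vH pH, of n] by linarith
  have "(\<lambda>n. 1 / real (Suc n)) \<longlonglongrightarrow> 0" using LIMSEQ_inverse_real_of_nat by (simp add: inverse_eq_divide)
  then have "(\<lambda>n. H_inner s (\<lambda>x. \<phi> n x - v x) (\<lambda>x. \<phi> n x - v x)) \<longlonglongrightarrow> 0"
    by (rule real_tendsto_sandwich[rotated 2, OF tendsto_const])
      (use \<phi>(2) H.nonneg[OF H.diff_mem[OF pH vH]] in \<open>auto simp: eq less_imp_le intro!: always_eventually\<close>)
  then have c: "H.converges_in \<phi> v" using pH vH by (simp add: H.converges_in_def)
  have cf: "frac.converges_in \<phi> v" by (rule H_converges_frac[OF c])
  show ?thesis
  proof (intro exI[of _ \<phi>] conjI allI ballI \<phi>(1) H_converges_L2[OF c])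
    fix w :: "'a \<Rightarrow> real" assume "w \<in> sobolev_space s"
    then show "(\<lambda>n. frac_laplacian s (\<phi> n) w) \<longlonglongrightarrow> frac_laplacian s v w"
      using cf pH vH by (intro frac.tendsto_left) (auto simp: frac.converges_in_def)
  qed
qed

text \<open>
  Mean convergence of test functions implies convergence almost everywhere along a subsequence.
\<close>

lemma sobolev_tilde_outside:
  assumes v: "v \<in> sobolev_tilde s (\<Omega> :: 'a::euclidean_space set)"
  shows "AE x in lebesgue. x \<notin> \<Omega> \<longrightarrow> v x = 0"
proof -
  obtain \<phi> where \<phi>: "\<And>n. \<phi> n \<in> test_functions \<Omega>" "L2.converges_in lebesgue \<phi> v"
    using sobolev_tilde_approx[OF v] by metis
  have vL: "v \<in> L2 lebesgue" using \<phi>(2) by (simp add: L2.converges_in_def)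
  have l: "(\<lambda>n. sqn lebesgue (\<lambda>x. \<phi> n x - v x)) \<longlonglongrightarrow> 0"
    using \<phi>(2) L2_converges_iff_sqn[OF test_function_L2[OF \<phi>(1)] vL] by simp
  obtain r where "strict_mono (r :: nat \<Rightarrow> nat)" "AE x in lebesgue. (\<lambda>k. \<phi> (r k) x) \<longlonglongrightarrow> v x"
    by (rule L2_tendsto_AE_subseq[OF test_function_measurable[OF \<phi>(1)] L2_measurable[OF vL] l])
  then show ?thesis
  proof (elim eventually_mono, intro impI)
    fix x assume "(\<lambda>k. \<phi> (r k) x) \<longlonglongrightarrow> v x" "x \<notin> \<Omega>"
    then show "v x = 0" using test_function_outside[OF \<phi>(1)] by (simp add: LIMSEQ_const_iff)
  qed
qed

text \<open>
  Both sides are continuous along the approximation of \<open>w\<close> by test functions.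
\<close>

lemma frac_laplacian_weak_extend:
  fixes \<Omega> :: "'a::euclidean_space set"
  assumes \<Omega>: "\<Omega> \<in> sets lebesgue" and v: "v \<in> sobolev_space s" and G: "G \<in> L2 (lebesgue_on \<Omega>)"
    and eq: "\<And>\<phi>. \<phi> \<in> test_functions \<Omega> \<Longrightarrow> frac_laplacian s v \<phi> = L2_inner (lebesgue_on \<Omega>) G \<phi>"
    and w: "w \<in> sobolev_tilde s \<Omega>"
  shows "frac_laplacian s v w = L2_inner (lebesgue_on \<Omega>) G w"
proof -
  obtain \<phi> where \<phi>: "\<And>n. \<phi> n \<in> test_functions \<Omega>" "L2.converges_in lebesgue \<phi> w"
    "\<And>u. u \<in> sobolev_space s \<Longrightarrow> (\<lambda>n. frac_laplacian s (\<phi> n) u) \<longlonglongrightarrow> frac_laplacian s w u"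
    using sobolev_tilde_approx[OF w] by metis
  have wH: "w \<in> sobolev_space s" using w by (simp add: sobolev_tilde_def)
  have G': "(\<lambda>x. indicator \<Omega> x * G x) \<in> L2 lebesgue" using G \<Omega> by (simp add: L2_on_iff)
  have c: "L2_inner (lebesgue_on \<Omega>) G u = L2_inner lebesgue u (\<lambda>x. indicator \<Omega> x * G x)" for u
    unfolding L2_inner_on(1)[OF \<Omega>] by (simp add: L2_inner_def mult.commute)
  have "(\<lambda>n. L2_inner lebesgue (\<phi> n) (\<lambda>x. indicator \<Omega> x * G x)) \<longlonglongrightarrow> L2_inner lebesgue w (\<lambda>x. indicator \<Omega> x * G x)"
    using \<phi>(2) G' by (intro L2.tendsto_left) (auto simp: L2.converges_in_def)
  then have "(\<lambda>n. L2_inner (lebesgue_on \<Omega>) G (\<phi> n)) \<longlonglongrightarrow> L2_inner (lebesgue_on \<Omega>) G w" by (simp only: c)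
  moreover have "(\<lambda>n. frac_laplacian s (\<phi> n) v) \<longlonglongrightarrow> frac_laplacian s w v" by (rule \<phi>(3)[OF v])
  then have "(\<lambda>n. frac_laplacian s v (\<phi> n)) \<longlonglongrightarrow> frac_laplacian s v w"
    using frac.sym[OF v test_function_sobolev[OF \<phi>(1)]] frac.sym[OF v wH] by simp
  ultimately show ?thesis using eq[OF \<phi>(1)] LIMSEQ_unique by simp
qed

end


section \<open>Compactness\<close>

lemma cis_Lipschitz: "cmod (cis a - cis b) \<le> \<bar>a - b\<bar>"
proof -
  have "cis a - cis b = cis b * (cis (a - b) - 1)"
    by (simp add: algebra_simps cis_mult)
  then have "cmod (cis a - cis b) = cmod (iexp (a - b) - 1)"
    by (simp add: norm_mult cis_conv_exp)
  also have "\<dots> \<le> \<bar>a - b\<bar>" using iexp_approx1[of "a - b" 0] by simp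
  finally show ?thesis .
qed

lemma fourier_integral_Lipschitz:
  fixes u :: "'a::euclidean_space \<Rightarrow> real"
  assumes u: "integrable lebesgue u" and supp: "\<And>x. x \<notin> ball 0 R \<Longrightarrow> u x = 0"
  shows "cmod (fourier_integral u \<xi> - fourier_integral u \<eta>) \<le> R * norm (\<xi> - \<eta>) * (LINT x|lebesgue. \<bar>u x\<bar>)"
proof -
  have i: "integrable lebesgue (\<lambda>x. of_real (u x) * cis (- (x \<bullet> \<xi>)))" for \<xi>
    by (rule integrable_fourier_integrand[OF u])
  have "fourier_integral u \<xi> - fourier_integral u \<eta>
      = (LINT x|lebesgue. of_real (u x) * cis (- (x \<bullet> \<xi>)) - of_real (u x) * cis (- (x \<bullet> \<eta>)))"
    unfolding fourier_integral_def using i by simp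
  also have "cmod \<dots> \<le> (LINT x|lebesgue. R * norm (\<xi> - \<eta>) * \<bar>u x\<bar>)"
  proof (rule Bochner_Integration.integral_norm_bound_integral)
    show "integrable lebesgue (\<lambda>x. of_real (u x) * cis (- (x \<bullet> \<xi>)) - of_real (u x) * cis (- (x \<bullet> \<eta>)))"
      using i by simp
    show "integrable lebesgue (\<lambda>x. R * norm (\<xi> - \<eta>) * \<bar>u x\<bar>)" using u by simp
    fix x :: 'a
    have eq: "of_real (u x) * cis (- (x \<bullet> \<xi>)) - of_real (u x) * cis (- (x \<bullet> \<eta>)) = of_real (u x) * (cis (- (x \<bullet> \<xi>)) - cis (- (x \<bullet> \<eta>)))"
      by (simp add: algebra_simps)
    show "cmod (of_real (u x) * cis (- (x \<bullet> \<xi>)) - of_real (u x) * cis (- (x \<bullet> \<eta>))) \<le> R * norm (\<xi> - \<eta>) * \<bar>u x\<bar>"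
    proof (cases "x \<in> ball 0 R")
      case True
      have "cmod (cis (- (x \<bullet> \<xi>)) - cis (- (x \<bullet> \<eta>))) \<le> \<bar>x \<bullet> (\<xi> - \<eta>)\<bar>"
        using cis_Lipschitz[of "- (x \<bullet> \<xi>)" "- (x \<bullet> \<eta>)"] by (simp add: inner_diff_right abs_minus_commute)
      also have "\<dots> \<le> norm x * norm (\<xi> - \<eta>)" by (rule Cauchy_Schwarz_ineq2)
      also have "\<dots> \<le> R * norm (\<xi> - \<eta>)" using True by (intro mult_right_mono) auto
      finally have "\<bar>u x\<bar> * cmod (cis (- (x \<bullet> \<xi>)) - cis (- (x \<bullet> \<eta>))) \<le> \<bar>u x\<bar> * (R * norm (\<xi> - \<eta>))"
        by (rule mult_left_mono) simp
      then show ?thesis unfolding eq by (simp add: norm_mult mult.commute)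
    qed (use supp[of x] in simp)
  qed
  finally show ?thesis by simp
qed

context frac_order
begin

interpretation frac: semi_inner "sobolev_space s" "frac_laplacian s :: ('a::euclidean_space \<Rightarrow> real) \<Rightarrow> _"
  by (rule sobolev_semi_inner[OF s])

text \<open>
  Functions supported in a ball and bounded in the mean have transforms that are uniformly bounded and
  uniformly Lipschitz, so that a diagonal subsequence converges at every frequency. On a ball of
  frequencies dominated convergence makes this mean convergence; outside the ball of radius \<open>T\<close> the energy bound
  leaves at most a multiple of \<open>T\<^bsup>-2s\<^esup>\<close>. Plancherel carries the Cauchy property back to the functions.
\<close>

lemma Rellich:
  fixes v :: "nat \<Rightarrow> 'a::euclidean_space \<Rightarrow> real"
  assumes v: "\<And>n. v n \<in> sobolev_tilde s (ball 0 R)" and bd: "\<And>n. H_inner s (v n) (v n) \<le> M" and R: "0 < R"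
  shows "\<exists>r g. strict_mono (r :: nat \<Rightarrow> nat) \<and> L2.converges_in lebesgue (\<lambda>n. v (r n)) g"
proof -
  define D where "D = (2 * pi) ^ DIM('a)"
  have D: "D > 0" by (simp add: D_def)
  have vH: "v n \<in> sobolev_space s" for n using v by (simp add: sobolev_tilde_def)
  have vL: "v n \<in> L2 lebesgue" for n by (rule sobolev_L2[OF vH])
  have vm: "v n \<in> borel_measurable lebesgue" for n by (rule L2_measurable[OF vL])
  \<comment> \<open>Members of \<open>sobolev_tilde\<close> vanish outside the ball only almost everywhere; \<open>w n\<close> vanishes everywhere there.\<close>
  define w where "w n = truncate R (v n)" for n
  have wL: "w n \<in> L2 lebesgue" for n unfolding w_def by (rule truncate_L2[OF vL])
  have ws: "w n x = 0" if "x \<notin> ball 0 R" for n x unfolding w_def using that by (rule truncate_support)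
  have wm: "w n \<in> borel_measurable lebesgue" for n by (rule L2_measurable[OF wL])
  have wv: "AE x in lebesgue. w n x = v n x" for n
    using sobolev_tilde_outside[OF v, of n] by eventually_elim (auto simp: w_def truncate_def indicator_def)
  have wi: "integrable lebesgue (w n)" for n by (rule bounded_support_integrable(1)[OF wL ws])
  define F where "F n = fourier_integral (w n)" for n
  have Fm: "F n \<in> borel_measurable lebesgue" for n
    unfolding F_def by (rule borel_measurable_lebesgueI[OF fourier_integral_measurable[OF wm]])
  have Fv: "AE \<xi> in lebesgue. fourier_transform (v n) \<xi> = F n \<xi>" for n
  proof -
    have "AE \<xi> in lebesgue. fourier_transform (w n) \<xi> = F n \<xi>"
      unfolding F_def by (rule fourier_transform_bounded_support[OF wL ws])
    then show ?thesis unfolding fourier_transform_cong_AE[OF wv wm vm] .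
  qed
  have M0: "0 \<le> M" using bd[of 0] L2_le_H[OF vH, of 0] L2.nonneg[OF vL, of 0] by linarith
  define A where "A = sqrt (measure lebesgue (ball (0::'a) R) * M)"
  have w1: "(LINT x|lebesgue. \<bar>w n x\<bar>) \<le> A" for n
  proof -
    have "L2_inner lebesgue (w n) (w n) = L2_inner lebesgue (v n) (v n)"
      by (rule L2_inner_cong_AE[OF wv wv wm vm wm vm])
    also have "\<dots> \<le> M" using L2_le_H[OF vH, of n] bd[of n] by linarith
    finally have le: "L2_inner lebesgue (w n) (w n) \<le> M" .
    have "(LINT x|lebesgue. \<bar>w n x\<bar>)\<^sup>2 \<le> measure lebesgue (ball (0::'a) R) * L2_inner lebesgue (w n) (w n)"
      by (rule bounded_support_integrable(2)[OF wL ws])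
    also have "\<dots> \<le> measure lebesgue (ball (0::'a) R) * M" using le by (rule mult_left_mono) simp
    finally show ?thesis unfolding A_def by (rule real_le_rsqrt)
  qed
  have A0: "0 \<le> A" using M0 by (simp add: A_def)
  have Fb: "cmod (F n \<xi>) \<le> A" for n \<xi>
    unfolding F_def using norm_fourier_integral_le[OF wi] w1 by (rule order_trans)
  have FL: "cmod (F n \<xi> - F n \<eta>) \<le> R * A * norm (\<xi> - \<eta>)" for n \<xi> \<eta>
  proof -
    have "cmod (F n \<xi> - F n \<eta>) \<le> R * norm (\<xi> - \<eta>) * (LINT x|lebesgue. \<bar>w n x\<bar>)"
      unfolding F_def by (rule fourier_integral_Lipschitz[OF wi ws])
    also have "\<dots> \<le> R * norm (\<xi> - \<eta>) * A" using R by (intro mult_left_mono w1) auto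
    finally show ?thesis by (simp add: mult_ac)
  qed
  obtain Q :: "'a set" where Q: "countable Q" "\<And>X. open X \<Longrightarrow> X \<noteq> {} \<Longrightarrow> \<exists>d\<in>Q. d \<in> X"
    using countable_dense_exists by blast
  obtain r where r: "strict_mono (r :: nat \<Rightarrow> nat)" and rl: "\<And>d. d \<in> Q \<Longrightarrow> \<exists>l. (\<lambda>n. F (r n) d) \<longlonglongrightarrow> l"
    using function_convergent_subsequence[OF Q(1), of F A] Fb by blast
  have conv: "convergent (\<lambda>n. F (r n) \<xi>)" for \<xi>
  proof (rule Cauchy_convergent, rule metric_CauchyI)
    fix e :: real assume e: "e > 0"
    define \<delta> where "\<delta> = (e / 3) / (R * A + 1)"
    have pos: "0 < R * A + 1" using R A0 by (simp add: add_nonneg_pos)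
    have "\<delta> > 0" using e pos by (simp add: \<delta>_def)
    then obtain d where d: "d \<in> Q" "norm (\<xi> - d) < \<delta>"
      using Q(2)[of "ball \<xi> \<delta>"] by (auto simp: dist_norm)
    have "R * A * norm (\<xi> - d) \<le> (R * A + 1) * \<delta>" using d R A0 by (intro mult_mono) auto
    also have "\<dots> = e / 3"
    proof -
      have "k * ((e / 3) / k) = e / 3" if "k > 0" for k :: real using that by simp
      then show ?thesis unfolding \<delta>_def using pos by blast
    qed
    finally have small: "dist (F n \<xi>) (F n d) \<le> e / 3" for n
      using FL[of n \<xi> d] by (simp add: dist_norm)
    have "Cauchy (\<lambda>n. F (r n) d)" using rl[OF d(1)] LIMSEQ_imp_Cauchy by blast
    then obtain N where N: "\<forall>m\<ge>N. \<forall>n\<ge>N. dist (F (r m) d) (F (r n) d) < e / 3"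
      unfolding Cauchy_def using e by (metis divide_pos_pos zero_less_numeral)
    have "dist (F (r m) \<xi>) (F (r n) \<xi>) < e" if "m \<ge> N" "n \<ge> N" for m n
    proof -
      have "dist (F (r m) \<xi>) (F (r n) \<xi>) \<le> dist (F (r m) \<xi>) (F (r m) d) + dist (F (r m) d) (F (r n) d) + dist (F (r n) \<xi>) (F (r n) d)"
        using dist_triangle[of "F (r m) \<xi>" "F (r n) \<xi>" "F (r m) d"] dist_triangle[of "F (r m) d" "F (r n) \<xi>" "F (r n) d"]
          dist_commute[of "F (r n) d" "F (r n) \<xi>"] by linarith
      moreover have "dist (F (r m) d) (F (r n) d) < e / 3" using N that by blast
      ultimately show ?thesis using small[of "r m"] small[of "r n"] by linarith
    qed
    then show "\<exists>N. \<forall>m\<ge>N. \<forall>n\<ge>N. dist (F (r m) \<xi>) (F (r n) \<xi>) < e" by blast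
  qed
  define G where "G \<xi> = lim (\<lambda>n. F (r n) \<xi>)" for \<xi>
  have GL: "(\<lambda>n. F (r n) \<xi>) \<longlonglongrightarrow> G \<xi>" for \<xi> using conv by (simp add: G_def convergent_LIMSEQ_iff)
  have Gm: "G \<in> borel_measurable lebesgue" unfolding G_def by (rule borel_measurable_lim_metric[OF Fm])
  have tail: "sqn lebesgue (\<lambda>\<xi>. indicator (- ball 0 T) \<xi> *\<^sub>R (F m \<xi> - F n \<xi>)) \<le> ennreal (4 * D * M / (T powr s)\<^sup>2)" if T: "T > 0" for T m n
  proof -
    define z where "z x = v m x - v n x" for x
    have zH: "z \<in> sobolev_space s" unfolding z_def[abs_def] by (rule frac.diff_mem[OF vH vH])
    have zL: "z \<in> L2 lebesgue" by (rule sobolev_L2[OF zH])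
    have Tp: "T powr s > 0" using T by simp
    have "frac_laplacian s z z \<le> 4 * M"
      using frac.diff_sq[OF vH[of m] vH[of n]] frac_le_H[OF vH, of m] frac_le_H[OF vH, of n] bd[of m] bd[of n]
      unfolding z_def[abs_def] by linarith
    then have "ennreal (D * frac_laplacian s z z) \<le> ennreal (4 * D * M)"
      using D by (intro ennreal_leI) simp
    then have zs: "sqn lebesgue (frac_symbol s z) \<le> ennreal (4 * D * M)" using frac_quad_eq_sqn[OF zH] by (simp add: D_def)
    have "sqn lebesgue (\<lambda>\<xi>. indicator (- ball 0 T) \<xi> *\<^sub>R (F m \<xi> - F n \<xi>)) \<le> sqn lebesgue (\<lambda>\<xi>. (1 / T powr s) *\<^sub>R frac_symbol s z \<xi>)"
    proof (rule sqn_mono_AE)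
      show "AE \<xi> in lebesgue. norm (indicator (- ball 0 T) \<xi> *\<^sub>R (F m \<xi> - F n \<xi>)) \<le> norm ((1 / T powr s) *\<^sub>R frac_symbol s z \<xi>)"
        using Fv[of m] Fv[of n] fourier_transform_diff[OF vL vL, of m n]
      proof eventually_elim
        case (elim \<xi>)
        then have eq: "F m \<xi> - F n \<xi> = fourier_transform z \<xi>" by (simp add: z_def[abs_def])
        show ?case
        proof (cases "\<xi> \<in> ball 0 T")
          case False
          then have "T powr s \<le> norm \<xi> powr s" using T s by (intro powr_mono2) auto
          then have "1 \<le> (1 / T powr s) * norm \<xi> powr s" using Tp by (simp add: field_simps)
          then have "1 * norm (fourier_transform z \<xi>) \<le> (1 / T powr s) * norm \<xi> powr s * norm (fourier_transform z \<xi>)"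
            by (rule mult_right_mono) simp
          then show ?thesis using False by (simp add: eq frac_symbol_def)
        qed simp
      qed
    qed
    also have "\<dots> = ennreal ((1 / T powr s)\<^sup>2) * sqn lebesgue (frac_symbol s z)"
      by (rule sqn_scale[OF frac_symbol_measurable[OF zL]])
    also have "\<dots> \<le> ennreal ((1 / T powr s)\<^sup>2) * ennreal (4 * D * M)" by (intro mult_left_mono zs) simp
    also have "\<dots> = ennreal (4 * D * M / (T powr s)\<^sup>2)"
      using D M0 by (simp add: power_divide flip: ennreal_mult)
    finally show ?thesis .
  qed
  have head: "(\<lambda>n. sqn lebesgue (\<lambda>\<xi>. indicator (ball 0 T) \<xi> *\<^sub>R F (r n) \<xi> - indicator (ball 0 T) \<xi> *\<^sub>R G \<xi>)) \<longlonglongrightarrow> 0" for T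
  proof (rule sqn_dominated[where w = "\<lambda>\<xi>. A * indicator (ball 0 T) \<xi>"])
    have im: "(\<lambda>\<xi>::'a. indicator (ball 0 T) \<xi> :: real) \<in> borel_measurable lebesgue"
      by (intro borel_measurable_lebesgueI borel_measurable_indicator) simp
    show "(\<lambda>\<xi>. indicator (ball 0 T) \<xi> *\<^sub>R F (r k) \<xi>) \<in> borel_measurable lebesgue" for k
      by (intro borel_measurable_scaleR im Fm)
    show "(\<lambda>\<xi>. indicator (ball 0 T) \<xi> *\<^sub>R G \<xi>) \<in> borel_measurable lebesgue"
      by (intro borel_measurable_scaleR im Gm)
    show wm: "(\<lambda>\<xi>::'a. A * indicator (ball 0 T) \<xi>) \<in> borel_measurable lebesgue"
      by (intro borel_measurable_times borel_measurable_const im)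
    show "AE \<xi> in lebesgue. (\<lambda>k. indicator (ball 0 T) \<xi> *\<^sub>R F (r k) \<xi>) \<longlonglongrightarrow> indicator (ball 0 T) \<xi> *\<^sub>R G \<xi>"
      by (intro AE_I2 tendsto_scaleR tendsto_const GL)
    show "AE \<xi> in lebesgue. norm (indicator (ball 0 T) \<xi> *\<^sub>R F (r k) \<xi>) \<le> norm (A * indicator (ball 0 T) \<xi>)" for k
      by (rule AE_I2) (use Fb A0 in \<open>auto simp: indicator_def\<close>)
    have "(\<lambda>\<xi>::'a. A * indicator (ball 0 T) \<xi>) \<in> L2 lebesgue"
      by (rule bounded_L2(1)[OF wm, of T A]) (use A0 in \<open>auto simp: indicator_def\<close>)
    then show "sqn lebesgue (\<lambda>\<xi>::'a. A * indicator (ball 0 T) \<xi>) < \<infinity>" by (simp add: L2_iff)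
  qed
  have "L2.Cauchy_in lebesgue (\<lambda>n. v (r n))"
    unfolding L2.Cauchy_in_def
  proof (intro conjI allI impI vL)
    fix \<epsilon> :: real assume e: "\<epsilon> > 0"
    define a where "a = D * \<epsilon> / 4"
    have a: "a > 0" using D e by (simp add: a_def)
    obtain T where T: "T > 0" "4 * D * M / (T powr s)\<^sup>2 < a"
    proof -
      define T where "T = ((4 * D * M) / a + 1) powr (1 / (2 * s))"
      have b: "0 < (4 * D * M) / a + 1" using D M0 a by (simp add: add_nonneg_pos)
      have "(T powr s)\<^sup>2 = (4 * D * M) / a + 1"
        using s b by (simp add: T_def powr_powr power2_eq_square powr_add[symmetric])
      moreover have "(4 * D * M) / ((4 * D * M) / a + 1) < a"
        using a b D M0 by (simp add: field_simps add_nonneg_pos)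
      ultimately show ?thesis using that[of T] b by (simp add: T_def)
    qed
    have im: "(\<lambda>\<xi>::'a. indicator (ball 0 T) \<xi> :: real) \<in> borel_measurable lebesgue"
      "(\<lambda>\<xi>::'a. indicator (- ball 0 T) \<xi> :: real) \<in> borel_measurable lebesgue"
      by (intro borel_measurable_lebesgueI borel_measurable_indicator; simp)+
    obtain N where N: "\<forall>m\<ge>N. \<forall>n\<ge>N. sqn lebesgue (\<lambda>\<xi>. indicator (ball 0 T) \<xi> *\<^sub>R F (r m) \<xi> - indicator (ball 0 T) \<xi> *\<^sub>R F (r n) \<xi>) < ennreal a"
      using L2_tendsto_Cauchy[OF _ _ head a] borel_measurable_scaleR[OF im(1) Fm] borel_measurable_scaleR[OF im(1) Gm] by blast
    have "L2_inner lebesgue (\<lambda>x. v (r m) x - v (r n) x) (\<lambda>x. v (r m) x - v (r n) x) < \<epsilon>" if mn: "m \<ge> N" "n \<ge> N" for m n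
    proof -
      define z where "z = (\<lambda>x. v (r m) x - v (r n) x)"
      have zL: "z \<in> L2 lebesgue" unfolding z_def by (rule L2.diff_mem[OF vL vL])
      have "ennreal D * sqn lebesgue z = sqn lebesgue (fourier_transform z)" using Plancherel(1)[OF zL] by (simp add: D_def)
      also have "\<dots> = sqn lebesgue (\<lambda>\<xi>. indicator (ball 0 T) \<xi> *\<^sub>R (F (r m) \<xi> - F (r n) \<xi>) + indicator (- ball 0 T) \<xi> *\<^sub>R (F (r m) \<xi> - F (r n) \<xi>))"
      proof (rule sqn_cong_AE)
        show "AE \<xi> in lebesgue. norm (fourier_transform z \<xi>) = norm (indicator (ball 0 T) \<xi> *\<^sub>R (F (r m) \<xi> - F (r n) \<xi>) + indicator (- ball 0 T) \<xi> *\<^sub>R (F (r m) \<xi> - F (r n) \<xi>))"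
          using Fv[of "r m"] Fv[of "r n"] fourier_transform_diff[OF vL vL, of "r m" "r n"]
          by eventually_elim (simp add: z_def indicator_def)
      qed
      also have "\<dots> \<le> 2 * sqn lebesgue (\<lambda>\<xi>. indicator (ball 0 T) \<xi> *\<^sub>R (F (r m) \<xi> - F (r n) \<xi>)) + 2 * sqn lebesgue (\<lambda>\<xi>. indicator (- ball 0 T) \<xi> *\<^sub>R (F (r m) \<xi> - F (r n) \<xi>))"
        by (intro sqn_add_le borel_measurable_scaleR borel_measurable_diff Fm im)
      also have "\<dots> < 2 * ennreal a + 2 * ennreal a"
      proof (intro add_strict_mono ennreal_mult_strict_left_mono)
        show "sqn lebesgue (\<lambda>\<xi>. indicator (ball 0 T) \<xi> *\<^sub>R (F (r m) \<xi> - F (r n) \<xi>)) < ennreal a"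
          using N mn by (simp add: scaleR_diff_right)
        show "sqn lebesgue (\<lambda>\<xi>. indicator (- ball 0 T) \<xi> *\<^sub>R (F (r m) \<xi> - F (r n) \<xi>)) < ennreal a"
          using tail[OF T(1)] by (rule order_le_less_trans) (use T(2) a in \<open>simp add: ennreal_lessI\<close>)
      qed auto
      also have "\<dots> = ennreal (D * \<epsilon>)"
        using a by (simp add: a_def mult_2[symmetric] ennreal_mult'[symmetric] flip: ennreal_numeral)
      finally have "ennreal (D * L2_inner lebesgue z z) < ennreal (D * \<epsilon>)"
        using D by (simp add: sqn_eq_L2_inner[OF zL] ennreal_mult L2.nonneg[OF zL])
      then have "D * L2_inner lebesgue z z < D * \<epsilon>"
        using D L2.nonneg[OF zL] by (subst (asm) ennreal_less_iff) auto
      then show ?thesis using D by (simp add: z_def)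
    qed
    then show "\<exists>N. \<forall>m\<ge>N. \<forall>n\<ge>N. L2_inner lebesgue (\<lambda>x. v (r m) x - v (r n) x) (\<lambda>x. v (r m) x - v (r n) x) < \<epsilon>" by blast
  qed
  then show ?thesis using L2.complete r by blast
qed

end


section \<open>Weak solutions\<close>

lemma Linf_I:
  assumes "f \<in> borel_measurable M" "AE x in M. \<bar>f x\<bar> \<le> c"
  shows "f \<in> Linf M"
proof -
  have "esssup M (\<lambda>x. ereal \<bar>f x\<bar>) \<le> ereal c" using assms by (intro esssup_I) auto
  then show ?thesis using assms(1) by (auto simp: Linf_def)
qed

lemma Linf_mult_L2_inner_le:
  assumes q: "q \<in> Linf M" "0 \<le> Linf_norm M q" and u: "u \<in> L2 M" and v: "v \<in> L2 M"
  shows "\<bar>L2_inner M (\<lambda>x. q x * u x) v\<bar> \<le> Linf_norm M q * L2_norm M u * L2_norm M v"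
proof -
  have "\<bar>L2_inner M (\<lambda>x. q x * u x) v\<bar> \<le> sqrt (L2_inner M (\<lambda>x. q x * u x) (\<lambda>x. q x * u x)) * L2_norm M v"
    unfolding L2_norm_def by (rule L2.Cauchy_Schwarz_sqrt[OF Linf_mult_L2(1)[OF q(1) u] v])
  also have "\<dots> \<le> sqrt ((Linf_norm M q)\<^sup>2 * L2_inner M u u) * L2_norm M v"
    unfolding L2_norm_def by (intro mult_right_mono real_sqrt_le_mono Linf_mult_L2(2)[OF q(1) u]) (simp add: L2.nonneg[OF v])
  finally show ?thesis using q(2) by (simp add: real_sqrt_mult L2_norm_def)
qed

lemma L2_norm_nonneg: "u \<in> L2 M \<Longrightarrow> 0 \<le> L2_norm M u"
  by (simp add: L2_norm_def L2.nonneg)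

lemma ball_lebesgue [simp]: "ball a r \<in> sets (lebesgue :: 'a::euclidean_space measure)"
  by simp

lemma AE_lebesgue_on:
  "S \<in> sets lebesgue \<Longrightarrow> AE x in lebesgue. P x \<Longrightarrow> AE x in lebesgue_on S. P x"
  by (subst AE_restrict_space_iff) (auto elim: eventually_mono)

lemma B1_not_null: "\<not> (AE x in lebesgue_on (B1 :: 'a::euclidean_space set). False)"
proof
  assume "AE x in lebesgue_on (B1 :: 'a set). False"
  then have "AE x in lebesgue. x \<notin> (B1 :: 'a set)" by (subst (asm) AE_restrict_space_iff) auto
  then have "negligible (B1 :: 'a set)" by (simp add: AE_iff_null_sets negligible_iff_null_sets)
  then show False using open_not_negligible[of "B1 :: 'a set"] by simp
qed

context frac_order
begin

interpretation frac: semi_inner "sobolev_space s" "frac_laplacian s :: ('a::euclidean_space \<Rightarrow> real) \<Rightarrow> _"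
  by (rule sobolev_semi_inner[OF s])

interpretation Ht: semi_hilbert "sobolev_tilde s \<Omega>" "H_inner s" for \<Omega> :: "'a::euclidean_space set"
  by (rule sobolev_tilde_hilbert)

lemma sobolev_tilde_sobolev: "v \<in> sobolev_tilde s \<Omega> \<Longrightarrow> v \<in> sobolev_space s"
  by (simp add: sobolev_tilde_def)

lemma sobolev_tilde_L2: "v \<in> sobolev_tilde s \<Omega> \<Longrightarrow> v \<in> L2 lebesgue"
  by (rule sobolev_L2[OF sobolev_tilde_sobolev])

lemma sobolev_tilde_L2_on: "v \<in> sobolev_tilde s \<Omega> \<Longrightarrow> v \<in> L2 (lebesgue_on B1)"
  by (intro L2_restrict(1) sobolev_tilde_L2) auto

lemma test_function_sobolev_tilde: "\<phi> \<in> test_functions \<Omega> \<Longrightarrow> \<phi> \<in> sobolev_tilde s \<Omega>"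
  for \<Omega> :: "'a::euclidean_space set"
proof -
  assume \<phi>: "\<phi> \<in> test_functions \<Omega>"
  have "H_inner s (\<lambda>x. \<phi> x - \<phi> x) (\<lambda>x. \<phi> x - \<phi> x) = 0"
    using Ht.scale_left[of "\<lambda>x. 0" \<Omega> "\<lambda>x. 0" 0] Ht.zero[of \<Omega>] by simp
  then show ?thesis unfolding sobolev_tilde_eq using \<phi> test_function_sobolev[OF \<phi>]
    by (auto intro!: bexI[of _ \<phi>])
qed

lemma L2_inner_on_B1:
  assumes v: "v \<in> sobolev_tilde s (B1 :: 'a::euclidean_space set)" and w: "w \<in> L2 lebesgue"
  shows "L2_inner (lebesgue_on B1) v w = L2_inner lebesgue v w"
proof -
  have vm: "v \<in> borel_measurable lebesgue" by (rule L2_measurable[OF sobolev_tilde_L2[OF v]])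
  have m: "(\<lambda>x. indicator B1 x * v x) \<in> borel_measurable lebesgue"
    by (intro borel_measurable_times borel_measurable_indicator vm) simp
  have "AE x in lebesgue. indicator B1 x * v x = v x"
    using sobolev_tilde_outside[OF v] by eventually_elim (auto simp: indicator_def)
  then show ?thesis unfolding L2_inner_on(1)[OF ball_lebesgue]
    by (rule L2_inner_cong_AE) (use m vm L2_measurable[OF w] in auto)
qed

definition schroedinger_form :: "('a::euclidean_space \<Rightarrow> real) \<Rightarrow> ('a \<Rightarrow> real) \<Rightarrow> ('a \<Rightarrow> real) \<Rightarrow> real" where
  "schroedinger_form q u v = frac_laplacian s u v + L2_inner (lebesgue_on B1) (\<lambda>x. q x * u x) v"

lemma schroedinger_form_commute:
  assumes "u \<in> sobolev_space s" "v \<in> sobolev_space s"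
  shows "schroedinger_form q u v = schroedinger_form q v u"
  unfolding schroedinger_form_def using frac.sym[OF assms] by (simp add: L2_inner_def mult_ac)

lemma schroedinger_form_lincomb:
  assumes q: "q \<in> Linf (lebesgue_on B1)" and uvw: "u \<in> sobolev_space s" "v \<in> sobolev_space s" "w \<in> sobolev_space s"
  shows "schroedinger_form q (\<lambda>x. a * u x + b * v x) w = a * schroedinger_form q u w + b * schroedinger_form q v w"
proof -
  have L: "u \<in> L2 (lebesgue_on B1)" "v \<in> L2 (lebesgue_on B1)" "w \<in> L2 (lebesgue_on B1)"
    using uvw by (auto intro!: L2_restrict(1) sobolev_L2)
  have "(\<lambda>x. q x * (a * u x + b * v x)) = (\<lambda>x. a * (q x * u x) + b * (q x * v x))" by (simp add: algebra_simps)
  then show ?thesis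
    unfolding schroedinger_form_def
    using frac.linear_left[OF uvw, of a b] L2.linear_left[OF Linf_mult_L2(1)[OF q L(1)] Linf_mult_L2(1)[OF q L(2)] L(3), of a b]
    by (simp add: algebra_simps)
qed

text \<open>
  Test functions are dense in \<open>sobolev_tilde\<close>, so a weak solution may be tested with every member of it.
\<close>

lemma weak_solution_iff:
  assumes q: "q \<in> Linf (lebesgue_on B1)" and F: "F \<in> L2 (lebesgue_on B1)"
  shows "weak_solution s q (\<lambda>\<phi>. LINT x|lebesgue_on B1. F x * \<phi> x) v \<longleftrightarrow>
    v \<in> sobolev_tilde s B1 \<and> (\<forall>w\<in>sobolev_tilde s B1. schroedinger_form q v w = L2_inner (lebesgue_on B1) F w)"
proof
  assume w: "weak_solution s q (\<lambda>\<phi>. LINT x|lebesgue_on B1. F x * \<phi> x) v"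
  then have v: "v \<in> sobolev_tilde s B1" by (simp add: weak_solution_def)
  have qv: "(\<lambda>x. q x * v x) \<in> L2 (lebesgue_on B1)" by (rule Linf_mult_L2(1)[OF q sobolev_tilde_L2_on[OF v]])
  have G: "(\<lambda>x. F x - q x * v x) \<in> L2 (lebesgue_on B1)" by (rule L2.diff_mem[OF F qv])
  have "frac_laplacian s v w = L2_inner (lebesgue_on B1) (\<lambda>x. F x - q x * v x) w" if wt: "w \<in> sobolev_tilde s B1" for w
  proof (rule frac_laplacian_weak_extend[OF _ sobolev_tilde_sobolev[OF v] G _ wt])
    fix \<phi> :: "'a \<Rightarrow> real" assume \<phi>: "\<phi> \<in> test_functions B1"
    have "frac_laplacian s v \<phi> + L2_inner (lebesgue_on B1) (\<lambda>x. q x * v x) \<phi> = L2_inner (lebesgue_on B1) F \<phi>"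
      using w \<phi> by (simp add: weak_solution_def L2_inner_def)
    then show "frac_laplacian s v \<phi> = L2_inner (lebesgue_on B1) (\<lambda>x. F x - q x * v x) \<phi>"
      using L2.diff_left[OF F qv sobolev_tilde_L2_on[OF test_function_sobolev_tilde[OF \<phi>]]] by simp
  qed simp
  then show "v \<in> sobolev_tilde s B1 \<and> (\<forall>w\<in>sobolev_tilde s B1. schroedinger_form q v w = L2_inner (lebesgue_on B1) F w)"
    using v L2.diff_left[OF F qv sobolev_tilde_L2_on] by (simp add: schroedinger_form_def)
next
  assume "v \<in> sobolev_tilde s B1 \<and> (\<forall>w\<in>sobolev_tilde s B1. schroedinger_form q v w = L2_inner (lebesgue_on B1) F w)"
  then show "weak_solution s q (\<lambda>\<phi>. LINT x|lebesgue_on B1. F x * \<phi> x) v"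
    using test_function_sobolev_tilde by (auto simp: weak_solution_def schroedinger_form_def L2_inner_def)
qed

lemma weak_solution_unique:
  assumes q: "q \<in> Linf (lebesgue_on (B1 :: 'a::euclidean_space set))" and ne: "\<not> zero_eigenvalue s q"
    and v: "weak_solution s q T v" and w: "weak_solution s q T w"
  shows "AE x in lebesgue. v x = w x"
proof -
  have vw: "v \<in> sobolev_tilde s B1" "w \<in> sobolev_tilde s B1" using v w by (auto simp: weak_solution_def)
  have "weak_solution s q (\<lambda>\<phi>. 0) (\<lambda>x. v x - w x)"
    unfolding weak_solution_def
  proof (intro conjI ballI Ht.diff_mem vw)
    fix \<phi> :: "'a \<Rightarrow> real" assume \<phi>: "\<phi> \<in> test_functions B1"
    have "schroedinger_form q (\<lambda>x. 1 * v x + (- 1) * w x) \<phi> = 1 * schroedinger_form q v \<phi> + (- 1) * schroedinger_form q w \<phi>"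
      by (rule schroedinger_form_lincomb[OF q]) (use vw \<phi> in \<open>auto intro: sobolev_tilde_sobolev test_function_sobolev\<close>)
    moreover have "schroedinger_form q v \<phi> = T \<phi>" "schroedinger_form q w \<phi> = T \<phi>"
      using v w \<phi> by (simp_all add: weak_solution_def schroedinger_form_def L2_inner_def)
    ultimately show "frac_laplacian s (\<lambda>x. v x - w x) \<phi> + (LINT x|lebesgue_on B1. q x * (v x - w x) * \<phi> x) = 0"
      by (simp add: schroedinger_form_def L2_inner_def)
  qed
  then have "AE x in lebesgue. v x - w x = 0" using ne unfolding zero_eigenvalue_def by blast
  then show ?thesis by eventually_elim simp
qed

text \<open>
  For a potential that is at least \<open>1\<close> the form of the equation is itself an inner product, equivalent to
  that of the Sobolev space.
\<close>

lemma energy_form_hilbert: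
  fixes p :: "'a::euclidean_space \<Rightarrow> real"
  assumes p: "p \<in> Linf (lebesgue_on B1)" and p1: "AE x in lebesgue_on B1. 1 \<le> p x"
  shows "semi_hilbert (sobolev_tilde s B1) (schroedinger_form p)"
    and "\<And>u. u \<in> sobolev_tilde s B1 \<Longrightarrow> H_inner s u u \<le> schroedinger_form p u u"
proof -
  have pu: "(\<lambda>x. p x * u x) \<in> L2 (lebesgue_on B1)" if "u \<in> sobolev_tilde s B1" for u
    by (rule Linf_mult_L2(1)[OF p sobolev_tilde_L2_on[OF that]])
  show le: "H_inner s u u \<le> schroedinger_form p u u" if u: "u \<in> sobolev_tilde s B1" for u
  proof -
    have "L2_inner (lebesgue_on B1) u u \<le> L2_inner (lebesgue_on B1) (\<lambda>x. p x * u x) u"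
      unfolding L2_inner_def
    proof (rule integral_mono_AE)
      show "integrable (lebesgue_on B1) (\<lambda>x. u x * u x)" "integrable (lebesgue_on B1) (\<lambda>x. p x * u x * u x)"
        using sobolev_tilde_L2_on[OF u] pu[OF u] by (auto intro: L2_integrable_mult)
      show "AE x in lebesgue_on B1. u x * u x \<le> p x * u x * u x"
        using p1
      proof eventually_elim
        case (elim x)
        have "1 * (u x * u x) \<le> p x * (u x * u x)" by (rule mult_right_mono[OF elim]) simp
        then show ?case by (simp add: mult.assoc)
      qed
    qed
    then show ?thesis
      unfolding H_inner_def schroedinger_form_def by (simp add: L2_inner_on_B1[OF u sobolev_tilde_L2[OF u]])
  qed
  have semi: "semi_inner (sobolev_tilde s B1) (schroedinger_form p)"
  proof
    show "schroedinger_form p (\<lambda>x. a * u x + b * v x) w = a * schroedinger_form p u w + b * schroedinger_form p v w"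
      if "u \<in> sobolev_tilde s B1" "v \<in> sobolev_tilde s B1" "w \<in> sobolev_tilde s B1" for u v w a b
      using that by (intro schroedinger_form_lincomb[OF p] sobolev_tilde_sobolev)
    show "schroedinger_form p u v = schroedinger_form p v u"
      if "u \<in> sobolev_tilde s B1" "v \<in> sobolev_tilde s B1" for u v
      using that by (intro schroedinger_form_commute sobolev_tilde_sobolev)
    show "0 \<le> schroedinger_form p u u" if "u \<in> sobolev_tilde s B1" for u
      using le[OF that] Ht.nonneg[OF that] by linarith
  qed (auto intro: Ht.lincomb Ht.zero)
  show "semi_hilbert (sobolev_tilde s B1) (schroedinger_form p)"
  proof (rule semi_hilbert_equivalent[OF sobolev_tilde_hilbert semi, of 1 "1 + Linf_norm (lebesgue_on B1) p"])
    show "1 * H_inner s u u \<le> schroedinger_form p u u" if "u \<in> sobolev_tilde s B1" for u using le[OF that] by simp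
    show "schroedinger_form p u u \<le> (1 + Linf_norm (lebesgue_on B1) p) * H_inner s u u" if u: "u \<in> sobolev_tilde s B1" for u
    proof -
      define N where "N = Linf_norm (lebesgue_on B1) p"
      have N: "0 \<le> N" unfolding N_def by (rule Linf_norm_nonneg[OF p B1_not_null])
      have uL: "u \<in> L2 (lebesgue_on B1)" by (rule sobolev_tilde_L2_on[OF u])
      have "L2_inner (lebesgue_on B1) (\<lambda>x. p x * u x) u \<le> N * L2_norm (lebesgue_on B1) u * L2_norm (lebesgue_on B1) u"
        using Linf_mult_L2_inner_le[OF p Linf_norm_nonneg[OF p B1_not_null] uL uL] unfolding N_def by linarith
      also have "\<dots> = N * L2_inner lebesgue u u"
        by (simp add: L2_norm_def L2.nonneg[OF uL] L2.nonneg[OF sobolev_tilde_L2[OF u]] mult.assoc L2_inner_on_B1[OF u sobolev_tilde_L2[OF u]])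
      also have "\<dots> \<le> N * H_inner s u u" by (rule mult_left_mono[OF L2_le_H[OF sobolev_tilde_sobolev[OF u]] N])
      finally show ?thesis
        using frac_le_H[OF sobolev_tilde_sobolev[OF u]] unfolding schroedinger_form_def N_def[symmetric] by (simp add: algebra_simps)
    qed
  qed simp
qed

text \<open>
  With the shift \<open>\<mu> = \<parallel>q\<parallel> + 1\<close> the operator \<open>(-\<Delta>)\<^sup>s + q + \<mu>\<close> has, by Riesz, an inverse \<open>S\<close> on \<open>L\<^sup>2(B\<^sub>1)\<close>, which
  is symmetric and compact by Rellich. The equation with right-hand side \<open>G\<close> is solved by \<open>S F\<close> as soon as
  \<open>F - \<mu> S F = G\<close>. An element \<open>u\<close> of the kernel of \<open>id - \<mu> S\<close> yields the solution \<open>S u\<close> of the homogeneous equation, which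
  vanishes because \<open>0\<close> is not an eigenvalue. So the Fredholm alternative applies, and it bounds \<open>F\<close> by \<open>G\<close>.
\<close>

theorem weak_solution_exists:
  fixes q :: "'a::euclidean_space \<Rightarrow> real"
  assumes q: "q \<in> Linf (lebesgue_on B1)" and ne: "\<not> zero_eigenvalue s q"
  shows "\<exists>C\<ge>0. \<forall>G\<in>L2 (lebesgue_on B1). \<exists>w. weak_solution s q (\<lambda>\<phi>. LINT x|lebesgue_on B1. G x * \<phi> x) w \<and>
    L2_inner (lebesgue_on B1) w w \<le> C * L2_inner (lebesgue_on B1) G G"
proof -
  let ?M = "lebesgue_on (B1 :: 'a set)"
  define \<mu> where "\<mu> = Linf_norm ?M q + 1"
  define p where "p x = q x + \<mu>" for x
  have qm[measurable]: "q \<in> borel_measurable ?M" using q by (simp add: Linf_def)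
  note qb = AE_le_Linf_norm[OF q]
  have N0: "0 \<le> Linf_norm ?M q" by (rule Linf_norm_nonneg[OF q B1_not_null])
  have p: "p \<in> Linf ?M"
  proof (rule Linf_I)
    show "p \<in> borel_measurable ?M" unfolding p_def by measurable
    show "AE x in ?M. \<bar>p x\<bar> \<le> Linf_norm ?M q + \<mu>"
      using qb by eventually_elim (use N0 in \<open>auto simp: p_def \<mu>_def\<close>)
  qed
  have p1: "AE x in ?M. 1 \<le> p x" using qb by eventually_elim (auto simp: p_def \<mu>_def)
  interpret E: semi_hilbert "sobolev_tilde s B1" "schroedinger_form p" by (rule energy_form_hilbert(1)[OF p p1])
  have L2E: "L2_inner ?M w w \<le> schroedinger_form p w w" if w: "w \<in> sobolev_tilde s B1" for w
    using L2_inner_on_B1[OF w sobolev_tilde_L2[OF w]] L2_le_H[OF sobolev_tilde_sobolev[OF w]]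
      energy_form_hilbert(2)[OF p p1 w] by linarith
  have "\<exists>v\<in>sobolev_tilde s B1. \<forall>w\<in>sobolev_tilde s B1. schroedinger_form p v w = L2_inner ?M F w" if F: "F \<in> L2 ?M" for F
  proof (rule E.Riesz_representation[where C = "L2_inner ?M F F"])
    show "L2_inner ?M F (\<lambda>x. a * u x + b * v x) = a * L2_inner ?M F u + b * L2_inner ?M F v"
      if "u \<in> sobolev_tilde s B1" "v \<in> sobolev_tilde s B1" for u v a b
      by (rule L2.linear_right[OF sobolev_tilde_L2_on[OF that(1)] sobolev_tilde_L2_on[OF that(2)] F])
    show "(L2_inner ?M F u)\<^sup>2 \<le> L2_inner ?M F F * schroedinger_form p u u" if u: "u \<in> sobolev_tilde s B1" for u
      by (rule order_trans[OF L2.Cauchy_Schwarz[OF F sobolev_tilde_L2_on[OF u]] mult_left_mono[OF L2E[OF u] L2.nonneg[OF F]]])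
  qed (rule L2.nonneg[OF F])
  then obtain S where S: "\<And>F. F \<in> L2 ?M \<Longrightarrow> S F \<in> sobolev_tilde s B1"
    "\<And>F w. F \<in> L2 ?M \<Longrightarrow> w \<in> sobolev_tilde s B1 \<Longrightarrow> schroedinger_form p (S F) w = L2_inner ?M F w"
    by metis
  have SL: "S F \<in> L2 ?M" if "F \<in> L2 ?M" for F by (rule sobolev_tilde_L2_on[OF S(1)[OF that]])
  have Ssym: "L2_inner ?M (S F) G = L2_inner ?M F (S G)" if F: "F \<in> L2 ?M" and G: "G \<in> L2 ?M" for F G
    using S(2)[OF F S(1)[OF G]] S(2)[OF G S(1)[OF F]] E.sym[OF S(1)[OF F] S(1)[OF G]] L2.sym[OF SL[OF F] G] by simp
  have SE: "schroedinger_form p (S F) (S F) \<le> L2_inner ?M F F" if F: "F \<in> L2 ?M" for F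
  proof -
    define e where "e = schroedinger_form p (S F) (S F)"
    have e0: "0 \<le> e" unfolding e_def by (rule E.nonneg[OF S(1)[OF F]])
    have "e\<^sup>2 \<le> L2_inner ?M F F * L2_inner ?M (S F) (S F)"
      unfolding e_def S(2)[OF F S(1)[OF F]] by (rule L2.Cauchy_Schwarz[OF F SL[OF F]])
    also have "\<dots> \<le> L2_inner ?M F F * e" unfolding e_def by (rule mult_left_mono[OF L2E[OF S(1)[OF F]] L2.nonneg[OF F]])
    finally have "e * e \<le> L2_inner ?M F F * e" by (simp add: power2_eq_square)
    then show ?thesis using e0 L2.nonneg[OF F] unfolding e_def[symmetric] by (cases "e = 0") auto
  qed
  have SS: "L2_inner ?M (S F) (S F) \<le> L2_inner ?M F F" if F: "F \<in> L2 ?M" for F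
    using L2E[OF S(1)[OF F]] SE[OF F] by linarith
  define K where "K F = (\<lambda>x. \<mu> * S F x)" for F
  have form_pq: "schroedinger_form p v w = schroedinger_form q v w + \<mu> * L2_inner ?M v w"
    if v: "v \<in> sobolev_tilde s B1" and w: "w \<in> sobolev_tilde s B1" for v w
  proof -
    have L: "v \<in> L2 ?M" "w \<in> L2 ?M" using v w by (auto intro: sobolev_tilde_L2_on)
    have "(\<lambda>x. p x * v x) = (\<lambda>x. 1 * (q x * v x) + \<mu> * v x)" by (simp add: p_def algebra_simps)
    then show ?thesis
      unfolding schroedinger_form_def using L2.linear_left[OF Linf_mult_L2(1)[OF q L(1)] L, of 1 \<mu>] by simp
  qed
  have "\<exists>C\<ge>0. \<forall>G\<in>L2 ?M. \<exists>F\<in>L2 ?M. L2_inner ?M (\<lambda>x. (F x - K F x) - G x) (\<lambda>x. (F x - K F x) - G x) = 0 \<and>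
      L2_inner ?M F F \<le> C * L2_inner ?M G G"
  proof (rule L2.Fredholm_alternative[where M = "\<mu>\<^sup>2"])
    show KL: "K u \<in> L2 ?M" if "u \<in> L2 ?M" for u unfolding K_def by (rule L2.scale_mem[OF SL[OF that]])
    show "L2_inner ?M (K u) v = L2_inner ?M u (K v)" if uv: "u \<in> L2 ?M" "v \<in> L2 ?M" for u v
      unfolding K_def L2.scale_left[OF SL[OF uv(1)] uv(2)]
      using L2.linear_right[OF SL[OF uv(2)] SL[OF uv(2)] uv(1), of \<mu> 0] Ssym[OF uv] by simp
    show "L2_inner ?M (K u) (K u) \<le> \<mu>\<^sup>2 * L2_inner ?M u u" if u: "u \<in> L2 ?M" for u
      unfolding K_def using L2.quad_expand[OF SL[OF u] SL[OF u], of \<mu> 0] mult_left_mono[OF SS[OF u], of "\<mu>\<^sup>2"] by simp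
    show "\<exists>r g. strict_mono (r :: nat \<Rightarrow> nat) \<and> L2.converges_in ?M (\<lambda>n. K (f (r n))) g"
      if f: "\<And>n. f n \<in> L2 ?M" and f1: "\<And>n. L2_inner ?M (f n) (f n) \<le> 1" for f
    proof -
      have "H_inner s (S (f n)) (S (f n)) \<le> 1" for n
        using energy_form_hilbert(2)[OF p p1 S(1)[OF f]] SE[OF f] f1 by (meson order_trans)
      then obtain r g where r: "strict_mono (r :: nat \<Rightarrow> nat)" and g: "L2.converges_in lebesgue (\<lambda>n. S (f (r n))) g"
        using Rellich[of "\<lambda>n. S (f n)" 1 1] S(1)[OF f] by auto
      have gL: "g \<in> L2 lebesgue" and gl: "(\<lambda>n. L2_inner lebesgue (\<lambda>x. S (f (r n)) x - g x) (\<lambda>x. S (f (r n)) x - g x)) \<longlonglongrightarrow> 0"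
        using g by (auto simp: L2.converges_in_def)
      have gM: "g \<in> L2 ?M" by (rule L2_restrict(1)[OF _ gL]) simp
      have d: "(\<lambda>x. S (f (r n)) x - g x) \<in> L2 lebesgue" for n by (rule L2.diff_mem[OF sobolev_tilde_L2[OF S(1)[OF f]] gL])
      have "(\<lambda>n. L2_inner ?M (\<lambda>x. S (f (r n)) x - g x) (\<lambda>x. S (f (r n)) x - g x)) \<longlonglongrightarrow> 0"
        by (rule real_tendsto_sandwich[OF _ _ tendsto_const gl])
          (auto intro!: always_eventually L2.nonneg L2_restrict d)
      then have "(\<lambda>n. \<mu>\<^sup>2 * L2_inner ?M (\<lambda>x. S (f (r n)) x - g x) (\<lambda>x. S (f (r n)) x - g x)) \<longlonglongrightarrow> \<mu>\<^sup>2 * 0"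
        by (intro tendsto_intros)
      moreover have "\<mu>\<^sup>2 * L2_inner ?M (\<lambda>x. S (f (r n)) x - g x) (\<lambda>x. S (f (r n)) x - g x)
          = L2_inner ?M (\<lambda>x. K (f (r n)) x - \<mu> * g x) (\<lambda>x. K (f (r n)) x - \<mu> * g x)" for n
      proof -
        have dM: "(\<lambda>x. S (f (r n)) x - g x) \<in> L2 ?M" by (rule L2_restrict(1)[OF _ d]) simp
        show ?thesis using L2.quad_expand[OF dM dM, of \<mu> 0] by (simp add: K_def right_diff_distrib)
      qed
      ultimately have "L2.converges_in ?M (\<lambda>n. K (f (r n))) (\<lambda>x. \<mu> * g x)"
        by (simp add: L2.converges_in_def KL f L2.scale_mem gM)
      then show ?thesis using r by blast
    qed
    show "L2_inner ?M u u = 0" if u: "u \<in> L2 ?M" and null: "L2_inner ?M (\<lambda>x. u x - K u x) (\<lambda>x. u x - K u x) = 0" for u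
    proof -
      have dL: "(\<lambda>x. u x - K u x) \<in> L2 ?M" by (rule L2.diff_mem[OF u KL[OF u]])
      have "schroedinger_form q (S u) w = L2_inner ?M (\<lambda>x. 0) w" if w: "w \<in> sobolev_tilde s B1" for w
      proof -
        have wL: "w \<in> L2 ?M" by (rule sobolev_tilde_L2_on[OF w])
        have "L2_inner ?M (\<lambda>x. u x - K u x) w = 0" by (rule L2.null_orthogonal[OF dL wL null])
        then have "L2_inner ?M u w = \<mu> * L2_inner ?M (S u) w"
          using L2.diff_left[OF u KL[OF u] wL] L2.scale_left[OF SL[OF u] wL, of \<mu>] by (simp add: K_def)
        then show ?thesis using S(2)[OF u w] form_pq[OF S(1)[OF u] w] by (simp add: L2_inner_def)
      qed
      then have "weak_solution s q (\<lambda>\<phi>. LINT x|?M. 0 * \<phi> x) (S u)"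
        using weak_solution_iff[OF q L2.zero] S(1)[OF u] by simp
      then have "AE x in lebesgue. S u x = 0" using ne unfolding zero_eigenvalue_def by auto
      then have "AE x in ?M. S u x = 0" by (rule AE_lebesgue_on[rotated]) simp
      moreover have "AE x in ?M. u x - K u x = 0" using null L2_inner_self_eq_0_iff[OF dL] by simp
      ultimately have "AE x in ?M. u x = 0" by eventually_elim (simp add: K_def)
      then show ?thesis using L2_inner_self_eq_0_iff[OF u] by simp
    qed
  qed
  then obtain C where C0: "C \<ge> 0" and C: "\<forall>G\<in>L2 ?M. \<exists>F\<in>L2 ?M.
      L2_inner ?M (\<lambda>x. (F x - K F x) - G x) (\<lambda>x. (F x - K F x) - G x) = 0 \<and> L2_inner ?M F F \<le> C * L2_inner ?M G G"
    by (elim exE conjE) (rule that)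
  have "\<exists>w. weak_solution s q (\<lambda>\<phi>. LINT x|?M. G x * \<phi> x) w \<and> L2_inner ?M w w \<le> C * L2_inner ?M G G" if G: "G \<in> L2 ?M" for G
  proof -
    obtain F where F: "F \<in> L2 ?M" and null: "L2_inner ?M (\<lambda>x. (F x - K F x) - G x) (\<lambda>x. (F x - K F x) - G x) = 0"
      and le: "L2_inner ?M F F \<le> C * L2_inner ?M G G" using bspec[OF C G] by blast
    have KF: "K F \<in> L2 ?M" unfolding K_def by (rule L2.scale_mem[OF SL[OF F]])
    have "schroedinger_form q (S F) w = L2_inner ?M G w" if w: "w \<in> sobolev_tilde s B1" for w
    proof -
      have wL: "w \<in> L2 ?M" by (rule sobolev_tilde_L2_on[OF w])
      have "L2_inner ?M (\<lambda>x. (F x - K F x) - G x) w = 0"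
        by (rule L2.null_orthogonal[OF L2.diff_mem[OF L2.diff_mem[OF F KF] G] wL null])
      then have "L2_inner ?M F w - \<mu> * L2_inner ?M (S F) w = L2_inner ?M G w"
        using L2.diff_left[OF L2.diff_mem[OF F KF] G wL] L2.diff_left[OF F KF wL] L2.scale_left[OF SL[OF F] wL, of \<mu>]
        by (simp add: K_def)
      then show ?thesis using S(2)[OF F w] form_pq[OF S(1)[OF F] w] by simp
    qed
    then have "weak_solution s q (\<lambda>\<phi>. LINT x|?M. G x * \<phi> x) (S F)"
      using weak_solution_iff[OF q G] S(1)[OF F] by simp
    moreover have "L2_inner ?M (S F) (S F) \<le> C * L2_inner ?M G G" using SS[OF F] le by linarith
    ultimately show ?thesis by blast
  qed
  then show ?thesis using C0 by blast
qed

text \<open>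
  Tested with itself, a solution of \<open>(-\<Delta>)\<^sup>s v = 0\<close> has transform \<open>0\<close> wherever the weight \<open>\<bar>\<xi>\<bar>\<^sup>s\<close> is positive, that is, off the
  origin.
\<close>

lemma zero_potential_no_zero_eigenvalue: "\<not> zero_eigenvalue s (\<lambda>x :: 'a::euclidean_space. 0)"
proof
  assume "zero_eigenvalue s (\<lambda>x :: 'a. 0)"
  then obtain v :: "'a \<Rightarrow> real" where v: "weak_solution s (\<lambda>x. 0) (\<lambda>\<phi>. 0) v" "\<not> (AE x in lebesgue. v x = 0)"
    unfolding zero_eigenvalue_def by blast
  have z: "(\<lambda>x::'a. 0) \<in> Linf (lebesgue_on B1)" by (rule Linf_I[of _ _ 0]) auto
  have "weak_solution s (\<lambda>x. 0) (\<lambda>\<phi>. LINT x|lebesgue_on B1. 0 * \<phi> x) v" using v(1) by simp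
  then have vt: "v \<in> sobolev_tilde s B1" and "schroedinger_form (\<lambda>x. 0) v v = L2_inner (lebesgue_on B1) (\<lambda>x. 0) v"
    using weak_solution_iff[OF z L2.zero] by auto
  then have f0: "frac_laplacian s v v = 0" by (simp add: schroedinger_form_def L2_inner_def)
  have vL: "v \<in> L2 lebesgue" by (rule sobolev_tilde_L2[OF vt])
  have "sqn lebesgue (frac_symbol s v) = 0" using frac_quad_eq_sqn[OF sobolev_tilde_sobolev[OF vt]] f0 by simp
  then have "AE \<xi> in lebesgue. frac_symbol s v \<xi> = 0" using sqn_eq_0_iff[OF frac_symbol_measurable[OF vL]] by blast
  moreover have "AE \<xi> in lebesgue. \<xi> \<notin> {0::'a}" by (rule AE_not_in) (simp add: negligible_iff_null_sets[symmetric])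
  ultimately have "AE \<xi> in lebesgue. fourier_transform v \<xi> = 0"
    by eventually_elim (simp add: frac_symbol_def)
  then have "sqn lebesgue (fourier_transform v) = 0" using sqn_eq_0_iff[OF fourier_transform_spec(1)[OF vL]] by blast
  then have "sqn lebesgue v = 0" using Plancherel(1)[OF vL] by simp
  then show False using v(2) sqn_eq_0_iff[OF L2_measurable[OF vL]] by blast
qed

end


section \<open>The fractional Laplacian away from the support\<close>

lemma powr_integrable_to_infinity:
  fixes a :: real
  assumes "a < -1"
  shows "integrable lborel (\<lambda>t::real. indicator {1..} t * t powr a)"
proof -
  have "(\<lambda>x::real. x powr a) integrable_on {1..}"
    using has_integral_powr_to_inf[of a 1] assms by (auto simp: integrable_on_def)
  then have "(\<lambda>x::real. x powr a) absolutely_integrable_on {1..}"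
    by (rule nonnegative_absolutely_integrable_1) simp
  then have "integrable lebesgue (\<lambda>t::real. indicator {1..} t * t powr a)"
    by (simp add: set_integrable_def)
  then show ?thesis by (subst (asm) integrable_completion) auto
qed

lemma powr_integrable_from_zero:
  fixes a :: real
  assumes "-1 < a"
  shows "integrable lborel (\<lambda>t::real. indicator {0..1} t * t powr a)"
proof -
  have "(\<lambda>x::real. x powr a) integrable_on {0..1}"
    using integrable_on_powr_from_0[of a 1] assms by simp
  then have "(\<lambda>x::real. x powr a) absolutely_integrable_on {0..1}"
    by (rule nonnegative_absolutely_integrable_1) simp
  then have "integrable lebesgue (\<lambda>t::real. indicator {0..1} t * t powr a)"
    by (simp add: set_integrable_def)
  then show ?thesis by (subst (asm) integrable_completion) auto
qed

lemma power_times_exp_minus_le: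
  fixes x :: real
  assumes x: "0 \<le> x" and N: "0 < N"
  shows "x ^ N * exp (- x / 4) \<le> (4 * real N) ^ N"
proof -
  have "(x / (4 * real N)) ^ N \<le> (1 + (x / 4) / real N) ^ N"
    using x N by (intro power_mono) auto
  also have "\<dots> \<le> exp (x / 4)" by (rule exp_ge_one_plus_x_over_n_power_n) (use x N in linarith)+
  finally have "x ^ N \<le> (4 * real N) ^ N * exp (x / 4)" using N by (simp add: power_divide field_simps)
  then have "x ^ N * exp (- x / 4) \<le> (4 * real N) ^ N * exp (x / 4) * exp (- x / 4)" by (rule mult_right_mono) simp
  then show ?thesis by (simp add: mult.assoc exp_add[symmetric])
qed

context frac_order
begin

text \<open>
  The density of the subordination formula; its power is integrable at infinity but not at \<open>0\<close>.
\<close>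

definition subord :: "real \<Rightarrow> real" where
  "subord t = indicator {0<..} t * t powr (- 1 - s)"

lemma subord_measurable [measurable]: "subord \<in> borel_measurable borel"
  unfolding subord_def by measurable

lemma subord_nonneg: "0 \<le> subord t"
  by (simp add: subord_def)

text \<open>
  The value is \<open>\<Gamma>(1 - s) / s\<close>.
\<close>

definition subord_const :: real where
  "subord_const = (LINT t|lborel. subord t * (1 - exp (- t)))"

lemma subord_integrable: "integrable lborel (\<lambda>t. subord t * (1 - exp (- t)))"
proof (rule Bochner_Integration.integrable_bound)
  show "integrable lborel (\<lambda>t. indicator {0..1} t * t powr (- s) + indicator {1..} t * t powr (- 1 - s))"
    using s by (intro Bochner_Integration.integrable_add powr_integrable_from_zero powr_integrable_to_infinity) auto
  show "AE t in lborel. norm (subord t * (1 - exp (- t))) \<le> norm (indicator {0..1} t * t powr (- s) + indicator {1..} t * t powr (- 1 - s))"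
  proof (rule AE_I2)
    fix t :: real
    consider "t \<le> 0" | "0 < t" "t \<le> 1" | "1 < t" by linarith
    then show "norm (subord t * (1 - exp (- t))) \<le> norm (indicator {0..1} t * t powr (- s) + indicator {1..} t * t powr (- 1 - s))"
    proof cases
      case 1 then show ?thesis by (simp add: subord_def)
    next
      case 2
      have e: "0 \<le> 1 - exp (- t)" "1 - exp (- t) \<le> t" using 2 exp_ge_add_one_self[of "- t"] by auto
      have "t powr (- 1 - s) * (1 - exp (- t)) \<le> t powr (- 1 - s) * t" using e by (intro mult_left_mono) auto
      also have "\<dots> = t powr (- s)" using 2 powr_mult_base[of t "- 1 - s"] by (simp add: mult.commute)
      finally show ?thesis using 2 e by (simp add: subord_def abs_mult add_increasing2)
    next
      case 3
      have "t powr (- 1 - s) * (1 - exp (- t)) \<le> t powr (- 1 - s) * 1" by (intro mult_left_mono) auto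
      then show ?thesis using 3 by (simp add: subord_def abs_mult)
    qed
  qed
qed measurable

lemma subord_const_pos: "0 < subord_const"
proof -
  have nn: "0 \<le> subord t * (1 - exp (- t))" for t
    by (cases "t > 0") (auto simp: subord_def)
  have "0 \<le> subord_const" unfolding subord_const_def by (rule Bochner_Integration.integral_nonneg) (rule nn)
  moreover have "subord_const \<noteq> 0"
  proof
    assume "subord_const = 0"
    then have "AE t in lborel. subord t * (1 - exp (- t)) = 0"
      unfolding subord_const_def using integral_nonneg_eq_0_iff_AE[OF subord_integrable] nn by simp
    then have "AE t in lborel. t \<notin> {1..2::real}"
      by eventually_elim (auto simp: subord_def)
    then have "{1..2::real} \<in> null_sets lborel" by (subst (asm) AE_iff_null_sets[symmetric]) auto
    then show False by (simp add: null_sets_def)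
  qed
  ultimately show ?thesis by simp
qed

text \<open>
  Substituting \<open>t / r\<^sup>2\<close> for \<open>t\<close> scales the density \<open>t\<^bsup>-1-s\<^esup> dt\<close> by \<open>r\<^bsup>2s\<^esup>\<close>. The formula expresses
  the symbol of the fractional Laplacian through Gaussians.
\<close>

lemma subordination:
  assumes r: "0 \<le> r"
  shows "integrable lborel (\<lambda>t. subord t * (1 - exp (- t * r\<^sup>2)))"
    and "(LINT t|lborel. subord t * (1 - exp (- t * r\<^sup>2))) = subord_const * r powr (2 * s)"
proof -
  have *: "integrable lborel (\<lambda>t. subord t * (1 - exp (- t * r\<^sup>2))) \<and>
    (LINT t|lborel. subord t * (1 - exp (- t * r\<^sup>2))) = subord_const * r powr (2 * s)"
  proof (cases "r = 0")
    case False
    then have r: "r > 0" using r by simp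
    then have r2: "r\<^sup>2 \<noteq> 0" by simp
    define f where "f t = subord t * (1 - exp (- t))" for t
    have eq: "subord t * (1 - exp (- t * r\<^sup>2)) = (r powr (2 * s) * r\<^sup>2) * f (0 + r\<^sup>2 * t)" for t
    proof (cases "t > 0")
      case True
      have "(r\<^sup>2 * t) powr (- 1 - s) = (r powr 2) powr (- 1 - s) * t powr (- 1 - s)"
        using r True by (simp add: powr_mult)
      also have "(r powr 2) powr (- 1 - s) = r powr (- 2 - 2 * s)" by (simp add: powr_powr algebra_simps)
      finally have "r powr (2 * s) * r\<^sup>2 * (r\<^sup>2 * t) powr (- 1 - s) = (r powr (2 * s) * r powr 2 * r powr (- 2 - 2 * s)) * t powr (- 1 - s)"
        using r by simp
      also have "r powr (2 * s) * r powr 2 * r powr (- 2 - 2 * s) = 1"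
        using r by (simp only: powr_add[symmetric]) simp
      finally have "r powr (2 * s) * r\<^sup>2 * subord (r\<^sup>2 * t) = subord t" using True r by (simp add: subord_def)
      then show ?thesis by (simp add: f_def mult.commute mult.left_commute)
    next
      case False
      then show ?thesis using r by (simp add: f_def subord_def zero_less_mult_iff)
    qed
    have i: "integrable lborel (\<lambda>t. f (0 + r\<^sup>2 * t))"
      by (rule lborel_integrable_real_affine[OF _ r2]) (unfold f_def, rule subord_integrable)
    have "subord_const = \<bar>r\<^sup>2\<bar> *\<^sub>R (LINT t|lborel. f (0 + r\<^sup>2 * t))"
      unfolding subord_const_def f_def[symmetric] by (rule lborel_integral_real_affine[OF r2])
    then have "subord_const = r\<^sup>2 * (LINT t|lborel. f (0 + r\<^sup>2 * t))" by simp
    then show ?thesis unfolding eq using i by simp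
  qed simp
  then show "integrable lborel (\<lambda>t. subord t * (1 - exp (- t * r\<^sup>2)))"
    "(LINT t|lborel. subord t * (1 - exp (- t * r\<^sup>2))) = subord_const * r powr (2 * s)" by auto
qed

text \<open>
  For \<open>\<bar>z\<bar> \<ge> 1\<close> the heat kernel, weighted by \<open>subord\<close>, factors into \<open>far_weight\<close>, which is its value at \<open>\<bar>z\<bar> = 1\<close>
  and is integrable in \<open>t\<close>, and \<open>far_profile\<close>, which lies between \<open>0\<close> and \<open>1\<close>. Distance from the origin tames
  the singularity of \<open>subord\<close> at \<open>t = 0\<close>.
\<close>

definition far_weight :: "nat \<Rightarrow> real \<Rightarrow> real" where
  "far_weight n t = subord t * (exp (- 1 / (4 * t)) / sqrt (4 * pi * t) ^ n)"

lemma far_weight_integrable: "integrable lborel (far_weight n)"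
proof (rule Bochner_Integration.integrable_bound)
  define N where "N = n + 2"
  show "integrable lborel (\<lambda>t. (4 * real N) ^ N * (indicator {0..1} t * t powr 0) + indicator {1..} t * t powr (- 1 - s))"
    using s by (intro Bochner_Integration.integrable_add integrable_mult_right powr_integrable_from_zero powr_integrable_to_infinity) auto
  show "far_weight n \<in> borel_measurable lborel" unfolding far_weight_def by measurable
  show "AE t in lborel. norm (far_weight n t) \<le> norm ((4 * real N) ^ N * (indicator {0..1} t * t powr 0) + indicator {1..} t * t powr (- 1 - s))"
  proof (rule AE_I2)
    fix t :: real
    have nn: "0 \<le> far_weight n t" if "0 < t" using that by (simp add: far_weight_def subord_nonneg)
    consider "t \<le> 0" | "0 < t" "t < 1" | "1 \<le> t" by linarith
    then show "norm (far_weight n t) \<le> norm ((4 * real N) ^ N * (indicator {0..1} t * t powr 0) + indicator {1..} t * t powr (- 1 - s))"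
    proof cases
      case 1 then show ?thesis by (simp add: far_weight_def subord_def)
    next
      case 2
      define x where "x = 1 / t"
      have x: "1 \<le> x" using 2 by (simp add: x_def)
      have tx: "t = 1 / x" using 2 by (simp add: x_def)
      have "t powr (- 1 - s) = x powr (1 + s)"
        using 2 by (simp add: x_def powr_divide powr_minus_divide[symmetric])
      also have "\<dots> \<le> x powr 2" using x s by (intro powr_mono) auto
      also have "\<dots> = x ^ 2" using x by (simp add: powr_numeral)
      finally have p1: "t powr (- 1 - s) \<le> x ^ 2" .
      have "t \<le> 4 * pi * t" using 2 pi_gt3 by simp
      then have "t * t \<le> 4 * pi * t" using 2 by (meson mult_left_le order_trans less_imp_le)
      then have "t \<le> sqrt (4 * pi * t)" using 2 by (intro real_le_rsqrt) (simp add: power2_eq_square)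
      then have "t ^ n \<le> sqrt (4 * pi * t) ^ n" using 2 by (intro power_mono) auto
      then have p2: "1 / sqrt (4 * pi * t) ^ n \<le> x ^ n"
        using 2 by (simp add: x_def power_one_over frac_le)
      have "far_weight n t = t powr (- 1 - s) * (1 / sqrt (4 * pi * t) ^ n) * exp (- x / 4)"
        using 2 by (simp add: far_weight_def subord_def x_def)
      also have "\<dots> \<le> (x ^ 2 * x ^ n) * exp (- x / 4)"
        using p1 p2 x 2 by (intro mult_right_mono mult_mono) auto
      also have "x ^ 2 * x ^ n = x ^ N" by (simp add: N_def power_add power2_eq_square mult.commute)
      also have "x ^ N * exp (- x / 4) \<le> (4 * real N) ^ N" using x by (intro power_times_exp_minus_le) (auto simp: N_def)
      finally show ?thesis using nn 2 by simp
    next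
      case 3
      have "sqrt 1 \<le> sqrt (4 * pi * t)" using 3 pi_gt3 by (intro real_sqrt_le_mono) (smt (verit) mult_le_cancel_left1 mult_mono)
      then have "1 \<le> sqrt (4 * pi * t) ^ n" by simp
      then have "exp (- 1 / (4 * t)) / sqrt (4 * pi * t) ^ n \<le> 1 / 1" using 3 by (intro frac_le) auto
      then have "t powr (- 1 - s) * (exp (- 1 / (4 * t)) / sqrt (4 * pi * t) ^ n) \<le> t powr (- 1 - s) * 1"
        by (intro mult_left_mono) simp_all
      then have "far_weight n t \<le> t powr (- 1 - s) * 1"
        using 3 by (simp add: far_weight_def subord_def)
      then show ?thesis using nn 3 by (simp add: add_increasing)
    qed
  qed
qed

text \<open>
  Set to \<open>0\<close> for \<open>\<bar>z\<bar> < 1\<close>, where the quotient is unbounded. So \<open>far_profile\<close> is bounded everywhere, and with it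
  the kernel below.
\<close>

definition far_profile :: "real \<Rightarrow> 'a::euclidean_space \<Rightarrow> real" where
  "far_profile t z = (if 0 < t \<and> 1 \<le> norm z then exp (- ((norm z)\<^sup>2 - 1) / (4 * t)) else 0)"

lemma far_profile_bounds: "0 \<le> far_profile t z" "far_profile t z \<le> 1"
proof -
  have "1 \<le> (norm z)\<^sup>2" if "1 \<le> norm z" using that by (simp add: one_le_power)
  then show "0 \<le> far_profile t z" "far_profile t z \<le> 1" by (auto simp: far_profile_def divide_nonpos_pos)
qed

lemma far_profile_measurable [measurable]: "(\<lambda>(t, z). far_profile t z) \<in> borel_measurable (borel \<Otimes>\<^sub>M borel)"
  unfolding far_profile_def by measurable

lemma far_profile_heat_kernel:
  assumes "1 \<le> norm (z :: 'a::euclidean_space)"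
  shows "far_weight DIM('a) t * far_profile t z = subord t * heat_kernel t z"
proof (cases "t > 0")
  case True
  have "exp (- 1 / (4 * t)) * exp (- ((norm z)\<^sup>2 - 1) / (4 * t)) = exp (- (norm z)\<^sup>2 / (4 * t))"
  proof -
    have "- 1 / (4 * t) + - ((norm z)\<^sup>2 - 1) / (4 * t) = - (norm z)\<^sup>2 / (4 * t)"
      using True by (simp add: field_simps)
    then show ?thesis unfolding exp_add[symmetric] by simp
  qed
  then show ?thesis using True assms by (simp add: far_weight_def far_profile_def heat_kernel_def)
next
  case False
  then show ?thesis by (simp add: far_weight_def subord_def)
qed

text \<open>
  For \<open>\<bar>z\<bar> \<ge> 1\<close> this is the classical kernel \<open>- c\<^sub>n\<^sub>,\<^sub>s / \<bar>z\<bar>\<^bsup>n + 2s\<^esup>\<close>, written as an integral of the heat kernel;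
  for \<open>\<bar>z\<bar> < 1\<close> it is \<open>0\<close>.
\<close>

definition frac_kernel :: "'a::euclidean_space \<Rightarrow> real" where
  "frac_kernel z = - (LINT t|lborel. far_weight DIM('a) t * far_profile t z) / subord_const"

lemma frac_kernel_measurable [measurable]: "(frac_kernel :: 'a::euclidean_space \<Rightarrow> real) \<in> borel_measurable borel"
proof -
  have [measurable]: "far_weight DIM('a) \<in> borel_measurable borel" unfolding far_weight_def by measurable
  have "(\<lambda>z::'a. LINT t|lborel. far_weight DIM('a) t * far_profile t z) \<in> borel_measurable borel"
    by (rule lborel.borel_measurable_lebesgue_integral) measurable
  then show ?thesis unfolding frac_kernel_def by measurable
qed

lemma frac_kernel_minus: "frac_kernel (- z) = frac_kernel z"
  unfolding frac_kernel_def far_profile_def norm_minus_cancel ..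

definition frac_kernel_bound :: "nat \<Rightarrow> real" where
  "frac_kernel_bound n = (LINT t|lborel. \<bar>far_weight n t\<bar>) / subord_const"

lemma frac_kernel_le: "\<bar>frac_kernel (z :: 'a::euclidean_space)\<bar> \<le> frac_kernel_bound DIM('a)"
proof -
  have [measurable]: "far_weight DIM('a) \<in> borel_measurable borel" unfolding far_weight_def by measurable
  have le: "\<bar>far_weight DIM('a) t * far_profile t z\<bar> \<le> \<bar>far_weight DIM('a) t\<bar>" for t
    using far_profile_bounds[of t z] by (simp add: abs_mult mult_left_le)
  have i: "integrable lborel (\<lambda>t. \<bar>far_weight DIM('a) t\<bar>)" using far_weight_integrable by simp
  have "integrable lborel (\<lambda>t. far_weight DIM('a) t * far_profile t z)"
    by (rule Bochner_Integration.integrable_bound[OF i]) (use le in auto)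
  then have "norm (LINT t|lborel. far_weight DIM('a) t * far_profile t z) \<le> (LINT t|lborel. \<bar>far_weight DIM('a) t\<bar>)"
    by (rule Bochner_Integration.integral_norm_bound_integral[OF _ i]) (use le in auto)
  then show ?thesis using subord_const_pos by (simp add: frac_kernel_def frac_kernel_bound_def abs_divide divide_right_mono)
qed

text \<open>
  Write \<open>\<bar>\<xi>\<bar>\<^bsup>2s\<^esup>\<close> by the subordination formula and integrate over \<open>\<xi>\<close> first. The term \<open>1\<close> contributes the inner
  product of \<open>u\<close> and \<open>\<phi>\<close>, which is \<open>0\<close> because the supports are disjoint; the Gaussian term is the heat form. What
  remains is minus the \<open>subord\<close>-integral of the heat kernel, taken only where \<open>\<bar>x - y\<bar> \<ge> 1\<close>.
\<close>

lemma frac_laplacian_kernel: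
  fixes u \<phi> :: "'a::euclidean_space \<Rightarrow> real"
  assumes u: "u \<in> L2 lebesgue" "\<And>x. x \<notin> ball 0 R \<Longrightarrow> u x = 0"
    and \<phi>: "\<phi> \<in> L2 lebesgue" "\<And>x. x \<notin> ball 0 R \<Longrightarrow> \<phi> x = 0"
    and sep: "\<And>x y. u x \<noteq> 0 \<Longrightarrow> \<phi> y \<noteq> 0 \<Longrightarrow> 1 \<le> norm (x - y)"
    and int: "integrable lebesgue (\<lambda>\<xi>. frac_symbol s u \<xi> * cnj (frac_symbol s \<phi> \<xi>))"
  shows "frac_laplacian s u \<phi> = (LINT x|lebesgue. u x * (LINT y|lebesgue. \<phi> y * frac_kernel (x - y)))"
proof -
  define D where "D = (2 * pi) ^ DIM('a)"
  have D: "D > 0" by (simp add: D_def)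
  have ui: "integrable lebesgue u" by (rule bounded_support_integrable(1)[OF u])
  have pi: "integrable lebesgue \<phi>" by (rule bounded_support_integrable(1)[OF \<phi>])
  have um[measurable]: "u \<in> borel_measurable lebesgue" and pm[measurable]: "\<phi> \<in> borel_measurable lebesgue"
    using u \<phi> by (auto simp: L2_iff)
  define p where "p \<xi> = Re (fourier_integral u \<xi> * cnj (fourier_integral \<phi> \<xi>))" for \<xi>
  have [measurable]: "fourier_integral u \<in> borel_measurable borel" "fourier_integral \<phi> \<in> borel_measurable borel"
    using um pm by (auto intro: fourier_integral_measurable)
  have pb[measurable]: "p \<in> borel_measurable borel" unfolding p_def by measurable
  have ae_u: "AE \<xi> in lebesgue. fourier_transform u \<xi> = fourier_integral u \<xi>"
    by (rule fourier_transform_bounded_support[OF u])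
  have ae_\<phi>: "AE \<xi> in lebesgue. fourier_transform \<phi> \<xi> = fourier_integral \<phi> \<xi>"
    by (rule fourier_transform_bounded_support[OF \<phi>])
  note ae = ae_u ae_\<phi>
  note ftm = fourier_transform_spec(1)[OF u(1)] fourier_transform_spec(1)[OF \<phi>(1)]
  have p_int: "integrable lborel p" and p_0: "(LINT \<xi>|lborel. p \<xi>) = 0"
  proof -
    have i: "integrable lebesgue (\<lambda>\<xi>. Re (fourier_transform u \<xi> * cnj (fourier_transform \<phi> \<xi>)))"
      by (rule integrable_Re, rule re_inner_integrable[OF ftm Plancherel(2)[OF u(1)] Plancherel(2)[OF \<phi>(1)]])
    have eq: "AE \<xi> in lebesgue. Re (fourier_transform u \<xi> * cnj (fourier_transform \<phi> \<xi>)) = p \<xi>"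
      using ae by eventually_elim (simp add: p_def)
    have pl: "p \<in> borel_measurable lebesgue" by (rule borel_measurable_lebesgueI[OF pb])
    have "integrable lebesgue p" using i eq pl by (subst integrable_cong_AE[symmetric]) auto
    then show "integrable lborel p" by (subst (asm) integrable_completion) auto
    have "(LINT \<xi>|lborel. p \<xi>) = (LINT \<xi>|lebesgue. p \<xi>)" by (rule integral_completion[symmetric]) simp
    also have "\<dots> = (LINT \<xi>|lebesgue. Re (fourier_transform u \<xi> * cnj (fourier_transform \<phi> \<xi>)))"
      by (rule integral_cong_AE) (use i eq pl in \<open>auto elim: eventually_mono\<close>)
    also have "\<dots> = Re (LINT \<xi>|lebesgue. fourier_transform u \<xi> * cnj (fourier_transform \<phi> \<xi>))"
      by (rule integral_Re, rule re_inner_integrable[OF ftm Plancherel(2)[OF u(1)] Plancherel(2)[OF \<phi>(1)]])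
    also have "\<dots> = D * L2_inner lebesgue u \<phi>" unfolding D_def by (rule Parseval[OF u(1) \<phi>(1)])
    also have "L2_inner lebesgue u \<phi> = (LINT x|(lebesgue :: 'a measure). 0)"
      unfolding L2_inner_def
    proof (rule Bochner_Integration.integral_cong[OF refl])
      fix x show "u x * \<phi> x = 0" using sep[of x x] by auto
    qed
    finally show "(LINT \<xi>|lborel. p \<xi>) = 0" by simp
  qed
  have fs: "AE \<xi> in lebesgue. Re (frac_symbol s u \<xi> * cnj (frac_symbol s \<phi> \<xi>)) = norm \<xi> powr (2 * s) * p \<xi>"
    using ae
  proof eventually_elim
    case (elim \<xi>)
    have "norm \<xi> powr (2 * s) = norm \<xi> powr s * norm \<xi> powr s" by (simp add: powr_add[symmetric])
    then show ?case using elim by (simp add: frac_symbol_def p_def algebra_simps)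
  qed
  have wl: "(\<lambda>\<xi>. norm \<xi> powr (2 * s) * p \<xi>) \<in> borel_measurable lebesgue" by (rule borel_measurable_lebesgueI) measurable
  have w_int: "integrable lborel (\<lambda>\<xi>. norm \<xi> powr (2 * s) * p \<xi>)"
  proof -
    have "integrable lebesgue (\<lambda>\<xi>. norm \<xi> powr (2 * s) * p \<xi>)"
      using integrable_Re[OF int] fs wl by (subst integrable_cong_AE[symmetric]) auto
    then show ?thesis by (subst (asm) integrable_completion) auto
  qed
  have lhs: "frac_laplacian s u \<phi> = (LINT \<xi>|lborel. norm \<xi> powr (2 * s) * p \<xi>) / D"
  proof -
    have "Re (LINT \<xi>|lebesgue. frac_symbol s u \<xi> * cnj (frac_symbol s \<phi> \<xi>)) = (LINT \<xi>|lebesgue. Re (frac_symbol s u \<xi> * cnj (frac_symbol s \<phi> \<xi>)))"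
      by (rule integral_Re[OF int, symmetric])
    also have "\<dots> = (LINT \<xi>|lebesgue. norm \<xi> powr (2 * s) * p \<xi>)"
      by (rule integral_cong_AE) (use integrable_Re[OF int] fs wl in auto)
    also have "\<dots> = (LINT \<xi>|lborel. norm \<xi> powr (2 * s) * p \<xi>)" by (rule integral_completion) measurable
    finally show ?thesis by (simp add: frac_laplacian_eq_re_inner re_inner_def D_def)
  qed
  let ?n = "DIM('a)"
  define Q where "Q t = (LINT x|lebesgue. u x * (LINT y|lebesgue. \<phi> y * far_profile t (x - y)))" for t
  have fwm[measurable]: "far_weight ?n \<in> borel_measurable borel" unfolding far_weight_def by measurable
  \<comment> \<open>Exchange the frequency integral and the integral over the heat time.\<close>
  have "subord_const * (LINT \<xi>|lborel. norm \<xi> powr (2 * s) * p \<xi>)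
      = (LINT \<xi>|lborel. LINT t|lborel. p \<xi> * (subord t * (1 - exp (- t * (norm \<xi>)\<^sup>2))))"
  proof -
    have inner: "(LINT t|lborel. p \<xi> * (subord t * (1 - exp (- t * (norm \<xi>)\<^sup>2)))) = subord_const * (norm \<xi> powr (2 * s) * p \<xi>)" for \<xi> :: 'a
      using subordination(2)[of "norm \<xi>"] by (simp add: mult_ac)
    show ?thesis unfolding inner by (rule integral_mult_right_zero[symmetric])
  qed
  also have "\<dots> = (LINT t|lborel. LINT \<xi>|lborel. p \<xi> * (subord t * (1 - exp (- t * (norm \<xi>)\<^sup>2))))"
  proof (rule lborel_pair.Fubini_integral[symmetric])
    show "integrable (lborel \<Otimes>\<^sub>M lborel) (\<lambda>(\<xi>::'a, t). p \<xi> * (subord t * (1 - exp (- t * (norm \<xi>)\<^sup>2))))"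
    proof (rule lborel_pair.Fubini_integrable)
      have sub: "(LINT t|lborel. \<bar>subord t * (1 - exp (- t * (norm \<xi>)\<^sup>2))\<bar>) = subord_const * norm \<xi> powr (2 * s)" for \<xi> :: 'a
      proof -
        have "\<bar>subord t * (1 - exp (- t * (norm \<xi>)\<^sup>2))\<bar> = subord t * (1 - exp (- t * (norm \<xi>)\<^sup>2))" for t
          by (cases "t > 0") (auto simp: subord_def)
        then show ?thesis using subordination(2)[of "norm \<xi>"] by simp
      qed
      have "(\<lambda>\<xi>::'a. LINT t|lborel. norm (case (\<xi>, t) of (\<xi>, t) \<Rightarrow> p \<xi> * (subord t * (1 - exp (- t * (norm \<xi>)\<^sup>2)))))
          = (\<lambda>\<xi>. subord_const * \<bar>norm \<xi> powr (2 * s) * p \<xi>\<bar>)"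
      proof
        fix \<xi> :: 'a
        have "(LINT t|lborel. norm (case (\<xi>, t) of (\<xi>, t) \<Rightarrow> p \<xi> * (subord t * (1 - exp (- t * (norm \<xi>)\<^sup>2)))))
            = (LINT t|lborel. \<bar>p \<xi>\<bar> * \<bar>subord t * (1 - exp (- t * (norm \<xi>)\<^sup>2))\<bar>)"
          by (simp add: abs_mult)
        also have "\<dots> = \<bar>p \<xi>\<bar> * (LINT t|lborel. \<bar>subord t * (1 - exp (- t * (norm \<xi>)\<^sup>2))\<bar>)" by (rule integral_mult_right_zero)
        finally show "(LINT t|lborel. norm (case (\<xi>, t) of (\<xi>, t) \<Rightarrow> p \<xi> * (subord t * (1 - exp (- t * (norm \<xi>)\<^sup>2)))))
            = subord_const * \<bar>norm \<xi> powr (2 * s) * p \<xi>\<bar>"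
          unfolding sub by (simp add: abs_mult mult_ac)
      qed
      then show "integrable lborel (\<lambda>\<xi>::'a. LINT t|lborel. norm (case (\<xi>, t) of (\<xi>, t) \<Rightarrow> p \<xi> * (subord t * (1 - exp (- t * (norm \<xi>)\<^sup>2)))))"
        using integrable_abs[OF w_int] by simp
      show "AE \<xi>::'a in lborel. integrable lborel (\<lambda>t. case (\<xi>, t) of (\<xi>, t) \<Rightarrow> p \<xi> * (subord t * (1 - exp (- t * (norm \<xi>)\<^sup>2))))"
        using subordination(1) by auto
    qed measurable
  qed
  also have "\<dots> = (LINT t|lborel. far_weight ?n t * (- D * Q t))"
  proof (rule Bochner_Integration.integral_cong[OF refl])
    fix t :: real
    show "(LINT \<xi>|lborel. p \<xi> * (subord t * (1 - exp (- t * (norm \<xi>)\<^sup>2)))) = far_weight ?n t * (- D * Q t)"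
    proof (cases "t > 0")
      case True
      have gi: "integrable lborel (\<lambda>\<xi>. exp (- t * (norm \<xi>)\<^sup>2) * p \<xi>)"
        using integrable_Re[OF gaussian_fourier_integrable[OF True ui pi]] by (simp add: p_def)
      have "(LINT \<xi>|lborel. exp (- t * (norm \<xi>)\<^sup>2) * p \<xi>)
          = Re (LINT \<xi>|lborel. of_real (exp (- t * (norm \<xi>)\<^sup>2)) * (fourier_integral u \<xi> * cnj (fourier_integral \<phi> \<xi>)))"
        using integral_Re[OF gaussian_fourier_integrable[OF True ui pi]] by (simp add: p_def)
      also have "\<dots> = D * (LINT x|lebesgue. u x * (LINT y|lebesgue. \<phi> y * heat_kernel t (x - y)))"
        unfolding heat_form[OF True ui pi] D_def by simp
      finally have g: "(LINT \<xi>|lborel. exp (- t * (norm \<xi>)\<^sup>2) * p \<xi>) = D * (LINT x|lebesgue. u x * (LINT y|lebesgue. \<phi> y * heat_kernel t (x - y)))" .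
      have "(LINT \<xi>|lborel. p \<xi> * (subord t * (1 - exp (- t * (norm \<xi>)\<^sup>2))))
          = (LINT \<xi>|lborel. subord t * (p \<xi> - exp (- t * (norm \<xi>)\<^sup>2) * p \<xi>))"
        by (simp add: algebra_simps)
      also have "\<dots> = subord t * ((LINT \<xi>|lborel. p \<xi>) - (LINT \<xi>|lborel. exp (- t * (norm \<xi>)\<^sup>2) * p \<xi>))"
        using p_int gi by simp
      also have "\<dots> = - D * (subord t * (LINT x|lebesgue. u x * (LINT y|lebesgue. \<phi> y * heat_kernel t (x - y))))"
        unfolding p_0 g by simp
      also have "subord t * (LINT x|lebesgue. u x * (LINT y|lebesgue. \<phi> y * heat_kernel t (x - y))) = far_weight ?n t * Q t"
      proof -
        have e: "subord t * (u x * (LINT y|lebesgue. \<phi> y * heat_kernel t (x - y))) = far_weight ?n t * (u x * (LINT y|lebesgue. \<phi> y * far_profile t (x - y)))" for x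
        proof (cases "u x = 0")
          case False
          have e: "subord t * (\<phi> y * heat_kernel t (x - y)) = far_weight ?n t * (\<phi> y * far_profile t (x - y))" for y
            using sep[OF False, of y] far_profile_heat_kernel[of "x - y" t] by (cases "\<phi> y = 0") auto
          have "subord t * (LINT y|lebesgue. \<phi> y * heat_kernel t (x - y)) = (LINT y|lebesgue. subord t * (\<phi> y * heat_kernel t (x - y)))"
            by (rule integral_mult_right_zero[symmetric])
          also have "\<dots> = far_weight ?n t * (LINT y|lebesgue. \<phi> y * far_profile t (x - y))"
            unfolding e by (rule integral_mult_right_zero)
          finally have "subord t * (LINT y|lebesgue. \<phi> y * heat_kernel t (x - y)) = far_weight ?n t * (LINT y|lebesgue. \<phi> y * far_profile t (x - y))" .
          then show ?thesis by (metis mult.left_commute)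
        qed simp
        have "subord t * (LINT x|lebesgue. u x * (LINT y|lebesgue. \<phi> y * heat_kernel t (x - y))) = (LINT x|lebesgue. subord t * (u x * (LINT y|lebesgue. \<phi> y * heat_kernel t (x - y))))"
          by (rule integral_mult_right_zero[symmetric])
        also have "\<dots> = far_weight ?n t * Q t"
          unfolding e Q_def by (rule integral_mult_right_zero)
        finally show ?thesis .
      qed
      finally show ?thesis by (simp add: mult_ac)
    next
      case False
      then show ?thesis by (simp add: far_weight_def subord_def)
    qed
  qed
  also have "\<dots> = - D * (LINT t|lborel. far_weight ?n t * Q t)" by (simp add: mult_ac flip: integral_mult_right_zero)
  also have "(LINT t|lborel. far_weight ?n t * Q t) = - subord_const * (LINT x|lebesgue. u x * (LINT y|lebesgue. \<phi> y * frac_kernel (x - y)))"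
  proof -
    have inner_le: "norm (LINT y|lebesgue. \<phi> y * far_profile t (x - y)) \<le> (LINT y|lebesgue. \<bar>\<phi> y\<bar>)" for t x
    proof (rule Bochner_Integration.integral_norm_bound_integral)
      have le: "norm (\<phi> y * far_profile t (x - y)) \<le> \<bar>\<phi> y\<bar>" for y
        using far_profile_bounds[of t "x - y"] by (simp add: abs_mult mult_left_le)
      then show "norm (\<phi> y * far_profile t (x - y)) \<le> \<bar>\<phi> y\<bar>" for y .
      show "integrable lebesgue (\<lambda>y. \<phi> y * far_profile t (x - y))"
      proof (rule Bochner_Integration.integrable_bound[OF pi])
        have "(\<lambda>y. far_profile t (x - y)) \<in> borel_measurable lebesgue"
          unfolding far_profile_def by (rule borel_measurable_lebesgueI) measurable
        then show "(\<lambda>y. \<phi> y * far_profile t (x - y)) \<in> borel_measurable lebesgue" by measurable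
      qed (use le in auto)
    qed (use pi in simp)
    have "(LINT t|lborel. far_weight ?n t * Q t) = (LINT x|lebesgue. u x * (LINT t|lborel. far_weight ?n t * (LINT y|lebesgue. \<phi> y * far_profile t (x - y))))"
      unfolding Q_def
    proof (rule Fubini_kernel(1)[OF lborel.sigma_finite_measure_axioms sigma_finite_lebesgue far_weight_integrable ui _ inner_le])
      show "(\<lambda>(t, x). LINT y|lebesgue. \<phi> y * far_profile t (x - y)) \<in> borel_measurable (lborel \<Otimes>\<^sub>M lebesgue)"
        unfolding case_prod_beta
        by (rule lebesgue.borel_measurable_lebesgue_integral) (unfold far_profile_def, measurable)
    qed
    also have "\<dots> = (LINT x|lebesgue. u x * (LINT y|lebesgue. \<phi> y * (LINT t|lborel. far_weight ?n t * far_profile t (x - y))))"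
    proof (rule Bochner_Integration.integral_cong[OF refl], rule arg_cong[where f = "(*) _"])
      fix x
      show "(LINT t|lborel. far_weight ?n t * (LINT y|lebesgue. \<phi> y * far_profile t (x - y))) = (LINT y|lebesgue. \<phi> y * (LINT t|lborel. far_weight ?n t * far_profile t (x - y)))"
      proof (rule Fubini_kernel(1)[OF lborel.sigma_finite_measure_axioms sigma_finite_lebesgue far_weight_integrable pi, where C = 1])
        show "(\<lambda>(t, y). far_profile t (x - y)) \<in> borel_measurable (lborel \<Otimes>\<^sub>M lebesgue)"
          unfolding far_profile_def by measurable
        show "norm (far_profile t (x - y)) \<le> 1" for t y using far_profile_bounds[of t "x - y"] by simp
      qed
    qed
    also have "\<dots> = (LINT x|lebesgue. u x * (LINT y|lebesgue. (- subord_const) * (\<phi> y * frac_kernel (x - y))))"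
      using subord_const_pos by (simp add: frac_kernel_def mult_ac)
    also have "\<dots> = (LINT x|lebesgue. (- subord_const) * (u x * (LINT y|lebesgue. \<phi> y * frac_kernel (x - y))))"
    proof (rule Bochner_Integration.integral_cong[OF refl])
      fix x
      show "u x * (LINT y|lebesgue. (- subord_const) * (\<phi> y * frac_kernel (x - y))) = (- subord_const) * (u x * (LINT y|lebesgue. \<phi> y * frac_kernel (x - y)))"
        unfolding integral_mult_right_zero by (rule mult.left_commute)
    qed
    also have "\<dots> = - subord_const * (LINT x|lebesgue. u x * (LINT y|lebesgue. \<phi> y * frac_kernel (x - y)))"
      by (rule integral_mult_right_zero)
    finally show ?thesis .
  qed
  finally have "subord_const * (LINT \<xi>|lborel. norm \<xi> powr (2 * s) * p \<xi>)
    = subord_const * (D * (LINT x|lebesgue. u x * (LINT y|lebesgue. \<phi> y * frac_kernel (x - y))))" by simp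
  then have "(LINT \<xi>|lborel. norm \<xi> powr (2 * s) * p \<xi>) = D * (LINT x|lebesgue. u x * (LINT y|lebesgue. \<phi> y * frac_kernel (x - y)))"
    using subord_const_pos by simp
  then show ?thesis unfolding lhs using D by simp
qed

end


section \<open>Test functions separate L2\<close>

text \<open>
  The functions \<open>t\<^sup>-\<^sup>j e\<^bsup>-1/t\<^esup>\<close>, extended by \<open>0\<close>. Their derivatives are combinations of functions of the same
  family, so that \<open>C_k\<close> for all \<open>k\<close> follows by induction for the whole family at once.
\<close>

definition flat :: "nat \<Rightarrow> real \<Rightarrow> real" where
  "flat j t = (if 0 < t then exp (- 1 / t) / t ^ j else 0)"

lemma flat_nonneg: "0 \<le> flat j t"
  by (simp add: flat_def)

lemma flat_0_le_1: "flat 0 t \<le> 1"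
  by (simp add: flat_def)

lemma flat_quadratic_bound: "flat j t \<le> (4 * real (j + 2)) ^ (j + 2) * t\<^sup>2"
proof (cases "t > 0")
  case True
  define x where "x = 1 / t"
  have x: "0 < x" "t = 1 / x" using True by (simp_all add: x_def)
  have "exp (- x) \<le> exp (- x / 4)" using x by simp
  then have "x ^ (j + 2) * exp (- x) \<le> x ^ (j + 2) * exp (- x / 4)" using x by (intro mult_left_mono) auto
  also have "\<dots> \<le> (4 * real (j + 2)) ^ (j + 2)" using x by (intro power_times_exp_minus_le) auto
  finally have le: "x ^ (j + 2) * exp (- x) \<le> (4 * real (j + 2)) ^ (j + 2)" .
  have "flat j t = x ^ j * exp (- x)" using True by (simp add: flat_def x_def power_one_over)
  also have "\<dots> = (x ^ (j + 2) * exp (- x)) * t\<^sup>2" using x by (simp add: power_add power_divide power2_eq_square)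
  also have "\<dots> \<le> (4 * real (j + 2)) ^ (j + 2) * t\<^sup>2" by (rule mult_right_mono[OF le]) simp
  finally show ?thesis .
qed (simp add: flat_def)

lemma flat_has_derivative:
  "(flat j has_real_derivative flat (j + 2) t - real j * flat (j + 1) t) (at t)"
proof -
  consider "t < 0" | "t = 0" | "0 < t" by linarith
  then show ?thesis
  proof cases
    case 1
    have "((\<lambda>_. 0) has_real_derivative 0) (at t)" by simp
    then have "(flat j has_real_derivative 0) (at t)"
      by (rule has_field_derivative_transform_within_open[of _ _ _ "{..<0}"]) (use 1 in \<open>auto simp: flat_def\<close>)
    then show ?thesis using 1 by (simp add: flat_def)
  next
    case 2
    define C where "C = (4 * real (j + 2)) ^ (j + 2)"
    have "(\<lambda>h. (flat j (0 + h) - flat j 0) / h) \<midarrow>0\<rightarrow> 0"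
    proof (rule Lim_null_comparison[where g = "\<lambda>h. C * \<bar>h\<bar>"])
      show "\<forall>\<^sub>F h in at 0. norm ((flat j (0 + h) - flat j 0) / h) \<le> C * \<bar>h\<bar>"
      proof (intro always_eventually allI)
        fix h :: real
        have "flat j h \<le> C * h\<^sup>2" unfolding C_def by (rule flat_quadratic_bound)
        then have "flat j h / \<bar>h\<bar> \<le> C * h\<^sup>2 / \<bar>h\<bar>" by (rule divide_right_mono) simp
        also have "C * h\<^sup>2 / \<bar>h\<bar> = C * \<bar>h\<bar>" by (cases "h = 0") (simp_all add: power2_eq_square abs_if)
        finally show "norm ((flat j (0 + h) - flat j 0) / h) \<le> C * \<bar>h\<bar>"
          using flat_nonneg[of j h] by (simp add: flat_def[of j 0] abs_divide)
      qed
      have "((\<lambda>h. C * \<bar>h\<bar>) \<longlongrightarrow> C * \<bar>0\<bar>) (at 0)" by (intro tendsto_intros)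
      then show "((\<lambda>h. C * \<bar>h\<bar>) \<longlongrightarrow> 0) (at 0)" by simp
    qed
    then have "(flat j has_real_derivative 0) (at 0)" unfolding DERIV_def by simp
    then show ?thesis using 2 by (simp add: flat_def)
  next
    case 3
    have "((\<lambda>t. exp (- 1 / t) / t ^ j) has_real_derivative flat (j + 2) t - real j * flat (j + 1) t) (at t)"
    proof -
      have "((\<lambda>t. exp (- 1 / t) / t ^ j) has_real_derivative
          ((exp (- 1 / t) * (1 / t\<^sup>2)) * t ^ j - exp (- 1 / t) * (real j * t ^ (j - Suc 0))) / (t ^ j * t ^ j)) (at t)"
        using 3 by (auto intro!: derivative_eq_intros simp: power2_eq_square)
      moreover have "((exp (- 1 / t) * (1 / t\<^sup>2)) * t ^ j - exp (- 1 / t) * (real j * t ^ (j - Suc 0))) / (t ^ j * t ^ j)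
          = flat (j + 2) t - real j * flat (j + 1) t"
        using 3 by (cases j) (simp_all add: flat_def field_simps power2_eq_square)
      ultimately show ?thesis by simp
    qed
    then show ?thesis
      by (rule has_field_derivative_transform_within_open[of _ _ _ "{0<..}"]) (use 3 in \<open>auto simp: flat_def\<close>)
  qed
qed

lemma C_k_Suc_imp: "C_k (Suc k) f \<Longrightarrow> C_k k f"
proof (induction k arbitrary: f)
  case 0
  then show ?case using C_k_continuous[of "Suc 0" f] by simp
next
  case (Suc k)
  then show ?case by simp
qed

lemma C_k_const: "C_k k (\<lambda>x. c)"
proof (induction k arbitrary: c)
  case (Suc k)
  then show ?case by (simp add: frechet_derivative_const)
qed simp

lemma C_k_mult: "C_k k f \<Longrightarrow> C_k k g \<Longrightarrow> C_k k (\<lambda>x. f x * g x)"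
proof (induction k arbitrary: f g)
  case 0
  then show ?case by (auto intro!: continuous_intros)
next
  case (Suc k)
  have d: "f differentiable (at x)" "g differentiable (at x)" for x using Suc.prems by auto
  have D: "((\<lambda>x. f x * g x) has_derivative
      (\<lambda>v. f x * frechet_derivative g (at x) v + frechet_derivative f (at x) v * g x)) (at x)" for x
    using d by (intro has_derivative_mult) (simp_all add: frechet_derivative_works)
  have e: "frechet_derivative (\<lambda>x. f x * g x) (at x) b
      = 1 * (f x * frechet_derivative g (at x) b) + 1 * (frechet_derivative f (at x) b * g x)" for x b
    using frechet_derivative_at[OF D[of x], symmetric] by (simp add: fun_eq_iff)
  have "C_k k f" "C_k k g" using Suc.prems by (auto dest: C_k_Suc_imp simp del: C_k.simps)
  then have "C_k k (\<lambda>x. frechet_derivative (\<lambda>x. f x * g x) (at x) b)" if "b \<in> Basis" for b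
    unfolding e using Suc.prems that by (intro C_k_lincomb Suc.IH) auto
  moreover have "(\<lambda>x. f x * g x) differentiable (at x)" for x using D differentiableI by blast
  ultimately show ?case by simp
qed

lemma C_k_prod: "finite A \<Longrightarrow> (\<And>i. i \<in> A \<Longrightarrow> C_k k (f i)) \<Longrightarrow> C_k k (\<lambda>x. \<Prod>i\<in>A. f i x)"
  by (induction A rule: finite_induct) (simp_all add: C_k_const C_k_mult)

lemma C_k_flat_affine: "C_k k (\<lambda>x::'a::euclidean_space. flat j (\<alpha> + \<beta> \<bullet> x))"
proof -
  have D: "((\<lambda>x. flat j (\<alpha> + \<beta> \<bullet> x)) has_derivative
      (\<lambda>v. (flat (j + 2) (\<alpha> + \<beta> \<bullet> x) - real j * flat (j + 1) (\<alpha> + \<beta> \<bullet> x)) * (\<beta> \<bullet> v))) (at x)" for j and x :: 'a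
  proof -
    have "((\<lambda>x. \<alpha> + \<beta> \<bullet> x) has_derivative (\<lambda>v. \<beta> \<bullet> v)) (at x)" by (auto intro!: derivative_eq_intros)
    from has_derivative_compose[OF this flat_has_derivative[unfolded has_field_derivative_def]]
    show ?thesis .
  qed
  show ?thesis
  proof (induction k arbitrary: j)
    case 0
    have "isCont (\<lambda>x. flat j (\<alpha> + \<beta> \<bullet> x)) x" for x using has_derivative_continuous[OF D] .
    then show ?case by (simp add: continuous_on_eq_continuous_at)
  next
    case (Suc k)
    have e: "frechet_derivative (\<lambda>x. flat j (\<alpha> + \<beta> \<bullet> x)) (at x) b
        = (\<beta> \<bullet> b) * flat (j + 2) (\<alpha> + \<beta> \<bullet> x) + (- real j * (\<beta> \<bullet> b)) * flat (j + 1) (\<alpha> + \<beta> \<bullet> x)" for x b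
      using frechet_derivative_at[OF D[of j x], symmetric] by (simp add: fun_eq_iff algebra_simps)
    have "C_k k (\<lambda>x. frechet_derivative (\<lambda>x. flat j (\<alpha> + \<beta> \<bullet> x)) (at x) b)" for b
      unfolding e by (intro C_k_lincomb Suc.IH)
    moreover have "(\<lambda>x. flat j (\<alpha> + \<beta> \<bullet> x)) differentiable (at x)" for x using D differentiableI by blast
    ultimately show ?case by simp
  qed
qed

text \<open>
  Increases in \<open>N\<close> to the indicator of the open box. The shift by \<open>1\<close> makes it vanish at distance less than \<open>1 / N\<close>
  from the faces, so that its support is a compact part of the box.
\<close>

definition box_bump :: "nat \<Rightarrow> 'a::euclidean_space \<Rightarrow> 'a \<Rightarrow> 'a \<Rightarrow> real" where
  "box_bump N a c x = (\<Prod>b\<in>Basis. flat 0 (real N * (x \<bullet> b - a \<bullet> b) - 1) * flat 0 (real N * (c \<bullet> b - x \<bullet> b) - 1))"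

lemma box_bump_bounds: "0 \<le> box_bump N a c x" "box_bump N a c x \<le> 1"
  unfolding box_bump_def
  by (auto intro!: prod_nonneg prod_le_1 mult_nonneg_nonneg mult_le_one flat_nonneg flat_0_le_1)

lemma box_bump_test_function:
  assumes N: "0 < N" and sub: "box a c \<subseteq> \<Omega>"
  shows "box_bump N a c \<in> test_functions (\<Omega> :: 'a::euclidean_space set)"
proof -
  define e :: 'a where "e = (1 / real N) *\<^sub>R One"
  have nz: "{x. box_bump N a c x \<noteq> 0} \<subseteq> cbox (a + e) (c - e)"
  proof
    fix x assume "x \<in> {x. box_bump N a c x \<noteq> 0}"
    then have "flat 0 (real N * (x \<bullet> b - a \<bullet> b) - 1) \<noteq> 0 \<and> flat 0 (real N * (c \<bullet> b - x \<bullet> b) - 1) \<noteq> 0" if "b \<in> Basis" for b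
      using that by (auto simp: box_bump_def)
    then have "1 < real N * (x \<bullet> b - a \<bullet> b) \<and> 1 < real N * (c \<bullet> b - x \<bullet> b)" if "b \<in> Basis" for b
      using that by (force simp: flat_def split: if_splits)
    then have "1 / real N < x \<bullet> b - a \<bullet> b \<and> 1 / real N < c \<bullet> b - x \<bullet> b" if "b \<in> Basis" for b
      using that N by (simp add: divide_less_eq mult.commute)
    then show "x \<in> cbox (a + e) (c - e)" by (force simp: mem_box e_def inner_add_left inner_diff_left)
  qed
  then have cl: "closure {x. box_bump N a c x \<noteq> 0} \<subseteq> cbox (a + e) (c - e)" by (rule closure_minimal) (rule closed_cbox)
  have "cbox (a + e) (c - e) \<subseteq> box a c"
  proof
    fix x assume x: "x \<in> cbox (a + e) (c - e)"
    have "a \<bullet> b < x \<bullet> b \<and> x \<bullet> b < c \<bullet> b" if b: "b \<in> Basis" for b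
    proof -
      have "e \<bullet> b = 1 / real N" using b by (simp add: e_def)
      moreover have "0 < 1 / real N" using N by simp
      moreover have "a \<bullet> b + e \<bullet> b \<le> x \<bullet> b" "x \<bullet> b \<le> c \<bullet> b - e \<bullet> b"
        using x b by (auto simp: mem_box inner_add_left inner_diff_left)
      ultimately show ?thesis by linarith
    qed
    then show "x \<in> box a c" by (simp add: mem_box)
  qed
  then have "closure {x. box_bump N a c x \<noteq> 0} \<subseteq> \<Omega>" using cl sub by blast
  moreover have "compact (closure {x. box_bump N a c x \<noteq> 0})"
    using compact_Int_closed[OF compact_cbox closed_closure, of "a + e" "c - e" "{x. box_bump N a c x \<noteq> 0}"] cl
    by (simp add: inf_absorb2)
  moreover have "C_k k (box_bump N a c)" for k
  proof -
    have 1: "real N * (x \<bullet> b - a \<bullet> b) - 1 = (- real N * (a \<bullet> b) - 1) + (real N *\<^sub>R b) \<bullet> x" for x b :: 'a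
      by (simp add: algebra_simps inner_commute)
    have 2: "real N * (c \<bullet> b - x \<bullet> b) - 1 = (real N * (c \<bullet> b) - 1) + (- real N *\<^sub>R b) \<bullet> x" for x b :: 'a
      by (simp add: algebra_simps inner_commute)
    show ?thesis unfolding box_bump_def[abs_def] 1 2
      by (intro C_k_prod C_k_mult C_k_flat_affine finite_Basis)
  qed
  ultimately show ?thesis by (simp add: test_functions_def)
qed

lemma flat_tendsto:
  "(\<lambda>N. flat 0 (real N * t - 1)) \<longlonglongrightarrow> (if 0 < t then 1 else 0)"
proof (cases "t > 0")
  case True
  have "(\<lambda>N. exp (- 1 / (real N * t - 1))) \<longlonglongrightarrow> 1" using True by real_asymp
  moreover have "\<forall>\<^sub>F N in sequentially. exp (- 1 / (real N * t - 1)) = flat 0 (real N * t - 1)"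
  proof -
    have "\<forall>\<^sub>F N in sequentially. 1 < real N * t" using True by real_asymp
    then show ?thesis by eventually_elim (simp add: flat_def)
  qed
  ultimately show ?thesis using True by (simp add: Lim_transform_eventually)
next
  case False
  have "real N * t \<le> 0" for N using False by (simp add: mult_nonneg_nonpos)
  then have "flat 0 (real N * t - 1) = 0" for N using le_less_trans[of "real N * t" 0 1] by (auto simp: flat_def not_less)
  then show ?thesis using False by simp
qed

lemma box_bump_tendsto: "(\<lambda>N. box_bump N a c x) \<longlonglongrightarrow> indicator (box a c) x"
proof -
  have "(\<lambda>N. box_bump N a c x) \<longlonglongrightarrow> (\<Prod>b\<in>Basis. (if 0 < x \<bullet> b - a \<bullet> b then 1 else 0) * (if 0 < c \<bullet> b - x \<bullet> b then 1 else 0))"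
    unfolding box_bump_def by (intro tendsto_prod tendsto_mult flat_tendsto)
  also have "(\<Prod>b\<in>Basis. (if 0 < x \<bullet> b - a \<bullet> b then 1 else 0) * (if 0 < c \<bullet> b - x \<bullet> b then 1 else 0)) = (indicator (box a c) x :: real)"
  proof (cases "x \<in> box a c")
    case True
    then show ?thesis by (simp add: mem_box)
  next
    case False
    then obtain b where "b \<in> Basis" "\<not> (a \<bullet> b < x \<bullet> b \<and> x \<bullet> b < c \<bullet> b)" by (auto simp: mem_box)
    then show ?thesis using False by (auto intro!: bexI[of _ b])
  qed
  finally show ?thesis .
qed

text \<open>
  Inside a box contained in \<open>\<Omega>\<close> the positive and the negative part of \<open>g\<close> are densities of two measures that
  agree on all boxes, which form an intersection-stable generator. Countably many such boxes cover \<open>\<Omega>\<close>.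
\<close>

lemma box_integrals_zero_imp_AE_zero:
  fixes g :: "'a::euclidean_space \<Rightarrow> real"
  assumes gi: "integrable lborel g" and \<Omega>: "open \<Omega>"
    and zero: "\<And>a c. box a c \<subseteq> \<Omega> \<Longrightarrow> (LINT x|lborel. indicator (box a c) x * g x) = 0"
  shows "AE x in lborel. x \<in> \<Omega> \<longrightarrow> g x = 0"
proof -
  have gm[measurable]: "g \<in> borel_measurable borel" using gi by auto
  have one: "AE x in lborel. x \<in> box p q \<longrightarrow> g x = 0" if Q: "box p q \<subseteq> \<Omega>" for p q
  proof -
    define P where "P x = ennreal (indicator (box p q) x * max 0 (g x))" for x
    define M where "M x = ennreal (indicator (box p q) x * max 0 (- g x))" for x
    have [measurable]: "P \<in> borel_measurable borel" "M \<in> borel_measurable borel" unfolding P_def M_def by measurable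
    have em: "emeasure (density lborel (\<lambda>x. ennreal (indicator (box p q) x * h x))) (box a c)
        = ennreal (LINT x|lborel. indicator (box a c \<inter> box p q) x * h x)"
      and hi: "integrable lborel (\<lambda>x. indicator (box a c \<inter> box p q) x * h x)"
      if h: "integrable lborel h" "\<And>x. 0 \<le> h x" for h a c
    proof -
      have [measurable]: "h \<in> borel_measurable borel" using h(1) by auto
      show i: "integrable lborel (\<lambda>x. indicator (box a c \<inter> box p q) x * h x)"
        by (rule Bochner_Integration.integrable_bound[OF h(1)]) (auto simp: indicator_def)
      have "emeasure (density lborel (\<lambda>x. ennreal (indicator (box p q) x * h x))) (box a c)
          = (\<integral>\<^sup>+x. ennreal (indicator (box p q) x * h x) * indicator (box a c) x \<partial>lborel)"
        by (rule emeasure_density) auto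
      also have "\<dots> = (\<integral>\<^sup>+x. ennreal (indicator (box a c \<inter> box p q) x * h x) \<partial>lborel)"
        by (intro nn_integral_cong) (auto simp: indicator_def)
      also have "\<dots> = ennreal (LINT x|lborel. indicator (box a c \<inter> box p q) x * h x)"
        by (rule nn_integral_eq_integral[OF i]) (use h(2) in auto)
      finally show "emeasure (density lborel (\<lambda>x. ennreal (indicator (box p q) x * h x))) (box a c)
        = ennreal (LINT x|lborel. indicator (box a c \<inter> box p q) x * h x)" .
    qed
    have pi: "integrable lborel (\<lambda>x. max 0 (g x))" "integrable lborel (\<lambda>x. max 0 (- g x))"
      using gi by (auto intro!: Bochner_Integration.integrable_max)
    have eq: "emeasure (density lborel P) (box a c) = emeasure (density lborel M) (box a c)" for a c
    proof -
      have "\<exists>a' c'. box a c \<inter> box p q = box a' c'" unfolding box_Int_box by blast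
      then obtain a' c' where ac: "box a c \<inter> box p q = box a' c'" by blast
      then have "(LINT x|lborel. indicator (box a c \<inter> box p q) x * g x) = 0" using zero[of a' c'] Q by auto
      moreover have "(LINT x|lborel. indicator (box a c \<inter> box p q) x * g x)
        = (LINT x|lborel. indicator (box a c \<inter> box p q) x * max 0 (g x) - indicator (box a c \<inter> box p q) x * max 0 (- g x))"
        by (intro Bochner_Integration.integral_cong refl) (auto simp: max_def)
      ultimately have "(LINT x|lborel. indicator (box a c \<inter> box p q) x * max 0 (g x)) = (LINT x|lborel. indicator (box a c \<inter> box p q) x * max 0 (- g x))"
        using hi[OF pi(1), of a c] hi[OF pi(2), of a c] by simp
      then show ?thesis unfolding P_def M_def em[OF pi(1) max.cobounded1] em[OF pi(2) max.cobounded1] by simp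
    qed
    have "density lborel P = density lborel M"
    proof (rule measure_eqI_generator_eq[where E = "range (\<lambda>(a, b). box a b)" and \<Omega> = UNIV and A = "\<lambda>n. box (- (real n *\<^sub>R One)) (real n *\<^sub>R One)"])
      show "Int_stable (range (\<lambda>(a, b). box a b :: 'a set))"
        by (auto simp: Int_stable_def box_Int_box)
      show "emeasure (density lborel P) X = emeasure (density lborel M) X" if "X \<in> range (\<lambda>(a, b). box a b)" for X
        using that eq by auto
      show "sets (density lborel P) = sigma_sets UNIV (range (\<lambda>(a, b). box a b))"
        "sets (density lborel M) = sigma_sets UNIV (range (\<lambda>(a, b). box a b))"
        by (simp_all add: borel_eq_box)
      show "(\<Union>n. box (- (real n *\<^sub>R One)) (real n *\<^sub>R One)) = (UNIV :: 'a set)"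
        by (rule UN_box_eq_UNIV)
      show "emeasure (density lborel P) (box (- (real n *\<^sub>R One)) (real n *\<^sub>R One)) \<noteq> \<infinity>" for n
        unfolding P_def em[OF pi(1) max.cobounded1] by simp
    qed auto
    then have "AE x in lborel. P x = M x" by (intro sigma_finite_measure.density_unique[OF sigma_finite_lborel]) auto
    then show ?thesis
    proof eventually_elim
      case (elim x)
      show ?case
      proof
        assume x: "x \<in> box p q"
        then have "max 0 (g x) = max 0 (- g x)" using elim by (simp add: P_def M_def)
        then show "g x = 0" by (auto simp: max_def split: if_splits)
      qed
    qed
  qed
  obtain \<D> where D: "countable \<D>" "\<D> \<subseteq> Pow \<Omega>" "\<And>X. X \<in> \<D> \<Longrightarrow> \<exists>a b. X = box a b" "\<Union>\<D> = \<Omega>"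
    using open_countable_Union_open_box[OF \<Omega>] by metis
  have "AE x in lborel. \<forall>X\<in>\<D>. x \<in> X \<longrightarrow> g x = 0"
    unfolding AE_ball_countable[OF D(1)]
  proof
    fix X assume X: "X \<in> \<D>"
    then obtain a b where "X = box a b" using D(3) by blast
    then show "AE x in lborel. x \<in> X \<longrightarrow> g x = 0" using one[of a b] X D(2) by auto
  qed
  then show ?thesis by eventually_elim (use D(4) in blast)
qed

text \<open>
  Bump functions tend to indicators of boxes, so that the integrals over boxes vanish as well. The function
  is first replaced by a Borel measurable representative.
\<close>

lemma test_functions_separate:
  fixes \<Omega> :: "'a::euclidean_space set"
  assumes \<Omega>: "open \<Omega>" "\<Omega> \<subseteq> ball 0 R" and G: "G \<in> L2 (lebesgue_on \<Omega>)"
    and zero: "\<And>\<phi>. \<phi> \<in> test_functions \<Omega> \<Longrightarrow> (LINT x|lebesgue_on \<Omega>. G x * \<phi> x) = 0"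
  shows "AE x in lebesgue_on \<Omega>. G x = 0"
proof -
  have \<Omega>m: "\<Omega> \<in> sets lebesgue" "\<Omega> \<inter> space lebesgue \<in> sets lebesgue" using \<Omega>(1) by auto
  define g where "g x = indicator \<Omega> x * G x" for x
  have gL: "g \<in> L2 lebesgue" using G unfolding g_def[abs_def] by (simp add: L2_on_iff[OF \<Omega>m(1)])
  have gs: "g x = 0" if "x \<notin> ball 0 R" for x using that \<Omega>(2) by (auto simp: g_def indicator_def)
  have gi: "integrable lebesgue g" by (rule bounded_support_integrable(1)[OF gL gs])
  have gm[measurable]: "g \<in> borel_measurable lebesgue" using gi by auto
  obtain g' where g': "g' \<in> borel_measurable lborel" "AE x in lborel. g x = g' x"
    using completion_ex_borel_measurable_real[of g lborel] gm by blast
  have g'm[measurable]: "g' \<in> borel_measurable borel" using g'(1) by simp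
  have g'l: "g' \<in> borel_measurable lebesgue" by (rule borel_measurable_lebesgueI[OF g'm])
  have ae: "AE x in lebesgue. g x = g' x" using g'(2) by (rule AE_completion)
  have "integrable lebesgue g'" using gi ae g'l by (subst integrable_cong_AE[symmetric]) auto
  then have g'i: "integrable lborel g'" by (subst (asm) integrable_completion) auto
  have "(LINT x|lborel. indicator (box a c) x * g' x) = 0" if sub: "box a c \<subseteq> \<Omega>" for a c
  proof -
    have t: "box_bump (Suc N) a c \<in> test_functions \<Omega>" for N by (rule box_bump_test_function[OF _ sub]) simp
    have z: "(LINT x|lebesgue. g x * box_bump (Suc N) a c x) = 0" for N
      using zero[OF t] unfolding integral_restrict_space[OF \<Omega>m(2)] by (simp add: g_def mult.assoc)
    have "(\<lambda>N. LINT x|lebesgue. g x * box_bump (Suc N) a c x) \<longlonglongrightarrow> (LINT x|lebesgue. g x * indicator (box a c) x)"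
    proof (rule integral_dominated_convergence[where w = "\<lambda>x. \<bar>g x\<bar>"])
      have "(\<lambda>x. indicator (box a c) x :: real) \<in> borel_measurable lebesgue"
        by (intro borel_measurable_lebesgueI borel_measurable_indicator) simp
      then show "(\<lambda>x. g x * indicator (box a c) x) \<in> borel_measurable lebesgue" by measurable
      show "(\<lambda>x. g x * box_bump (Suc i) a c x) \<in> borel_measurable lebesgue" for i
        by (intro borel_measurable_times gm test_function_measurable[OF t])
      show "AE x in lebesgue. (\<lambda>i. g x * box_bump (Suc i) a c x) \<longlonglongrightarrow> g x * indicator (box a c) x"
        by (intro AE_I2 tendsto_mult tendsto_const LIMSEQ_Suc box_bump_tendsto)
      show "AE x in lebesgue. norm (g x * box_bump (Suc i) a c x) \<le> \<bar>g x\<bar>" for i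
        using box_bump_bounds[of "Suc i" a c] by (intro AE_I2) (simp add: abs_mult mult_left_le)
    qed (use gi in simp)
    then have "(LINT x|lebesgue. g x * indicator (box a c) x) = 0" unfolding z by (simp add: LIMSEQ_const_iff)
    also have "(LINT x|lebesgue. g x * indicator (box a c) x) = (LINT x|lebesgue. indicator (box a c) x * g' x)"
    proof (rule integral_cong_AE)
      have i: "(\<lambda>x. indicator (box a c) x :: real) \<in> borel_measurable lebesgue"
        by (intro borel_measurable_lebesgueI borel_measurable_indicator) simp
      then show "(\<lambda>x. g x * indicator (box a c) x) \<in> borel_measurable lebesgue" by measurable
      show "(\<lambda>x. indicator (box a c) x * g' x) \<in> borel_measurable lebesgue" by (rule borel_measurable_times[OF i g'l])
      show "AE x in lebesgue. g x * indicator (box a c) x = indicator (box a c) x * g' x"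
        using ae by eventually_elim simp
    qed
    also have "\<dots> = (LINT x|lborel. indicator (box a c) x * g' x)"
      by (rule integral_completion) measurable
    finally show ?thesis by simp
  qed
  then have "AE x in lborel. x \<in> \<Omega> \<longrightarrow> g' x = 0" by (rule box_integrals_zero_imp_AE_zero[OF g'i \<Omega>(1)])
  then have "AE x in lebesgue. x \<in> \<Omega> \<longrightarrow> g' x = 0" by (rule AE_completion)
  with ae have "AE x in lebesgue. x \<in> \<Omega> \<longrightarrow> G x = 0"
    by eventually_elim (auto simp: g_def)
  then show ?thesis using \<Omega>m by (subst AE_restrict_space_iff) auto
qed


section \<open>The exterior problem\<close>

lemma L2_norm_scale: "u \<in> L2 M \<Longrightarrow> L2_norm M (\<lambda>x. a * u x) = \<bar>a\<bar> * L2_norm M u"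
  using L2.quad_expand[of u M u a 0] by (simp add: L2_norm_def real_sqrt_mult)

lemma L2_norm_cong_AE:
  assumes "AE x in M. u x = v x" "u \<in> borel_measurable M" "v \<in> borel_measurable M"
  shows "L2_norm M u = L2_norm M v"
  unfolding L2_norm_def using L2_inner_cong_AE[OF assms(1,1,2,3,2,3)] by simp

lemma weak_solution_cong:
  assumes "\<And>\<phi>. \<phi> \<in> test_functions B1 \<Longrightarrow> T \<phi> = T' \<phi>"
  shows "weak_solution s q T v = weak_solution s q T' v"
  using assms by (simp add: weak_solution_def)

lemma annulus_open: "open (annulus :: 'a::euclidean_space set)"
  by (intro open_Diff) auto

lemma annulus_lebesgue [simp]: "(annulus :: 'a::euclidean_space set) \<in> sets lebesgue"
  using annulus_open by auto

lemma E0_eq: "E0 f = (\<lambda>x. indicator annulus x * f x)"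
  by (simp add: E0_def indicator_def fun_eq_iff)

lemma E0_L2: "f \<in> L2 (lebesgue_on annulus) \<Longrightarrow> E0 f \<in> L2 lebesgue"
  unfolding E0_eq by (simp add: L2_on_iff)

lemma E0_support: "x \<notin> ball 0 3 \<Longrightarrow> E0 f x = 0"
  by (simp add: E0_def)

lemma annulus_B1_separated:
  assumes "x \<in> annulus" "y \<in> B1" shows "1 \<le> norm (x - y)"
  using assms norm_triangle_ineq2[of x y] by simp

context frac_order
begin

interpretation frac: semi_inner "sobolev_space s" "frac_laplacian s :: ('a::euclidean_space \<Rightarrow> real) \<Rightarrow> _"
  by (rule sobolev_semi_inner[OF s])

interpretation Ht: semi_hilbert "sobolev_tilde s \<Omega>" "H_inner s" for \<Omega> :: "'a::euclidean_space set"
  by (rule sobolev_tilde_hilbert)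

subsection \<open>The resolvent\<close>

lemma resolvent_weak_solution:
  fixes q :: "'a::euclidean_space \<Rightarrow> real"
  assumes "q \<in> Linf (lebesgue_on B1)" "\<not> zero_eigenvalue s q" "F \<in> L2 (lebesgue_on B1)"
  shows "weak_solution s q (\<lambda>\<phi>. LINT x|lebesgue_on B1. F x * \<phi> x) (resolvent s q F)"
proof -
  have "\<exists>w. weak_solution s q (\<lambda>\<phi>. LINT x|lebesgue_on B1. F x * \<phi> x) w"
    using weak_solution_exists[OF assms(1,2)] assms(3) by blast
  then show ?thesis unfolding resolvent_def by (rule someI_ex)
qed

lemma weak_solution_L2_on: "weak_solution s q T (v :: 'a::euclidean_space \<Rightarrow> real) \<Longrightarrow> v \<in> L2 (lebesgue_on B1)"
  by (auto simp: weak_solution_def intro: sobolev_tilde_L2_on)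

lemma weak_solution_L2_norm_unique:
  fixes q :: "'a::euclidean_space \<Rightarrow> real"
  assumes q: "q \<in> Linf (lebesgue_on B1)" "\<not> zero_eigenvalue s q"
    and v: "weak_solution s q T v" and w: "weak_solution s q T w"
  shows "L2_norm (lebesgue_on B1) v = L2_norm (lebesgue_on B1) w"
proof (rule L2_norm_cong_AE)
  show "AE x in lebesgue_on B1. v x = w x"
    by (rule AE_lebesgue_on[OF _ weak_solution_unique[OF q v w]]) simp
qed (use weak_solution_L2_on[OF v] weak_solution_L2_on[OF w] in \<open>auto simp: L2_iff\<close>)

text \<open>
  The solution operator is bounded by the existence theorem, so its operator norm is the supremum of
  a bounded set; for an unbounded set the supremum would have no meaning. Solutions are unique only up to null
  sets, hence homogeneity of the resolvent is available only for norms.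
\<close>

lemma resolvent_bounds:
  fixes q :: "'a::euclidean_space \<Rightarrow> real"
  assumes q: "q \<in> Linf (lebesgue_on B1)" "\<not> zero_eigenvalue s q"
  defines "N \<equiv> L2_opnorm (lebesgue_on B1) (lebesgue_on B1) (resolvent s q)"
  shows "0 \<le> N"
    and "F \<in> L2 (lebesgue_on B1) \<Longrightarrow> L2_norm (lebesgue_on B1) (resolvent s q F) \<le> N * L2_norm (lebesgue_on B1) F"
proof -
  let ?M = "lebesgue_on (B1 :: 'a set)"
  let ?R = "resolvent s q"
  note R = resolvent_weak_solution[OF q]
  have RL: "?R F \<in> L2 ?M" if "F \<in> L2 ?M" for F by (rule weak_solution_L2_on[OF R[OF that]])
  obtain C where C: "C \<ge> 0" "\<And>F. F \<in> L2 ?M \<Longrightarrow> L2_norm ?M (?R F) \<le> sqrt C * L2_norm ?M F"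
  proof -
    obtain C where C: "C \<ge> 0" "\<forall>G\<in>L2 ?M. \<exists>w. weak_solution s q (\<lambda>\<phi>. LINT x|?M. G x * \<phi> x) w \<and>
      L2_inner ?M w w \<le> C * L2_inner ?M G G"
      using weak_solution_exists[OF q] by blast
    have "L2_norm ?M (?R F) \<le> sqrt C * L2_norm ?M F" if F: "F \<in> L2 ?M" for F
    proof -
      obtain w where w: "weak_solution s q (\<lambda>\<phi>. LINT x|?M. F x * \<phi> x) w" "L2_inner ?M w w \<le> C * L2_inner ?M F F"
        using C(2) F by blast
      have "L2_norm ?M (?R F) = L2_norm ?M w" by (rule weak_solution_L2_norm_unique[OF q R[OF F] w(1)])
      then show ?thesis using w(2) real_sqrt_le_mono[OF w(2)] by (simp add: L2_norm_def real_sqrt_mult)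
    qed
    then show ?thesis using that C(1) by blast
  qed
  have bdd: "bdd_above ((\<lambda>F. L2_norm ?M (?R F)) ` {F \<in> L2 ?M. L2_norm ?M F \<le> 1})"
  proof (rule bdd_aboveI2)
    fix F assume "F \<in> {F \<in> L2 ?M. L2_norm ?M F \<le> 1}"
    then show "L2_norm ?M (?R F) \<le> sqrt C"
      using C(2)[of F] mult_left_mono[of "L2_norm ?M F" 1 "sqrt C"] C(1) by simp
  qed
  have le: "L2_norm ?M (?R F) \<le> N" if "F \<in> L2 ?M" "L2_norm ?M F \<le> 1" for F
    unfolding N_def L2_opnorm_def using that by (intro cSUP_upper[OF _ bdd]) simp
  have z: "L2_norm ?M (\<lambda>x. 0) \<le> 1" by (simp add: L2_norm_def L2_inner_def)
  show "0 \<le> N" using le[OF L2.zero z] L2_norm_nonneg[OF RL[OF L2.zero]] by linarith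
  show "L2_norm ?M (?R F) \<le> N * L2_norm ?M F" if F: "F \<in> L2 ?M"
  proof (cases "L2_norm ?M F = 0")
    case True
    then show ?thesis using C(2)[OF F] by simp
  next
    case False
    define a where "a = 1 / L2_norm ?M F"
    have p: "0 < L2_norm ?M F" using False L2_norm_nonneg[OF F] by simp
    then have a: "0 < a" by (simp add: a_def)
    have aF: "(\<lambda>x. a * F x) \<in> L2 ?M" by (rule L2.scale_mem[OF F])
    have "weak_solution s q (\<lambda>\<phi>. LINT x|?M. (a * F x) * \<phi> x) (\<lambda>x. a * ?R F x)"
      unfolding weak_solution_iff[OF q(1) aF]
    proof (intro conjI ballI)
      have Rt: "?R F \<in> sobolev_tilde s B1" using R[OF F] by (simp add: weak_solution_def)
      then show "(\<lambda>x. a * ?R F x) \<in> sobolev_tilde s B1" by (rule Ht.scale_mem)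
      fix w :: "'a \<Rightarrow> real" assume w: "w \<in> sobolev_tilde s B1"
      have "schroedinger_form q (\<lambda>x. a * ?R F x + 0 * ?R F x) w = a * schroedinger_form q (?R F) w + 0 * schroedinger_form q (?R F) w"
        using Rt w by (intro schroedinger_form_lincomb[OF q(1)] sobolev_tilde_sobolev)
      moreover have "schroedinger_form q (?R F) w = L2_inner ?M F w" using R[OF F] weak_solution_iff[OF q(1) F] w by blast
      ultimately show "schroedinger_form q (\<lambda>x. a * ?R F x) w = L2_inner ?M (\<lambda>x. a * F x) w"
        using L2.scale_left[OF F sobolev_tilde_L2_on[OF w]] by simp
    qed
    then have "L2_norm ?M (?R (\<lambda>x. a * F x)) = L2_norm ?M (\<lambda>x. a * ?R F x)"
      by (rule weak_solution_L2_norm_unique[OF q R[OF aF]])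
    also have "\<dots> = a * L2_norm ?M (?R F)" using a by (simp add: L2_norm_scale[OF RL[OF F]])
    finally have eq: "L2_norm ?M (?R (\<lambda>x. a * F x)) = a * L2_norm ?M (?R F)" .
    have "L2_norm ?M (\<lambda>x. a * F x) = 1" unfolding L2_norm_scale[OF F] using p by (simp add: a_def)
    then have "a * L2_norm ?M (?R F) \<le> N" using le[OF aF] unfolding eq by simp
    then show ?thesis using p by (simp add: a_def divide_le_eq)
  qed
qed

subsection \<open>The far field\<close>

text \<open>
  The function \<open>(-\<Delta>)\<^sup>s u\<close> at points of distance at least \<open>1\<close> from the support of \<open>u\<close>.
\<close>

definition far_field :: "('a::euclidean_space \<Rightarrow> real) \<Rightarrow> 'a \<Rightarrow> real" where
  "far_field u y = (LINT x|lebesgue. u x * frac_kernel (x - y))"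

lemma far_field_measurable:
  fixes u :: "'a::euclidean_space \<Rightarrow> real"
  assumes [measurable]: "u \<in> borel_measurable lebesgue"
  shows "far_field u \<in> borel_measurable borel"
  unfolding far_field_def[abs_def] by (rule lebesgue.borel_measurable_lebesgue_integral) measurable

lemma far_field_le:
  fixes u :: "'a::euclidean_space \<Rightarrow> real"
  assumes u: "integrable lebesgue u"
  shows "\<bar>far_field u y\<bar> \<le> frac_kernel_bound DIM('a) * (LINT x|lebesgue. \<bar>u x\<bar>)"
proof -
  let ?k = "frac_kernel_bound DIM('a)"
  have le: "norm (u x * frac_kernel (x - y)) \<le> ?k * \<bar>u x\<bar>" for x
    using mult_left_mono[OF frac_kernel_le[of "x - y"], of "\<bar>u x\<bar>"] by (simp add: abs_mult mult.commute)
  have i: "integrable lebesgue (\<lambda>x. ?k * \<bar>u x\<bar>)" using u by simp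
  have um[measurable]: "u \<in> borel_measurable lebesgue" using u by auto
  have k: "(\<lambda>x. frac_kernel (x - y)) \<in> borel_measurable lebesgue" by (rule borel_measurable_lebesgueI) measurable
  have "integrable lebesgue (\<lambda>x. u x * frac_kernel (x - y))"
  proof (rule Bochner_Integration.integrable_bound[OF i])
    show "AE x in lebesgue. norm (u x * frac_kernel (x - y)) \<le> norm (?k * \<bar>u x\<bar>)"
      by (rule AE_I2) (use le in \<open>simp only: real_norm_def order_trans[OF _ abs_ge_self]\<close>)
  qed (rule borel_measurable_times[OF um k])
  then have "norm (far_field u y) \<le> (LINT x|lebesgue. ?k * \<bar>u x\<bar>)"
    unfolding far_field_def by (rule Bochner_Integration.integral_norm_bound_integral[OF _ i le])
  then show ?thesis by simp
qed

lemma far_field_symmetric: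
  fixes u v :: "'a::euclidean_space \<Rightarrow> real"
  assumes u: "integrable lebesgue u" and v: "integrable lebesgue v"
  shows "(LINT x|lebesgue. u x * far_field v x) = (LINT y|lebesgue. v y * far_field u y)"
proof -
  have sym: "frac_kernel (y - x) = frac_kernel (x - y)" for x y :: 'a using frac_kernel_minus[of "x - y"] by simp
  have "(LINT x|lebesgue. u x * (LINT y|lebesgue. v y * frac_kernel (x - y))) = (LINT y|lebesgue. v y * (LINT x|lebesgue. u x * frac_kernel (x - y)))"
    by (rule Fubini_kernel(1)[OF sigma_finite_lebesgue sigma_finite_lebesgue u v _, where C = "frac_kernel_bound DIM('a)"])
      (measurable, use frac_kernel_le in simp)
  then show ?thesis by (simp add: far_field_def sym[of _ _])
qed

text \<open>
  The whole operator can be put on the test function, whose symbol of order \<open>2 s \<le> 2\<close> is square integrable; \<open>u\<close>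
  is merely in \<open>L\<^sup>2\<close> here.
\<close>

lemma frac_symbol_integrable_test:
  fixes u \<phi> :: "'a::euclidean_space \<Rightarrow> real"
  assumes u: "u \<in> L2 lebesgue" and \<phi>: "\<phi> \<in> test_functions \<Omega>"
  shows "integrable lebesgue (\<lambda>\<xi>. frac_symbol s u \<xi> * cnj (frac_symbol s \<phi> \<xi>))"
proof -
  have "integrable lebesgue (\<lambda>\<xi>. fourier_transform u \<xi> * cnj (frac_symbol (2 * s) \<phi> \<xi>))"
    by (rule re_inner_integrable[OF fourier_transform_spec(1)[OF u] frac_symbol_measurable[OF test_function_L2[OF \<phi>]]
          Plancherel(2)[OF u] test_function_frac_symbol[OF \<phi>]]) (use s in auto)
  moreover have "fourier_transform u \<xi> * cnj (frac_symbol (2 * s) \<phi> \<xi>) = frac_symbol s u \<xi> * cnj (frac_symbol s \<phi> \<xi>)" for \<xi>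
  proof -
    have p: "norm \<xi> powr (2 * s) = norm \<xi> powr s * norm \<xi> powr s" by (simp add: powr_add[symmetric])
    show ?thesis unfolding frac_symbol_def p by (simp add: scaleR_conv_of_real mult_ac)
  qed
  ultimately show ?thesis by simp
qed

lemma frac_laplacian_far_field:
  fixes u \<phi> :: "'a::euclidean_space \<Rightarrow> real"
  assumes u: "u \<in> L2 lebesgue" "\<And>x. x \<notin> A \<Longrightarrow> u x = 0" and \<phi>: "\<phi> \<in> test_functions B"
    and A: "A \<subseteq> ball 0 R" and B: "B \<subseteq> ball 0 R" and sep: "\<And>x y. x \<in> A \<Longrightarrow> y \<in> B \<Longrightarrow> 1 \<le> norm (x - y)"
  shows "frac_laplacian s u \<phi> = (LINT x|lebesgue. \<phi> x * far_field u x)"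
proof -
  have uR: "u x = 0" if "x \<notin> ball 0 R" for x using u(2) A that by blast
  have \<phi>R: "\<phi> x = 0" if "x \<notin> ball 0 R" for x using test_function_outside[OF \<phi>] B that by blast
  note \<phi>L = test_function_L2[OF \<phi>]
  have i: "integrable lebesgue u" "integrable lebesgue \<phi>"
    by (rule bounded_support_integrable(1)[OF u(1) uR], assumption, rule bounded_support_integrable(1)[OF \<phi>L \<phi>R])
  have sym: "frac_kernel (x - y) = frac_kernel (y - x)" for x y :: 'a using frac_kernel_minus[of "x - y"] by simp
  have "frac_laplacian s u \<phi> = (LINT x|lebesgue. u x * (LINT y|lebesgue. \<phi> y * frac_kernel (x - y)))"
  proof (rule frac_laplacian_kernel[OF u(1) uR \<phi>L \<phi>R _ frac_symbol_integrable_test[OF u(1) \<phi>]])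
    show "1 \<le> norm (x - y)" if "u x \<noteq> 0" "\<phi> y \<noteq> 0" for x y
      using that u(2) test_function_outside[OF \<phi>] by (intro sep) blast+
  qed
  also have "\<dots> = (LINT x|lebesgue. u x * far_field \<phi> x)"
    unfolding far_field_def using sym by simp
  also have "\<dots> = (LINT x|lebesgue. \<phi> x * far_field u x)" by (rule far_field_symmetric[OF i])
  finally show ?thesis .
qed

lemma far_field_L2_on:
  fixes u :: "'a::euclidean_space \<Rightarrow> real"
  assumes u: "u \<in> L2 lebesgue" "\<And>x. x \<notin> ball 0 R \<Longrightarrow> u x = 0" and S: "S \<in> sets lebesgue" "S \<subseteq> ball 0 R"
  shows "far_field u \<in> L2 (lebesgue_on S)"
    and "L2_norm (lebesgue_on S) (far_field u) \<le> frac_kernel_bound DIM('a) * measure lebesgue (ball (0::'a) R) * L2_norm lebesgue u"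
proof -
  define m where "m = measure lebesgue (ball (0::'a) R)"
  define k where "k = frac_kernel_bound DIM('a)"
  define M where "M = k * (sqrt m * L2_norm lebesgue u)"
  have m0: "0 \<le> m" by (simp add: m_def)
  have k0: "0 \<le> k" unfolding k_def using frac_kernel_le[of "0::'a"] by linarith
  have ui: "integrable lebesgue u" by (rule bounded_support_integrable(1)[OF u])
  have um: "u \<in> borel_measurable lebesgue" using ui by auto
  have n0: "0 \<le> L2_norm lebesgue u" by (rule L2_norm_nonneg[OF u(1)])
  have "(LINT x|lebesgue. \<bar>u x\<bar>) \<le> sqrt (m * L2_inner lebesgue u u)"
    unfolding m_def by (rule real_le_rsqrt, rule bounded_support_integrable(2)[OF u])
  also have "\<dots> = sqrt m * L2_norm lebesgue u" by (simp add: real_sqrt_mult L2_norm_def)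
  finally have "k * (LINT x|lebesgue. \<bar>u x\<bar>) \<le> M" unfolding M_def using k0 by (rule mult_left_mono)
  then have le: "\<bar>far_field u y\<bar> \<le> M" for y using far_field_le[OF ui, of y] by (simp add: k_def)
  have M0: "0 \<le> M" unfolding M_def using k0 m0 n0 by simp
  define g where "g x = indicator S x * far_field u x" for x
  have gm: "g \<in> borel_measurable lebesgue"
    unfolding g_def[abs_def] using S(1)
    by (intro borel_measurable_times borel_measurable_indicator borel_measurable_lebesgueI[OF far_field_measurable[OF um]])
  have gs: "g x = 0" if "x \<notin> ball 0 R" for x using that S(2) by (auto simp: g_def indicator_def)
  have gb: "\<bar>g x\<bar> \<le> M" for x using le[of x] M0 by (auto simp: g_def indicator_def)
  note gL = bounded_L2[OF gm gs gb]
  show "far_field u \<in> L2 (lebesgue_on S)"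
    unfolding L2_on_iff[OF S(1)] using bounded_L2(1)[OF gm gs gb] by (simp add: g_def[abs_def])
  have gL2: "g \<in> L2 lebesgue" by (rule bounded_L2(1)[OF gm gs gb])
  have "sqn lebesgue g \<le> ennreal (M\<^sup>2) * emeasure lborel (ball (0::'a) R)" by (rule bounded_L2(2)[OF gm gs gb])
  also have "emeasure lborel (ball (0::'a) R) = ennreal m"
    unfolding m_def using emeasure_bounded_finite[OF bounded_ball, of "0::'a" R]
    by (simp add: measure_def)
  also have "ennreal (M\<^sup>2) * ennreal m = ennreal (M\<^sup>2 * m)" using m0 by (simp add: ennreal_mult)
  finally have "L2_inner lebesgue g g \<le> M\<^sup>2 * m"
    unfolding sqn_eq_L2_inner[OF gL2] using m0 by (subst (asm) ennreal_le_iff) auto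
  then have "L2_norm (lebesgue_on S) (far_field u) \<le> sqrt (M\<^sup>2 * m)"
    unfolding L2_norm_def L2_inner_on(2)[OF S(1)] g_def[abs_def] by (rule real_sqrt_le_mono)
  also have "\<dots> = M * sqrt m" using M0 by (simp add: real_sqrt_mult)
  also have "\<dots> = k * m * L2_norm lebesgue u" using m0 by (simp add: M_def)
  finally show "L2_norm (lebesgue_on S) (far_field u) \<le> frac_kernel_bound DIM('a) * measure lebesgue (ball (0::'a) R) * L2_norm lebesgue u"
    by (simp add: m_def k_def)
qed

subsection \<open>The exterior solution\<close>

definition exterior_correction :: "('a::euclidean_space \<Rightarrow> real) \<Rightarrow> ('a \<Rightarrow> real) \<Rightarrow> 'a \<Rightarrow> real" where
  "exterior_correction q f = (SOME v. weak_solution s q (\<lambda>\<phi>. - frac_laplacian s (E0 f) \<phi>) v)"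

lemma exterior_solution_eq: "exterior_solution s q f = (\<lambda>x. E0 f x + exterior_correction q f x)"
  by (simp add: exterior_solution_def exterior_correction_def Let_def)

lemma far_field_E0_L2_on:
  fixes f :: "'a::euclidean_space \<Rightarrow> real"
  assumes "f \<in> L2 (lebesgue_on annulus)"
  shows "far_field (E0 f) \<in> L2 (lebesgue_on B1)"
    and "L2_norm (lebesgue_on B1) (far_field (E0 f))
      \<le> frac_kernel_bound DIM('a) * measure lebesgue (ball (0::'a) 3) * L2_norm (lebesgue_on annulus) f"
proof -
  have "L2_norm lebesgue (E0 f) = L2_norm (lebesgue_on annulus) f"
    unfolding L2_norm_def E0_eq by (simp only: L2_inner_on(2)[OF annulus_lebesgue])
  moreover have "B1 \<subseteq> ball (0::'a) 3" by auto
  ultimately show "far_field (E0 f) \<in> L2 (lebesgue_on B1)" "L2_norm (lebesgue_on B1) (far_field (E0 f))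
      \<le> frac_kernel_bound DIM('a) * measure lebesgue (ball (0::'a) 3) * L2_norm (lebesgue_on annulus) f"
    using far_field_L2_on[OF E0_L2[OF assms] E0_support ball_lebesgue, of 3 0 1] by auto
qed

lemma exterior_weak_solution_iff:
  fixes f :: "'a::euclidean_space \<Rightarrow> real"
  assumes f: "f \<in> L2 (lebesgue_on annulus)"
  shows "weak_solution s q (\<lambda>\<phi>. - frac_laplacian s (E0 f) \<phi>) v \<longleftrightarrow>
    weak_solution s q (\<lambda>\<phi>. LINT x|lebesgue_on B1. - far_field (E0 f) x * \<phi> x) v"
proof (rule weak_solution_cong)
  fix \<phi> :: "'a \<Rightarrow> real" assume \<phi>: "\<phi> \<in> test_functions B1"
  have "frac_laplacian s (E0 f) \<phi> = (LINT x|lebesgue. \<phi> x * far_field (E0 f) x)"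
    by (rule frac_laplacian_far_field[OF E0_L2[OF f] _ \<phi>, of annulus 3])
      (auto simp: E0_def intro: annulus_B1_separated)
  also have "\<dots> = (LINT x|lebesgue. indicator B1 x *\<^sub>R (far_field (E0 f) x * \<phi> x))"
    by (intro Bochner_Integration.integral_cong refl) (auto simp: indicator_def test_function_outside[OF \<phi>])
  also have "\<dots> = (LINT x|lebesgue_on B1. far_field (E0 f) x * \<phi> x)"
    by (rule integral_restrict_space[symmetric]) simp
  finally show "- frac_laplacian s (E0 f) \<phi> = (LINT x|lebesgue_on B1. - far_field (E0 f) x * \<phi> x)" by simp
qed

text \<open>
  On \<open>B\<^sub>1\<close> the distribution \<open>(-\<Delta>)\<^sup>s E\<^sub>0 f\<close> is the far field of \<open>E\<^sub>0 f\<close>, a function in \<open>L\<^sup>2(B\<^sub>1)\<close>. So the interior part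
  of the exterior solution is the resolvent applied to minus this function, up to null sets.
\<close>

lemma exterior_correction:
  fixes q f :: "'a::euclidean_space \<Rightarrow> real"
  assumes q: "q \<in> Linf (lebesgue_on B1)" "\<not> zero_eigenvalue s q" and f: "f \<in> L2 (lebesgue_on annulus)"
  shows "exterior_correction q f \<in> sobolev_tilde s B1"
    and "\<And>w. w \<in> sobolev_tilde s B1 \<Longrightarrow>
      schroedinger_form q (exterior_correction q f) w = - L2_inner (lebesgue_on B1) (far_field (E0 f)) w"
    and "L2_norm (lebesgue_on B1) (exterior_correction q f)
      \<le> L2_opnorm (lebesgue_on B1) (lebesgue_on B1) (resolvent s q) *
        (frac_kernel_bound DIM('a) * measure lebesgue (ball (0::'a) 3) * L2_norm (lebesgue_on annulus) f)"
proof -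
  let ?M = "lebesgue_on (B1 :: 'a set)"
  define F where "F x = - far_field (E0 f) x" for x
  note P = far_field_E0_L2_on[OF f]
  have F: "F \<in> L2 ?M" using L2.scale_mem[OF P(1), of "- 1"] by (simp add: F_def[abs_def])
  have "\<exists>v. weak_solution s q (\<lambda>\<phi>. LINT x|?M. F x * \<phi> x) v"
    using weak_solution_exists[OF q] F by blast
  then have "\<exists>v. weak_solution s q (\<lambda>\<phi>. - frac_laplacian s (E0 f) \<phi>) v"
    unfolding exterior_weak_solution_iff[OF f] F_def .
  then have "weak_solution s q (\<lambda>\<phi>. - frac_laplacian s (E0 f) \<phi>) (exterior_correction q f)"
    unfolding exterior_correction_def by (rule someI_ex)
  then have w: "weak_solution s q (\<lambda>\<phi>. LINT x|?M. F x * \<phi> x) (exterior_correction q f)"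
    unfolding exterior_weak_solution_iff[OF f] F_def .
  then show "exterior_correction q f \<in> sobolev_tilde s B1" by (simp add: weak_solution_def)
  show "schroedinger_form q (exterior_correction q f) w = - L2_inner ?M (far_field (E0 f)) w" if "w \<in> sobolev_tilde s B1" for w
    using w that weak_solution_iff[OF q(1) F] L2.scale_left[OF P(1) sobolev_tilde_L2_on[OF that], of "- 1"]
    by (simp add: F_def[abs_def])
  have "L2_norm ?M (exterior_correction q f) = L2_norm ?M (resolvent s q F)"
    by (rule weak_solution_L2_norm_unique[OF q w resolvent_weak_solution[OF q F]])
  also have "\<dots> \<le> L2_opnorm ?M ?M (resolvent s q) * L2_norm ?M F" by (rule resolvent_bounds(2)[OF q F])
  also have "L2_norm ?M F = L2_norm ?M (far_field (E0 f))"
    using L2_norm_scale[OF P(1), of "- 1"] by (simp add: F_def[abs_def])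
  also have "L2_opnorm ?M ?M (resolvent s q) * \<dots> \<le> L2_opnorm ?M ?M (resolvent s q) *
        (frac_kernel_bound DIM('a) * measure lebesgue (ball (0::'a) 3) * L2_norm (lebesgue_on annulus) f)"
    by (rule mult_left_mono[OF P(2) resolvent_bounds(1)[OF q]])
  finally show "L2_norm ?M (exterior_correction q f) \<le> L2_opnorm ?M ?M (resolvent s q) *
        (frac_kernel_bound DIM('a) * measure lebesgue (ball (0::'a) 3) * L2_norm (lebesgue_on annulus) f)" .
qed

lemma zero_Linf: "(\<lambda>x. 0) \<in> Linf M"
  by (rule Linf_I[of _ _ 0]) auto

lemma A0_norm:
  "L2_norm (lebesgue_on B1) (A0 s f) = L2_norm (lebesgue_on B1) (exterior_correction (\<lambda>x. 0) f)"
proof -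
  have "E0 f x = 0" if "x \<in> B1" for x using that by (simp add: E0_def)
  then show ?thesis
    unfolding L2_norm_def L2_inner_def A0_def exterior_solution_eq
    by (intro arg_cong[where f = sqrt] Bochner_Integration.integral_cong refl) simp
qed

subsection \<open>The difference of the Dirichlet-to-Neumann maps\<close>

text \<open>
  The exterior solutions for \<open>q\<close> and \<open>0\<close> differ by \<open>w = v\<^sub>q - v\<^sub>0\<close>, supported in \<open>B\<^sub>1\<close>, so on the annulus the
  Dirichlet-to-Neumann maps differ by the far field of \<open>w\<close>. Since test functions separate \<open>L\<^sup>2\<close>, every function
  that represents the difference equals this one almost everywhere. Symmetry of the kernel moves the far field to \<open>f2\<close>.
\<close>

lemma Gamma_inner:
  fixes q f1 f2 :: "'a::euclidean_space \<Rightarrow> real"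
  assumes q: "q \<in> Linf (lebesgue_on B1)" "\<not> zero_eigenvalue s q"
    and f1: "f1 \<in> L2 (lebesgue_on annulus)" and f2: "f2 \<in> L2 (lebesgue_on annulus)"
  shows "L2_inner (lebesgue_on annulus) (Gamma_map s q f1) f2
    = L2_inner (lebesgue_on B1) (\<lambda>x. exterior_correction q f1 x - exterior_correction (\<lambda>x. 0) f1 x) (far_field (E0 f2))"
proof -
  let ?A = "lebesgue_on (annulus :: 'a set)"
  define v v0 where "v = exterior_correction q f1" and "v0 = exterior_correction (\<lambda>x. 0) f1"
  note z = zero_Linf zero_potential_no_zero_eigenvalue
  have vt: "v \<in> sobolev_tilde s B1" "v0 \<in> sobolev_tilde s B1"
    unfolding v_def v0_def by (rule exterior_correction(1)[OF q f1], rule exterior_correction(1)[OF z f1])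
  \<comment> \<open>The representative that vanishes everywhere outside \<open>B1\<close>, as the kernel representation requires.\<close>
  define w where "w x = indicator B1 x * (v x - v0 x)" for x
  have dt: "(\<lambda>x. v x - v0 x) \<in> sobolev_tilde s B1" by (rule Ht.diff_mem[OF vt])
  have dL: "(\<lambda>x. v x - v0 x) \<in> L2 lebesgue" by (rule sobolev_tilde_L2[OF dt])
  have wL: "w \<in> L2 lebesgue"
    unfolding w_def[abs_def] using L2_restrict(1)[OF ball_lebesgue[of 0 1] dL] unfolding L2_on_iff[OF ball_lebesgue] .
  have ae: "AE x in lebesgue. v x - v0 x = w x"
    using sobolev_tilde_outside[OF dt] by eventually_elim (auto simp: w_def indicator_def)
  have w0: "w x = 0" if "x \<notin> B1" for x using that by (simp add: w_def)
  have w3: "w x = 0" if "x \<notin> ball 0 3" for x using that by (intro w0) auto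
  have L: "E0 f1 \<in> L2 lebesgue" "v \<in> L2 lebesgue" "v0 \<in> L2 lebesgue" using vt by (auto intro: sobolev_tilde_L2 E0_L2[OF f1])
  have an3: "annulus \<subseteq> ball (0::'a) 3" by auto
  have DN: "DN_map s q f1 \<phi> - DN_map s (\<lambda>x. 0) f1 \<phi> = (LINT x|lebesgue. \<phi> x * far_field w x)" if \<phi>: "\<phi> \<in> test_functions annulus" for \<phi>
  proof -
    have \<phi>L: "\<phi> \<in> L2 lebesgue" by (rule test_function_L2[OF \<phi>])
    have add: "frac_laplacian s (\<lambda>x. E0 f1 x + u x) \<phi> = frac_laplacian s (E0 f1) \<phi> + frac_laplacian s u \<phi>" if "u \<in> L2 lebesgue" for u
      using frac_laplacian_lincomb[OF L(1) that \<phi>L frac_symbol_integrable_test[OF L(1) \<phi>] frac_symbol_integrable_test[OF that \<phi>], of 1 1] by simp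
    have "DN_map s q f1 \<phi> - DN_map s (\<lambda>x. 0) f1 \<phi> = frac_laplacian s v \<phi> - frac_laplacian s v0 \<phi>"
      using \<phi> add[OF L(2)] add[OF L(3)] by (simp add: DN_map_def exterior_solution_eq v_def v0_def)
    also have "\<dots> = frac_laplacian s (\<lambda>x. v x - v0 x) \<phi>"
      using frac_laplacian_lincomb[OF L(2,3) \<phi>L frac_symbol_integrable_test[OF L(2) \<phi>] frac_symbol_integrable_test[OF L(3) \<phi>], of 1 "- 1"] by simp
    also have "\<dots> = frac_laplacian s w \<phi>"
      unfolding frac_laplacian_def using fourier_transform_cong_AE[OF ae L2_measurable[OF dL] L2_measurable[OF wL]] by simp
    also have "\<dots> = (LINT x|lebesgue. \<phi> x * far_field w x)"
    proof (rule frac_laplacian_far_field[OF wL w0 \<phi> _ an3])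
      show "1 \<le> norm (x - y)" if "x \<in> B1" "y \<in> annulus" for x y :: 'a
        using annulus_B1_separated[OF that(2,1)] by (simp add: norm_minus_commute)
    qed auto
    finally show ?thesis .
  qed
  have PL: "far_field w \<in> L2 ?A"
    by (rule far_field_L2_on(1)[OF wL w3 annulus_lebesgue an3])
  have Pt: "(LINT x|?A. far_field w x * \<phi> x) = DN_map s q f1 \<phi> - DN_map s (\<lambda>x. 0) f1 \<phi>" if \<phi>: "\<phi> \<in> test_functions annulus" for \<phi>
  proof -
    have "(LINT x|?A. far_field w x * \<phi> x) = (LINT x|lebesgue. indicator annulus x *\<^sub>R (far_field w x * \<phi> x))"
      by (rule integral_restrict_space) simp
    also have "\<dots> = (LINT x|lebesgue. \<phi> x * far_field w x)"
    proof (rule Bochner_Integration.integral_cong[OF refl])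
      fix x
      show "indicator annulus x *\<^sub>R (far_field w x * \<phi> x) = \<phi> x * far_field w x"
        using test_function_outside[OF \<phi>, of x] by (cases "x \<in> annulus") simp_all
    qed
    finally show ?thesis by (simp add: DN[OF \<phi>])
  qed
  have "Gamma_map s q f1 \<in> L2 ?A \<and> (\<forall>\<phi>\<in>test_functions annulus.
        (LINT x|?A. Gamma_map s q f1 x * \<phi> x) = DN_map s q f1 \<phi> - DN_map s (\<lambda>x. 0) f1 \<phi>)"
    unfolding Gamma_map_def by (rule someI[of _ "far_field w"]) (use PL Pt in blast)
  then have GL: "Gamma_map s q f1 \<in> L2 ?A" and Gt: "\<And>\<phi>. \<phi> \<in> test_functions annulus \<Longrightarrow>
        (LINT x|?A. Gamma_map s q f1 x * \<phi> x) = DN_map s q f1 \<phi> - DN_map s (\<lambda>x. 0) f1 \<phi>" by auto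
  have "AE x in ?A. Gamma_map s q f1 x - far_field w x = 0"
  proof (rule test_functions_separate[OF annulus_open an3 L2.diff_mem[OF GL PL]])
    fix \<phi> :: "'a \<Rightarrow> real" assume \<phi>: "\<phi> \<in> test_functions annulus"
    have \<phi>A: "\<phi> \<in> L2 ?A" by (rule L2_restrict(1)[OF annulus_lebesgue test_function_L2[OF \<phi>]])
    show "(LINT x|?A. (Gamma_map s q f1 x - far_field w x) * \<phi> x) = 0"
      using L2.diff_left[OF GL PL \<phi>A] Gt[OF \<phi>] Pt[OF \<phi>] by (simp add: L2_inner_def)
  qed
  then have "AE x in ?A. Gamma_map s q f1 x = far_field w x" by eventually_elim simp
  then have "L2_inner ?A (Gamma_map s q f1) f2 = L2_inner ?A (far_field w) f2"
    by (rule L2_inner_cong_AE) (use GL PL f2 in \<open>auto simp: L2_iff\<close>)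
  also have "\<dots> = L2_inner lebesgue (\<lambda>x. indicator annulus x * f2 x) (far_field w)"
    using L2.sym[OF PL f2] L2_inner_on(1)[OF annulus_lebesgue] by simp
  also have "\<dots> = (LINT x|lebesgue. E0 f2 x * far_field w x)" by (simp add: L2_inner_def E0_eq)
  also have "\<dots> = (LINT x|lebesgue. w x * far_field (E0 f2) x)"
    by (rule far_field_symmetric[OF bounded_support_integrable(1)[OF E0_L2[OF f2] E0_support] bounded_support_integrable(1)[OF wL w3]])
  also have "\<dots> = L2_inner (lebesgue_on B1) (\<lambda>x. v x - v0 x) (far_field (E0 f2))"
    unfolding L2_inner_on(1)[OF ball_lebesgue] by (simp add: L2_inner_def w_def)
  finally show ?thesis by (simp add: v_def v0_def)
qed

text \<open>
  Write \<open>a\<^sub>q\<close> for \<open>schroedinger_form q\<close> and \<open>v\<^sub>q(f)\<close> for the interior part of the exterior solution. Replacing the far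
  field of \<open>f2\<close> by the equations of \<open>v\<^sub>q(f2)\<close> and \<open>v\<^sub>0(f2)\<close> gives
  \<open>a\<^sub>0(v\<^sub>0(f2), v\<^sub>0(f1)) - a\<^sub>q(v\<^sub>q(f2), v\<^sub>q(f1))\<close>, which is symmetric. Using the equation of \<open>v\<^sub>0(f2)\<close> for both
  terms instead, and \<open>a\<^sub>q(v\<^sub>q(f1), v\<^sub>0(f2)) = a\<^sub>0(v\<^sub>0(f1), v\<^sub>0(f2))\<close>, leaves \<open>a\<^sub>q - a\<^sub>0\<close> at \<open>v\<^sub>q(f1), v\<^sub>0(f2)\<close>, which is the
  integral of \<open>q v\<^sub>q(f1) v\<^sub>0(f2)\<close>.
\<close>

lemma Gamma_inner_identity:
  fixes q f1 f2 :: "'a::euclidean_space \<Rightarrow> real"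
  assumes q: "q \<in> Linf (lebesgue_on B1)" "\<not> zero_eigenvalue s q"
    and f1: "f1 \<in> L2 (lebesgue_on annulus)" and f2: "f2 \<in> L2 (lebesgue_on annulus)"
  shows "L2_inner (lebesgue_on annulus) (Gamma_map s q f1) f2
      = L2_inner (lebesgue_on B1) (\<lambda>x. q x * exterior_correction q f1 x) (exterior_correction (\<lambda>x. 0) f2)"
    and "L2_inner (lebesgue_on annulus) (Gamma_map s q f1) f2 = L2_inner (lebesgue_on annulus) (Gamma_map s q f2) f1"
proof -
  let ?M = "lebesgue_on (B1 :: 'a set)"
  note z = zero_Linf zero_potential_no_zero_eigenvalue
  let ?v = "exterior_correction q" and ?w = "exterior_correction (\<lambda>x::'a. 0)"
  note V = exterior_correction(1,2)[OF q] and V0 = exterior_correction(1,2)[OF z]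
  have G: "L2_inner (lebesgue_on annulus) (Gamma_map s q f) g
      = - schroedinger_form q (?v g) (?v f) + schroedinger_form (\<lambda>x. 0) (?w g) (?w f)"
    if f: "f \<in> L2 (lebesgue_on annulus)" and g: "g \<in> L2 (lebesgue_on annulus)" for f g
  proof -
    note P = far_field_E0_L2_on(1)[OF g]
    note L = sobolev_tilde_L2_on[OF V(1)[OF f]] sobolev_tilde_L2_on[OF V0(1)[OF f]]
    show ?thesis
      unfolding Gamma_inner[OF q f g] L2.diff_left[OF L P]
      using V(2)[OF g V(1)[OF f]] V0(2)[OF g V0(1)[OF f]] L2.sym[OF L(1) P] L2.sym[OF L(2) P] by simp
  qed
  have H: "?v f \<in> sobolev_space s" "?w f \<in> sobolev_space s" if "f \<in> L2 (lebesgue_on annulus)" for f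
    using V(1)[OF that] V0(1)[OF that] by (auto intro: sobolev_tilde_sobolev)
  show "L2_inner (lebesgue_on annulus) (Gamma_map s q f1) f2 = L2_inner (lebesgue_on annulus) (Gamma_map s q f2) f1"
    unfolding G[OF f1 f2] G[OF f2 f1]
    using schroedinger_form_commute[OF H(1)[OF f1] H(1)[OF f2], of q] schroedinger_form_commute[OF H(2)[OF f1] H(2)[OF f2], of "\<lambda>x. 0"]
    by simp
  have "L2_inner ?M (?v f1) (far_field (E0 f2)) = - schroedinger_form (\<lambda>x. 0) (?w f2) (?v f1)"
    using V0(2)[OF f2 V(1)[OF f1]] L2.sym[OF sobolev_tilde_L2_on[OF V(1)[OF f1]] far_field_E0_L2_on(1)[OF f2]] by simp
  moreover have "schroedinger_form (\<lambda>x. 0) (?w f2) (?v f1) = frac_laplacian s (?v f1) (?w f2)"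
    using frac.sym[OF H(1)[OF f1] H(2)[OF f2]] by (simp add: schroedinger_form_def L2_inner_def)
  moreover have "L2_inner ?M (?w f1) (far_field (E0 f2)) = - schroedinger_form (\<lambda>x. 0) (?w f1) (?w f2)"
    using V0(2)[OF f2 V0(1)[OF f1]] L2.sym[OF sobolev_tilde_L2_on[OF V0(1)[OF f1]] far_field_E0_L2_on(1)[OF f2]]
      schroedinger_form_commute[OF H(2)[OF f1] H(2)[OF f2], of "\<lambda>x. 0"] by simp
  moreover have "schroedinger_form q (?v f1) (?w f2) = schroedinger_form (\<lambda>x. 0) (?w f1) (?w f2)"
    using V(2)[OF f1 V0(1)[OF f2]] V0(2)[OF f1 V0(1)[OF f2]] by simp
  ultimately show "L2_inner (lebesgue_on annulus) (Gamma_map s q f1) f2 = L2_inner ?M (\<lambda>x. q x * ?v f1 x) (?w f2)"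
    unfolding Gamma_inner[OF q f1 f2] L2.diff_left[OF sobolev_tilde_L2_on[OF V(1)[OF f1]] sobolev_tilde_L2_on[OF V0(1)[OF f1]] far_field_E0_L2_on(1)[OF f2]]
    by (simp add: schroedinger_form_def)
qed

lemma Gamma_bound:
  fixes q f1 f2 :: "'a::euclidean_space \<Rightarrow> real"
  assumes q: "q \<in> Linf (lebesgue_on B1)" "\<not> zero_eigenvalue s q"
    and f1: "f1 \<in> L2 (lebesgue_on annulus)" and f2: "f2 \<in> L2 (lebesgue_on annulus)"
  shows "L2_inner (lebesgue_on annulus) (Gamma_map s q f1) f2
      \<le> frac_kernel_bound DIM('a) * measure lebesgue (ball (0::'a) 3) * L2_norm (lebesgue_on annulus) f1 *
        L2_norm (lebesgue_on B1) (A0 s f2) * Linf_norm (lebesgue_on B1) q *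
        L2_opnorm (lebesgue_on B1) (lebesgue_on B1) (resolvent s q)"
proof -
  let ?M = "lebesgue_on (B1 :: 'a set)"
  let ?v = "exterior_correction q f1" and ?w = "exterior_correction (\<lambda>x. 0) f2"
  let ?K = "frac_kernel_bound DIM('a) * measure lebesgue (ball (0::'a) 3) * L2_norm (lebesgue_on annulus) f1"
  note z = zero_Linf zero_potential_no_zero_eigenvalue
  have L: "?v \<in> L2 ?M" "?w \<in> L2 ?M"
    by (rule sobolev_tilde_L2_on[OF exterior_correction(1)[OF q f1]], rule sobolev_tilde_L2_on[OF exterior_correction(1)[OF z f2]])
  have q0: "0 \<le> Linf_norm ?M q" by (rule Linf_norm_nonneg[OF q(1) B1_not_null])
  have "L2_inner (lebesgue_on annulus) (Gamma_map s q f1) f2 \<le> Linf_norm ?M q * L2_norm ?M ?v * L2_norm ?M ?w"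
    unfolding Gamma_inner_identity(1)[OF q f1 f2] using Linf_mult_L2_inner_le[OF q(1) q0 L] by linarith
  also have "\<dots> \<le> Linf_norm ?M q * (L2_opnorm ?M ?M (resolvent s q) * ?K) * L2_norm ?M ?w"
    by (intro mult_right_mono mult_left_mono exterior_correction(3)[OF q f1] q0 L2_norm_nonneg[OF L(2)])
  finally show ?thesis by (simp add: A0_norm mult_ac)
qed

end

theorem proposition2p4:
  fixes s C0 c :: real
  assumes "0 < s" "s < 1" "0 < C0" "0 < c"
  shows "\<exists>C>1. \<forall>(d :: nat \<Rightarrow> nat) (h :: nat \<Rightarrow> nat \<Rightarrow> real ^ 'n \<Rightarrow> real)
      (g :: nat \<Rightarrow> nat \<Rightarrow> real \<Rightarrow> real) (f :: nat \<Rightarrow> nat \<Rightarrow> nat \<Rightarrow> real ^ 'n \<Rightarrow> real).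
    (\<forall>m. spherical_harmonic_basis m (d m) (h m)) \<longrightarrow>
    (\<forall>m k l. l < d m \<longrightarrow> (\<forall>x\<in>annulus. f m k l x = g m k (norm x) * h m l (x /\<^sub>R norm x))) \<longrightarrow>
    L2_orthonormal_basis (lebesgue_on annulus) {(m, k, l). l < d m} (\<lambda>(m, k, l). f m k l) \<longrightarrow>
    (\<forall>m k l. l < d m \<longrightarrow>
       L2_norm (lebesgue_on B1) (A0 s (f m k l)) \<le> C0 * exp (- c * real (m + k))) \<longrightarrow>
    (\<forall>q :: real ^ 'n \<Rightarrow> real. q \<in> Linf (lebesgue_on B1) \<longrightarrow> \<not> zero_eigenvalue s q \<longrightarrow>
      (\<forall>m1 k1 l1 m2 k2 l2. l1 < d m1 \<longrightarrow> l2 < d m2 \<longrightarrow>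
         L2_inner (lebesgue_on annulus) (Gamma_map s q (f m1 k1 l1)) (f m2 k2 l2)
           \<le> C * exp (- c * real (max (m1 + k1) (m2 + k2))) * Linf_norm (lebesgue_on B1) q
               * L2_opnorm (lebesgue_on B1) (lebesgue_on B1) (resolvent s q)))"
proof -
  interpret frac_order s by unfold_locales fact+
  define K where "K = frac_kernel_bound DIM(real ^ 'n) * measure lebesgue (ball (0 :: real ^ 'n) 3)"
  have K0: "0 \<le> K"
    unfolding K_def using frac_kernel_le[of "0 :: real ^ 'n"] by (intro mult_nonneg_nonneg) (linarith, simp)
  \<comment> \<open>The summand \<open>2\<close> only secures \<open>C > 1\<close>.\<close>
  define C where "C = K * C0 + 2"
  have KC: "0 \<le> K * C0" using K0 assms(3) by simp
  show ?thesis
  proof (intro exI[of _ C] conjI allI impI)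
    show "1 < C" using KC by (simp add: C_def)
    fix d :: "nat \<Rightarrow> nat" and h :: "nat \<Rightarrow> nat \<Rightarrow> real ^ 'n \<Rightarrow> real" and g :: "nat \<Rightarrow> nat \<Rightarrow> real \<Rightarrow> real"
      and f :: "nat \<Rightarrow> nat \<Rightarrow> nat \<Rightarrow> real ^ 'n \<Rightarrow> real" and q :: "real ^ 'n \<Rightarrow> real" and m1 k1 l1 m2 k2 l2
    assume basis: "L2_orthonormal_basis (lebesgue_on annulus) {(m, k, l). l < d m} (\<lambda>(m, k, l). f m k l)"
      and decay: "\<forall>m k l. l < d m \<longrightarrow> L2_norm (lebesgue_on B1) (A0 s (f m k l)) \<le> C0 * exp (- c * real (m + k))"
      and q: "q \<in> Linf (lebesgue_on B1)" "\<not> zero_eigenvalue s q"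
      and l: "l1 < d m1" "l2 < d m2"
    let ?M = "lebesgue_on (B1 :: (real ^ 'n) set)" and ?A = "lebesgue_on (annulus :: (real ^ 'n) set)"
    let ?N = "Linf_norm ?M q * L2_opnorm ?M ?M (resolvent s q)"
    have f: "f m k l \<in> L2 ?A \<and> L2_norm ?A (f m k l) = 1" if "l < d m" for m k l
    proof -
      have "(m, k, l) \<in> {(m, k, l). l < d m}" using that by simp
      then have "(\<lambda>(m, k, l). f m k l) (m, k, l) \<in> L2 ?A"
        "L2_inner ?A ((\<lambda>(m, k, l). f m k l) (m, k, l)) ((\<lambda>(m, k, l). f m k l) (m, k, l)) = 1"
        using basis unfolding L2_orthonormal_basis_def L2_orthonormal_def by (simp_all only: simp_thms if_True)
      then show ?thesis by (simp add: L2_norm_def)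
    qed
    have N0: "0 \<le> ?N"
      by (intro mult_nonneg_nonneg Linf_norm_nonneg[OF q(1) B1_not_null] resolvent_bounds(1)[OF q])
    \<comment> \<open>Decay in the second index alone; the symmetry of the pairing then allows the larger index in that place.\<close>
    have bound: "L2_inner ?A (Gamma_map s q (f m k l)) (f m' k' l') \<le> C * exp (- c * real (m' + k')) * ?N"
      if "l < d m" "l' < d m'" for m k l m' k' l'
    proof -
      have "L2_inner ?A (Gamma_map s q (f m k l)) (f m' k' l') \<le> K * L2_norm ?M (A0 s (f m' k' l')) * ?N"
        using Gamma_bound[OF q, of "f m k l" "f m' k' l'"] f[OF that(1), of k] f[OF that(2), of k'] by (simp add: K_def mult_ac)
      also have "\<dots> \<le> K * (C0 * exp (- c * real (m' + k'))) * ?N"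
        using decay that(2) by (intro mult_right_mono mult_left_mono K0 N0) blast
      also have "\<dots> \<le> C * exp (- c * real (m' + k')) * ?N"
      proof -
        have "(K * C0) * (exp (- c * real (m' + k')) * ?N) \<le> C * (exp (- c * real (m' + k')) * ?N)"
          by (rule mult_right_mono[OF _ mult_nonneg_nonneg[OF exp_ge_zero N0]]) (simp add: C_def)
        then show ?thesis by (simp only: mult.assoc)
      qed
      finally show ?thesis .
    qed
    have "L2_inner ?A (Gamma_map s q (f m1 k1 l1)) (f m2 k2 l2) \<le> C * exp (- c * real (max (m1 + k1) (m2 + k2))) * ?N"
    proof (cases "m1 + k1 \<le> m2 + k2")
      case True
      then show ?thesis using bound[OF l, of k1 k2] by (simp add: max_def)
    next
      case False
      have "L2_inner ?A (Gamma_map s q (f m1 k1 l1)) (f m2 k2 l2) = L2_inner ?A (Gamma_map s q (f m2 k2 l2)) (f m1 k1 l1)"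
        using f[OF l(1)] f[OF l(2)] by (intro Gamma_inner_identity(2)[OF q]) auto
      then show ?thesis using bound[OF l(2,1), of k2 k1] False by (simp add: max_def)
    qed
    then show "L2_inner ?A (Gamma_map s q (f m1 k1 l1)) (f m2 k2 l2)
           \<le> C * exp (- c * real (max (m1 + k1) (m2 + k2))) * Linf_norm ?M q * L2_opnorm ?M ?M (resolvent s q)"
      by (simp add: mult.assoc)
  qed
qed

end
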